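(* The problem $\textsc{CDPE}(\{\mathsf{ea},\mathsf{ed}\})$ can be solved in $O(n+m)$ time, and an optimal solution (if one exists) can be found in $O(n^3)$ time, where $n$ and $m$ are the numbers of vertices and edges of the input graph.
   Context: All graphs are finite, simple, undirected. The operation $\mathsf{ea}$ adds an edge between two distinct non-adjacent vertices; $\mathsf{ed}$ deletes an edge. For a set $S$ of operations and integer $k\ge 0$, a graph $G$ can be $(S,k)$-modified into $H$ if $H$ is obtained from $G$ by at most $k$ operations from $S$. The problem $\textsc{CDPE}(S)$ takes as input a graph $G$, an integer $k$ and a function $\delta\colon V(G)\to\{0,1\}$, and asks whether $G$ can be $(S,k)$-modified into a connected graph $H$ with $d_H(v)\equiv\delta(v)\pmod 2$ for each $v\in V(H)$. For $S=\{\mathsf{ea},\mathsf{ed}\}$, a solution for $(G,\delta)$ is a pair $(A,D)$ with $A$ a set of non-edges of $G$ and $D$ a set of edges of $G$ such that $H=G+A-D$ (add $A$, delete $D$) is connected and $d_H(v)\equiv\delta(v)\pmod 2$ for all $v$; its size is $|A|+|D|$; an optimal solution is one of minimum size. *)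

theory Defs
  imports Main "HOL-Number_Theory.Cong"
begin

section \<open>Graphs, modifications and the problem CDPE\<close>

record 'a graph =
  verts :: "'a set"
  edges :: "'a set set"

definition simple_graph :: "'a graph \<Rightarrow> bool" where
  "simple_graph G \<longleftrightarrow>
     finite (verts G) \<and> edges G \<subseteq> {{u, v} | u v. u \<in> verts G \<and> v \<in> verts G \<and> u \<noteq> v}"

definition non_edges :: "'a graph \<Rightarrow> 'a set set" where
  "non_edges G = {{u, v} | u v. u \<in> verts G \<and> v \<in> verts G \<and> u \<noteq> v} - edges G"

definition degree :: "'a graph \<Rightarrow> 'a \<Rightarrow> nat" where
  "degree G v = card {e \<in> edges G. v \<in> e}"

text \<open>The graph without vertices counts as connected.  Adding and deleting edges keeps the
  vertex set, so this convention only concerns the empty input graph.\<close>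

definition connected_graph :: "'a graph \<Rightarrow> bool" where
  "connected_graph G \<longleftrightarrow>
     (\<forall>u \<in> verts G. \<forall>v \<in> verts G. (u, v) \<in> {(x, y). {x, y} \<in> edges G}\<^sup>*)"

datatype operation = ea | ed

inductive apply_op :: "operation \<Rightarrow> 'a graph \<Rightarrow> 'a graph \<Rightarrow> bool" where
  add_edge: "e \<in> non_edges G \<Longrightarrow> apply_op ea G \<lparr>verts = verts G, edges = insert e (edges G)\<rparr>"
| delete_edge: "e \<in> edges G \<Longrightarrow> apply_op ed G \<lparr>verts = verts G, edges = edges G - {e}\<rparr>"

definition modifiable :: "operation set \<Rightarrow> nat \<Rightarrow> 'a graph \<Rightarrow> 'a graph \<Rightarrow> bool" where
  "modifiable S k G H \<longleftrightarrow> (\<exists>j \<le> k. (G, H) \<in> {(G1, G2). \<exists>x \<in> S. apply_op x G1 G2} ^^ j)"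

definition CDPE :: "operation set \<Rightarrow> 'a graph \<Rightarrow> nat \<Rightarrow> ('a \<Rightarrow> nat) \<Rightarrow> bool" where
  "CDPE S G k \<delta> \<longleftrightarrow>
     (\<exists>H. modifiable S k G H \<and> connected_graph H \<and> (\<forall>v \<in> verts H. [degree H v = \<delta> v] (mod 2)))"

definition modify :: "'a graph \<Rightarrow> 'a set set \<Rightarrow> 'a set set \<Rightarrow> 'a graph" where
  "modify G A D = \<lparr>verts = verts G, edges = (edges G \<union> A) - D\<rparr>"

definition is_solution :: "'a graph \<Rightarrow> ('a \<Rightarrow> nat) \<Rightarrow> 'a set set \<times> 'a set set \<Rightarrow> bool" where
  "is_solution G \<delta> = (\<lambda>(A, D). A \<subseteq> non_edges G \<and> D \<subseteq> edges G \<and>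
     connected_graph (modify G A D) \<and>
     (\<forall>v \<in> verts G. [degree (modify G A D) v = \<delta> v] (mod 2)))"

definition solution_size :: "'a set set \<times> 'a set set \<Rightarrow> nat" where
  "solution_size = (\<lambda>(A, D). card A + card D)"

definition is_optimal_solution :: "'a graph \<Rightarrow> ('a \<Rightarrow> nat) \<Rightarrow> 'a set set \<times> 'a set set \<Rightarrow> bool" where
  "is_optimal_solution G \<delta> X \<longleftrightarrow>
     is_solution G \<delta> X \<and> (\<forall>Y. is_solution G \<delta> Y \<longrightarrow> solution_size X \<le> solution_size Y)"

section \<open>The machine model\<close>

text \<open>Running times refer to a random access machine with registers and (statically named)
  one-dimensional arrays of natural numbers, programmed by structured programs.  Every elementary
  instruction and every test has cost 1.  The only arithmetic is addition and truncated
  subtraction, and no number \<open>\<ge> W\<close> may ever be written: an overflowing program has no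
  execution.  With \<open>W\<close> polynomial in the input, this is the machine with words of
  logarithmic length.\<close>

datatype operand = Num nat | Reg nat

datatype test = Less operand operand | Equal operand operand

datatype program =
    Skip
  | Assign nat operand
  | Add nat operand operand
  | Sub nat operand operand
  | Load nat nat operand  \<comment> \<open>register, array, index\<close>
  | Store nat operand operand  \<comment> \<open>array, index, value\<close>
  | Seq program program
  | Cond test program program
  | While test program

record state =
  regs :: "nat \<Rightarrow> nat"
  arrs :: "nat \<Rightarrow> nat \<Rightarrow> nat"

fun val :: "state \<Rightarrow> operand \<Rightarrow> nat" where
  "val s (Num c) = c"
| "val s (Reg r) = regs s r"

fun holds :: "state \<Rightarrow> test \<Rightarrow> bool" where
  "holds s (Less x y) = (val s x < val s y)"
| "holds s (Equal x y) = (val s x = val s y)"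

definition set_reg :: "nat \<Rightarrow> nat \<Rightarrow> state \<Rightarrow> state" where
  "set_reg r a s = s\<lparr>regs := (regs s)(r := a)\<rparr>"

definition set_arr :: "nat \<Rightarrow> nat \<Rightarrow> nat \<Rightarrow> state \<Rightarrow> state" where
  "set_arr b i a s = s\<lparr>arrs := (arrs s)(b := (arrs s b)(i := a))\<rparr>"

text \<open>\<open>exec W P s t s'\<close>: started in state \<open>s\<close>, program \<open>P\<close> halts in state
  \<open>s'\<close> after exactly \<open>t\<close> steps, writing only numbers below \<open>W\<close>.\<close>

inductive exec :: "nat \<Rightarrow> program \<Rightarrow> state \<Rightarrow> nat \<Rightarrow> state \<Rightarrow> bool" for W where
  Skip: "exec W Skip s 1 s"
| Assign: "val s x < W \<Longrightarrow> exec W (Assign r x) s 1 (set_reg r (val s x) s)"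
| Add: "val s x + val s y < W \<Longrightarrow> exec W (Add r x y) s 1 (set_reg r (val s x + val s y) s)"
| Sub: "val s x - val s y < W \<Longrightarrow> exec W (Sub r x y) s 1 (set_reg r (val s x - val s y) s)"
| Load: "arrs s b (val s x) < W \<Longrightarrow> exec W (Load r b x) s 1 (set_reg r (arrs s b (val s x)) s)"
| Store: "val s y < W \<Longrightarrow> exec W (Store b x y) s 1 (set_arr b (val s x) (val s y) s)"
| Seq: "exec W P s t s' \<Longrightarrow> exec W Q s' u s'' \<Longrightarrow> exec W (Seq P Q) s (t + u) s''"
| CondT: "holds s b \<Longrightarrow> exec W P s t s' \<Longrightarrow> exec W (Cond b P Q) s (1 + t) s'"
| CondF: "\<not> holds s b \<Longrightarrow> exec W Q s t s' \<Longrightarrow> exec W (Cond b P Q) s (1 + t) s'"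
| WhileF: "\<not> holds s b \<Longrightarrow> exec W (While b P) s 1 s"
| WhileT: "holds s b \<Longrightarrow> exec W P s t s' \<Longrightarrow> exec W (While b P) s' u s'' \<Longrightarrow>
     exec W (While b P) s (1 + t + u) s''"

lemma exec_deterministic:
  "exec W P s t s' \<Longrightarrow> exec W P s u s'' \<Longrightarrow> u = t \<and> s'' = s'"
proof (induction arbitrary: u s'' rule: exec.induct)
  case (Seq P s t s' Q v s3)
  from Seq.prems show ?case
    by cases (use Seq.IH in blast)
next
  case (WhileT s b P t s' v s3)
  from WhileT.prems show ?case
    by cases (use WhileT.IH WhileT.hyps in blast)+
qed (erule exec.cases; force)+

section \<open>Input and output conventions\<close>

definition adjacency_lists :: "nat graph \<Rightarrow> nat list list \<Rightarrow> bool" where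
  "adjacency_lists G adj \<longleftrightarrow>
     verts G = {..<length adj} \<and>
     (\<forall>v < length adj. distinct (adj ! v) \<and> set (adj ! v) = {u. {v, u} \<in> edges G})"

text \<open>Register 0 holds the number of vertices, register 1 the budget, array 0 the function
  \<open>\<delta>\<close>.  The adjacency lists are stored one after the other in array 2; the list of
  \<open>v\<close> occupies the positions from entry \<open>v\<close> of array 1 up to, but excluding, entry
  \<open>v + 1\<close>.  All other memory cells are 0.\<close>

definition graph_input :: "nat list list \<Rightarrow> (nat \<Rightarrow> nat) \<Rightarrow> state" where
  "graph_input adj \<delta> =
     \<lparr>regs = (\<lambda>_. 0)(0 := length adj),
      arrs = (\<lambda>_ _. 0)
        (0 := (\<lambda>v. if v < length adj then \<delta> v else 0),
         1 := (\<lambda>v. if v \<le> length adj then length (concat (take v adj)) else 0),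
         2 := (\<lambda>i. if i < length (concat adj) then concat adj ! i else 0))\<rparr>"

definition cdpe_input :: "nat list list \<Rightarrow> (nat \<Rightarrow> nat) \<Rightarrow> nat \<Rightarrow> state" where
  "cdpe_input adj \<delta> k = set_reg 1 k (graph_input adj \<delta>)"

text \<open>A set of edges is output as a duplicate-free listing of its members: a register holds their
  number, two arrays hold the two endpoints.\<close>

definition outputs_edges :: "state \<Rightarrow> nat \<Rightarrow> nat \<Rightarrow> nat \<Rightarrow> nat set set \<Rightarrow> bool" where
  "outputs_edges s r a b F \<longleftrightarrow>
     F = (\<lambda>i. {arrs s a i, arrs s b i}) ` {..<regs s r} \<and> card F = regs s r"

definition outputs_solution :: "state \<Rightarrow> nat set set \<times> nat set set \<Rightarrow> bool" where
  "outputs_solution s = (\<lambda>(A, D). outputs_edges s 1 3 4 A \<and> outputs_edges s 2 5 6 D)"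

end

theory Submission
  imports Defs
begin

text \<open>
  A solution is the same as an edge set \<open>F\<close> to be toggled such that the odd vertices of \<open>F\<close> form the
  set \<open>T\<close> of vertices whose degree has the wrong parity and such that toggling \<open>F\<close> leaves the graph
  connected. If \<open>|T|\<close> is odd there is none. Otherwise \<open>p\<close> components need \<open>p - 1\<close> new edges, every vertex
  of \<open>T\<close> needs one edge end, and a component disjoint from \<open>T\<close> needs two; the optimum is the larger of
  \<open>p - 1\<close> and \<open>|T|/2\<close> plus the number of components disjoint from \<open>T\<close>, with two exceptions: one more
  edge is needed if the graph is connected and some vertex of \<open>T\<close> is joined to all others by bridges,
  and three edges are needed if \<open>p = 2\<close> and \<open>T = {}\<close>. With at most two vertices these exceptional
  cases have no solution.

  The components are first joined by edges between vertices that still have the wrong parity; the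
  remaining such vertices are matched and the matching is toggled, pairing non-adjacent vertices as
  long as possible so that the matching edges that get deleted lie in a clique. If this disconnects
  the graph, exactly one deleted edge \<open>ab\<close> is to blame and it is a bridge. Then either exchanging \<open>ab\<close>
  and another toggled pair \<open>xy\<close> for \<open>ax\<close> and \<open>by\<close> reconnects the graph, or the exceptional case has been
  reached and \<open>ab\<close> is replaced by a path through a third vertex.
\<close>

section \<open>Parity and connectivity of edge sets\<close>

text \<open>There is no separate combinatorial proof of the upper bound: correctness of the
  optimization program provides a feasible set no larger than the lower bound, and
  \<open>feasible_exists\<close> reads this off a run of it. The decision program, which merely
  computes the bound, rests on that run too.

  Linear time requires recognising the exceptional star without testing every edge for being a
  bridge. If there is a star, a vertex of \<open>T\<close> with the most neighbours in
  \<open>T\<close> is a centre, so one candidate suffices, and one search in the graph without this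
  vertex tells which edges at it are bridges. The optimization program matches the same vertex
  first: it then lies in a deleted pair only if all of \<open>T\<close> is adjacent to it, which
  lets a failed matching prove that the star is present.

  The order of joining matters: a component with a single vertex of \<open>T\<close> uses it up when
  joined, so such components come last, and ends outside \<open>T\<close> occur only where the lower
  bound pays for them. Cubic time comes from trying only toggled pairs for the exchange: there are
  at most 2n of them, and each connectivity test takes quadratic time.\<close>

definition edge_rel :: "'a set set \<Rightarrow> ('a \<times> 'a) set" where
  "edge_rel E = {(x, y). {x, y} \<in> E}"

abbreviation reach :: "'a set set \<Rightarrow> 'a \<Rightarrow> 'a \<Rightarrow> bool" where
  "reach E u v \<equiv> (u, v) \<in> (edge_rel E)\<^sup>*"

definition pairs :: "'a set \<Rightarrow> 'a set set" where
  "pairs V = {{u, v} | u v. u \<in> V \<and> v \<in> V \<and> u \<noteq> v}"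

definition conn :: "'a set \<Rightarrow> 'a set set \<Rightarrow> bool" where
  "conn V E \<longleftrightarrow> (\<forall>u \<in> V. \<forall>v \<in> V. reach E u v)"

definition dg :: "'a set set \<Rightarrow> 'a \<Rightarrow> nat" where
  "dg F v = card {e \<in> F. v \<in> e}"

definition tog :: "'a set set \<Rightarrow> 'a \<Rightarrow> 'a \<Rightarrow> 'a set set" where
  "tog H x y = sym_diff H {{x, y}}"

definition bridge :: "'a set set \<Rightarrow> 'a \<Rightarrow> 'a \<Rightarrow> bool" where
  "bridge E x y \<longleftrightarrow> {x, y} \<in> E \<and> \<not> reach (E - {{x, y}}) x y"

definition feasible :: "'a set \<Rightarrow> 'a set set \<Rightarrow> 'a set \<Rightarrow> 'a set set \<Rightarrow> bool" where
  "feasible V E T F \<longleftrightarrow>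
     F \<subseteq> pairs V \<and> conn V (sym_diff E F) \<and> (\<forall>v \<in> V. odd (dg F v) \<longleftrightarrow> v \<in> T)"

text \<open>Abstracts the label arrays of the search: subtracting 1 from every label gives such a
  \<rho>, and components are counted as values of \<rho>.\<close>

definition is_rep :: "'a set \<Rightarrow> 'a set set \<Rightarrow> ('a \<Rightarrow> 'a) \<Rightarrow> bool" where
  "is_rep V E \<rho> \<longleftrightarrow> (\<forall>v \<in> V. \<rho> v \<in> V \<and> \<rho> (\<rho> v) = \<rho> v) \<and>
     (\<forall>u \<in> V. \<forall>v \<in> V. \<rho> u = \<rho> v \<longleftrightarrow> reach E u v)"

definition star_exc :: "'a set set \<Rightarrow> 'a set \<Rightarrow> bool" where
  "star_exc E T \<longleftrightarrow> (\<exists>c \<in> T. \<forall>x \<in> T - {c}. bridge E c x)"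

definition tfree :: "'a set \<Rightarrow> ('a \<Rightarrow> 'a) \<Rightarrow> 'a set \<Rightarrow> 'a set" where
  "tfree V \<rho> T = {r \<in> \<rho> ` V. \<forall>v \<in> V. \<rho> v = r \<longrightarrow> v \<notin> T}"

text \<open>The 3 is the size of a triangle, the least nonempty edge set with all degrees even. It
  only matters for two components: if \<open>T = {}\<close>, every component is disjoint from
  \<open>T\<close>, so the term before it is already the number of components. The case of fewer
  than two components includes the empty graph.\<close>

definition opt_bound :: "'a set \<Rightarrow> 'a set set \<Rightarrow> ('a \<Rightarrow> 'a) \<Rightarrow> 'a set \<Rightarrow> nat" where
  "opt_bound V E \<rho> T =
     (if card (\<rho> ` V) < 2 then card T div 2 + (if star_exc E T then 1 else 0)
      else max (max (card (\<rho> ` V) - 1) (card T div 2 + card (tfree V \<rho> T))) (if T = {} then 3 else 0))"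

lemma edge_rel_iff [simp]: "(x, y) \<in> edge_rel E \<longleftrightarrow> {x, y} \<in> E"
  by (simp add: edge_rel_def)

lemma reach_sym: "reach E u v \<Longrightarrow> reach E v u"
proof -
  have "sym (edge_rel E)" by (auto simp: sym_def insert_commute)
  then show "reach E u v \<Longrightarrow> reach E v u" by (meson sym_rtrancl symD)
qed

lemma reach_edge: "{x, y} \<in> E \<Longrightarrow> reach E x y"
  by auto

lemma reach_step: "reach E u v \<Longrightarrow> {v, w} \<in> E \<Longrightarrow> reach E u w"
  by (rule rtrancl.rtrancl_into_rtrancl) auto

text \<open>The standard way below to show that a modified graph stays connected: only the edges
  that were lost need a replacement path.\<close>

lemma reach_subst:
  assumes "reach E u v" "\<And>x y. {x, y} \<in> E \<Longrightarrow> reach E' x y"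
  shows "reach E' u v"
  using assms(1)
proof induction
  case (step y z)
  then show ?case using assms(2)[of y z] by auto
qed simp

lemma reach_mono: "reach E u v \<Longrightarrow> E \<subseteq> E' \<Longrightarrow> reach E' u v"
  by (erule reach_subst) (auto intro: reach_edge)

lemma reach_closed:
  assumes "reach E u v" "u \<in> S" "\<And>x y. x \<in> S \<Longrightarrow> {x, y} \<in> E \<Longrightarrow> y \<in> S"
  shows "v \<in> S"
  using assms(1,2) by induction (auto intro: assms(3))

text \<open>A walk that passes the new edge several times can be shortened to one that passes it at
  most once, in one of the two directions.\<close>

lemma reach_insert:
  assumes "reach (insert {x, y} E) u v"
  shows "reach E u v \<or> (reach E u x \<and> reach E y v) \<or> (reach E u y \<and> reach E x v)"
  using assms
proof induction
  case (step v w)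
  from step.hyps(2) consider "{v, w} \<in> E" | "v = x" "w = y" | "v = y" "w = x"
    by (auto simp: doubleton_eq_iff)
  then show ?case
  proof cases
    case 1
    then show ?thesis using step.IH reach_step by metis
  next
    case 2
    then show ?thesis using step.IH by (meson reach_sym rtrancl.rtrancl_refl rtrancl_trans)
  next
    case 3
    then show ?thesis using step.IH by (meson reach_sym rtrancl.rtrancl_refl rtrancl_trans)
  qed
qed simp

lemma bridge_commute: "bridge E x y \<longleftrightarrow> bridge E y x"
  unfolding bridge_def by (auto simp: insert_commute dest: reach_sym)

lemma bridge_no_common:
  assumes "bridge E x y" "{x, z} \<in> E" "{y, z} \<in> E" "z \<noteq> x" "z \<noteq> y"
  shows False
proof -
  have "{x, z} \<in> E - {{x, y}}" "{z, y} \<in> E - {{x, y}}"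
    using assms by (auto simp: doubleton_eq_iff insert_commute)
  then have "reach (E - {{x, y}}) x y" using reach_step reach_edge by metis
  then show False using assms(1) by (simp add: bridge_def)
qed

lemma finite_pairs: "finite V \<Longrightarrow> finite (pairs V)"
  by (rule finite_subset[of _ "Pow V"]) (auto simp: pairs_def)

lemma pairs_iff [simp]: "{x, y} \<in> pairs V \<longleftrightarrow> x \<in> V \<and> y \<in> V \<and> x \<noteq> y"
  by (auto simp: pairs_def doubleton_eq_iff)

lemma pairs_singleton [simp]: "{x} \<notin> pairs V"
  using pairs_iff[of x x V] by simp

lemma pairs_E:
  assumes "e \<in> F" "F \<subseteq> pairs V"
  obtains x y where "e = {x, y}" "x \<in> V" "y \<in> V" "x \<noteq> y"
  using assms by (auto simp: pairs_def)

text \<open>Serves the small cases: with at most two vertices a feasible set has at most one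
  element, so a lower bound above 1 means that there is no solution.\<close>

lemma card_pairs_le1:
  assumes "finite V" "card V \<le> 2"
  shows "card (pairs V) \<le> 1"
proof -
  have "pairs V \<subseteq> {V}"
  proof
    fix e assume "e \<in> pairs V"
    then obtain x y where e: "e = {x, y}" "x \<in> V" "y \<in> V" "x \<noteq> y" by (auto simp: pairs_def)
    then have "e \<subseteq> V" "card e = 2" by auto
    then show "e \<in> {V}" using assms by (metis card_mono card_subset_eq insertI1 le_antisym)
  qed
  then show ?thesis by (metis card.empty card_insert_disjoint card_mono empty_iff finite.emptyI finite.insertI One_nat_def)
qed

lemma handshake:
  assumes "finite V" "F \<subseteq> pairs V"
  shows "(\<Sum>v\<in>V. dg F v) = 2 * card F"
proof -
  have "finite F" using assms finite_pairs finite_subset by blast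
  moreover have "\<forall>e\<in>F. card {v \<in> V. v \<in> e} = 2"
  proof
    fix e assume "e \<in> F"
    with assms(2) obtain x y where e: "e = {x, y}" "x \<in> V" "y \<in> V" "x \<noteq> y" by (auto simp: pairs_def)
    then have "{v \<in> V. v \<in> e} = {x, y}" by auto
    then show "card {v \<in> V. v \<in> e} = 2" using e by simp
  qed
  ultimately show ?thesis
    unfolding dg_def by (intro sum_multicount[OF assms(1)]) auto
qed

lemma odd_card_sym_diff:
  assumes "finite A" "finite B"
  shows "odd (card (sym_diff A B)) \<longleftrightarrow> odd (card A) \<noteq> odd (card B)"
proof -
  have "card (sym_diff A B) = card (A - B) + card (B - A)"
    by (rule card_Un_disjoint) (use assms in auto)
  moreover have "card A = card (A - B) + card (A \<inter> B)"
    using assms by (metis add.commute card_Diff_subset_Int card_mono finite_Int inf_le1 le_add_diff_inverse)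
  moreover have "card B = card (B - A) + card (A \<inter> B)"
    using assms by (metis add.commute card_Diff_subset_Int card_mono finite_Int inf_commute inf_le1 le_add_diff_inverse)
  ultimately show ?thesis by presburger
qed

lemma odd_dg_sym_diff:
  assumes "finite E" "finite F"
  shows "odd (dg (sym_diff E F) v) \<longleftrightarrow> odd (dg E v) \<noteq> odd (dg F v)"
proof -
  have "{e \<in> sym_diff E F. v \<in> e} = sym_diff {e \<in> E. v \<in> e} {e \<in> F. v \<in> e}" by auto
  then show ?thesis unfolding dg_def using odd_card_sym_diff[of "{e \<in> E. v \<in> e}" "{e \<in> F. v \<in> e}"] assms
    by simp
qed

lemma dg_singleton: "dg {{x, y}} v = (if v = x \<or> v = y then 1 else 0)"
proof -
  have "{e \<in> {{x, y}}. v \<in> e} = (if v = x \<or> v = y then {{x, y}} else {})" by auto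
  then show ?thesis by (simp add: dg_def)
qed

lemma odd_dg_tog:
  assumes "finite H"
  shows "odd (dg (tog H x y) v) \<longleftrightarrow> (odd (dg H v) \<noteq> (v = x \<or> v = y))"
  unfolding tog_def using odd_dg_sym_diff[OF assms, of "{{x, y}}" v] by (simp add: dg_singleton)

text \<open>Components as sets, for counting while edges are inserted: a representative function
  would have to be rebuilt after every insertion.\<close>

definition comps :: "'a set \<Rightarrow> 'a set set \<Rightarrow> 'a set set" where
  "comps V E = (\<lambda>v. {u \<in> V. reach E v u}) ` V"

lemma card_comps_rep:
  assumes "is_rep V E \<rho>"
  shows "card (comps V E) = card (\<rho> ` V)"
proof -
  have "bij_betw (\<lambda>r. {u \<in> V. reach E r u}) (\<rho> ` V) (comps V E)"
    unfolding bij_betw_def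
  proof
    show "inj_on (\<lambda>r. {u \<in> V. reach E r u}) (\<rho> ` V)"
    proof (rule inj_onI)
      fix r s assume rs: "r \<in> \<rho> ` V" "s \<in> \<rho> ` V" "{u \<in> V. reach E r u} = {u \<in> V. reach E s u}"
      then have "r \<in> V" "s \<in> V" "\<rho> r = r" "\<rho> s = s" using assms by (auto simp: is_rep_def)
      moreover then have "reach E r s" using rs(3) by auto
      ultimately show "r = s" using assms by (metis is_rep_def)
    qed
    show "(\<lambda>r. {u \<in> V. reach E r u}) ` \<rho> ` V = comps V E"
    proof -
      have "{u \<in> V. reach E (\<rho> v) u} = {u \<in> V. reach E v u}" if "v \<in> V" for v
      proof -
        have "reach E v (\<rho> v)" using that assms by (metis is_rep_def)
        then show ?thesis by (meson reach_sym rtrancl_trans)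
      qed
      then show ?thesis unfolding comps_def image_image by (auto intro!: image_eqI)
    qed
  qed
  then show ?thesis by (simp add: bij_betw_same_card)
qed

text \<open>Sending each component to the component of the larger graph around it is injective once
  the component of y is set aside, because two components can only merge if one of them contains
  y.\<close>

lemma card_comps_insert:
  assumes "finite V"
  shows "card (comps V E) \<le> card (comps V (insert {x, y} E)) + 1"
proof -
  let ?E = "insert {x, y} E"
  let ?Y = "{u \<in> V. reach E y u}"
  let ?f = "\<lambda>C. {u \<in> V. \<exists>v \<in> C. reach ?E v u}"
  have fin: "finite (comps V E)" "finite (comps V ?E)" using assms by (auto simp: comps_def)
  have mono: "reach ?E a b" if "reach E a b" for a b using that by (rule reach_mono) auto
  have f: "?f {u \<in> V. reach E v u} = {u \<in> V. reach ?E v u}" if "v \<in> V" for v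
    using that by (auto intro: mono rtrancl_trans)
  have "inj_on ?f (comps V E - {?Y})"
  proof (rule inj_onI)
    fix C D assume C: "C \<in> comps V E - {?Y}" and D: "D \<in> comps V E - {?Y}" and eq: "?f C = ?f D"
    from C D obtain c d where c: "c \<in> V" "C = {u \<in> V. reach E c u}" and d: "d \<in> V" "D = {u \<in> V. reach E d u}"
      by (auto simp: comps_def)
    have "d \<in> ?f C" using d eq f[of d] by auto
    then have "reach ?E c d" using f[of c] c by auto
    then consider "reach E c d" | "reach E c y" | "reach E y d"
      using reach_insert by metis
    then show "C = D"
    proof cases
      case 1
      then show ?thesis using c d by (auto intro: rtrancl_trans dest: reach_sym)
    next
      case 2
      then have "C = ?Y" using c by (auto intro: rtrancl_trans dest: reach_sym)
      then show ?thesis using C by simp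
    next
      case 3
      then have "D = ?Y" using d by (auto intro: rtrancl_trans dest: reach_sym)
      then show ?thesis using D by simp
    qed
  qed
  moreover have "?f ` (comps V E - {?Y}) \<subseteq> comps V ?E"
  proof
    fix D assume "D \<in> ?f ` (comps V E - {?Y})"
    then obtain v where "v \<in> V" "D = ?f {u \<in> V. reach E v u}" unfolding comps_def by blast
    then show "D \<in> comps V ?E" unfolding comps_def using f by blast
  qed
  ultimately have "card (comps V E - {?Y}) \<le> card (comps V ?E)"
    by (rule card_inj_on_le[OF _ _ fin(2)])
  moreover have "card (comps V E) \<le> card (comps V E - {?Y}) + 1"
    using fin(1) by (cases "?Y \<in> comps V E") (auto simp: card_Diff_singleton)
  ultimately show ?thesis by simp
qed

text \<open>Each pair of \<open>F\<close> lowers the number of components by at most one, and at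
  most one component is left in the end.\<close>

lemma card_comps_le:
  assumes "finite V" "finite F" "F \<subseteq> pairs V" "conn V (E \<union> F)"
  shows "card (comps V E) \<le> card F + 1"
  using assms(2,3,4)
proof (induction F arbitrary: E)
  case empty
  have "comps V E \<subseteq> {V}" using empty by (auto simp: comps_def conn_def)
  then show ?case by (metis add.commute card.empty card_insert_disjoint card_mono empty_iff finite.emptyI finite.insertI One_nat_def plus_nat.add_0 add_0)
next
  case (insert e F)
  then obtain x y where e: "e = {x, y}" by (auto simp: pairs_def)
  have "card (comps V (insert e E)) \<le> card F + 1"
    using insert.prems by (intro insert.IH) auto
  then show ?case using card_comps_insert[OF assms(1), of E x y] insert.hyps e by simp
qed

section \<open>Lower bounds on the size of a feasible set\<close>

lemma feasible_finite: "finite V \<Longrightarrow> feasible V E T F \<Longrightarrow> finite F"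
  unfolding feasible_def using finite_pairs finite_subset by blast

lemma feasible_card_T:
  assumes "finite V" "T \<subseteq> V" "feasible V E T F"
  shows "even (card T)" "card T \<le> 2 * card F"
proof -
  have "(\<Sum>v\<in>V. dg F v) = 2 * card F" using assms by (intro handshake) (auto simp: feasible_def)
  moreover have "(\<Sum>v\<in>T. dg F v) \<le> (\<Sum>v\<in>V. dg F v)" using assms by (intro sum_mono2) auto
  moreover have "(\<Sum>v\<in>T. 1) \<le> (\<Sum>v\<in>T. dg F v)"
    using assms by (intro sum_mono) (auto simp: feasible_def subset_iff odd_pos Suc_leI)
  ultimately show "card T \<le> 2 * card F" by simp
  have "{v \<in> V. odd (dg F v)} = T" using assms by (auto simp: feasible_def)
  then have "even (\<Sum>v\<in>V. dg F v) \<longleftrightarrow> even (card T)"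
    using even_sum_iff[OF assms(1), of "dg F"] by simp
  then show "even (card T)" using \<open>_ = 2 * card F\<close> by simp
qed

text \<open>A component disjoint from \<open>T\<close> is not the whole graph, so \<open>F\<close>
  must leave it; an end of \<open>F\<close> inside it has positive even degree, hence degree at
  least 2. One such vertex per component, together with the vertices of \<open>T\<close>, bounds the
  degree sum of \<open>F\<close> from below.\<close>

lemma feasible_tfree_bound:
  assumes V: "finite V" "E \<subseteq> pairs V" "T \<subseteq> V" and F: "feasible V E T F" and rep: "is_rep V E \<rho>"
    and two: "2 \<le> card (\<rho> ` V)"
  shows "card T + 2 * card (tfree V \<rho> T) \<le> 2 * card F"
proof -
  have finF: "finite F" using V(1) F by (rule feasible_finite)
  have "\<exists>v\<in>V. \<rho> v = r \<and> 2 \<le> dg F v" if r: "r \<in> tfree V \<rho> T" for r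
  proof (rule ccontr)
    assume "\<not> ?thesis"
    then have small: "dg F v < 2" if "v \<in> V" "\<rho> v = r" for v using that by force
    have rV: "r \<in> V" "\<rho> r = r" using r rep by (auto simp: tfree_def is_rep_def)
    obtain s where s: "s \<in> \<rho> ` V" "s \<noteq> r"
    proof -
      have "\<not> \<rho> ` V \<subseteq> {r}" using two card_mono[of "{r}" "\<rho> ` V"] by auto
      then show ?thesis using that by auto
    qed
    then have sV: "s \<in> V" "\<rho> s = s" using rep by (auto simp: is_rep_def)
    \<comment> \<open>Degrees below 2 outside \<open>T\<close> are 0 by parity, so \<open>F\<close>
      would not touch the component, which would then be closed under the edges of the modified
      graph.\<close>
    have "reach (sym_diff E F) r s" using F rV sV by (auto simp: feasible_def conn_def)
    moreover have "r \<in> {v \<in> V. \<rho> v = r}" using rV by simp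
    moreover have "y \<in> {v \<in> V. \<rho> v = r}" if x: "x \<in> {v \<in> V. \<rho> v = r}" and e: "{x, y} \<in> sym_diff E F" for x y
    proof -
      have "dg F x < 2" "x \<notin> T" using x small r by (auto simp: tfree_def)
      then have "dg F x = 0" using F x unfolding feasible_def
        by (metis (mono_tags, lifting) less_2_cases mem_Collect_eq odd_one One_nat_def)
      then have "{x, y} \<notin> F" unfolding dg_def using finF by auto
      then have "{x, y} \<in> E" using e by auto
      then have "y \<in> V" "reach E x y" using V by (auto simp: pairs_def doubleton_eq_iff)
      then show ?thesis using x rep by (metis (mono_tags, lifting) is_rep_def mem_Collect_eq)
    qed
    ultimately have "s \<in> {v \<in> V. \<rho> v = r}" by (rule reach_closed)
    then show False using s sV by simp
  qed
  then obtain f where f: "f r \<in> V" "\<rho> (f r) = r" "2 \<le> dg F (f r)" if "r \<in> tfree V \<rho> T" for r by metis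
  let ?K = "tfree V \<rho> T"
  have fin: "finite ?K" using V by (simp add: tfree_def)
  have inj: "inj_on f ?K" by (rule inj_onI) (metis f(2))
  have disj: "T \<inter> f ` ?K = {}" using f by (auto simp: tfree_def)
  have "card T + 2 * card ?K = (\<Sum>v\<in>T. 1) + (\<Sum>v\<in>f ` ?K. 2)" using inj by (simp add: card_image)
  also have "\<dots> \<le> (\<Sum>v\<in>T. dg F v) + (\<Sum>v\<in>f ` ?K. dg F v)"
  proof (rule add_mono)
    show "(\<Sum>v\<in>T. 1) \<le> (\<Sum>v\<in>T. dg F v)"
      using F V by (intro sum_mono) (auto simp: feasible_def subset_iff odd_pos Suc_leI)
    show "(\<Sum>v\<in>f ` ?K. 2) \<le> (\<Sum>v\<in>f ` ?K. dg F v)" using f by (intro sum_mono) auto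
  qed
  also have "\<dots> = (\<Sum>v\<in>T \<union> f ` ?K. dg F v)"
    using V fin disj by (intro sum.union_disjoint[symmetric]) (auto intro: finite_subset)
  also have "\<dots> \<le> (\<Sum>v\<in>V. dg F v)" using V f by (intro sum_mono2) auto
  also have "\<dots> = 2 * card F" using F V by (intro handshake) (auto simp: feasible_def)
  finally show ?thesis .
qed

text \<open>Each end of an edge lies on a further edge, and these two further edges differ, since an
  edge through both ends would be the first one again.\<close>

lemma even_graph_card:
  assumes V: "finite V" "F \<subseteq> pairs V" and ev: "\<forall>v \<in> V. even (dg F v)" and ne: "F \<noteq> {}"
  shows "3 \<le> card F"
proof -
  have fin: "finite F" using V finite_pairs finite_subset by blast
  have dg2: "2 \<le> dg F v" if "e \<in> F" "v \<in> e" for e v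
  proof -
    have "v \<in> V" using that V(2) by (auto simp: pairs_def)
    moreover have "dg F v \<noteq> 0" unfolding dg_def using that fin by auto
    ultimately show ?thesis using ev by (metis One_nat_def bot_nat_0.not_eq_extremum less_2_cases not_le odd_one)
  qed
  from ne obtain e where "e \<in> F" by auto
  then obtain x y where e: "{x, y} \<in> F" "x \<noteq> y" using V(2) by (auto simp: pairs_def)
  have ex: "\<exists>f\<in>F. f \<noteq> {x, y} \<and> v \<in> f" if "v \<in> {x, y}" for v
  proof (rule ccontr)
    assume "\<not> ?thesis"
    then have "{f \<in> F. v \<in> f} \<subseteq> {{x, y}}" by auto
    then have "dg F v \<le> 1" unfolding dg_def by (metis card.empty card_insert_disjoint card_mono empty_iff finite.emptyI finite.insertI One_nat_def)
    then show False using dg2[OF e(1) that] by simp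
  qed
  obtain f g where fg: "f \<in> F" "f \<noteq> {x, y}" "x \<in> f" "g \<in> F" "g \<noteq> {x, y}" "y \<in> g" using ex by blast
  have "f \<noteq> g"
  proof
    assume "f = g"
    then have "{x, y} \<subseteq> f" using fg by auto
    moreover obtain a b where "f = {a, b}" using fg(1) V(2) by (auto simp: pairs_def)
    ultimately show False using fg(2) e(2) by auto
  qed
  then have "card {{x, y}, f, g} = 3" using fg by simp
  moreover have "{{x, y}, f, g} \<subseteq> F" using e fg by auto
  ultimately show ?thesis using card_mono[OF fin] by metis
qed

text \<open>If \<open>F\<close> had only half as many pairs as \<open>T\<close> has vertices, it
  would be a perfect matching of \<open>T\<close>. The pair at the centre c is then a bridge cx,
  which gets deleted, and on the side of x no vertex other than x is touched by \<open>F\<close>, so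
  this side stays cut off.\<close>

lemma star_exc_bound:
  assumes V: "finite V" "E \<subseteq> pairs V" "T \<subseteq> V" and F: "feasible V E T F" and exc: "star_exc E T"
  shows "card T < 2 * card F"
proof (rule ccontr)
  assume "\<not> ?thesis"
  then have eq: "card T = 2 * card F" using feasible_card_T[OF V(1,3) F] by simp
  have hs: "(\<Sum>v\<in>V. dg F v) = 2 * card F" using F V by (intro handshake) (auto simp: feasible_def)
  have finF: "finite F" using V(1) F by (rule feasible_finite)
  have finT: "finite T" using V finite_subset by blast
  have ge: "(if v \<in> T then 1 else 0) \<le> dg F v" if "v \<in> V" for v
    using that F by (auto simp: feasible_def odd_pos Suc_leI)
  have "(\<Sum>v\<in>V. if v \<in> T then 1 else 0) = card T"
    using V by (simp add: sum.If_cases Int_absorb1)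
  \<comment> \<open>Equality in the degree count forces degree 1 on \<open>T\<close> and degree 0
    elsewhere.\<close>
  then have all: "\<forall>v\<in>V. (if v \<in> T then 1 else 0) = dg F v"
    using sum_mono_inv[of "\<lambda>v. if v \<in> T then 1 else 0" V "dg F"] ge V(1) eq hs by auto
  from exc obtain c where c: "c \<in> T" "\<And>x. x \<in> T - {c} \<Longrightarrow> bridge E c x" by (auto simp: star_exc_def)
  have "dg F c = 1" using all c V by (metis subsetD)
  then obtain e where e: "{e \<in> F. c \<in> e} = {e}" unfolding dg_def using card_1_singletonE by blast
  then have eF: "e \<in> F" "c \<in> e" by auto
  then obtain x where x: "e = {c, x}" "x \<in> V" "x \<noteq> c"
    using F by (auto simp: feasible_def pairs_def)
  have dx: "dg F x \<noteq> 0" unfolding dg_def using eF x finF by auto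
  then have xT: "x \<in> T" using all x by metis
  have br: "bridge E c x" using c xT x by auto
  let ?E = "E - {{c, x}}"
  let ?S = "{z \<in> V. reach ?E x z}"
  have cS: "c \<notin> ?S" using br by (auto simp: bridge_def dest: reach_sym)
  \<comment> \<open>Any other vertex of \<open>T\<close> is joined to c by an edge different from
    cx, so it cannot lie on the side of x.\<close>
  have ST: "z = x" if "z \<in> ?S" "z \<in> T" for z
  proof (rule ccontr)
    assume "z \<noteq> x"
    have "z \<noteq> c" using that cS by auto
    then have "{z, c} \<in> ?E" using c(2)[of z] that \<open>z \<noteq> x\<close> by (auto simp: bridge_def doubleton_eq_iff insert_commute)
    moreover have "reach ?E x z" using that by simp
    ultimately have "reach ?E x c" by (rule reach_step[rotated])
    then show False using cS c V by auto
  qed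
  have "dg F x = 1" using all xT V by (metis subsetD)
  then obtain e' where e': "{e \<in> F. x \<in> e} = {e'}" unfolding dg_def using card_1_singletonE by blast
  have uniq: "f = {c, x}" if "f \<in> F" "x \<in> f" for f
    using e' eF x that by (metis (no_types, lifting) insertCI mem_Collect_eq singletonD)
  have "reach (sym_diff E F) x c" using F x c V by (auto simp: feasible_def conn_def)
  moreover have "x \<in> ?S" using x by simp
  moreover have "w \<in> ?S" if z: "z \<in> ?S" and zw: "{z, w} \<in> sym_diff E F" for z w
  proof (cases "{z, w} \<in> E")
    case True
    then have "{z, w} \<notin> F" using zw by auto
    then have "{z, w} \<in> ?E" using True eF x by auto
    moreover have "w \<in> V" using True V(2) by (auto simp: pairs_def doubleton_eq_iff)
    ultimately show ?thesis using z reach_step[of x z ?E w] by simp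
  next
    case False
    then have zwF: "{z, w} \<in> F" using zw by auto
    then have "dg F z \<noteq> 0" unfolding dg_def using finF by auto
    then have "z \<in> T" using all z by (metis (no_types, lifting) mem_Collect_eq)
    then have "z = x" using ST z by blast
    then have "{z, w} = {c, x}" using uniq zwF by auto
    then show ?thesis using False br by (simp add: bridge_def)
  qed
  ultimately have "c \<in> ?S" by (rule reach_closed)
  then show False using cS by simp
qed

theorem opt_bound_le:
  assumes V: "finite V" "E \<subseteq> pairs V" "T \<subseteq> V" and F: "feasible V E T F" and rep: "is_rep V E \<rho>"
  shows "opt_bound V E \<rho> T \<le> card F"
proof -
  note ft = feasible_card_T[OF V(1,3) F]
  have finF: "finite F" "F \<subseteq> pairs V" using feasible_finite[OF V(1) F] F by (auto simp: feasible_def)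
  show ?thesis
  proof (cases "card (\<rho> ` V) < 2")
    case True
    show ?thesis
    proof (cases "star_exc E T")
      case exc: True
      then show ?thesis using star_exc_bound[OF V F exc] ft True by (simp add: opt_bound_def)
    next
      case False
      then show ?thesis using ft True by (simp add: opt_bound_def)
    qed
  next
    case False
    then have two: "2 \<le> card (\<rho> ` V)" by simp
    have "card (comps V E) \<le> card F + 1"
    proof (rule card_comps_le[OF V(1) finF])
      show "conn V (E \<union> F)" using F unfolding feasible_def conn_def by (meson Diff_subset Un_mono reach_mono sup.cobounded1 sup.cobounded2 Un_least order_trans)
    qed
    then have 1: "card (\<rho> ` V) - 1 \<le> card F" using card_comps_rep[OF rep] by simp
    have 2: "card T div 2 + card (tfree V \<rho> T) \<le> card F"
      using feasible_tfree_bound[OF V F rep two] ft by simp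
    have 3: "3 \<le> card F" if "T = {}"
    proof (rule even_graph_card[OF V(1) finF(2)])
      show "\<forall>v\<in>V. even (dg F v)" using F that by (auto simp: feasible_def)
      have "tfree V \<rho> T = \<rho> ` V" using that by (auto simp: tfree_def)
      then have "card F \<noteq> 0" using 2 two by auto
      then show "F \<noteq> {}" by auto
    qed
    show ?thesis using 1 2 3 False by (auto simp: opt_bound_def)
  qed
qed

section \<open>Translation of operations and solutions into sets of toggled pairs\<close>

definition odd_set :: "'a graph \<Rightarrow> ('a \<Rightarrow> nat) \<Rightarrow> 'a set" where
  "odd_set G \<delta> = {v \<in> verts G. odd (degree G v) \<noteq> odd (\<delta> v)}"

lemma cong_2_iff: "[a = b] (mod 2) \<longleftrightarrow> (odd a \<longleftrightarrow> odd (b :: nat))"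
  unfolding cong_def by presburger

lemma simple_graph_iff: "simple_graph G \<longleftrightarrow> finite (verts G) \<and> edges G \<subseteq> pairs (verts G)"
  by (simp add: simple_graph_def pairs_def)

lemma non_edges_eq: "non_edges G = pairs (verts G) - edges G"
  by (simp add: non_edges_def pairs_def)

lemma connected_graph_iff: "connected_graph G \<longleftrightarrow> conn (verts G) (edges G)"
  by (simp add: connected_graph_def conn_def edge_rel_def)

lemma degree_eq_dg: "degree G v = dg (edges G) v"
  by (simp add: degree_def dg_def)

lemma feasible_iff_modified:
  assumes "simple_graph G" "F \<subseteq> pairs (verts G)"
    and H: "H = \<lparr>verts = verts G, edges = sym_diff (edges G) F\<rparr>"
  shows "feasible (verts G) (edges G) (odd_set G \<delta>) F \<longleftrightarrow>
    connected_graph H \<and> (\<forall>v \<in> verts G. [degree H v = \<delta> v] (mod 2))"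
proof -
  have fin: "finite (edges G)" "finite F"
    using assms finite_pairs finite_subset by (auto simp: simple_graph_iff)
  show ?thesis
    using assms(2) by (auto simp: feasible_def H connected_graph_iff cong_2_iff degree_eq_dg
        odd_dg_sym_diff[OF fin] odd_set_def)
qed

lemma solution_feasible:
  assumes G: "simple_graph G" and sol: "is_solution G \<delta> X"
  shows "\<exists>F. feasible (verts G) (edges G) (odd_set G \<delta>) F \<and> solution_size X = card F"
proof -
  obtain A D where X: "X = (A, D)" by fastforce
  have AD: "A \<subseteq> non_edges G" "D \<subseteq> edges G" using sol by (auto simp: X is_solution_def)
  then have sub: "A \<union> D \<subseteq> pairs (verts G)" using G by (auto simp: simple_graph_iff non_edges_eq)
  have eq: "modify G A D = \<lparr>verts = verts G, edges = sym_diff (edges G) (A \<union> D)\<rparr>"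
    using AD by (auto simp: modify_def non_edges_eq)
  have "feasible (verts G) (edges G) (odd_set G \<delta>) (A \<union> D)"
    using sol by (subst feasible_iff_modified[OF G sub eq]) (simp add: X is_solution_def)
  moreover have "card (A \<union> D) = card A + card D"
  proof (rule card_Un_disjoint)
    have "finite (A \<union> D)" using sub G finite_pairs finite_subset by (auto simp: simple_graph_iff)
    then show "finite A" "finite D" by auto
    show "A \<inter> D = {}" using AD by (auto simp: non_edges_eq)
  qed
  ultimately show ?thesis by (auto simp: X solution_size_def)
qed

lemma feasible_solution:
  assumes G: "simple_graph G" and F: "feasible (verts G) (edges G) (odd_set G \<delta>) F"
  shows "is_solution G \<delta> (F - edges G, F \<inter> edges G)"
    and "solution_size (F - edges G, F \<inter> edges G) = card F"
proof -
  have sub: "F \<subseteq> pairs (verts G)" using F by (simp add: feasible_def)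
  have eq: "modify G (F - edges G) (F \<inter> edges G) = \<lparr>verts = verts G, edges = sym_diff (edges G) F\<rparr>"
    by (auto simp: modify_def)
  show "is_solution G \<delta> (F - edges G, F \<inter> edges G)"
    using F sub by (auto simp: feasible_iff_modified[OF G sub eq] is_solution_def non_edges_eq)
  have "finite F" using G F feasible_finite by (auto simp: simple_graph_iff)
  then have "card F = card (F - edges G) + card (F \<inter> edges G)"
    by (metis Int_Diff_disjoint Un_Diff_Int add.commute card_Un_disjoint finite_Diff finite_Int inf_commute)
  then show "solution_size (F - edges G, F \<inter> edges G) = card F" by (simp add: solution_size_def)
qed

abbreviation op_step :: "('a graph \<times> 'a graph) set" where
  "op_step \<equiv> {(G1, G2). \<exists>x \<in> {ea, ed}. apply_op x G1 G2}"

lemma op_stepD: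
  assumes "(G1, G2) \<in> op_step" "edges G1 \<subseteq> pairs (verts G1)"
  shows "\<exists>e \<in> pairs (verts G1). G2 = \<lparr>verts = verts G1, edges = sym_diff (edges G1) {e}\<rparr>"
proof -
  from assms(1) obtain x where "apply_op x G1 G2" by auto
  then show ?thesis
  proof cases
    case (add_edge e)
    then have "e \<in> pairs (verts G1)" "insert e (edges G1) = sym_diff (edges G1) {e}"
      by (auto simp: non_edges_eq)
    then show ?thesis using add_edge by metis
  next
    case (delete_edge e)
    then have "e \<in> pairs (verts G1)" "edges G1 - {e} = sym_diff (edges G1) {e}"
      using assms(2) by auto
    then show ?thesis using delete_edge by metis
  qed
qed

lemma op_stepI:
  assumes "e \<in> pairs (verts G1)"
  shows "(G1, \<lparr>verts = verts G1, edges = sym_diff (edges G1) {e}\<rparr>) \<in> op_step"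
proof (cases "e \<in> edges G1")
  case True
  then have "sym_diff (edges G1) {e} = edges G1 - {e}" by auto
  then show ?thesis using delete_edge[OF True] by auto
next
  case False
  then have "sym_diff (edges G1) {e} = insert e (edges G1)" by auto
  then show ?thesis using add_edge[of e G1] False assms by (auto simp: non_edges_eq)
qed

text \<open>Operations on the same pair cancel, so the set of toggled pairs can be smaller than the
  number of operations but never larger.\<close>

lemma op_steps_sym_diff:
  assumes "(G, H) \<in> op_step ^^ j" "edges G \<subseteq> pairs (verts G)" "finite (verts G)"
  shows "\<exists>F \<subseteq> pairs (verts G). card F \<le> j \<and> H = \<lparr>verts = verts G, edges = sym_diff (edges G) F\<rparr>"
  using assms(1)
proof (induction j arbitrary: H)
  case 0
  then show ?case by (intro exI[of _ "{}"]) auto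
next
  case (Suc j)
  then obtain K where K: "(G, K) \<in> op_step ^^ j" "(K, H) \<in> op_step" by auto
  from Suc.IH[OF K(1)] obtain F where F: "F \<subseteq> pairs (verts G)" "card F \<le> j"
    "K = \<lparr>verts = verts G, edges = sym_diff (edges G) F\<rparr>" by auto
  from op_stepD[OF K(2)] F assms(2) obtain e where e: "e \<in> pairs (verts G)"
    "H = \<lparr>verts = verts G, edges = sym_diff (sym_diff (edges G) F) {e}\<rparr>" by auto
  have fin: "finite F" using F finite_pairs[OF assms(3)] finite_subset by blast
  have "card (sym_diff F {e}) \<le> card (insert e F)" using fin by (intro card_mono) auto
  also have "\<dots> \<le> Suc j" using F fin by (simp add: card_insert_if)
  finally have "card (sym_diff F {e}) \<le> Suc j" .
  moreover have "sym_diff (sym_diff (edges G) F) {e} = sym_diff (edges G) (sym_diff F {e})" by auto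
  ultimately show ?case using F e by (intro exI[of _ "sym_diff F {e}"]) auto
qed

lemma sym_diff_op_steps:
  assumes "finite F" "F \<subseteq> pairs (verts G)"
  shows "(G, \<lparr>verts = verts G, edges = sym_diff (edges G) F\<rparr>) \<in> op_step ^^ card F"
  using assms
proof (induction F)
  case empty
  then show ?case by simp
next
  case (insert e F)
  let ?K = "\<lparr>verts = verts G, edges = sym_diff (edges G) F\<rparr>"
  have "sym_diff (edges G) (insert e F) = sym_diff (edges ?K) {e}"
    using insert.hyps by auto
  moreover have "(?K, \<lparr>verts = verts ?K, edges = sym_diff (edges ?K) {e}\<rparr>) \<in> op_step"
    using insert.prems by (intro op_stepI) simp
  moreover have "(G, ?K) \<in> op_step ^^ card F" using insert by simp
  ultimately have "(G, \<lparr>verts = verts G, edges = sym_diff (edges G) (insert e F)\<rparr>) \<in> op_step ^^ Suc (card F)"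
    unfolding relpow.simps by (metis (no_types, lifting) relcompI graph.select_convs(1))
  then show ?case using insert.hyps by simp
qed

lemma CDPE_iff_feasible:
  assumes G: "simple_graph G"
  shows "CDPE {ea, ed} G k \<delta> \<longleftrightarrow> (\<exists>F. feasible (verts G) (edges G) (odd_set G \<delta>) F \<and> card F \<le> k)"
proof
  assume "CDPE {ea, ed} G k \<delta>"
  then obtain H j where H: "j \<le> k" "(G, H) \<in> op_step ^^ j" "connected_graph H"
    "\<forall>v \<in> verts H. [degree H v = \<delta> v] (mod 2)"
    by (auto simp: CDPE_def modifiable_def)
  from op_steps_sym_diff[OF H(2)] G obtain F where F: "F \<subseteq> pairs (verts G)" "card F \<le> j"
    "H = \<lparr>verts = verts G, edges = sym_diff (edges G) F\<rparr>" by (auto simp: simple_graph_iff)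
  have "verts H = verts G" using F(3) by simp
  then have "feasible (verts G) (edges G) (odd_set G \<delta>) F"
    using H feasible_iff_modified[OF G F(1,3)] by simp
  then show "\<exists>F. feasible (verts G) (edges G) (odd_set G \<delta>) F \<and> card F \<le> k"
    using F H by (intro exI[of _ F]) simp
next
  assume "\<exists>F. feasible (verts G) (edges G) (odd_set G \<delta>) F \<and> card F \<le> k"
  then obtain F where F: "feasible (verts G) (edges G) (odd_set G \<delta>) F" "card F \<le> k" by auto
  have sub: "F \<subseteq> pairs (verts G)" using F by (simp add: feasible_def)
  have fin: "finite F" using G F feasible_finite by (auto simp: simple_graph_iff)
  let ?H = "\<lparr>verts = verts G, edges = sym_diff (edges G) F\<rparr>"
  have "modifiable {ea, ed} k G ?H"
    unfolding modifiable_def using sym_diff_op_steps[OF fin sub] F(2) by blast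
  then show "CDPE {ea, ed} G k \<delta>"
    unfolding CDPE_def using feasible_iff_modified[OF G sub refl] F(1) by (intro exI[of _ ?H]) simp
qed

section \<open>Weakest preconditions with running time\<close>

text \<open>Total correctness with cost: the postcondition receives the exact number of steps. Since
  an overflowing program has no execution, \<open>wp\<close> also certifies that all written numbers
  stay below W.\<close>

definition wp :: "nat \<Rightarrow> program \<Rightarrow> state \<Rightarrow> (nat \<Rightarrow> state \<Rightarrow> bool) \<Rightarrow> bool" where
  "wp W P s Q \<longleftrightarrow> (\<exists>t s'. exec W P s t s' \<and> Q t s')"

abbreviation Seq_infix :: "program \<Rightarrow> program \<Rightarrow> program"  (infixr ";;" 60) where
  "P ;; Q \<equiv> Seq P Q"

lemma wp_mono: "wp W P s Q \<Longrightarrow> (\<And>t s'. Q t s' \<Longrightarrow> Q' t s') \<Longrightarrow> wp W P s Q'"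
  by (auto simp: wp_def)

lemma wp_Skip: "wp W Skip s Q \<longleftrightarrow> Q 1 s"
  unfolding wp_def by (auto simp del: One_nat_def intro: exec.Skip elim: exec.cases)

lemma wp_Assign: "wp W (Assign r x) s Q \<longleftrightarrow> val s x < W \<and> Q 1 (set_reg r (val s x) s)"
  unfolding wp_def by (auto simp del: One_nat_def intro: exec.Assign elim: exec.cases)

lemma wp_Add: "wp W (Add r x y) s Q \<longleftrightarrow>
    val s x + val s y < W \<and> Q 1 (set_reg r (val s x + val s y) s)"
  unfolding wp_def by (auto simp del: One_nat_def intro: exec.Add elim: exec.cases)

lemma wp_Sub: "wp W (Sub r x y) s Q \<longleftrightarrow>
    val s x - val s y < W \<and> Q 1 (set_reg r (val s x - val s y) s)"
  unfolding wp_def by (auto simp del: One_nat_def intro: exec.Sub elim: exec.cases)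

lemma wp_Load: "wp W (Load r b x) s Q \<longleftrightarrow>
    arrs s b (val s x) < W \<and> Q 1 (set_reg r (arrs s b (val s x)) s)"
  unfolding wp_def by (auto simp del: One_nat_def intro: exec.Load elim: exec.cases)

lemma wp_Store: "wp W (Store b x y) s Q \<longleftrightarrow>
    val s y < W \<and> Q 1 (set_arr b (val s x) (val s y) s)"
  unfolding wp_def by (auto simp del: One_nat_def intro: exec.Store elim: exec.cases)

lemma wp_Seq: "wp W (P ;; P') s Q \<longleftrightarrow> wp W P s (\<lambda>t s'. wp W P' s' (\<lambda>u. Q (t + u)))"
proof
  assume "wp W (P ;; P') s Q"
  then obtain t s' where e: "exec W (P ;; P') s t s'" and q: "Q t s'" by (auto simp: wp_def)
  from e q show "wp W P s (\<lambda>t s'. wp W P' s' (\<lambda>u. Q (t + u)))"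
    by cases (auto simp: wp_def)
next
  assume "wp W P s (\<lambda>t s'. wp W P' s' (\<lambda>u. Q (t + u)))"
  then show "wp W (P ;; P') s Q" unfolding wp_def by (blast intro: exec.Seq)
qed

lemma wp_Cond: "wp W (Cond b P P') s Q \<longleftrightarrow>
    (if holds s b then wp W P s (\<lambda>t. Q (1 + t)) else wp W P' s (\<lambda>t. Q (1 + t)))"
proof
  assume "wp W (Cond b P P') s Q"
  then obtain t s' where e: "exec W (Cond b P P') s t s'" and q: "Q t s'" by (auto simp: wp_def)
  from e q show "if holds s b then wp W P s (\<lambda>t. Q (1 + t)) else wp W P' s (\<lambda>t. Q (1 + t))"
    by cases (auto simp: wp_def)
next
  assume "if holds s b then wp W P s (\<lambda>t. Q (1 + t)) else wp W P' s (\<lambda>t. Q (1 + t))"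
  then show "wp W (Cond b P P') s Q"
    unfolding wp_def
    by (cases "holds s b") (simp_all only: if_True if_False, (blast intro: exec.CondT exec.CondF)+)
qed

lemmas wp_simps = wp_Skip wp_Assign wp_Add wp_Sub wp_Load wp_Store wp_Seq wp_Cond

lemma regs_set_reg [simp]: "regs (set_reg r a s) = (regs s)(r := a)"
  by (simp add: set_reg_def)

lemma arrs_set_reg [simp]: "arrs (set_reg r a s) = arrs s"
  by (simp add: set_reg_def)

lemma regs_set_arr [simp]: "regs (set_arr b i a s) = regs s"
  by (simp add: set_arr_def)

lemma arrs_set_arr [simp]: "arrs (set_arr b i a s) = (arrs s)(b := (arrs s b)(i := a))"
  by (simp add: set_arr_def)

fun wregs :: "program \<Rightarrow> nat set" where
  "wregs Skip = {}"
| "wregs (Assign r x) = {r}"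
| "wregs (Add r x y) = {r}"
| "wregs (Sub r x y) = {r}"
| "wregs (Load r b x) = {r}"
| "wregs (Store b x y) = {}"
| "wregs (Seq P Q) = wregs P \<union> wregs Q"
| "wregs (Cond b P Q) = wregs P \<union> wregs Q"
| "wregs (While b P) = wregs P"

fun warrs :: "program \<Rightarrow> nat set" where
  "warrs (Store b x y) = {b}"
| "warrs (Seq P Q) = warrs P \<union> warrs Q"
| "warrs (Cond b P Q) = warrs P \<union> warrs Q"
| "warrs (While b P) = warrs P"
| "warrs _ = {}"

text \<open>What a program may change is read off its syntax by \<open>wregs\<close> and
  \<open>warrs\<close>. Specifications can thus concentrate on what is computed and recover
  unchanged memory from \<open>wp_frame\<close>.\<close>

definition frame :: "nat set \<Rightarrow> nat set \<Rightarrow> state \<Rightarrow> state \<Rightarrow> bool" where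
  "frame R A s s' \<longleftrightarrow> (\<forall>r. r \<notin> R \<longrightarrow> regs s' r = regs s r) \<and> (\<forall>b. b \<notin> A \<longrightarrow> arrs s' b = arrs s b)"

lemma frame_trans: "frame R A s s' \<Longrightarrow> frame R A s' s'' \<Longrightarrow> frame R A s s''"
  by (simp add: frame_def)

lemma frame_mono: "frame R A s s' \<Longrightarrow> R \<subseteq> R' \<Longrightarrow> A \<subseteq> A' \<Longrightarrow> frame R' A' s s'"
  by (auto simp: frame_def)

lemma exec_frame: "exec W P s t s' \<Longrightarrow> frame (wregs P) (warrs P) s s'"
  by (induction rule: exec.induct) (auto simp: frame_def)

lemma wp_frame:
  "wp W P s Q \<Longrightarrow> wp W P s (\<lambda>t s'. Q t s' \<and> frame (wregs P) (warrs P) s s')"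
  unfolding wp_def using exec_frame by blast

text \<open>Amortized cost: each round is paid by a decrease of the potential \<Phi>. The 1 in the
  step is the successful test, the 1 in the conclusion the final failing one.\<close>

lemma wp_While:
  assumes "I s"
    and step: "\<And>s. I s \<Longrightarrow> holds s b \<Longrightarrow> wp W P s (\<lambda>t s'. I s' \<and> t + 1 + \<Phi> s' \<le> \<Phi> s)"
  shows "wp W (While b P) s (\<lambda>t s'. t \<le> \<Phi> s + 1 \<and> I s' \<and> \<not> holds s' b)"
  using assms(1)
proof (induction "\<Phi> s" arbitrary: s rule: less_induct)
  case less
  show ?case
  proof (cases "holds s b")
    case False
    then show ?thesis using less.prems by (auto simp: wp_def intro!: exI[of _ 1] exec.WhileF)
  next
    case True
    from step[OF less.prems True] obtain t s1 where 1: "exec W P s t s1" "I s1" "t + 1 + \<Phi> s1 \<le> \<Phi> s"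
      by (auto simp: wp_def)
    from less.hyps[of s1] 1 obtain u s2 where
      2: "exec W (While b P) s1 u s2" "u \<le> \<Phi> s1 + 1" "I s2" "\<not> holds s2 b" by (auto simp: wp_def)
    have "exec W (While b P) s (1 + t + u) s2" using True 1(1) 2(1) by (rule exec.WhileT)
    then show ?thesis using 1 2 unfolding wp_def by (intro exI[of _ "1 + t + u"] exI[of _ s2]) auto
  qed
qed

text \<open>The upper bound is an operand that every test evaluates anew; \<open>wp_For\<close>
  therefore demands that neither the body nor the counter changes it.\<close>

definition For :: "nat \<Rightarrow> operand \<Rightarrow> operand \<Rightarrow> program \<Rightarrow> program" where
  "For i lo hi P = Assign i lo ;; While (Less (Reg i) hi) (P ;; Add i (Reg i) (Num 1))"

lemma wregs_For [simp]: "wregs (For i lo hi P) = insert i (wregs P)"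
  by (auto simp: For_def)

lemma warrs_For [simp]: "warrs (For i lo hi P) = warrs P"
  by (auto simp: For_def)

text \<open>Per round, the extra 2 are the test and the increment; the final 2 are the initial
  assignment and the failing test. The bound \<open>c\<close> may depend on the round, which is
  needed for sums over degrees.\<close>

lemma wp_For:
  assumes le: "val s lo \<le> val s hi" "val s hi < W"
    and i: "i \<notin> wregs P" and hi: "\<And>r. hi = Reg r \<Longrightarrow> r \<noteq> i \<and> r \<notin> wregs P"
    and init: "I (val s lo) (set_reg i (val s lo) s)"
    and step: "\<And>j s'. val s lo \<le> j \<Longrightarrow> j < val s hi \<Longrightarrow> regs s' i = j \<Longrightarrow> I j s' \<Longrightarrow>
      frame (insert i (wregs P)) (warrs P) s s' \<Longrightarrow>
      wp W P s' (\<lambda>t s''. t \<le> c j \<and> I (Suc j) (set_reg i (Suc j) s''))"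
  shows "wp W (For i lo hi P) s (\<lambda>t s'. t \<le> (\<Sum>j = val s lo..<val s hi. c j + 2) + 2 \<and>
    I (val s hi) s' \<and> regs s' i = val s hi \<and> frame (insert i (wregs P)) (warrs P) s s')"
proof -
  let ?l = "val s lo" and ?h = "val s hi" and ?s = "set_reg i (val s lo) s"
  let ?I = "\<lambda>s'. \<exists>j. ?l \<le> j \<and> j \<le> ?h \<and> regs s' i = j \<and> I j s' \<and> frame (insert i (wregs P)) (warrs P) s s'"
  let ?\<Phi> = "\<lambda>s'. \<Sum>j = regs s' i..<?h. c j + 2"
  have hi_val: "val s' hi = ?h" if "frame (insert i (wregs P)) (warrs P) s s'" for s'
    using that hi by (cases hi) (auto simp: frame_def)
  have "wp W (While (Less (Reg i) hi) (P ;; Add i (Reg i) (Num 1))) ?s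
     (\<lambda>t s'. t \<le> ?\<Phi> ?s + 1 \<and> ?I s' \<and> \<not> holds s' (Less (Reg i) hi))"
  proof (rule wp_While)
    show "?I ?s" using le init by (auto simp: frame_def)
  next
    fix s' assume I: "?I s'" and h: "holds s' (Less (Reg i) hi)"
    then obtain j where j: "?l \<le> j" "j \<le> ?h" "regs s' i = j" "I j s'"
      "frame (insert i (wregs P)) (warrs P) s s'" by auto
    then have jh: "j < ?h" using h hi_val[of s'] by simp
    have sum: "?\<Phi> s' = c j + 2 + (\<Sum>j = Suc j..<?h. c j + 2)"
      using jh j by (simp add: sum.atLeast_Suc_lessThan)
    have "wp W P s' (\<lambda>t s''. (t \<le> c j \<and> I (Suc j) (set_reg i (Suc j) s'')) \<and> frame (wregs P) (warrs P) s' s'')"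
      using step[OF j(1) jh j(3,4,5)] by (rule wp_frame)
    then show "wp W (P ;; Add i (Reg i) (Num 1)) s' (\<lambda>t s''. ?I s'' \<and> t + 1 + ?\<Phi> s'' \<le> ?\<Phi> s')"
      unfolding wp_Seq
    proof (rule wp_mono)
      fix t s''
      assume A: "(t \<le> c j \<and> I (Suc j) (set_reg i (Suc j) s'')) \<and> frame (wregs P) (warrs P) s' s''"
      then have i'': "regs s'' i = j" using i j by (auto simp: frame_def)
      have fr: "frame (insert i (wregs P)) (warrs P) s (set_reg i (Suc j) s'')"
        using A j(5) by (auto simp: frame_def)
      show "wp W (Add i (Reg i) (Num 1)) s'' (\<lambda>u s3. ?I s3 \<and> t + u + 1 + ?\<Phi> s3 \<le> ?\<Phi> s')"
        unfolding wp_Add using i'' A fr j jh le sum by auto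
    qed
  qed
  then show ?thesis
    unfolding For_def wp_Seq wp_Assign
  proof (intro conjI)
    show "?l < W" using le by simp
  next
    assume "wp W (While (Less (Reg i) hi) (P ;; Add i (Reg i) (Num 1))) ?s
     (\<lambda>t s'. t \<le> ?\<Phi> ?s + 1 \<and> ?I s' \<and> \<not> holds s' (Less (Reg i) hi))"
    then show "wp W (While (Less (Reg i) hi) (P ;; Add i (Reg i) (Num 1))) ?s
       (\<lambda>u s'. 1 + u \<le> (\<Sum>j = ?l..<?h. c j + 2) + 2 \<and> I ?h s' \<and> regs s' i = ?h \<and>
        frame (insert i (wregs P)) (warrs P) s s')"
    proof (rule wp_mono)
      fix t s'
      assume A: "t \<le> ?\<Phi> ?s + 1 \<and> ?I s' \<and> \<not> holds s' (Less (Reg i) hi)"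
      then obtain j where j: "?l \<le> j" "j \<le> ?h" "regs s' i = j" "I j s'"
        "frame (insert i (wregs P)) (warrs P) s s'" by auto
      then have "j = ?h" using A hi_val[of s'] by simp
      then show "1 + t \<le> (\<Sum>j = ?l..<?h. c j + 2) + 2 \<and> I ?h s' \<and> regs s' i = ?h \<and>
        frame (insert i (wregs P)) (warrs P) s s'" using A j by simp
    qed
  qed
qed

lemma wp_For_const:
  assumes "val s lo = 0" "val s hi < W" "val s hi \<le> n"
    and "i \<notin> wregs P" and "\<And>r. hi = Reg r \<Longrightarrow> r \<noteq> i \<and> r \<notin> wregs P"
    and "I 0 (set_reg i 0 s)"
    and "\<And>j s'. j < val s hi \<Longrightarrow> regs s' i = j \<Longrightarrow> I j s' \<Longrightarrow>
      frame (insert i (wregs P)) (warrs P) s s' \<Longrightarrow>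
      wp W P s' (\<lambda>t s''. t \<le> c \<and> I (Suc j) (set_reg i (Suc j) s''))"
  shows "wp W (For i lo hi P) s (\<lambda>t s'. t \<le> (c + 2) * n + 2 \<and>
    I (val s hi) s' \<and> frame (insert i (wregs P)) (warrs P) s s')"
proof -
  have "wp W (For i lo hi P) s (\<lambda>t s'. t \<le> (\<Sum>j = val s lo..<val s hi. c + 2) + 2 \<and>
    I (val s hi) s' \<and> regs s' i = val s hi \<and> frame (insert i (wregs P)) (warrs P) s s')"
    by (rule wp_For) (use assms in auto)
  then show ?thesis
  proof (rule wp_mono)
    fix t s' assume A: "t \<le> (\<Sum>j = val s lo..<val s hi. c + 2) + 2 \<and>
      I (val s hi) s' \<and> regs s' i = val s hi \<and> frame (insert i (wregs P)) (warrs P) s s'"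
    have "(\<Sum>j = val s lo..<val s hi. c + 2) = (c + 2) * val s hi" using assms(1) by simp
    also have "\<dots> \<le> (c + 2) * n" using assms(3) by (intro mult_le_mono) auto
    finally show "t \<le> (c + 2) * n + 2 \<and> I (val s hi) s' \<and> frame (insert i (wregs P)) (warrs P) s s'"
      using A by linarith
  qed
qed

section \<open>Breadth-first search\<close>

lemma inj_on_append:
  assumes "inj_on Q {..<t}" "u \<notin> Q ` {..<t :: nat}"
  shows "inj_on (Q(t := u)) {..<Suc t}"
proof -
  have "(Q(t := u)) ` {..<t} = Q ` {..<t}" by auto
  then show ?thesis using assms by (simp add: lessThan_Suc inj_on_fun_updI)
qed

text \<open>Adjacency lists stored as a concatenation: the list of \<open>v\<close> occupies the positions
  from \<open>off v\<close> up to \<open>off (Suc v)\<close>.  The vertex \<open>X\<close> is skipped by the search;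
  \<open>X = n\<close> skips nothing.\<close>

locale list_graph =
  fixes off nb :: "nat \<Rightarrow> nat" and n X :: nat
  assumes off0: "off 0 = 0"
    and off_mono: "v < n \<Longrightarrow> off v \<le> off (Suc v)"
    and nb_less: "i < off n \<Longrightarrow> nb i < n"
    and nb_sym: "v < n \<Longrightarrow> off v \<le> i \<Longrightarrow> i < off (Suc v) \<Longrightarrow>
      \<exists>j. off (nb i) \<le> j \<and> j < off (Suc (nb i)) \<and> nb j = v"
begin

definition arcs :: "(nat \<times> nat) set" where
  "arcs = {(u, v). u < n \<and> u \<noteq> X \<and> v \<noteq> X \<and> (\<exists>i. off u \<le> i \<and> i < off (Suc u) \<and> nb i = v)}"

lemma off_le: "u \<le> v \<Longrightarrow> v \<le> n \<Longrightarrow> off u \<le> off v"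
proof (induction v)
  case (Suc v)
  then show ?case using off_mono[of v] by (cases "u = Suc v") auto
qed simp

lemma sum_off: "k \<le> n \<Longrightarrow> (\<Sum>v<k. off (Suc v) - off v) = off k"
proof (induction k)
  case (Suc k)
  then show ?case using off_mono[of k] by simp
qed (simp add: off0)

text \<open>\<open>s\<close> is the next seed, \<open>Q\<close> a queue whose entries before \<open>h\<close> have been
  dequeued, and \<open>[i, e)\<close> the unscanned part of the list of the last dequeued vertex;
  \<open>c\<close> is the current label.\<close>

definition search_inv ::
  "(nat \<Rightarrow> nat) \<Rightarrow> (nat \<Rightarrow> nat) \<Rightarrow> nat \<Rightarrow> nat \<Rightarrow> nat \<Rightarrow> nat \<Rightarrow> nat \<Rightarrow> nat \<Rightarrow> bool" where
  "search_inv lab Q s h t i e c \<longleftrightarrow>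
     h \<le> t \<and> s \<le> n \<and> inj_on Q {..<t} \<and> lab X = Suc n \<and> c \<le> n \<and>
     (\<forall>j<t. Q j < n \<and> Q j \<noteq> X \<and> lab (Q j) \<noteq> 0) \<and>
     (\<forall>v<n. v \<noteq> X \<longrightarrow> lab v \<noteq> 0 \<longrightarrow> v \<in> Q ` {..<t}) \<and>
     (\<forall>v<s. lab v \<noteq> 0) \<and>
     (\<forall>v<n. v \<noteq> X \<longrightarrow> lab v \<noteq> 0 \<longrightarrow>
        (\<exists>r<n. r \<noteq> X \<and> lab v = Suc r \<and> lab r = Suc r \<and> (r, v) \<in> arcs\<^sup>*)) \<and>
     (\<forall>j<t. h \<le> j \<or> (Suc j = h \<and> i < e) \<longrightarrow> lab (Q j) = c) \<and>
     (\<forall>j<h. \<forall>k. off (Q j) \<le> k \<and> k < off (Suc (Q j)) \<and> (Suc j = h \<longrightarrow> k < i) \<longrightarrow>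
        nb k = X \<or> lab (nb k) = lab (Q j)) \<and>
     (if h = 0 then i = 0 \<and> e = 0 else e = off (Suc (Q (h - 1))) \<and> off (Q (h - 1)) \<le> i \<and> i \<le> e)"

lemma search_invD:
  assumes "search_inv lab Q s h t i e c"
  shows "j < t \<Longrightarrow> Q j < n" "j < t \<Longrightarrow> Q j \<noteq> X" "j < t \<Longrightarrow> lab (Q j) \<noteq> 0"
    and "v < n \<Longrightarrow> v \<noteq> X \<Longrightarrow> lab v \<noteq> 0 \<Longrightarrow> v \<in> Q ` {..<t}"
    and "v < s \<Longrightarrow> lab v \<noteq> 0"
    and "v < n \<Longrightarrow> v \<noteq> X \<Longrightarrow> lab v \<noteq> 0 \<Longrightarrow>
      \<exists>r<n. r \<noteq> X \<and> lab v = Suc r \<and> lab r = Suc r \<and> (r, v) \<in> arcs\<^sup>*"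
    and "j < t \<Longrightarrow> h \<le> j \<or> (Suc j = h \<and> i < e) \<Longrightarrow> lab (Q j) = c"
    and "j < h \<Longrightarrow> off (Q j) \<le> k \<Longrightarrow> k < off (Suc (Q j)) \<Longrightarrow> (Suc j = h \<longrightarrow> k < i) \<Longrightarrow>
      nb k = X \<or> lab (nb k) = lab (Q j)"
    and "inj_on Q {..<t}" "lab X = Suc n"
  using assms unfolding search_inv_def by - (simp_all, (elim disjE conjE; simp))

lemma search_inv_bounds:
  assumes "search_inv lab Q s h t i e c"
  shows "h \<le> t" "s \<le> n" "t \<le> n" "c \<le> n" "i \<le> e" "e \<le> off n"
proof -
  note B = assms[unfolded search_inv_def]
  show "h \<le> t" "s \<le> n" "c \<le> n" using B by auto
  have "card (Q ` {..<t}) = t" using B by (simp add: card_image)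
  moreover have "Q ` {..<t} \<subseteq> {..<n}" using B by auto
  ultimately show "t \<le> n" by (metis card_lessThan card_mono finite_lessThan)
  show "i \<le> e" using B by (auto split: if_splits)
  show "e \<le> off n"
  proof (cases "h = 0")
    case False
    then have "Q (h - 1) < n" using B by auto
    then show ?thesis using False B off_le[of "Suc (Q (h - 1))" n] by auto
  qed (use B in auto)
qed

lemma search_inv_current:
  assumes B: "search_inv lab Q s h t i e c" and ie: "i < e"
  shows "0 < h" "Q (h - 1) < n" "Q (h - 1) \<noteq> X" "lab (Q (h - 1)) = c" "c \<noteq> 0"
    "off (Q (h - 1)) \<le> i" "i < off (Suc (Q (h - 1)))" "nb i < n"
proof -
  note B' = B[unfolded search_inv_def] and D = search_invD[OF B]
  show h: "0 < h" using B' ie by (cases "h = 0") auto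
  then have j: "h - 1 < t" using search_inv_bounds[OF B] by simp
  then show "Q (h - 1) < n" "Q (h - 1) \<noteq> X" using B' by auto
  show l: "lab (Q (h - 1)) = c" using B' ie j h by auto
  have "lab (Q (h - 1)) \<noteq> 0" using D(3) j by blast
  then show "c \<noteq> 0" using l by simp
  show "off (Q (h - 1)) \<le> i" "i < off (Suc (Q (h - 1)))" using B' ie h by auto
  show "nb i < n" using ie search_inv_bounds[OF B] nb_less by auto
qed

lemma search_inv_scan_new:
  assumes B: "search_inv lab Q s h t i e c" and ie: "i < e" and new: "lab (nb i) = 0"
  shows "search_inv (lab(nb i := c)) (Q(t := nb i)) s h (Suc t) (Suc i) e c"
proof -
  let ?u = "nb i" and ?q = "Q (h - 1)"
  note B' = B[unfolded search_inv_def] and D = search_invD[OF B]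
  note C = search_inv_current[OF B ie]
  have uX: "?u \<noteq> X" using B' new by auto
  have arc: "(?q, ?u) \<in> arcs" using C uX by (auto simp: arcs_def)
  have ht: "h \<le> t" and q: "h - 1 < t" "h - 1 < h" using C search_inv_bounds[OF B] by auto
  have uQ: "?u \<notin> Q ` {..<t}" using B' new by auto
  have old: "Q j \<noteq> ?u" if "j < t" for j using that uQ by (metis image_eqI lessThan_iff)
  have cl: "nb k = X \<or> lab (nb k) = lab (Q j)"
    if "j < h" "off (Q j) \<le> k" "k < off (Suc (Q j))" "Suc j = h \<longrightarrow> k < i" for j k
    using D(8) that by blast
  have labQ: "lab (Q j) \<noteq> 0" if "j < t" for j using D(3) that by blast
  show ?thesis unfolding search_inv_def
  proof (intro conjI)
    show "h \<le> Suc t" "s \<le> n" "c \<le> n" using B' by auto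
    show "inj_on (Q(t := ?u)) {..<Suc t}" 
    proof -
      have "inj_on Q {..<t}" by (rule D(9))
      then show ?thesis using old by (intro inj_on_append) (metis imageE lessThan_iff)+
    qed
    show "(lab(?u := c)) X = Suc n" using B' uX by auto
    show "\<forall>j<Suc t. (Q(t := ?u)) j < n \<and> (Q(t := ?u)) j \<noteq> X \<and> (lab(?u := c)) ((Q(t := ?u)) j) \<noteq> 0"
      using B' C uX by (auto simp: less_Suc_eq)
    show "\<forall>v<n. v \<noteq> X \<longrightarrow> (lab(?u := c)) v \<noteq> 0 \<longrightarrow> v \<in> (Q(t := ?u)) ` {..<Suc t}"
    proof (intro allI impI)
      fix v assume v: "v < n" "v \<noteq> X" "(lab(?u := c)) v \<noteq> 0"
      show "v \<in> (Q(t := ?u)) ` {..<Suc t}"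
      proof (cases "v = ?u")
        case True
        then show ?thesis by (intro image_eqI[of _ _ t]) auto
      next
        case False
        then have "v \<in> Q ` {..<t}" using D(4) v by auto
        then obtain j where "j < t" "v = Q j" by auto
        then show ?thesis by (intro image_eqI[of _ _ j]) auto
      qed
    qed
    show "\<forall>v<s. (lab(?u := c)) v \<noteq> 0" using B' C by auto
    show "\<forall>v<n. v \<noteq> X \<longrightarrow> (lab(?u := c)) v \<noteq> 0 \<longrightarrow>
      (\<exists>r<n. r \<noteq> X \<and> (lab(?u := c)) v = Suc r \<and> (lab(?u := c)) r = Suc r \<and> (r, v) \<in> arcs\<^sup>*)"
    proof (intro allI impI)
      fix v assume v: "v < n" "v \<noteq> X" "(lab(?u := c)) v \<noteq> 0"
      define w where "w = (if v = ?u then ?q else v)"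
      have w: "w < n" "w \<noteq> X" "lab w \<noteq> 0" using C v by (auto simp: w_def)
      then obtain r where r: "r < n" "r \<noteq> X" "lab w = Suc r" "lab r = Suc r" "(r, w) \<in> arcs\<^sup>*"
        using D(6)[OF w] by blast
      have "r \<noteq> ?u" using r new by auto
      moreover have "(r, v) \<in> arcs\<^sup>*" using r arc by (auto simp: w_def split: if_splits)
      moreover have "(lab(?u := c)) v = Suc r" using r C by (auto simp: w_def split: if_splits)
      ultimately show "\<exists>r<n. r \<noteq> X \<and> (lab(?u := c)) v = Suc r \<and> (lab(?u := c)) r = Suc r \<and> (r, v) \<in> arcs\<^sup>*"
        using r by auto
    qed
    show "\<forall>j<Suc t. h \<le> j \<or> Suc j = h \<and> Suc i < e \<longrightarrow> (lab(?u := c)) ((Q(t := ?u)) j) = c"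
      using B' ie by (auto simp: less_Suc_eq)
    show "\<forall>j<h. \<forall>k. off ((Q(t := ?u)) j) \<le> k \<and> k < off (Suc ((Q(t := ?u)) j)) \<and> (Suc j = h \<longrightarrow> k < Suc i) \<longrightarrow>
       nb k = X \<or> (lab(?u := c)) (nb k) = (lab(?u := c)) ((Q(t := ?u)) j)"
    proof (intro allI impI)
      fix j k assume j: "j < h" and k: "off ((Q(t := ?u)) j) \<le> k \<and> k < off (Suc ((Q(t := ?u)) j)) \<and> (Suc j = h \<longrightarrow> k < Suc i)"
      have jt: "j < t" "(Q(t := ?u)) j = Q j" "Q j \<noteq> ?u" using j ht old by auto
      show "nb k = X \<or> (lab(?u := c)) (nb k) = (lab(?u := c)) ((Q(t := ?u)) j)"
      proof (cases "Suc j = h \<and> k = i")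
        case True
        then have "lab (Q j) = c" using C by auto
        then show ?thesis using True jt by auto
      next
        case False
        then have "nb k = X \<or> lab (nb k) = lab (Q j)" using cl[OF j] k jt by (auto simp: less_Suc_eq)
        moreover have "lab (Q j) \<noteq> 0" using labQ jt by auto
        ultimately show ?thesis using jt new by auto
      qed
    qed
    show "if h = 0 then Suc i = 0 \<and> e = 0 else e = off (Suc ((Q(t := ?u)) (h - 1))) \<and> off ((Q(t := ?u)) (h - 1)) \<le> Suc i \<and> Suc i \<le> e"
      using C B' ie q by auto
  qed
qed

text \<open>The point is that the labelled neighbour already carries the current label. If it is
  still queued or was dequeued last, the invariant says so; if it was dequeued earlier, its list is
  completely scanned and contains the current vertex by symmetry, so both labels agree.\<close>

lemma search_inv_scan_old:
  assumes B: "search_inv lab Q s h t i e c" and ie: "i < e" and old: "lab (nb i) \<noteq> 0"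
  shows "search_inv lab Q s h t (Suc i) e c"
proof -
  let ?u = "nb i" and ?q = "Q (h - 1)"
  note B' = B[unfolded search_inv_def] and D = search_invD[OF B]
  note C = search_inv_current[OF B ie]
  have cl: "nb k = X \<or> lab (nb k) = lab (Q j)"
    if "j < h" "off (Q j) \<le> k" "k < off (Suc (Q j))" "Suc j = h \<longrightarrow> k < i" for j k
    using D(8) that by blast
  have u: "lab ?u = c" if "?u \<noteq> X"
  proof -
    have "?u \<in> Q ` {..<t}" using D(4) C old that by blast
    then obtain j where j: "j < t" "?u = Q j" by auto
    show ?thesis
    proof (cases "h \<le> j \<or> Suc j = h")
      case True
      then show ?thesis using B' j ie by auto
    next
      case False
      obtain k where k: "off ?u \<le> k" "k < off (Suc ?u)" "nb k = ?q" using nb_sym[OF C(2,6,7)] by auto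
      then have "lab ?q = lab ?u" using cl[of j k] False j C by auto
      then show ?thesis using C by simp
    qed
  qed
  show ?thesis unfolding search_inv_def
  proof (intro conjI)
    show "\<forall>j<h. \<forall>k. off (Q j) \<le> k \<and> k < off (Suc (Q j)) \<and> (Suc j = h \<longrightarrow> k < Suc i) \<longrightarrow>
       nb k = X \<or> lab (nb k) = lab (Q j)"
    proof (intro allI impI)
      fix j k assume j: "j < h" and k: "off (Q j) \<le> k \<and> k < off (Suc (Q j)) \<and> (Suc j = h \<longrightarrow> k < Suc i)"
      show "nb k = X \<or> lab (nb k) = lab (Q j)"
      proof (cases "Suc j = h \<and> k = i")
        case True
        then have "lab (Q j) = c" using C by auto
        then show ?thesis using True u by auto
      next
        case False
        then show ?thesis using cl[OF j] k by (auto simp: less_Suc_eq)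
      qed
    qed
    show "if h = 0 then Suc i = 0 \<and> e = 0 else e = off (Suc (Q (h - 1))) \<and> off (Q (h - 1)) \<le> Suc i \<and> Suc i \<le> e"
      using C B' ie by auto
    show "\<forall>j<t. h \<le> j \<or> Suc j = h \<and> Suc i < e \<longrightarrow> lab (Q j) = c" using B' ie by auto
  qed (use B' in blast)+
qed

lemma search_inv_dequeue:
  assumes B: "search_inv lab Q s h t i e c" and ie: "\<not> i < e" and ht: "h < t"
  shows "search_inv lab Q s (Suc h) t (off (Q h)) (off (Suc (Q h))) c"
proof -
  note B' = B[unfolded search_inv_def] and D = search_invD[OF B]
  have Qh: "Q h < n" using D(1) ht by blast
  have ie': "i = e" if "h \<noteq> 0" using that B' ie by auto
  show ?thesis unfolding search_inv_def
  proof (intro conjI)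
    show "Suc h \<le> t" using ht by simp
    show "\<forall>j<t. Suc h \<le> j \<or> Suc j = Suc h \<and> off (Q h) < off (Suc (Q h)) \<longrightarrow> lab (Q j) = c"
      using B' by auto
    show "\<forall>j<Suc h. \<forall>k. off (Q j) \<le> k \<and> k < off (Suc (Q j)) \<and> (Suc j = Suc h \<longrightarrow> k < off (Q h)) \<longrightarrow>
       nb k = X \<or> lab (nb k) = lab (Q j)"
    proof (intro allI impI)
      fix j k assume j: "j < Suc h" and k: "off (Q j) \<le> k \<and> k < off (Suc (Q j)) \<and> (Suc j = Suc h \<longrightarrow> k < off (Q h))"
      then have jh: "j < h" by (cases "j = h") auto
      then have "Suc j = h \<longrightarrow> k < i" using ie' k B' by auto
      then show "nb k = X \<or> lab (nb k) = lab (Q j)" using D(8) jh k by blast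
    qed
    show "if Suc h = 0 then off (Q h) = 0 \<and> off (Suc (Q h)) = 0
     else off (Suc (Q h)) = off (Suc (Q (Suc h - 1))) \<and> off (Q (Suc h - 1)) \<le> off (Q h) \<and> off (Q h) \<le> off (Suc (Q h))"
      using off_mono[OF Qh] by simp
  qed (use B' in blast)+
qed

lemma search_inv_seed_new:
  assumes B: "search_inv lab Q s h t i e c" and ie: "\<not> i < e" and ht: "\<not> h < t"
    and s: "s < n" and new: "lab s = 0"
  shows "search_inv (lab(s := Suc s)) (Q(t := s)) (Suc s) h (Suc t) i e (Suc s)"
proof -
  note B' = B[unfolded search_inv_def] and D = search_invD[OF B]
  have th: "t = h" using B' ht by auto
  have sX: "s \<noteq> X" using B' new by auto
  have labQ: "lab (Q j) \<noteq> 0" if "j < t" for j using D(3) that by blast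
  then have old: "Q j \<noteq> s" if "j < t" for j using that new by metis
  show ?thesis unfolding search_inv_def
  proof (intro conjI)
    show "h \<le> Suc t" "Suc s \<le> n" "Suc s \<le> n" using th s by auto
    show "inj_on (Q(t := s)) {..<Suc t}" 
    proof -
      have "inj_on Q {..<t}" by (rule D(9))
      then show ?thesis using old by (intro inj_on_append) (metis imageE lessThan_iff)+
    qed
    show "(lab(s := Suc s)) X = Suc n" using B' sX by auto
    show "\<forall>j<Suc t. (Q(t := s)) j < n \<and> (Q(t := s)) j \<noteq> X \<and> (lab(s := Suc s)) ((Q(t := s)) j) \<noteq> 0"
      using B' s sX by (auto simp: less_Suc_eq)
    show "\<forall>v<n. v \<noteq> X \<longrightarrow> (lab(s := Suc s)) v \<noteq> 0 \<longrightarrow> v \<in> (Q(t := s)) ` {..<Suc t}"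
    proof (intro allI impI)
      fix v assume v: "v < n" "v \<noteq> X" "(lab(s := Suc s)) v \<noteq> 0"
      show "v \<in> (Q(t := s)) ` {..<Suc t}"
      proof (cases "v = s")
        case True
        then show ?thesis by (intro image_eqI[of _ _ t]) auto
      next
        case False
        then have "v \<in> Q ` {..<t}" using D(4) v by auto
        then obtain j where "j < t" "v = Q j" by auto
        then show ?thesis by (intro image_eqI[of _ _ j]) auto
      qed
    qed
    show "\<forall>v<Suc s. (lab(s := Suc s)) v \<noteq> 0" using B' by (auto simp: less_Suc_eq)
    show "\<forall>v<n. v \<noteq> X \<longrightarrow> (lab(s := Suc s)) v \<noteq> 0 \<longrightarrow>
      (\<exists>r<n. r \<noteq> X \<and> (lab(s := Suc s)) v = Suc r \<and> (lab(s := Suc s)) r = Suc r \<and> (r, v) \<in> arcs\<^sup>*)"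
    proof (intro allI impI)
      fix v assume v: "v < n" "v \<noteq> X" "(lab(s := Suc s)) v \<noteq> 0"
      show "\<exists>r<n. r \<noteq> X \<and> (lab(s := Suc s)) v = Suc r \<and> (lab(s := Suc s)) r = Suc r \<and> (r, v) \<in> arcs\<^sup>*"
      proof (cases "v = s")
        case True
        then show ?thesis using v by auto
      next
        case False
        then obtain r where "r < n" "r \<noteq> X" "lab v = Suc r" "lab r = Suc r" "(r, v) \<in> arcs\<^sup>*"
          using D(6)[of v] v by auto
        then show ?thesis using False new by (intro exI[of _ r]) auto
      qed
    qed
    show "\<forall>j<Suc t. h \<le> j \<or> Suc j = h \<and> i < e \<longrightarrow> (lab(s := Suc s)) ((Q(t := s)) j) = Suc s"
      using ie th by (auto simp: less_Suc_eq)
    show "\<forall>j<h. \<forall>k. off ((Q(t := s)) j) \<le> k \<and> k < off (Suc ((Q(t := s)) j)) \<and> (Suc j = h \<longrightarrow> k < i) \<longrightarrow>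
       nb k = X \<or> (lab(s := Suc s)) (nb k) = (lab(s := Suc s)) ((Q(t := s)) j)"
    proof (intro allI impI)
      fix j k assume j: "j < h" and k: "off ((Q(t := s)) j) \<le> k \<and> k < off (Suc ((Q(t := s)) j)) \<and> (Suc j = h \<longrightarrow> k < i)"
      have jt: "j < t" "(Q(t := s)) j = Q j" "Q j \<noteq> s" using j th old by auto
      then have "nb k = X \<or> lab (nb k) = lab (Q j)" using D(8)[of j k] j k th by auto
      then show "nb k = X \<or> (lab(s := Suc s)) (nb k) = (lab(s := Suc s)) ((Q(t := s)) j)"
        using labQ[of j] jt new by auto
    qed
    show "if h = 0 then i = 0 \<and> e = 0 else e = off (Suc ((Q(t := s)) (h - 1))) \<and> off ((Q(t := s)) (h - 1)) \<le> i \<and> i \<le> e"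
      using B' th by auto
  qed
qed

text \<open>The current label is overwritten although nothing is enqueued. This is harmless, as no
  vertex is waiting and no list is partly scanned.\<close>

lemma search_inv_seed_old:
  assumes B: "search_inv lab Q s h t i e c" and ie: "\<not> i < e" and ht: "\<not> h < t"
    and s: "s < n" and old: "lab s \<noteq> 0"
  shows "search_inv lab Q (Suc s) h t i e (Suc s)"
proof -
  note B' = B[unfolded search_inv_def] and D = search_invD[OF B]
  show ?thesis unfolding search_inv_def
  proof (intro conjI)
    show "\<forall>v<Suc s. lab v \<noteq> 0" using B' old by (auto simp: less_Suc_eq)
    show "\<forall>j<t. h \<le> j \<or> Suc j = h \<and> i < e \<longrightarrow> lab (Q j) = Suc s" using ie ht by auto
  qed (use B' s in \<open>auto simp: Suc_le_eq; fail\<close> | use B' in blast)+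
qed

text \<open>What the search leaves behind. A label is the seed plus 1, because 0 marks unvisited
  vertices; the skipped vertex gets \<open>Suc n\<close>, which is the label of no seed, and so is
  never entered.\<close>

definition labelling :: "(nat \<Rightarrow> nat) \<Rightarrow> bool" where
  "labelling lab \<longleftrightarrow>
     (\<forall>v<n. v \<noteq> X \<longrightarrow> (\<exists>r<n. r \<noteq> X \<and> lab v = Suc r \<and> lab r = Suc r \<and> (r, v) \<in> arcs\<^sup>*)) \<and>
     (\<forall>(u, v) \<in> arcs. lab u = lab v) \<and> lab X = Suc n"

lemma search_inv_final:
  assumes B: "search_inv lab Q s h t i e c" and fin: "\<not> i < e" "\<not> h < t" "\<not> s < n"
  shows "labelling lab"
proof -
  note B' = B[unfolded search_inv_def] and D = search_invD[OF B]
  have s: "s = n" and h: "h = t" using B' fin by auto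
  have ie: "i = e" if "h \<noteq> 0" using that B' fin by auto
  have lab0: "lab v \<noteq> 0" if "v < n" for v using that D(5) s by blast
  have "lab u = lab v" if uv: "(u, v) \<in> arcs" for u v
  proof -
    obtain k where k: "u < n" "u \<noteq> X" "v \<noteq> X" "off u \<le> k" "k < off (Suc u)" "nb k = v"
      using uv by (auto simp: arcs_def)
    have "u \<in> Q ` {..<t}" using D(4) k lab0 by blast
    then obtain j where j: "j < h" "u = Q j" using h by auto
    then have "Suc j = h \<longrightarrow> k < i" using ie k B' by auto
    then have "nb k = X \<or> lab (nb k) = lab (Q j)" using D(8) j k by blast
    then show ?thesis using k j by auto
  qed
  moreover have "lab X = Suc n" by (rule D(10))
  moreover have "\<forall>v<n. v \<noteq> X \<longrightarrow> (\<exists>r<n. r \<noteq> X \<and> lab v = Suc r \<and> lab r = Suc r \<and> (r, v) \<in> arcs\<^sup>*)"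
    using D(6) lab0 by blast
  ultimately show ?thesis by (auto simp: labelling_def)
qed

lemma search_inv_init:
  assumes "\<And>v. v < n \<Longrightarrow> v \<noteq> X \<Longrightarrow> lab v = 0" "lab X = Suc n"
  shows "search_inv lab Q 0 0 0 0 0 0"
  using assms unfolding search_inv_def by auto

lemma labelling_iff:
  assumes L: "labelling lab" and v: "u < n" "v < n" "u \<noteq> X" "v \<noteq> X"
  shows "lab u = lab v \<longleftrightarrow> (u, v) \<in> arcs\<^sup>*"
proof
  assume "(u, v) \<in> arcs\<^sup>*"
  then show "lab u = lab v"
  proof induction
    case (step y z)
    then show ?case using L by (auto simp: labelling_def)
  qed simp
next
  assume eq: "lab u = lab v"
  have sym: "sym arcs"
  proof (rule symI)
    fix a b assume "(a, b) \<in> arcs"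
    then obtain i where i: "a < n" "a \<noteq> X" "b \<noteq> X" "off a \<le> i" "i < off (Suc a)" "nb i = b"
      by (auto simp: arcs_def)
    moreover have "i < off n" using i off_le[of "Suc a" n] by simp
    ultimately have "b < n" using nb_less by blast
    moreover obtain j where "off b \<le> j" "j < off (Suc b)" "nb j = a"
      using nb_sym[OF i(1,4,5)] i(6) by auto
    ultimately show "(b, a) \<in> arcs" using i by (auto simp: arcs_def)
  qed
  have "\<exists>r. lab w = Suc r \<and> (r, w) \<in> arcs\<^sup>*" if "w < n" "w \<noteq> X" for w
    using L that unfolding labelling_def by blast
  then obtain r where "(r, u) \<in> arcs\<^sup>*" "(r, v) \<in> arcs\<^sup>*" using v eq by (metis Suc_inject)
  then show "(u, v) \<in> arcs\<^sup>*" using sym by (meson rtrancl_trans sym_rtrancl symD)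
qed

text \<open>Potential: unscanned arcs, undequeued vertices and remaining seeds.\<close>

definition search_pot :: "(nat \<Rightarrow> nat) \<Rightarrow> nat \<Rightarrow> nat \<Rightarrow> nat \<Rightarrow> nat \<Rightarrow> nat" where
  "search_pot Q s h i e =
     (\<Sum>v\<in>{..<n} - Q ` {..<h}. off (Suc v) - off v) + (e - i) + (n - h) + (n - s)"

lemma search_pot_upd: "t \<ge> h \<Longrightarrow> search_pot (Q(t := u)) s h i e = search_pot Q s h i e"
  unfolding search_pot_def by (metis (no_types, lifting) fun_upd_other image_cong lessThan_iff not_le)

lemma search_pot_dequeue:
  assumes B: "search_inv lab Q s h t i e c" and ie: "\<not> i < e" and ht: "h < t"
  shows "search_pot Q s (Suc h) (off (Q h)) (off (Suc (Q h))) < search_pot Q s h i e"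
proof -
  note B' = B[unfolded search_inv_def] and D = search_invD[OF B]
  have "Q h \<notin> Q ` {..<h}"
  proof
    assume "Q h \<in> Q ` {..<h}"
    then obtain j where "j < h" "Q h = Q j" by auto
    then show False using D(9) ht by (metis inj_onD lessThan_iff less_trans less_irrefl)
  qed
  moreover have "Q h < n" using D(1) ht by blast
  ultimately have "Q h \<in> {..<n} - Q ` {..<h}" by auto
  moreover have "{..<n} - Q ` {..<Suc h} = ({..<n} - Q ` {..<h}) - {Q h}" by (auto simp: lessThan_Suc)
  ultimately have "(\<Sum>v\<in>{..<n} - Q ` {..<h}. off (Suc v) - off v) =
    (off (Suc (Q h)) - off (Q h)) + (\<Sum>v\<in>{..<n} - Q ` {..<Suc h}. off (Suc v) - off v)"
    by (simp add: sum.remove)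
  moreover have "h < n" using ht search_inv_bounds[OF B] by simp
  ultimately show ?thesis unfolding search_pot_def by simp
qed

lemma search_pot_init: "search_pot Q 0 0 0 0 \<le> off n + 2 * n"
  using sum_off[of n] by (simp add: search_pot_def)

end

text \<open>Registers 12 to 17 hold the parameters s, h, t, i, e, c of \<open>search_inv\<close>,
  arrays 7 and 8 the labels and the queue; register 20 is cleared when nothing is left to do. One
  flat loop replaces three nested ones, so that a single potential bounds its running time.\<close>

definition search_step :: "nat \<Rightarrow> nat \<Rightarrow> program" where
  "search_step ao an =
     Cond (Less (Reg 15) (Reg 16))
       (Load 18 an (Reg 15) ;; Load 19 7 (Reg 18) ;;
        Cond (Equal (Reg 19) (Num 0))
          (Store 7 (Reg 18) (Reg 17) ;; Store 8 (Reg 14) (Reg 18) ;; Add 14 (Reg 14) (Num 1)) Skip ;;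
        Add 15 (Reg 15) (Num 1))
       (Cond (Less (Reg 13) (Reg 14))
          (Load 18 8 (Reg 13) ;; Add 13 (Reg 13) (Num 1) ;; Load 15 ao (Reg 18) ;;
           Add 18 (Reg 18) (Num 1) ;; Load 16 ao (Reg 18))
          (Cond (Less (Reg 12) (Reg 10))
             (Load 19 7 (Reg 12) ;; Add 17 (Reg 12) (Num 1) ;;
              Cond (Equal (Reg 19) (Num 0))
                (Store 7 (Reg 12) (Reg 17) ;; Store 8 (Reg 14) (Reg 12) ;; Add 14 (Reg 14) (Num 1)) Skip ;;
              Assign 12 (Reg 17))
             (Assign 20 (Num 0))))"

definition search :: "nat \<Rightarrow> nat \<Rightarrow> program" where
  "search ao an =
     For 12 (Num 0) (Reg 10) (Store 7 (Reg 12) (Num 0)) ;;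
     Add 19 (Reg 10) (Num 1) ;; Store 7 (Reg 11) (Reg 19) ;;
     Assign 12 (Num 0) ;; Assign 13 (Num 0) ;; Assign 14 (Num 0) ;; Assign 15 (Num 0) ;;
     Assign 16 (Num 0) ;; Assign 17 (Num 0) ;; Assign 20 (Num 1) ;;
     While (Equal (Reg 20) (Num 1)) (search_step ao an)"

lemma wregs_search [simp]: "wregs (search ao an) = {12, 13, 14, 15, 16, 17, 18, 19, 20}"
  by (auto simp: search_def search_step_def)

lemma warrs_search [simp]: "warrs (search ao an) = {7, 8}"
  by (auto simp: search_def search_step_def)

context list_graph
begin

definition search_state :: "nat \<Rightarrow> nat \<Rightarrow> state \<Rightarrow> bool" where
  "search_state ao an s \<longleftrightarrow>
     search_inv (arrs s 7) (arrs s 8) (regs s 12) (regs s 13) (regs s 14) (regs s 15) (regs s 16) (regs s 17) \<and>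
     regs s 10 = n \<and> arrs s ao = off \<and> arrs s an = nb \<and> regs s 20 \<le> 1 \<and>
     (regs s 20 = 0 \<longrightarrow> \<not> regs s 15 < regs s 16 \<and> \<not> regs s 13 < regs s 14 \<and> \<not> regs s 12 < n)"

text \<open>The factor 11 is the cost of the longest branch of \<open>search_step\<close>, namely
  10, plus the loop test. Register 20 pays for the last round, which only clears this flag.\<close>

definition search_time :: "state \<Rightarrow> nat" where
  "search_time s = 11 * (search_pot (arrs s 8) (regs s 12) (regs s 13) (regs s 15) (regs s 16) + regs s 20)"

lemma search_inv_lab_le:
  assumes "search_inv lab Q s h t i e c" "v < n"
  shows "lab v \<le> Suc n"
proof (cases "v = X \<or> lab v = 0")
  case True
  then show ?thesis using search_invD(10)[OF assms(1)] by auto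
next
  case False
  then obtain r where "r < n" "lab v = Suc r" using search_invD(6)[OF assms] by auto
  then show ?thesis by simp
qed

lemma wp_search_step:
  assumes S: "search_state ao an s" and g: "regs s 20 = 1"
    and ar: "ao \<notin> {7, 8}" "an \<notin> {7, 8}" and W: "off n < W" "Suc n < W"
  shows "wp W (search_step ao an) s (\<lambda>t s'. search_state ao an s' \<and> t + 1 + search_time s' \<le> search_time s)"
proof -
  let ?lab = "arrs s 7" and ?Q = "arrs s 8" and ?s = "regs s 12" and ?h = "regs s 13"
    and ?t = "regs s 14" and ?i = "regs s 15" and ?e = "regs s 16" and ?c = "regs s 17"
  have B: "search_inv ?lab ?Q ?s ?h ?t ?i ?e ?c" and n: "regs s 10 = n"
    and off: "arrs s ao = off" and nb: "arrs s an = nb" using S by (auto simp: search_state_def)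
  note bd = search_inv_bounds[OF B]
  note lab = search_inv_lab_le[OF B]
  show ?thesis
  proof (cases "?i < ?e")
    case ie: True
    note C = search_inv_current[OF B ie]
    have pot: "Suc (search_pot ?Q ?s ?h (Suc ?i) ?e) = search_pot ?Q ?s ?h ?i ?e"
      using ie by (simp add: search_pot_def)
    have lu: "?lab (nb ?i) < W" using lab[OF C(8)] W by simp
    show ?thesis
    proof (cases "?lab (nb ?i) = 0")
      case True
      show ?thesis
        using ie True C bd W lu ar g n off nb search_inv_scan_new[OF B ie True] search_pot_upd[OF bd(1)] pot
        by (simp add: search_step_def wp_simps search_state_def search_time_def)
    next
      case False
      show ?thesis
        using ie False C bd W lu ar g n off nb search_inv_scan_old[OF B ie False] pot
        by (simp add: search_step_def wp_simps search_state_def search_time_def)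
    qed
  next
    case ie: False
    show ?thesis
    proof (cases "?h < ?t")
      case ht: True
      have Q: "?Q ?h < n" using search_invD(1)[OF B] ht by simp
      have o: "off (?Q ?h) \<le> off n" "off (Suc (?Q ?h)) \<le> off n" using Q off_le[of _ n] by auto
      show ?thesis
        using ie ht Q o bd W ar g n off nb search_inv_dequeue[OF B ie ht] search_pot_dequeue[OF B ie ht]
        by (simp add: search_step_def wp_simps search_state_def search_time_def)
    next
      case ht: False
      show ?thesis
      proof (cases "?s < n")
        case sn: True
        have pot: "Suc (search_pot ?Q (Suc ?s) ?h ?i ?e) = search_pot ?Q ?s ?h ?i ?e"
          using sn by (simp add: search_pot_def)
        have ls: "?lab ?s < W" using lab[OF sn] W by simp
        show ?thesis
        proof (cases "?lab ?s = 0")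
          case True
          show ?thesis
            using ie ht sn True bd W ls ar g n off nb search_inv_seed_new[OF B ie ht sn True]
              search_pot_upd[OF bd(1)] pot
            by (simp add: search_step_def wp_simps search_state_def search_time_def)
        next
          case False
          show ?thesis
            using ie ht sn False bd W ls ar g n off nb search_inv_seed_old[OF B ie ht sn False] pot
            by (simp add: search_step_def wp_simps search_state_def search_time_def)
        qed
      next
        case sn: False
        show ?thesis
          using ie ht sn bd W ar g n off nb B
          by (simp add: search_step_def wp_simps search_state_def search_time_def)
      qed
    qed
  qed
qed

lemma wp_search:
  assumes s: "regs s 10 = n" "regs s 11 = X" "arrs s ao = off" "arrs s an = nb"
    and ar: "ao \<notin> {7, 8}" "an \<notin> {7, 8}" and W: "off n < W" "Suc n < W"
  shows "wp W (search ao an) s (\<lambda>t s'. t \<le> 11 * off n + 25 * n + 30 \<and> labelling (arrs s' 7) \<and>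
    frame {12, 13, 14, 15, 16, 17, 18, 19, 20} {7, 8} s s')"
proof -
  let ?P = "\<lambda>t s'. t \<le> 11 * off n + 25 * n + 30 \<and> labelling (arrs s' 7)"
  have "wp W (search ao an) s ?P"
    unfolding search_def wp_Seq
  proof (rule wp_mono[OF wp_For_const[where I = "\<lambda>j s'. \<forall>v<j. arrs s' 7 v = 0" and c = 1 and n = n]],
      goal_cases)
    case (8 t1 s1)
    then have s1: "t1 \<le> 3 * n + 2" "\<forall>v<n. arrs s1 7 v = 0" "regs s1 10 = n" "regs s1 11 = X"
      "arrs s1 ao = off" "arrs s1 an = nb"
      using s ar by (auto simp: frame_def)
    have "search_inv ((arrs s1 7)(X := Suc n)) (arrs s1 8) 0 0 0 0 0 0"
      using s1 by (intro search_inv_init) auto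
    then have st: "search_state ao an (set_reg 20 1 (set_reg 17 0 (set_reg 16 0 (set_reg 15 0 (set_reg 14 0
       (set_reg 13 0 (set_reg 12 0 (set_arr 7 X (Suc n) (set_reg 19 (Suc n) s1)))))))))" (is "search_state ao an ?s2")
      using s1 ar by (simp add: search_state_def)
    have tm: "search_time ?s2 \<le> 11 * (off n + 2 * n + 1)"
      using search_pot_init[of "arrs s1 8"] by (simp add: search_time_def)
    have "wp W (While (Equal (Reg 20) (Num 1)) (search_step ao an)) ?s2
       (\<lambda>t s'. t \<le> search_time ?s2 + 1 \<and> search_state ao an s' \<and> \<not> holds s' (Equal (Reg 20) (Num 1)))"
      by (rule wp_While[where I = "search_state ao an" and \<Phi> = search_time, OF st])
        (use wp_search_step ar W in auto)
    then have "wp W (While (Equal (Reg 20) (Num 1)) (search_step ao an)) ?s2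
       (\<lambda>t s'. t \<le> 11 * off n + 22 * n + 12 \<and> labelling (arrs s' 7))"
    proof (rule wp_mono)
      fix t s' assume A: "t \<le> search_time ?s2 + 1 \<and> search_state ao an s' \<and> \<not> holds s' (Equal (Reg 20) (Num 1))"
      then have "search_inv (arrs s' 7) (arrs s' 8) (regs s' 12) (regs s' 13) (regs s' 14) (regs s' 15) (regs s' 16) (regs s' 17)"
        "\<not> regs s' 15 < regs s' 16" "\<not> regs s' 13 < regs s' 14" "\<not> regs s' 12 < n"
        by (auto simp: search_state_def le_Suc_eq)
      then have "labelling (arrs s' 7)" by (rule search_inv_final)
      then show "t \<le> 11 * off n + 22 * n + 12 \<and> labelling (arrs s' 7)" using A tm by simp
    qed
    then show ?case using W s1 by (simp add: wp_simps) (erule wp_mono, simp)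
  qed (use s W in \<open>auto simp: wp_simps less_Suc_eq\<close>)
  then show ?thesis using wp_frame by fastforce
qed

lemma labelling_is_rep:
  assumes L: "labelling lab" and X: "X = n"
    and eq: "\<And>u v. (u, v) \<in> arcs\<^sup>* \<longleftrightarrow> reach E u v"
  shows "is_rep {..<n} E (\<lambda>v. lab v - 1)"
proof -
  have 1: "\<exists>r<n. lab v = Suc r \<and> lab r = Suc r" if "v < n" for v
    using L that X unfolding labelling_def by (metis less_irrefl)
  have 2: "lab u - 1 = lab v - 1 \<longleftrightarrow> reach E u v" if "u < n" "v < n" for u v
  proof -
    have "lab u - 1 = lab v - 1 \<longleftrightarrow> lab u = lab v" using 1[OF that(1)] 1[OF that(2)] by auto
    then show ?thesis using labelling_iff[OF L that] that X eq by auto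
  qed
  show ?thesis unfolding is_rep_def
  proof (intro conjI ballI)
    fix v assume "v \<in> {..<n}"
    then obtain r where "r < n" "lab v = Suc r" "lab r = Suc r" using 1 by auto
    then show "lab v - 1 \<in> {..<n}" "lab (lab v - 1) - 1 = lab v - 1" by auto
  qed (use 2 in auto)
qed

end

section \<open>The input graph as an instance of the search\<close>

lemma concat_take_Suc:
  assumes "v < length adj"
  shows "length (concat (take (Suc v) adj)) = length (concat (take v adj)) + length (adj ! v)"
    and "k < length (adj ! v) \<Longrightarrow> concat adj ! (length (concat (take v adj)) + k) = adj ! v ! k"
proof -
  show "length (concat (take (Suc v) adj)) = length (concat (take v adj)) + length (adj ! v)"
    using assms by (simp add: take_Suc_conv_app_nth)
  have "concat adj = concat (take v adj) @ adj ! v @ concat (drop (Suc v) adj)"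
    using assms by (metis append_take_drop_id concat.simps(2) concat_append Cons_nth_drop_Suc)
  then show "k < length (adj ! v) \<Longrightarrow> concat adj ! (length (concat (take v adj)) + k) = adj ! v ! k"
    by (simp add: nth_append)
qed

locale input_graph =
  fixes G :: "nat graph" and adj :: "nat list list" and \<delta> :: "nat \<Rightarrow> nat"
  assumes simple: "simple_graph G" and lists: "adjacency_lists G adj" and \<delta>01: "\<forall>v \<in> verts G. \<delta> v \<in> {0, 1}"
begin

abbreviation n :: nat where "n \<equiv> length adj"
abbreviation V :: "nat set" where "V \<equiv> {..<n}"
abbreviation E :: "nat set set" where "E \<equiv> edges G"
abbreviation m :: nat where "m \<equiv> card E"

definition off :: "nat \<Rightarrow> nat" where
  "off = (\<lambda>v. if v \<le> n then length (concat (take v adj)) else 0)"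

definition nb :: "nat \<Rightarrow> nat" where
  "nb = (\<lambda>i. if i < length (concat adj) then concat adj ! i else 0)"

lemma verts_eq: "verts G = V"
  using lists by (simp add: adjacency_lists_def)

lemma E_pairs: "E \<subseteq> pairs V"
  using simple by (simp add: simple_graph_iff verts_eq)

lemma adj_set: "v < n \<Longrightarrow> set (adj ! v) = {u. {v, u} \<in> E}" "v < n \<Longrightarrow> distinct (adj ! v)"
  using lists by (auto simp: adjacency_lists_def)

lemma off_Suc: "v < n \<Longrightarrow> off (Suc v) = off v + length (adj ! v)"
  by (simp add: off_def concat_take_Suc(1))

lemma off_0: "off 0 = 0"
  by (simp add: off_def)

lemma off_n: "off n = length (concat adj)"
  by (simp add: off_def)

lemma off_le_n: "v \<le> n \<Longrightarrow> off v \<le> off n"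
proof -
  assume v: "v \<le> n"
  have "concat adj = concat (take v adj) @ concat (drop v adj)"
    by (metis append_take_drop_id concat_append)
  then have "length (concat (take v adj)) \<le> length (concat adj)"
    by (metis le_add1 length_append)
  then show "off v \<le> off n" using v by (simp add: off_def)
qed

lemma nb_off:
  assumes "v < n" "k < length (adj ! v)"
  shows "nb (off v + k) = adj ! v ! k"
proof -
  have "off v + k < off (Suc v)" using assms by (simp add: off_Suc)
  also have "\<dots> \<le> off n" using assms by (intro off_le_n) auto
  finally show ?thesis using assms concat_take_Suc(2)[OF assms] by (simp add: nb_def off_n off_def)
qed

lemma length_adj: "v < n \<Longrightarrow> length (adj ! v) = dg E v"
proof -
  assume v: "v < n"
  have "bij_betw (\<lambda>u. {v, u}) {u. {v, u} \<in> E} {e \<in> E. v \<in> e}"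
    unfolding bij_betw_def
  proof
    show "inj_on (\<lambda>u. {v, u}) {u. {v, u} \<in> E}" by (auto simp: inj_on_def doubleton_eq_iff)
    show "(\<lambda>u. {v, u}) ` {u. {v, u} \<in> E} = {e \<in> E. v \<in> e}"
    proof
      show "{e \<in> E. v \<in> e} \<subseteq> (\<lambda>u. {v, u}) ` {u. {v, u} \<in> E}"
      proof
        fix e assume e: "e \<in> {e \<in> E. v \<in> e}"
        then obtain x y where "e = {x, y}" using E_pairs by (auto simp: pairs_def)
        then have "e = {v, if v = x then y else x}" using e by auto
        then show "e \<in> (\<lambda>u. {v, u}) ` {u. {v, u} \<in> E}" using e by auto
      qed
    qed auto
  qed
  then have "card (set (adj ! v)) = dg E v"
    unfolding dg_def using adj_set(1)[OF v] by (simp add: bij_betw_same_card)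
  then show "length (adj ! v) = dg E v" using distinct_card[OF adj_set(2)[OF v]] by simp
qed

lemma length_adj_less: "v < n \<Longrightarrow> length (adj ! v) < n"
proof -
  assume v: "v < n"
  have "set (adj ! v) \<subseteq> V - {v}"
  proof
    fix u assume "u \<in> set (adj ! v)"
    then have "{v, u} \<in> pairs V" using adj_set(1)[OF v] E_pairs by blast
    then show "u \<in> V - {v}" by simp
  qed
  then have "card (set (adj ! v)) \<le> card (V - {v})" by (intro card_mono) auto
  then show "length (adj ! v) < n" using distinct_card[OF adj_set(2)[OF v]] v by simp
qed

lemma off_n_eq: "off n = 2 * m"
proof -
  have "off k = (\<Sum>v<k. dg E v)" if "k \<le> n" for k
    using that by (induction k) (auto simp: off_0 off_Suc length_adj)
  then show ?thesis using handshake[of V E] E_pairs by simp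
qed

lemma arc_iff:
  assumes "u < n"
  shows "(\<exists>i. off u \<le> i \<and> i < off (Suc u) \<and> nb i = v) \<longleftrightarrow> {u, v} \<in> E"
proof
  assume "\<exists>i. off u \<le> i \<and> i < off (Suc u) \<and> nb i = v"
  then obtain k where "k < length (adj ! u)" "nb (off u + k) = v"
    by (metis assms le_Suc_ex nat_add_left_cancel_less off_Suc)
  then show "{u, v} \<in> E" using nb_off[OF assms] adj_set(1)[OF assms] nth_mem by fastforce
next
  assume "{u, v} \<in> E"
  then obtain k where "k < length (adj ! u)" "adj ! u ! k = v"
    using adj_set(1)[OF assms] by (metis in_set_conv_nth mem_Collect_eq)
  then show "\<exists>i. off u \<le> i \<and> i < off (Suc u) \<and> nb i = v"
    using nb_off[OF assms] off_Suc[OF assms] by (intro exI[of _ "off u + k"]) auto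
qed

lemma nb_less_n: "i < off n \<Longrightarrow> nb i < n"
proof -
  assume "i < off n"
  then have "nb i \<in> set (concat adj)" by (simp add: nb_def off_n nth_mem del: set_concat)
  then obtain xs where xs: "xs \<in> set adj" "nb i \<in> set xs" by auto
  then obtain v where v: "v < n" "nb i \<in> set (adj ! v)" by (metis in_set_conv_nth)
  then have "{v, nb i} \<in> E" using adj_set(1) by auto
  then show "nb i < n" using E_pairs by auto
qed

text \<open>The skipped vertex stays a parameter because the input is searched twice: with nothing
  skipped for the components, and with the candidate centre skipped for the bridge test.\<close>

sublocale input: list_graph off nb n X for X
proof
  show "off 0 = 0" by (rule off_0)
  show "off v \<le> off (Suc v)" if "v < n" for v using off_Suc[OF that] by simp
  show "nb i < n" if "i < off n" for i using nb_less_n[OF that] .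
  show "\<exists>j. off (nb i) \<le> j \<and> j < off (Suc (nb i)) \<and> nb j = v"
    if v: "v < n" "off v \<le> i" "i < off (Suc v)" for v i
  proof -
    have "i < off n" using v off_le_n[of "Suc v"] by simp
    then have "nb i < n" by (rule nb_less_n)
    moreover have "{nb i, v} \<in> E" using arc_iff[OF v(1), of "nb i"] v by (auto simp: insert_commute)
    ultimately show ?thesis using arc_iff by blast
  qed
qed

lemma input_arcs: "input.arcs X = edge_rel {e \<in> E. X \<notin> e}"
proof -
  have "(u, v) \<in> input.arcs X \<longleftrightarrow> (u, v) \<in> edge_rel {e \<in> E. X \<notin> e}" for u v
  proof (cases "u < n")
    case True
    then show ?thesis using arc_iff[OF True, of v] by (auto simp: input.arcs_def)
  next
    case False
    then have "{u, v} \<notin> E" using E_pairs by auto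
    then show ?thesis using False by (auto simp: input.arcs_def)
  qed
  then show ?thesis by (intro set_eqI) auto
qed

lemma input_rep:
  assumes "input.labelling n lab"
  shows "is_rep V E (\<lambda>v. lab v - 1)"
proof (rule input.labelling_is_rep[OF assms refl])
  have "{e \<in> E. n \<notin> e} = E" using E_pairs by (auto simp: pairs_def)
  then show "(u, v) \<in> (input.arcs n)\<^sup>* \<longleftrightarrow> reach E u v" for u v by (simp add: input_arcs)
qed

end

lemma is_repD:
  assumes "is_rep V E \<rho>" "u \<in> V"
  shows "\<rho> u \<in> V" "\<rho> (\<rho> u) = \<rho> u" "v \<in> V \<Longrightarrow> \<rho> u = \<rho> v \<longleftrightarrow> reach E u v"
  using assms unfolding is_rep_def by blast+

section \<open>Padded adjacency matrices, toggling and connectivity checks\<close>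

definition is_row :: "nat \<Rightarrow> (nat \<Rightarrow> nat) \<Rightarrow> bool" where
  "is_row n R \<longleftrightarrow> (\<forall>v\<le>n. R v = v * n)"

text \<open>The row of \<open>u\<close> is an adjacency list of \<open>u\<close>, padded with \<open>u\<close> itself, so that
  the search also runs on matrices.\<close>

definition is_mat :: "nat \<Rightarrow> (nat \<Rightarrow> nat) \<Rightarrow> nat set set \<Rightarrow> bool" where
  "is_mat n M H \<longleftrightarrow> H \<subseteq> pairs {..<n} \<and> (\<forall>u<n. \<forall>v<n. M (u * n + v) = (if {u, v} \<in> H then v else u))"

lemma cell_inj:
  assumes "v < n" "v' < (n :: nat)" "u * n + v = u' * n + v'"
  shows "u = u'" "v = v'"
proof -
  have "(u * n + v) div n = u" "(u' * n + v') div n = u'" using assms(1,2) by auto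
  then show "u = u'" using assms(3) by metis
  then show "v = v'" using assms(3) by simp
qed

lemma cell_less: "u < n \<Longrightarrow> v < n \<Longrightarrow> u * n + v < n * (n :: nat)"
  by (metis add.commute add_less_cancel_left less_le_trans mult_Suc mult_le_mono1 Suc_leI add_strict_right_mono)

lemma row_arc:
  assumes M: "is_mat n M H" and u: "u < n"
  shows "(\<exists>i. u * n \<le> i \<and> i < Suc u * n \<and> M i = v) \<longleftrightarrow> {u, v} \<in> H \<or> u = v"
proof
  assume "\<exists>i. u * n \<le> i \<and> i < Suc u * n \<and> M i = v"
  then obtain i where i: "u * n \<le> i" "i < Suc u * n" "M i = v" by auto
  define w where "w = i - u * n"
  have "w < n" "i = u * n + w" using i by (auto simp: w_def)
  then show "{u, v} \<in> H \<or> u = v" using M u i by (auto simp: is_mat_def split: if_splits)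
next
  assume A: "{u, v} \<in> H \<or> u = v"
  have "{u, v} \<in> pairs {..<n}" if "{u, v} \<in> H" using M that by (auto simp: is_mat_def)
  then have v: "v < n" using A u by auto
  have "M (u * n + v) = v" using M u v A by (auto simp: is_mat_def)
  then show "\<exists>i. u * n \<le> i \<and> i < Suc u * n \<and> M i = v" using v by (intro exI[of _ "u * n + v"]) auto
qed

lemma list_graph_mat:
  assumes R: "is_row n R" and M: "is_mat n M H"
  shows "list_graph R M n"
proof
  show "R 0 = 0" using R by (simp add: is_row_def)
  show "R v \<le> R (Suc v)" if "v < n" for v using R that by (simp add: is_row_def)
  show "M i < n" if "i < R n" for i
  proof -
    have "i < n * n" using that R by (simp add: is_row_def)
    then have i: "i div n < n" "i mod n < n" "i = i div n * n + i mod n"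
      by (auto simp: less_mult_imp_div_less) (metis mod_less_divisor bot_nat_0.not_eq_extremum mult_0 not_less0)
    then show "M i < n" using M by (metis (full_types) is_mat_def)
  qed
  show "\<exists>j. R (M i) \<le> j \<and> j < R (Suc (M i)) \<and> M j = v"
    if v: "v < n" "R v \<le> i" "i < R (Suc v)" for v i
  proof -
    have vi: "v * n \<le> i" "i < Suc v * n" using v R by (simp_all add: is_row_def)
    have e: "{v, M i} \<in> H \<or> v = M i" using row_arc[OF M v(1), of "M i"] vi by blast
    have "{v, M i} \<in> pairs {..<n}" if "{v, M i} \<in> H" using M that by (auto simp: is_mat_def)
    then have Mi: "M i < n" using e v by auto
    have "{M i, v} \<in> H \<or> M i = v" using e by (auto simp: insert_commute)
    then obtain j where "M i * n \<le> j" "j < Suc (M i) * n" "M j = v" using row_arc[OF M Mi, of v] by blast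
    then show ?thesis using R Mi by (intro exI[of _ j]) (simp add: is_row_def)
  qed
qed

text \<open>The padding only adds loops, which leave reachability unchanged.\<close>

lemma mat_rep:
  assumes R: "is_row n R" and M: "is_mat n M H" and L: "list_graph.labelling R M n n lab"
  shows "is_rep {..<n} H (\<lambda>v. lab v - 1)"
proof -
  interpret list_graph R M n n using list_graph_mat[OF R M] .
  have H: "H \<subseteq> pairs {..<n}" using M by (simp add: is_mat_def)
  have arc: "(u, v) \<in> arcs \<longleftrightarrow> u < n \<and> v < n \<and> ({u, v} \<in> H \<or> u = v)" for u v
  proof (cases "u < n")
    case True
    have "{u, v} \<in> pairs {..<n}" if "{u, v} \<in> H" using H that by auto
    then show ?thesis using row_arc[OF M True, of v] R True by (auto simp: arcs_def is_row_def)
  qed (auto simp: arcs_def)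
  have "arcs\<^sup>* = (edge_rel H)\<^sup>*"
  proof (rule rtrancl_subset)
    show "edge_rel H \<subseteq> arcs"
    proof
      fix p assume "p \<in> edge_rel H"
      then obtain u v where "p = (u, v)" "{u, v} \<in> H" by (cases p) auto
      moreover then have "{u, v} \<in> pairs {..<n}" using H by auto
      ultimately show "p \<in> arcs" by (auto simp: arc)
    qed
    show "arcs \<subseteq> (edge_rel H)\<^sup>*" by (auto simp: arc intro: reach_edge)
  qed
  then show ?thesis using labelling_is_rep[OF L refl] by simp
qed

text \<open>A cell equal to its column index means an edge, one equal to its row index a non-edge.
  Both orientations are flipped, with array 14 supplying the row starts.\<close>

definition toggle :: "nat \<Rightarrow> nat \<Rightarrow> program" where
  "toggle u v =
     Load 18 14 (Reg u) ;; Add 18 (Reg 18) (Reg v) ;; Load 19 16 (Reg 18) ;;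
     Cond (Equal (Reg 19) (Reg v)) (Store 16 (Reg 18) (Reg u)) (Store 16 (Reg 18) (Reg v)) ;;
     Load 18 14 (Reg v) ;; Add 18 (Reg 18) (Reg u) ;; Load 19 16 (Reg 18) ;;
     Cond (Equal (Reg 19) (Reg u)) (Store 16 (Reg 18) (Reg v)) (Store 16 (Reg 18) (Reg u))"

lemma wregs_toggle [simp]: "wregs (toggle u v) = {18, 19}"
  by (auto simp: toggle_def)

lemma warrs_toggle [simp]: "warrs (toggle u v) = {16}"
  by (auto simp: toggle_def)

definition mat_state :: "nat \<Rightarrow> nat set set \<Rightarrow> state \<Rightarrow> bool" where
  "mat_state n H s \<longleftrightarrow> regs s 10 = n \<and> is_row n (arrs s 14) \<and> is_mat n (arrs s 16) H"

lemma tog_iff: "e \<in> tog H a b \<longleftrightarrow> (e \<in> H) \<noteq> (e = {a, b})"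
  by (auto simp: tog_def)

lemma wp_toggle:
  assumes S: "mat_state n H s" and W: "n * n < W"
    and uv: "regs s u = a" "regs s v = b" "a < n" "b < n" "a \<noteq> b" "u \<notin> {18, 19}" "v \<notin> {18, 19}"
  shows "wp W (toggle u v) s (\<lambda>t s'. t = 10 \<and> mat_state n (tog H a b) s' \<and> frame {18, 19} {16} s s')"
proof -
  have R: "arrs s 14 a = a * n" "arrs s 14 b = b * n" using S uv by (auto simp: mat_state_def is_row_def)
  have M: "is_mat n (arrs s 16) H" using S by (simp add: mat_state_def)
  let ?M = "arrs s 16"
  let ?x = "if {a, b} \<in> H then a else b" and ?y = "if {a, b} \<in> H then b else a"
  define M' where "M' = ?M(a * n + b := ?x, b * n + a := ?y)"
  have cells: "?M (a * n + b) = (if {a, b} \<in> H then b else a)" "?M (b * n + a) = (if {a, b} \<in> H then a else b)"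
    using M uv by (auto simp: is_mat_def insert_commute)
  have ne: "a * n + b \<noteq> b * n + a" using cell_inj[of b n a a b] uv by auto
  have small: "a * n + b < W" "b * n + a < W" "a * n < W" "b * n < W" "a < W" "b < W"
  proof -
    have "a * n + b < n * n" "b * n + a < n * n" using cell_less uv by auto
    then show "a * n + b < W" "b * n + a < W" "a * n < W" "b * n < W" "a < W" "b < W" using W by linarith+
  qed
  have M': "is_mat n M' (tog H a b)"
    unfolding is_mat_def
  proof (intro conjI allI impI)
    have "H \<subseteq> pairs {..<n}" using M by (simp add: is_mat_def)
    then show "tog H a b \<subseteq> pairs {..<n}" using uv by (auto simp: tog_def)
    fix c d assume cd: "c < n" "d < n"
    have 1: "c * n + d = a * n + b \<longleftrightarrow> c = a \<and> d = b" using cell_inj[of d n b c a] cd uv by auto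
    have 2: "c * n + d = b * n + a \<longleftrightarrow> c = b \<and> d = a" using cell_inj[of d n a c b] cd uv by auto
    have "?M (c * n + d) = (if {c, d} \<in> H then d else c)" using M cd by (simp add: is_mat_def)
    then show "M' (c * n + d) = (if {c, d} \<in> tog H a b then d else c)"
      using uv(5) by (auto simp: M'_def 1 2 tog_iff doubleton_eq_iff insert_commute)
  qed
  have "wp W (toggle u v) s (\<lambda>t s'. t = 10 \<and> mat_state n (tog H a b) s')"
    using S uv R cells ne small M' unfolding M'_def
    by (cases "{a, b} \<in> H") (simp_all add: toggle_def wp_simps mat_state_def)
  then show ?thesis using wp_frame by fastforce
qed

definition conn_check :: program where
  "conn_check =
     Assign 11 (Reg 10) ;; search 14 16 ;; Assign 21 (Num 1) ;;
     For 12 (Num 0) (Reg 10)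
       (Load 18 7 (Reg 12) ;; Load 19 7 (Num 0) ;; Cond (Equal (Reg 18) (Reg 19)) Skip (Assign 21 (Num 0)))"

lemma wregs_conn_check [simp]: "wregs conn_check = {11, 12, 13, 14, 15, 16, 17, 18, 19, 20, 21}"
  by (auto simp: conn_check_def)

lemma warrs_conn_check [simp]: "warrs conn_check = {7, 8}"
  by (auto simp: conn_check_def)

lemma wp_conn_check:
  assumes S: "mat_state n H s" and W: "n * n < W" "Suc n < W"
  shows "wp W conn_check s (\<lambda>t s'. t \<le> 11 * (n * n) + 40 * n + 40 \<and> mat_state n H s' \<and>
    regs s' 21 = (if conn {..<n} H then 1 else 0) \<and>
    frame {11, 12, 13, 14, 15, 16, 17, 18, 19, 20, 21} {7, 8} s s')"
proof -
  have n: "regs s 10 = n" and R: "is_row n (arrs s 14)" and M: "is_mat n (arrs s 16) H"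
    using S by (auto simp: mat_state_def)
  interpret list_graph "arrs s 14" "arrs s 16" n n using list_graph_mat[OF R M] .
  have Rn: "arrs s 14 n = n * n" using R by (simp add: is_row_def)
  define B :: nat where "B = (if conn {..<n} H then 1 else 0)"
  have srch: "wp W (search 14 16) (set_reg 11 n s) (\<lambda>t s'. t \<le> 11 * arrs s 14 n + 25 * n + 30 \<and> labelling (arrs s' 7) \<and>
    frame {12, 13, 14, 15, 16, 17, 18, 19, 20} {7, 8} (set_reg 11 n s) s')"
    by (rule wp_search) (use n W Rn in auto)
  have "wp W conn_check s (\<lambda>t s'. t \<le> 11 * (n * n) + 40 * n + 40 \<and> regs s' 21 = B)"
    unfolding conn_check_def wp_Seq wp_Assign val.simps n
  proof (intro conjI wp_mono[OF srch])
    show "n < W" using W by simp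
    fix t and s1 :: state
    let ?lab = "arrs s1 7"
    assume A: "t \<le> 11 * arrs s 14 n + 25 * n + 30 \<and> labelling ?lab \<and>
      frame {12, 13, 14, 15, 16, 17, 18, 19, 20} {7, 8} (set_reg 11 n s) s1"
    then have t: "t \<le> 11 * (n * n) + 25 * n + 30" and L: "labelling ?lab"
      and fr: "frame {12, 13, 14, 15, 16, 17, 18, 19, 20} {7, 8} (set_reg 11 n s) s1" using Rn by auto
    have n1: "regs s1 10 = n" using fr n by (simp add: frame_def)
    have rep: "is_rep {..<n} H (\<lambda>v. ?lab v - 1)" by (rule mat_rep[OF R M L])
    have lab: "?lab v \<noteq> 0 \<and> ?lab v < W" if "v < n" for v
    proof -
      have "\<exists>r<n. r \<noteq> n \<and> ?lab v = Suc r \<and> ?lab r = Suc r \<and> (r, v) \<in> arcs\<^sup>*"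
        using L that unfolding labelling_def by (elim conjE) simp
      then obtain r where "r < n" "?lab v = Suc r" by blast
      then show ?thesis using W by simp
    qed
    have conn: "conn {..<n} H \<longleftrightarrow> (\<forall>v<n. ?lab v = ?lab 0)"
    proof
      assume c: "conn {..<n} H"
      show "\<forall>v<n. ?lab v = ?lab 0"
      proof (intro allI impI)
        fix v assume v: "v < n"
        then have "reach H v 0" using c by (simp add: conn_def)
        then have "?lab v - 1 = ?lab 0 - 1" using rep v by (simp add: is_rep_def)
        then show "?lab v = ?lab 0" using lab[of v] lab[of 0] v by linarith
      qed
    next
      assume c: "\<forall>v<n. ?lab v = ?lab 0"
      show "conn {..<n} H" unfolding conn_def
      proof (intro ballI)
        fix u v assume uv: "u \<in> {..<n}" "v \<in> {..<n}"
        then have "?lab u = ?lab v" using c by (metis lessThan_iff)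
        then show "reach H u v" using is_repD(3)[OF rep uv] by simp
      qed
    qed
    show "1 < W" using W by simp
    show "wp W (For 12 (Num 0) (Reg 10)
         (Load 18 7 (Reg 12) ;; Load 19 7 (Num 0) ;; Cond (Equal (Reg 18) (Reg 19)) Skip (Assign 21 (Num 0))))
        (set_reg 21 1 s1) (\<lambda>u s'. 1 + (t + (1 + u)) \<le> 11 * (n * n) + 40 * n + 40 \<and> regs s' 21 = B)"
      proof (rule wp_mono[OF wp_For_const[where c = 4 and n = n and
          I = "\<lambda>j s'. regs s' 21 = (if \<forall>v<j. ?lab v = ?lab 0 then 1 else 0)"]], goal_cases)
        case (7 j s')
        then have "regs s' 12 = j" "arrs s' 7 = ?lab" "j < n" using n1 by (auto simp: frame_def)
        moreover have "?lab j < W" "?lab 0 < W" using lab \<open>j < n\<close> by auto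
        ultimately show ?case using 7(3) by (auto simp: wp_simps less_Suc_eq W)
      next
        case (8 t' s')
        then show ?case using n1 conn t by (simp add: B_def)
      qed (use n1 W in auto)
  qed
  from wp_frame[OF this] show ?thesis
    by (rule wp_mono) (use S in \<open>auto simp: mat_state_def frame_def B_def\<close>)
qed

section \<open>Joining components through odd vertices\<close>

locale comp_graph =
  fixes V :: "'a set" and E :: "'a set set" and T0 :: "'a set" and \<rho> :: "'a \<Rightarrow> 'a"
  assumes finV: "finite V" and EV: "E \<subseteq> pairs V" and T0V: "T0 \<subseteq> V" and rep: "is_rep V E \<rho>"
begin

definition tc :: "'a \<Rightarrow> nat" where
  "tc r = card {v \<in> V. \<rho> v = r \<and> v \<in> T0}"

definition teff :: "'a \<Rightarrow> nat" where
  "teff r = (if tc r = 0 then 2 else tc r)"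

definition blob :: "'a set \<Rightarrow> 'a set" where
  "blob R = {v \<in> V. \<rho> v \<in> R}"

text \<open>\<open>R\<close> are the components merged so far, \<open>H - E\<close> is the set of edges added for
  this, and \<open>T\<close> are the vertices whose parity is still wrong.  A component without wrong
  vertices has to be entered and left, hence \<open>teff\<close>.\<close>

definition attach_inv :: "'a set set \<Rightarrow> 'a set \<Rightarrow> 'a set \<Rightarrow> bool" where
  "attach_inv H T R \<longleftrightarrow>
     R \<subseteq> \<rho> ` V \<and> T \<subseteq> V \<and> E \<subseteq> H \<and> H \<subseteq> pairs V \<and>
     (\<forall>x y. {x, y} \<in> H - E \<longrightarrow> \<rho> x \<noteq> \<rho> y \<and> \<rho> x \<in> R \<and> \<rho> y \<in> R) \<and>
     (\<forall>u \<in> blob R. \<forall>v \<in> blob R. reach H u v) \<and>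
     card (H - E) \<le> card R - 1 \<and>
     (\<forall>v \<in> V. v \<in> T \<longleftrightarrow> (v \<in> T0) \<noteq> odd (dg (H - E) v)) \<and>
     (R \<noteq> {} \<longrightarrow> card (T \<inter> blob R) + 2 * card R \<le> sum teff R + 2 \<or>
        (card (T \<inter> blob R) \<le> 1 \<and> (\<exists>r \<in> R. tc r = 1))) \<and>
     (\<forall>x y. {x, y} \<in> H - E \<longrightarrow> x \<in> T \<longrightarrow> y \<in> T \<longrightarrow>
        card R = 2 \<and> card (T \<inter> blob R) = 2 \<and> (\<forall>r \<in> R. tc r = 0)) \<and>
     (\<forall>x y v. {x, y} \<in> H - E \<longrightarrow> x \<in> T \<longrightarrow> v \<in> V \<longrightarrow> \<rho> v = \<rho> x \<longrightarrow> v \<in> T \<longrightarrow> v = x) \<and>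
     ((\<forall>r \<in> R. tc r \<noteq> 1) \<longrightarrow> 2 \<le> card R \<longrightarrow> 2 \<le> card (T \<inter> blob R))"

lemma attach_invD:
  assumes "attach_inv H T R"
  shows "R \<subseteq> \<rho> ` V" "T \<subseteq> V" "E \<subseteq> H" "H \<subseteq> pairs V"
    and "{x, y} \<in> H - E \<Longrightarrow> \<rho> x \<noteq> \<rho> y \<and> \<rho> x \<in> R \<and> \<rho> y \<in> R"
    and "u \<in> blob R \<Longrightarrow> v \<in> blob R \<Longrightarrow> reach H u v"
    and "card (H - E) \<le> card R - 1"
    and "v \<in> V \<Longrightarrow> v \<in> T \<longleftrightarrow> (v \<in> T0) \<noteq> odd (dg (H - E) v)"
    and "R \<noteq> {} \<Longrightarrow> card (T \<inter> blob R) + 2 * card R \<le> sum teff R + 2 \<or>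
        (card (T \<inter> blob R) \<le> 1 \<and> (\<exists>r \<in> R. tc r = 1))"
    and "{x, y} \<in> H - E \<Longrightarrow> x \<in> T \<Longrightarrow> y \<in> T \<Longrightarrow>
        card R = 2 \<and> card (T \<inter> blob R) = 2 \<and> (\<forall>r \<in> R. tc r = 0)"
    and "{x, y} \<in> H - E \<Longrightarrow> x \<in> T \<Longrightarrow> v \<in> V \<Longrightarrow> \<rho> v = \<rho> x \<Longrightarrow> v \<in> T \<Longrightarrow> v = x"
    and "(\<And>r. r \<in> R \<Longrightarrow> tc r \<noteq> 1) \<Longrightarrow> 2 \<le> card R \<Longrightarrow> 2 \<le> card (T \<inter> blob R)"
proof -
  note A = assms[unfolded attach_inv_def]
  show "R \<subseteq> \<rho> ` V" "T \<subseteq> V" "E \<subseteq> H" "H \<subseteq> pairs V" "card (H - E) \<le> card R - 1"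
    using A by - (elim conjE, assumption)+
  have "\<forall>x y. {x, y} \<in> H - E \<longrightarrow> \<rho> x \<noteq> \<rho> y \<and> \<rho> x \<in> R \<and> \<rho> y \<in> R"
    using A by (elim conjE)
  then show "{x, y} \<in> H - E \<Longrightarrow> \<rho> x \<noteq> \<rho> y \<and> \<rho> x \<in> R \<and> \<rho> y \<in> R" by blast
  have "\<forall>u \<in> blob R. \<forall>v \<in> blob R. reach H u v" using A by (elim conjE)
  then show "u \<in> blob R \<Longrightarrow> v \<in> blob R \<Longrightarrow> reach H u v" by blast
  have "\<forall>v \<in> V. v \<in> T \<longleftrightarrow> (v \<in> T0) \<noteq> odd (dg (H - E) v)" using A by (elim conjE)
  then show "v \<in> V \<Longrightarrow> v \<in> T \<longleftrightarrow> (v \<in> T0) \<noteq> odd (dg (H - E) v)" by blast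
  have "R \<noteq> {} \<longrightarrow> card (T \<inter> blob R) + 2 * card R \<le> sum teff R + 2 \<or>
        (card (T \<inter> blob R) \<le> 1 \<and> (\<exists>r \<in> R. tc r = 1))" using A by (elim conjE)
  then show "R \<noteq> {} \<Longrightarrow> card (T \<inter> blob R) + 2 * card R \<le> sum teff R + 2 \<or>
        (card (T \<inter> blob R) \<le> 1 \<and> (\<exists>r \<in> R. tc r = 1))" by blast
  have "\<forall>x y. {x, y} \<in> H - E \<longrightarrow> x \<in> T \<longrightarrow> y \<in> T \<longrightarrow>
        card R = 2 \<and> card (T \<inter> blob R) = 2 \<and> (\<forall>r \<in> R. tc r = 0)" using A by (elim conjE)
  then show "{x, y} \<in> H - E \<Longrightarrow> x \<in> T \<Longrightarrow> y \<in> T \<Longrightarrow>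
        card R = 2 \<and> card (T \<inter> blob R) = 2 \<and> (\<forall>r \<in> R. tc r = 0)" by blast
  have "\<forall>x y v. {x, y} \<in> H - E \<longrightarrow> x \<in> T \<longrightarrow> v \<in> V \<longrightarrow> \<rho> v = \<rho> x \<longrightarrow> v \<in> T \<longrightarrow> v = x"
    using A by (elim conjE)
  then show "{x, y} \<in> H - E \<Longrightarrow> x \<in> T \<Longrightarrow> v \<in> V \<Longrightarrow> \<rho> v = \<rho> x \<Longrightarrow> v \<in> T \<Longrightarrow> v = x" by blast
  have "(\<forall>r \<in> R. tc r \<noteq> 1) \<longrightarrow> 2 \<le> card R \<longrightarrow> 2 \<le> card (T \<inter> blob R)" using A by (elim conjE)
  then show "(\<And>r. r \<in> R \<Longrightarrow> tc r \<noteq> 1) \<Longrightarrow> 2 \<le> card R \<Longrightarrow> 2 \<le> card (T \<inter> blob R)" by blast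
qed

lemma finite_reps: "R \<subseteq> \<rho> ` V \<Longrightarrow> finite R"
  using finV finite_subset by blast

lemma attach_inv_empty: "attach_inv E T0 {}"
  unfolding attach_inv_def using EV T0V by (auto simp: blob_def dg_def)

lemma tc_eq: "tc r = card (T0 \<inter> blob {r})"
  unfolding tc_def blob_def using T0V by (intro arg_cong[where f = card]) auto

lemma attach_first:
  assumes "r \<in> \<rho> ` V"
  shows "attach_inv E T0 {r}"
proof -
  have "reach E u v" if "u \<in> blob {r}" "v \<in> blob {r}" for u v
    using that is_repD(3)[OF rep, of u v] by (simp add: blob_def)
  then show ?thesis
    unfolding attach_inv_def using EV T0V assms by (auto simp: dg_def teff_def tc_eq)
qed

lemma attach_outside:
  assumes I: "attach_inv H T R" and v: "v \<in> V" "\<rho> v \<notin> R"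
  shows "v \<in> T \<longleftrightarrow> v \<in> T0"
proof -
  have "{e \<in> H - E. v \<in> e} = {}"
  proof (rule ccontr)
    assume "{e \<in> H - E. v \<in> e} \<noteq> {}"
    then obtain e where e: "e \<in> H - E" "v \<in> e" by auto
    then obtain x y where "e = {x, y}" using attach_invD(4)[OF I] by (auto simp: pairs_def)
    then show False using attach_invD(5)[OF I, of x y] e v by auto
  qed
  then have "dg (H - E) v = 0" by (simp only: dg_def card.empty)
  then show ?thesis using attach_invD(8)[OF I v(1)] by simp
qed

text \<open>Each end of the joining edge is taken from \<open>T\<close> if its side still meets
  \<open>T\<close>. By \<open>order\<close>, components with exactly one wrong vertex come last.
  Before that the merged part always keeps at least two wrong vertices, unless it is a single
  component without any.\<close>

lemma attach_step:
  assumes I: "attach_inv H T R" and ne: "R \<noteq> {}" and r: "r \<in> \<rho> ` V" "r \<notin> R"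
    and order: "tc r \<noteq> 1 \<Longrightarrow> \<forall>q \<in> R. tc q \<noteq> 1"
    and v: "v \<in> V" "\<rho> v = r" "tc r \<noteq> 0 \<Longrightarrow> v \<in> T"
    and u: "u \<in> V" "\<rho> u \<in> R" "T \<inter> blob R \<noteq> {} \<Longrightarrow> u \<in> T"
  shows "attach_inv (tog H u v) (sym_diff T {u, v}) (insert r R)"
proof -
  note D = attach_invD[OF I]
  let ?T = "sym_diff T {u, v}" and ?f = "card (T \<inter> blob R)" and ?R = "insert r R"
  have uv: "u \<noteq> v" using u v r by auto
  have finR: "finite R" using D(1) finite_reps by blast
  have finH: "finite H" using D(4) finite_pairs[OF finV] finite_subset by blast
  have uvH: "{u, v} \<notin> H"
  proof
    assume "{u, v} \<in> H"
    moreover have "{u, v} \<notin> E"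
    proof
      assume "{u, v} \<in> E"
      then have "reach E u v" by (rule reach_edge)
      then show False using is_repD(3)[OF rep u(1) v(1)] u v r by auto
    qed
    ultimately show False using D(5)[of u v] v r by auto
  qed
  then have tog: "tog H u v = insert {u, v} H" by (auto simp: tog_def)
  have uvE: "{u, v} \<notin> E" using uvH D(3) by auto
  have diff: "tog H u v - E = insert {u, v} (H - E)" using tog uvE by auto
  have cardR: "card ?R = card R + 1" using finR r by simp
  have R1: "1 \<le> card R" using ne finR by (simp add: Suc_leI card_gt_0_iff)
  have finB: "finite (blob S)" for S using finV by (simp add: blob_def)
  have blobR: "blob ?R = blob R \<union> blob {r}" by (auto simp: blob_def)
  have disj: "blob R \<inter> blob {r} = {}" using r by (auto simp: blob_def)
  have uB: "u \<in> blob R" "u \<notin> blob {r}" and vB: "v \<in> blob {r}" "v \<notin> blob R"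
    using u v r by (auto simp: blob_def)
  have Tr: "T \<inter> blob {r} = T0 \<inter> blob {r}"
    using attach_outside[OF I] r by (auto simp: blob_def)
  have vT: "v \<in> T \<longleftrightarrow> tc r \<noteq> 0"
  proof
    assume "v \<in> T"
    then have "v \<in> T0 \<inter> blob {r}" using Tr vB by auto
    then show "tc r \<noteq> 0" unfolding tc_eq using finB by auto
  qed (use v in simp)
  have uT: "u \<in> T \<longleftrightarrow> ?f \<noteq> 0" using u(3) uB finB by auto
  have f1: "card (?T \<inter> blob R) = (if ?f = 0 then 1 else ?f - 1)"
  proof (cases "u \<in> T")
    case True
    then have "?T \<inter> blob R = (T \<inter> blob R) - {u}" using vB by auto
    then show ?thesis using True uT uB finB by (simp add: card_Diff_singleton)
  next
    case False
    then have "?T \<inter> blob R = insert u (T \<inter> blob R)" using vB uB by auto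
    then show ?thesis using False uT finB by simp
  qed
  have f2: "card (?T \<inter> blob {r}) = (if tc r = 0 then 1 else tc r - 1)"
  proof (cases "v \<in> T")
    case True
    then have "?T \<inter> blob {r} = (T0 \<inter> blob {r}) - {v}" using uB Tr by auto
    moreover have "v \<in> T0 \<inter> blob {r}" using True Tr vB by auto
    ultimately show ?thesis using True vT finB by (simp add: card_Diff_singleton tc_eq)
  next
    case False
    then have "?T \<inter> blob {r} = insert v (T0 \<inter> blob {r})" using uB Tr vB by auto
    moreover have "v \<notin> T0 \<inter> blob {r}" using False Tr by auto
    ultimately show ?thesis using False vT finB by (simp add: tc_eq)
  qed
  have f': "card (?T \<inter> blob ?R) = (if ?f = 0 then 1 else ?f - 1) + (if tc r = 0 then 1 else tc r - 1)"
  proof -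
    have "card (?T \<inter> blob ?R) = card (?T \<inter> blob R) + card (?T \<inter> blob {r})"
      unfolding blobR Int_Un_distrib using finB disj by (intro card_Un_disjoint) auto
    then show ?thesis using f1 f2 by simp
  qed
  have sumR: "sum teff ?R = teff r + sum teff R" using finR r by simp
  \<comment> \<open>Needed if the merged part has no wrong vertex: the join then creates one there
    instead of removing one, and the count must still fit.\<close>
  have big: "2 * card R \<le> sum teff R" if "\<forall>q \<in> R. tc q \<noteq> 1"
  proof -
    have "(\<Sum>q\<in>R. 2) \<le> sum teff R" using that
      by (intro sum_mono) (auto simp: teff_def le_Suc_eq numeral_2_eq_2 intro: Suc_leI)
    then show ?thesis by simp
  qed
  have single: "?f = tc q" if "R = {q}" for q
  proof -
    have "card (H - E) = 0" using D(7) that by simp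
    then have emp: "H - E = {}" using finH by (metis card_eq_0_iff finite_Diff)
    have "w \<in> T \<longleftrightarrow> w \<in> T0" if "w \<in> V" for w
      using D(8)[OF that] unfolding emp by (simp add: dg_def)
    then have "T \<inter> blob R = T0 \<inter> blob {q}" using that by (auto simp: blob_def)
    then show ?thesis by (simp add: tc_eq)
  qed
  \<comment> \<open>Supplies a wrong vertex in the merged part for every join of the first stage;
    the only exception is the very first join, made from a component without wrong vertices.\<close>
  have low: "2 \<le> ?f \<or> (\<exists>q. R = {q} \<and> ?f = 0 \<and> tc q = 0)" if "\<forall>q \<in> R. tc q \<noteq> 1"
  proof (cases "2 \<le> card R")
    case True
    then show ?thesis using D(12) that by blast
  next
    case False
    then have "card R = 1" using R1 by simp
    then obtain q where "R = {q}" using card_1_singletonE by blast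
    then show ?thesis using single[of q] that by (cases "tc q") auto
  qed
  have mono: "reach (tog H u v) a b" if "reach H a b" for a b
    using that by (rule reach_mono) (auto simp: tog)
  show ?thesis
    unfolding attach_inv_def
  proof (intro conjI allI impI ballI)
    show "?R \<subseteq> \<rho> ` V" using D(1) r by auto
    show "?T \<subseteq> V" using D(2) u v by auto
    show "E \<subseteq> tog H u v" using D(3) by (auto simp: tog)
    show "tog H u v \<subseteq> pairs V" using D(4) u v uv by (auto simp: tog)
  next
    fix x y assume "{x, y} \<in> tog H u v - E"
    then consider "{x, y} = {u, v}" | "{x, y} \<in> H - E" by (auto simp: diff)
    then have "\<rho> x \<noteq> \<rho> y \<and> \<rho> x \<in> ?R \<and> \<rho> y \<in> ?R"
    proof cases
      case 1
      then show ?thesis using u v r by (auto simp: doubleton_eq_iff)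
    next
      case 2
      then show ?thesis using D(5)[OF 2] by auto
    qed
    then show "\<rho> x \<noteq> \<rho> y" "\<rho> x \<in> ?R" "\<rho> y \<in> ?R" by auto
  next
    fix a b assume ab: "a \<in> blob ?R" "b \<in> blob ?R"
    have to_u: "reach (tog H u v) u a" if "a \<in> blob ?R" for a
    proof (cases "a \<in> blob R")
      case True
      then show ?thesis using D(6) uB mono by blast
    next
      case False
      then have a: "a \<in> blob {r}" using that blobR by auto
      then have "reach E v a" using is_repD(3)[OF rep v(1), of a] v by (simp add: blob_def)
      then have "reach (tog H u v) v a" by (rule reach_mono) (use D(3) tog in auto)
      moreover have "reach (tog H u v) u v" by (rule reach_edge) (simp add: tog)
      ultimately show ?thesis by (meson rtrancl_trans)
    qed
    show "reach (tog H u v) a b" using to_u[OF ab(1)] to_u[OF ab(2)] by (meson reach_sym rtrancl_trans)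
  next
    have "card (tog H u v - E) \<le> card (H - E) + 1" unfolding diff using finH by (simp add: card_insert_if)
    then show "card (tog H u v - E) \<le> card ?R - 1" using D(7) cardR R1 by simp
  next
    fix w assume w: "w \<in> V"
    have "tog H u v - E = tog (H - E) u v" using uvE by (auto simp: tog_def)
    then have "odd (dg (tog H u v - E) w) \<longleftrightarrow> (odd (dg (H - E) w) \<noteq> (w = u \<or> w = v))"
      using odd_dg_tog[of "H - E" u v w] finH by simp
    then show "w \<in> ?T \<longleftrightarrow> (w \<in> T0) \<noteq> odd (dg (tog H u v - E) w)" using D(8)[OF w] by auto
  next
    show "card (?T \<inter> blob ?R) + 2 * card ?R \<le> sum teff ?R + 2 \<or>
        (card (?T \<inter> blob ?R) \<le> 1 \<and> (\<exists>r \<in> ?R. tc r = 1))"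
    proof (cases "tc r = 1")
      case True
      then show ?thesis using D(9)[OF ne] f' cardR sumR by (auto simp: teff_def)
    next
      case False
      then have n1: "\<forall>q \<in> R. tc q \<noteq> 1" using order by blast
      then have "?f + 2 * card R \<le> sum teff R + 2" using D(9)[OF ne] by blast
      then show ?thesis using f' cardR sumR big[OF n1] False by (auto simp: teff_def)
    qed
  next
    fix x y assume xy: "{x, y} \<in> tog H u v - E" "x \<in> ?T" "y \<in> ?T"
    \<comment> \<open>Both ends are wrong afterwards only if neither was wrong before, that is, if
      the first two components had no wrong vertices. Any later join uses up one of these two
      ends.\<close>
    have "card ?R = 2 \<and> card (?T \<inter> blob ?R) = 2 \<and> (\<forall>q\<in>?R. tc q = 0)"
    proof (cases "{x, y} = {u, v}")
      case True
      then have "u \<in> ?T" "v \<in> ?T" using xy by (auto simp: doubleton_eq_iff)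
      then have 0: "?f = 0" "tc r = 0" using uT vT uv by auto
      then have "\<forall>q \<in> R. tc q \<noteq> 1" using order by simp
      then obtain q where "R = {q}" "tc q = 0" using low 0 by auto
      then show ?thesis using 0 f' r by auto
    next
      case False
      then have old: "{x, y} \<in> H - E" using xy by (auto simp: diff)
      then have "\<rho> x \<in> R" "\<rho> y \<in> R" using D(5) by auto
      then have "x \<noteq> v" "y \<noteq> v" using v r by auto
      then have xyT: "x = u \<or> x \<in> T" "y = u \<or> y \<in> T" "x = u \<Longrightarrow> u \<notin> T" "y = u \<Longrightarrow> u \<notin> T"
        using xy by auto
      have xV: "x \<in> V" "y \<in> V" "x \<noteq> y" using old D(4) by auto
      have xyB: "x \<in> blob R" "y \<in> blob R" using xV \<open>\<rho> x \<in> R\<close> \<open>\<rho> y \<in> R\<close> by (auto simp: blob_def)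
      show ?thesis
      proof (cases "u \<in> T")
        case True
        then have T: "x \<in> T" "y \<in> T" "x \<noteq> u" "y \<noteq> u" using xyT by auto
        then have "?f = 2" using D(10)[OF old] by auto
        moreover have "{x, y, u} \<subseteq> T \<inter> blob R" using T xyB uB True by auto
        then have "card {x, y, u} \<le> ?f" using finB by (intro card_mono) auto
        moreover have "card {x, y, u} = 3" using T xV by auto
        ultimately show ?thesis by simp
      next
        case False
        then have "T \<inter> blob R = {}" using u(3) by auto
        then show ?thesis using xyT xyB xV by auto
      qed
    qed
    then show "card ?R = 2" "card (?T \<inter> blob ?R) = 2" "\<And>q. q \<in> ?R \<Longrightarrow> tc q = 0" by auto
  next
    fix x y w assume xy: "{x, y} \<in> tog H u v - E" "x \<in> ?T" and w: "w \<in> V" "\<rho> w = \<rho> x" "w \<in> ?T"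
    \<comment> \<open>An end that becomes wrong through this join lies in a component without other
      wrong vertices; for older ends the property persists, because the set of wrong vertices there
      does not grow.\<close>
    show "w = x"
    proof (cases "\<rho> x = r")
      case True
      have "x = v"
      proof (rule ccontr)
        assume "x \<noteq> v"
        moreover have "x \<noteq> u" using True u r by auto
        ultimately have "{x, y} \<in> H - E" using xy by (auto simp: diff doubleton_eq_iff)
        then show False using D(5) True r by auto
      qed
      then have "v \<notin> T" using xy uv by auto
      then have "tc r = 0" using vT by simp
      then have "T0 \<inter> blob {r} = {}" unfolding tc_eq using finB by simp
      then have "w \<notin> T" using Tr w True by (auto simp: blob_def)
      then have "w = u \<or> w = v" using w by auto
      then show ?thesis using \<open>x = v\<close> w True u r by auto
    next
      case False
      then have xv: "x \<noteq> v" "w \<noteq> v" using v w by auto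
      show ?thesis
      proof (cases "u \<in> T")
        case True
        then have "x \<noteq> u" using xy uv by auto
        then have "{x, y} \<in> H - E" "x \<in> T" "w \<in> T" using xy xv w True by (auto simp: diff doubleton_eq_iff)
        then show ?thesis using D(11) w by blast
      next
        case uF: False
        then have "T \<inter> blob R = {}" using u(3) by auto
        moreover have "\<rho> x \<in> R"
        proof (cases "{x, y} \<in> H - E")
          case True
          then show ?thesis using D(5) by auto
        next
          case False
          then have "x = u" using xy xv by (auto simp: diff doubleton_eq_iff)
          then show ?thesis using u by simp
        qed
        moreover have "x \<in> V"
          using xy D(2) u v by auto
        ultimately have "x \<notin> T" "w \<notin> T" using w by (auto simp: blob_def)
        then show ?thesis using xy w xv by auto
      qed
    qed
  next
    assume A: "\<forall>q\<in>?R. tc q \<noteq> 1" "2 \<le> card ?R"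
    then show "2 \<le> card (?T \<inter> blob ?R)" using low f' by auto
  qed
qed

lemma sum_tc: "sum tc (\<rho> ` V) = card T0"
proof -
  have "finite T0" using T0V finV finite_subset by blast
  moreover have "tc r = (\<Sum>v\<in>{v \<in> T0. \<rho> v = r}. 1)" for r
    unfolding tc_def using T0V by (simp, intro arg_cong[where f = card]) auto
  moreover have "\<rho> ` T0 \<subseteq> \<rho> ` V" using T0V by auto
  ultimately show ?thesis using sum.group[of T0 "\<rho> ` V" \<rho> "\<lambda>_. 1 :: nat"] finV by simp
qed

lemma tfree_eq: "tfree V \<rho> T0 = {r \<in> \<rho> ` V. tc r = 0}"
  unfolding tfree_def tc_def using finV by auto

lemma sum_teff: "sum teff (\<rho> ` V) = card T0 + 2 * card (tfree V \<rho> T0)"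
proof -
  have "sum teff (\<rho> ` V) = (\<Sum>r\<in>\<rho> ` V. tc r + (if tc r = 0 then 2 else 0))"
    by (intro sum.cong) (auto simp: teff_def)
  also have "\<dots> = card T0 + (\<Sum>r\<in>\<rho> ` V. if tc r = 0 then 2 else 0)"
    by (simp add: sum.distrib sum_tc)
  also have "(\<Sum>r\<in>\<rho> ` V. if tc r = 0 then 2 else 0) = (\<Sum>r\<in>tfree V \<rho> T0. 2)"
    unfolding tfree_eq using finV by (simp add: sum.If_cases Int_def)
  finally show ?thesis by simp
qed

text \<open>The two alternatives of the invariant correspond to the two terms of the maximum. If
  wrong vertices ran out, at most one is left, hence none by parity, and only the joining edges
  count. Otherwise every pair, joining or matching, is charged to a wrong vertex or to a component
  without one.\<close>

lemma attach_final:
  assumes I: "attach_inv H T (\<rho> ` V)" and ev: "even (card T)"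
  shows "conn V H"
    and "2 \<le> card (\<rho> ` V) \<Longrightarrow> card (H - E) + card T div 2 \<le>
      max (card (\<rho> ` V) - 1) (card T0 div 2 + card (tfree V \<rho> T0))"
    and "card (\<rho> ` V) < 2 \<Longrightarrow> H = E \<and> T = T0"
    and "{x, y} \<in> H - E \<Longrightarrow> x \<in> T \<Longrightarrow> y \<in> T \<Longrightarrow> card (\<rho> ` V) = 2 \<and> card T = 2 \<and> T0 = {}"
proof -
  note D = attach_invD[OF I]
  have B: "blob (\<rho> ` V) = V" by (auto simp: blob_def)
  have TB: "T \<inter> blob (\<rho> ` V) = T" using D(2) B by auto
  show "conn V H" using D(6) B by (auto simp: conn_def)
  show "card (H - E) + card T div 2 \<le>
      max (card (\<rho> ` V) - 1) (card T0 div 2 + card (tfree V \<rho> T0))" if p: "2 \<le> card (\<rho> ` V)"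
  proof -
    have "\<rho> ` V \<noteq> {}" using p by auto
    then consider "card T + 2 * card (\<rho> ` V) \<le> card T0 + 2 * card (tfree V \<rho> T0) + 2" | "card T \<le> 1"
      using D(9) TB sum_teff by auto
    then show ?thesis
    proof cases
      case 1
      then show ?thesis using D(7) p by linarith
    next
      case 2
      then have "card T = 0" using ev by (cases "card T") auto
      then show ?thesis using D(7) by simp
    qed
  qed
  show "H = E \<and> T = T0" if p: "card (\<rho> ` V) < 2"
  proof -
    have "finite H" using D(4) finite_pairs[OF finV] finite_subset by blast
    moreover have "card (H - E) = 0" using D(7) p by linarith
    ultimately have emp: "H - E = {}" by (metis card_eq_0_iff finite_Diff)
    have "w \<in> T \<longleftrightarrow> w \<in> T0" if "w \<in> V" for w
      using D(8)[OF that] unfolding emp by (simp add: dg_def)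
    then show ?thesis using D(2,3) T0V emp by blast
  qed
  assume xy: "{x, y} \<in> H - E" "x \<in> T" "y \<in> T"
  then have A: "card (\<rho> ` V) = 2" "card T = 2" "\<forall>r \<in> \<rho> ` V. tc r = 0" using D(10)[OF xy] TB by auto
  have "sum tc (\<rho> ` V) = 0" using A(3) by (intro sum.neutral)
  then have "T0 = {}" using sum_tc T0V finV finite_subset by fastforce
  then show "card (\<rho> ` V) = 2 \<and> card T = 2 \<and> T0 = {}" using A by simp
qed

end

section \<open>Matchings whose toggling disconnects the graph\<close>

definition is_pm :: "'a set set \<Rightarrow> 'a set \<Rightarrow> bool" where
  "is_pm N S \<longleftrightarrow> N \<subseteq> pairs S \<and> (\<forall>x \<in> S. \<exists>y. {x, y} \<in> N) \<and>
     (\<forall>x y z. {x, y} \<in> N \<longrightarrow> {x, z} \<in> N \<longrightarrow> y = z)"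

text \<open>The exchange of the pairs ab and xy for ax and by. Expressed by toggles it makes sense
  whichever of these pairs are edges, and it is its own inverse, so an unsuccessful attempt can be
  undone by repeating it.\<close>

definition swap4 :: "'a set set \<Rightarrow> 'a \<Rightarrow> 'a \<Rightarrow> 'a \<Rightarrow> 'a \<Rightarrow> 'a set set" where
  "swap4 K a b x y = tog (tog (tog (tog K a b) x y) a x) b y"

lemma is_pmD:
  assumes "is_pm N S"
  shows "N \<subseteq> pairs S" "x \<in> S \<Longrightarrow> \<exists>y. {x, y} \<in> N"
    "{x, y} \<in> N \<Longrightarrow> {x, z} \<in> N \<Longrightarrow> y = z" "{x, y} \<in> N \<Longrightarrow> x \<in> S \<and> y \<in> S \<and> x \<noteq> y"
proof -
  show 1: "N \<subseteq> pairs S" using assms by (simp add: is_pm_def)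
  show "x \<in> S \<Longrightarrow> \<exists>y. {x, y} \<in> N" using assms by (simp add: is_pm_def)
  show "{x, y} \<in> N \<Longrightarrow> {x, z} \<in> N \<Longrightarrow> y = z" using assms unfolding is_pm_def by blast
  show "{x, y} \<in> N \<Longrightarrow> x \<in> S \<and> y \<in> S \<and> x \<noteq> y" using subsetD[OF 1, of "{x, y}"] by simp
qed

lemma swap4_other:
  "e \<noteq> {x, y} \<Longrightarrow> e \<noteq> {a, x} \<Longrightarrow> e \<noteq> {b, y} \<Longrightarrow>
   e \<in> swap4 K a b x y \<longleftrightarrow> (e \<in> K) \<noteq> (e = {a, b})"
  by (simp add: swap4_def tog_iff)

lemma tog_sym: "tog K x y = tog K y x"
  by (simp add: tog_def insert_commute)

lemma tog_commute: "tog (tog K x y) z w = tog (tog K z w) x y"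
  by (rule set_eqI) (simp add: tog_iff, blast)

lemma swap4_commute: "swap4 K b a x y = swap4 K a b y x"
  unfolding swap4_def by (metis tog_sym tog_commute)

lemma sym_diff_tog: "sym_diff E (tog K x y) = tog (sym_diff E K) x y"
  unfolding tog_def by auto

lemma conn_subst:
  assumes "conn V H" "\<And>x y. {x, y} \<in> H \<Longrightarrow> reach K x y"
  shows "conn V K"
  unfolding conn_def
proof (intro ballI)
  fix u v assume "u \<in> V" "v \<in> V"
  then have "reach H u v" using assms(1) by (simp add: conn_def)
  then show "reach K u v" by (rule reach_subst) (rule assms(2))
qed

lemma conn_mono: "conn V H \<Longrightarrow> H \<subseteq> K \<Longrightarrow> conn V K"
  by (erule conn_subst) (auto intro: reach_edge)

text \<open>Deleting a perfect matching of a clique with at least four vertices disconnects nothing.\<close>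

lemma clique_matching_stuck:
  assumes H: "conn V H" and N: "is_pm N S"
    and clique: "\<And>x y. x \<in> \<Union>(N \<inter> H) \<Longrightarrow> y \<in> \<Union>(N \<inter> H) \<Longrightarrow> x \<noteq> y \<Longrightarrow> {x, y} \<in> H"
    and disc: "\<not> conn V (sym_diff H N)"
  shows "N \<inter> H \<noteq> {}" and "{a, b} \<in> N \<inter> H \<Longrightarrow> N \<inter> H = {{a, b}} \<and> bridge H a b"
proof -
  show "N \<inter> H \<noteq> {}"
  proof
    assume "N \<inter> H = {}"
    then have "H \<subseteq> sym_diff H N" by auto
    then show False using H disc conn_mono by blast
  qed
  assume ab: "{a, b} \<in> N \<inter> H"
  have eq: "N \<inter> H = {{a, b}}"
  proof (rule ccontr)
    assume "N \<inter> H \<noteq> {{a, b}}"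
    then obtain e where e: "e \<in> N \<inter> H" "e \<noteq> {a, b}" using ab by auto
    have "reach (sym_diff H N) x y" if xy: "{x, y} \<in> H" for x y
    proof (cases "{x, y} \<in> N")
      case False
      then show ?thesis using xy by (intro reach_edge) auto
    next
      case True
      \<comment> \<open>A second deleted pair has an end z outside xy. In the clique z is adjacent
        to x and y, and these two edges survive since x and y are matched to each other.\<close>
      obtain f where f: "f \<in> N \<inter> H" "f \<noteq> {x, y}" using e ab by metis
      then obtain z w where zw: "f = {z, w}" "z \<noteq> w" using pairs_E[of f N S] is_pmD(1)[OF N] by blast
      have "z \<noteq> x"
      proof
        assume "z = x"
        then have "w = y" using is_pmD(3)[OF N, of x w y] f zw True by auto
        then show False using f zw \<open>z = x\<close> by auto
      qed
      moreover have "z \<noteq> y"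
      proof
        assume "z = y"
        then have "w = x" using is_pmD(3)[OF N, of y w x] f zw True by (auto simp: insert_commute)
        then show False using f zw \<open>z = y\<close> by auto
      qed
      moreover have "x \<in> \<Union>(N \<inter> H)" "y \<in> \<Union>(N \<inter> H)" "z \<in> \<Union>(N \<inter> H)" using f zw True xy by auto
      ultimately have "{x, z} \<in> H" "{z, y} \<in> H" using clique by auto
      moreover have "{x, z} \<notin> N" using is_pmD(3)[OF N, of x y z] True \<open>z \<noteq> y\<close> by auto
      moreover have "{z, y} \<notin> N" using is_pmD(3)[OF N, of y x z] True \<open>z \<noteq> x\<close> by (auto simp: insert_commute)
      ultimately have "{x, z} \<in> sym_diff H N" "{z, y} \<in> sym_diff H N" by auto
      then show ?thesis using reach_edge reach_step by metis
    qed
    then show False using conn_subst[OF H] disc by blast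
  qed
  moreover have "bridge H a b"
  proof (rule ccontr)
    assume "\<not> bridge H a b"
    then have r: "reach (H - {{a, b}}) a b" using ab by (auto simp: bridge_def)
    have "reach (sym_diff H N) x y" if xy: "{x, y} \<in> H" for x y
    proof (cases "{x, y} = {a, b}")
      case False
      then have "{x, y} \<notin> N" using eq xy by (metis IntI singletonD)
      then show ?thesis using xy by (intro reach_edge) simp
    next
      case True
      have "reach (sym_diff H N) a b" using r
      proof (rule reach_mono)
        show "H - {{a, b}} \<subseteq> sym_diff H N"
        proof
          fix e assume "e \<in> H - {{a, b}}"
          then show "e \<in> sym_diff H N" using eq by (metis DiffD1 DiffD2 DiffI IntI UnI1)
        qed
      qed
      then show ?thesis using True by (auto simp: doubleton_eq_iff dest: reach_sym)
    qed
    then show False using conn_subst[OF H] disc by blast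
  qed
  ultimately show "N \<inter> H = {{a, b}} \<and> bridge H a b" by simp
qed

text \<open>The only way in which toggling the matching can disconnect the graph, by
  \<open>clique_matching_stuck\<close>. The situation is symmetric in a and b, which
  \<open>swapped\<close> exploits to halve the case analysis.\<close>

locale stuck_matching =
  fixes V S :: "'a set" and H N :: "'a set set" and a b :: 'a
  assumes finV: "finite V" and H: "conn V H" "H \<subseteq> pairs V" and S: "S \<subseteq> V" and N: "is_pm N S"
    and NH: "N \<inter> H = {{a, b}}" and br: "bridge H a b"
begin

abbreviation K :: "'a set set" where "K \<equiv> sym_diff H N"

lemma swapped: "stuck_matching V S H N b a"
  using finV H S N NH br by unfold_locales (auto simp: insert_commute bridge_commute)

lemma ab: "{a, b} \<in> N" "{a, b} \<in> H" "a \<noteq> b" "a \<in> S" "b \<in> S"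
proof -
  have "{a, b} \<in> N \<inter> H" using NH by simp
  then show "{a, b} \<in> N" "{a, b} \<in> H" "a \<noteq> b" "a \<in> S" "b \<in> S"
    using is_pmD(4)[OF N, of a b] by blast+
qed

lemma mate_ends: "{a, z} \<in> N \<Longrightarrow> z = b" "{b, z} \<in> N \<Longrightarrow> z = a"
  using is_pmD(3)[OF N, of a b z] is_pmD(3)[OF N, of b a z] ab(1) by (simp_all add: insert_commute)

lemma NHD: "e \<in> N \<Longrightarrow> e \<in> H \<Longrightarrow> e = {a, b}"
  using NH by (metis IntI singletonD)

lemma K_iff: "e \<in> H \<Longrightarrow> e \<in> K \<longleftrightarrow> e \<noteq> {a, b}"
proof -
  assume e: "e \<in> H"
  then have "e \<in> N \<longleftrightarrow> e = {a, b}" using NHD ab(1) by metis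
  then show "e \<in> K \<longleftrightarrow> e \<noteq> {a, b}" using e by simp
qed

lemma no_common: "{a, z} \<in> H \<Longrightarrow> {b, z} \<in> H \<Longrightarrow> False"
proof -
  assume z: "{a, z} \<in> H" "{b, z} \<in> H"
  then have "{a, z} \<in> pairs V" "{b, z} \<in> pairs V" using H by auto
  then have "z \<noteq> a" "z \<noteq> b" by auto
  then show False using bridge_no_common[OF br] z by blast
qed

lemma mateD:
  assumes "{x, y} \<in> N" "x \<notin> {a, b}"
  shows "y \<notin> {a, b}" "{x, y} \<notin> H" "{a, x} \<notin> N" "{b, y} \<notin> N" "{a, y} \<notin> N" "{b, x} \<notin> N"
    "x \<in> S" "y \<in> S" "x \<noteq> y"
proof -
  show xy: "x \<in> S" "y \<in> S" "x \<noteq> y" using is_pmD(4)[OF N assms(1)] by auto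
  show y: "y \<notin> {a, b}"
    using mate_ends[of x] assms by (auto simp: insert_commute)
  show "{x, y} \<notin> H" using assms NHD[of "{x, y}"] by (auto simp: doubleton_eq_iff)
  show "{a, x} \<notin> N" "{a, y} \<notin> N" using mate_ends(1) assms y by blast+
  show "{b, x} \<notin> N" "{b, y} \<notin> N" using mate_ends(2) assms y by blast+
qed

lemma swap_keeps:
  assumes xy: "{x, y} \<in> N" "x \<notin> {a, b}" and e: "e \<in> H" "e \<noteq> {a, x}" "e \<noteq> {b, y}"
  shows "e \<in> swap4 K a b x y"
proof -
  have "e \<noteq> {x, y}" using mateD(2)[OF xy] e by auto
  then show ?thesis using e K_iff[OF e(1)] swap4_other[of e x y a b K] by simp
qed

definition no_swap :: bool where
  "no_swap \<longleftrightarrow> (\<forall>x y. {x, y} \<in> N \<longrightarrow> x \<notin> {a, b} \<longrightarrow> y \<notin> {a, b} \<longrightarrow> \<not> conn V (swap4 K a b x y))"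

lemma no_swapD:
  assumes "no_swap" "{x, y} \<in> N" "x \<notin> {a, b}"
  shows "\<not> conn V (swap4 K a b x y)"
  using assms mateD(1)[OF assms(2,3)] unfolding no_swap_def by blast

text \<open>Otherwise the exchange would restore ab, delete no edge of \<open>H\<close> and so
  reconnect the graph.\<close>

lemma attached:
  assumes ns: no_swap and xy: "{x, y} \<in> N" "x \<notin> {a, b}"
  shows "{a, x} \<in> H \<or> {b, y} \<in> H"
proof (rule ccontr)
  assume "\<not> ?thesis"
  then have "H \<subseteq> swap4 K a b x y" using swap_keeps[OF xy] by auto
  then have "conn V (swap4 K a b x y)" using H(1) conn_mono by blast
  then show False using no_swapD[OF ns xy] by simp
qed

text \<open>\<open>attached\<close> holds for both orientations of the pair, and no vertex is
  adjacent to both a and b because ab is a bridge. So both ends of the pair hang on the same end of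
  the bridge.\<close>

lemma attached_cases:
  assumes ns: no_swap and xy: "{x, y} \<in> N" "x \<notin> {a, b}"
  shows "({a, x} \<in> H \<and> {a, y} \<in> H \<and> {b, x} \<notin> H \<and> {b, y} \<notin> H) \<or>
    ({b, x} \<in> H \<and> {b, y} \<in> H \<and> {a, x} \<notin> H \<and> {a, y} \<notin> H)"
proof -
  have yx: "{y, x} \<in> N" "y \<notin> {a, b}" using xy mateD(1)[OF xy] by (auto simp: insert_commute)
  show ?thesis using attached[OF ns xy] attached[OF ns yx] no_common[of x] no_common[of y] by blast
qed

text \<open>Apart from a itself, every neighbour of s in \<open>S\<close> is also a neighbour of a.
  But a has s, the mate of s and b in addition, and none of these three is a neighbour of s, so a
  has more neighbours in \<open>S\<close> than s.\<close>

lemma center_not_attached: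
  assumes ns: no_swap and s: "s \<in> S" "s \<notin> {a, b}" and as: "{a, s} \<in> H"
    and max: "card {w \<in> S. {a, w} \<in> H} \<le> card {w \<in> S. {s, w} \<in> H}"
  shows False
proof -
  obtain y where y: "{s, y} \<in> N" using is_pmD(2)[OF N s(1)] by auto
  note M = mateD[OF y s(2)]
  have ay: "{a, y} \<in> H" and bs: "{b, s} \<notin> H"
    using attached_cases[OF ns y s(2)] as by auto
  have sub: "{w \<in> S. {s, w} \<in> H} \<subseteq> insert a ({w \<in> S. {a, w} \<in> H} - {s, y, b})"
  proof
    fix w assume w: "w \<in> {w \<in> S. {s, w} \<in> H}"
    then have sw: "w \<in> S" "{s, w} \<in> H" "{s, w} \<in> pairs V" using H by auto
    show "w \<in> insert a ({w \<in> S. {a, w} \<in> H} - {s, y, b})"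
    proof (cases "w = a")
      case False
      have "w \<noteq> b" using bs sw by (auto simp: insert_commute)
      moreover have "w \<noteq> y" using M(2) sw by auto
      moreover have "w \<noteq> s" using sw by auto
      \<comment> \<open>Otherwise w hangs on b, and a, s, w, b is a path around the bridge.\<close>
      moreover have "{a, w} \<in> H"
      proof (rule ccontr)
        assume aw: "{a, w} \<notin> H"
        obtain z where "{w, z} \<in> N" using is_pmD(2)[OF N sw(1)] by auto
        then have "{b, w} \<in> H" using attached_cases[OF ns, of w z] aw False \<open>w \<noteq> b\<close> by auto
        then have "{a, s} \<in> H - {{a, b}}" "{s, w} \<in> H - {{a, b}}" "{w, b} \<in> H - {{a, b}}"
          using as sw s \<open>w \<noteq> b\<close> False by (auto simp: doubleton_eq_iff insert_commute)
        then have "reach (H - {{a, b}}) a b" using reach_edge reach_step by metis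
        then show False using br by (simp add: bridge_def)
      qed
      ultimately show ?thesis using sw by auto
    qed simp
  qed
  have finS: "finite S" using S finV finite_subset by blast
  have sub3: "{s, y, b} \<subseteq> {w \<in> S. {a, w} \<in> H}" using s as ay ab M by auto
  have c3: "card {s, y, b} = 3" using s M by auto
  have "card {w \<in> S. {s, w} \<in> H} \<le> card (insert a ({w \<in> S. {a, w} \<in> H} - {s, y, b}))"
    using finS by (intro card_mono[OF _ sub]) auto
  also have "\<dots> \<le> Suc (card ({w \<in> S. {a, w} \<in> H} - {s, y, b}))" by (rule card_insert_le_m1) auto
  also have "card ({w \<in> S. {a, w} \<in> H} - {s, y, b}) = card {w \<in> S. {a, w} \<in> H} - 3"
    using sub3 c3 by (subst card_Diff_subset) auto
  moreover have "3 \<le> card {w \<in> S. {a, w} \<in> H}"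
    using card_mono[OF _ sub3] c3 finS by auto
  ultimately show False using max by linarith
qed

text \<open>For a matched pair xy attached to a, the exchange deletes at most the edge ax of
  \<open>H\<close>, since by is not an edge. As no exchange reconnects the graph, ax must be a
  bridge.\<close>

lemma center_star:
  assumes ns: no_swap and all: "\<And>x. x \<in> S \<Longrightarrow> x \<noteq> a \<Longrightarrow> {a, x} \<in> H"
  shows "star_exc H S"
  unfolding star_exc_def
proof (intro bexI ballI)
  show "a \<in> S" using ab by simp
  fix x assume x: "x \<in> S - {a}"
  show "bridge H a x"
  proof (cases "x = b")
    case False
    obtain y where y: "{x, y} \<in> N" using is_pmD(2)[OF N] x by auto
    have xab: "x \<notin> {a, b}" using x False by auto
    have ax: "{a, x} \<in> H" using all x by auto
    then have byH: "{b, y} \<notin> H" using attached_cases[OF ns y xab] by auto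
    show ?thesis
    proof (rule ccontr)
      assume "\<not> bridge H a x"
      then have r: "reach (H - {{a, x}}) a x" using ax by (simp add: bridge_def)
      have keep: "H - {{a, x}} \<subseteq> swap4 K a b x y" using swap_keeps[OF y xab] byH by auto
      have "reach (swap4 K a b x y) u v" if uv: "{u, v} \<in> H" for u v
      proof (cases "{u, v} = {a, x}")
        case False
        then show ?thesis using keep uv by (intro reach_edge) auto
      next
        case True
        have "reach (swap4 K a b x y) a x" using r keep by (rule reach_mono)
        then show ?thesis using True by (auto simp: doubleton_eq_iff dest: reach_sym)
      qed
      then have "conn V (swap4 K a b x y)" using conn_subst[OF H(1)] by blast
      then show False using no_swapD[OF ns y xab] by simp
    qed
  qed (use br in simp)
qed

text \<open>The edge ab is restored. Since it is a bridge, at most one of aw and wb was an edge, so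
  toggling both adds at least one of them, and a, b, w remain connected to each other.\<close>

lemma conn_third_vertex:
  assumes w: "w \<in> V" "w \<noteq> a" "w \<noteq> b"
  shows "conn V (tog (tog (tog K a b) a w) w b)" (is "conn V ?K")
proof -
  have aw: "{a, w} \<notin> N" using mate_ends(1) w by blast
  have bw: "{w, b} \<notin> N" using mate_ends(2)[of w] w by (auto simp: insert_commute)
  have keep: "e \<in> ?K" if "e \<in> H" "e \<noteq> {a, w}" "e \<noteq> {w, b}" for e
    using that K_iff[OF that(1)] by (simp add: tog_iff)
  have abK: "{a, b} \<in> ?K" using keep ab w by (auto simp: doubleton_eq_iff)
  have K1: "{a, w} \<in> ?K \<longleftrightarrow> {a, w} \<notin> H" using aw w ab by (auto simp: tog_iff doubleton_eq_iff)
  have K2: "{w, b} \<in> ?K \<longleftrightarrow> {w, b} \<notin> H" using bw w ab by (auto simp: tog_iff doubleton_eq_iff)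
  have nc: "{a, w} \<notin> H \<or> {w, b} \<notin> H" using no_common[of w] by (auto simp: insert_commute)
  have rab: "reach ?K a b" using abK by (rule reach_edge)
  have raw: "reach ?K a w"
  proof (cases "{a, w} \<in> H")
    case True
    then have "{w, b} \<in> ?K" using nc K2 by auto
    then have "reach ?K w b" by (rule reach_edge)
    then show ?thesis using rab by (meson reach_sym rtrancl_trans)
  next
    case False
    then show ?thesis using K1 reach_edge by metis
  qed
  have rwb: "reach ?K w b" using raw rab by (meson reach_sym rtrancl_trans)
  have "reach ?K x y" if xy: "{x, y} \<in> H" for x y
  proof -
    consider "{x, y} = {a, w}" | "{x, y} = {w, b}" | "{x, y} \<in> ?K" using keep[of "{x, y}"] xy by blast
    then show ?thesis
    proof cases
      case 1
      then show ?thesis using raw by (auto simp: doubleton_eq_iff dest: reach_sym)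
    next
      case 2
      then show ?thesis using rwb by (auto simp: doubleton_eq_iff dest: reach_sym)
    qed (rule reach_edge)
  qed
  then show ?thesis using conn_subst[OF H(1)] by blast
qed

end

text \<open>Failure of all exchanges is a certificate for the star. Take s with the most neighbours
  in \<open>S\<close>. It cannot hang on a or b by \<open>center_not_attached\<close>, so it is one
  of them; then it is adjacent to all of \<open>S\<close>, an assumption provided by matching s
  first.\<close>

lemma stuck_star_exc:
  assumes st: "stuck_matching V S H N a b"
    and ns: "\<And>x y. {x, y} \<in> N \<Longrightarrow> x \<notin> {a, b} \<Longrightarrow> y \<notin> {a, b} \<Longrightarrow> \<not> conn V (swap4 (sym_diff H N) a b x y)"
    and s: "s \<in> S" "s \<in> {a, b} \<Longrightarrow> \<forall>v \<in> S - {s}. {s, v} \<in> H"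
    and max: "\<And>v. v \<in> S \<Longrightarrow> card {w \<in> S. {v, w} \<in> H} \<le> card {w \<in> S. {s, w} \<in> H}"
  shows "star_exc H S"
proof -
  interpret p: stuck_matching V S H N a b by (rule st)
  interpret q: stuck_matching V S H N b a by (rule p.swapped)
  have pn: p.no_swap unfolding p.no_swap_def using ns by blast
  have qn: q.no_swap unfolding q.no_swap_def swap4_commute[of _ b a]
    using ns by (metis insert_commute)
  consider "s = a" | "s = b" | "s \<notin> {a, b}" by auto
  then show ?thesis
  proof cases
    case 1
    then show ?thesis using p.center_star[OF pn] s by auto
  next
    case 2
    then show ?thesis using q.center_star[OF qn] s by auto
  next
    case 3
    obtain y where y: "{s, y} \<in> N" using is_pmD(2)[OF p.N s(1)] by auto
    then consider "{a, s} \<in> H" | "{b, s} \<in> H" using p.attached_cases[OF pn y 3] by blast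
    then have False
    proof cases
      case 1
      then show ?thesis using p.center_not_attached[OF pn s(1) 3] max p.ab by blast
    next
      case 2
      then show ?thesis using q.center_not_attached[OF qn s(1)] 3 max p.ab by blast
    qed
    then show ?thesis ..
  qed
qed

text \<open>Here the second pair is an edge uv of \<open>H\<close>. The exchange restores ab and
  deletes uv, but adds av; as u still reaches a without uv, the vertices u and v stay
  connected.\<close>

lemma stuck_cross_edge:
  assumes st: "stuck_matching V S H N a b"
    and uv: "{u, v} \<in> H" "u \<notin> {a, b}" "v \<notin> {a, b}" and av: "{a, v} \<notin> H" and bu: "{b, u} \<notin> H"
    and ua: "reach (H - {{u, v}}) u a"
  shows "conn V (swap4 (sym_diff H N) a b v u)"
proof -
  interpret stuck_matching V S H N a b by (rule st)
  let ?K = "swap4 K a b v u"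
  have uvN: "{u, v} \<notin> N" using NHD[of "{u, v}"] uv by (auto simp: doubleton_eq_iff)
  have avN: "{a, v} \<notin> N" using mate_ends(1) uv by blast
  have keep: "H - {{u, v}} \<subseteq> ?K"
  proof
    fix e assume e: "e \<in> H - {{u, v}}"
    then have "e \<noteq> {a, v}" "e \<noteq> {b, u}" "e \<noteq> {v, u}" using av bu by (auto simp: insert_commute)
    then show "e \<in> ?K" using e K_iff[of e] swap4_other[of e v u a b K] by simp
  qed
  have "{a, v} \<in> ?K" using av avN uv ab by (auto simp: swap4_def tog_iff doubleton_eq_iff)
  then have "reach ?K a v" by (rule reach_edge)
  moreover have "reach ?K u a" using ua keep by (rule reach_mono)
  ultimately have r: "reach ?K u v" by (meson rtrancl_trans)
  have "reach ?K x y" if "{x, y} \<in> H" for x y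
  proof (cases "{x, y} = {u, v}")
    case True
    then show ?thesis using r by (auto simp: doubleton_eq_iff dest: reach_sym)
  next
    case False
    then show ?thesis using keep that by (intro reach_edge) auto
  qed
  then show ?thesis using conn_subst[OF H(1)] by blast
qed

context comp_graph
begin

text \<open>With several components some joining edge uv leaves the component of a and b. Its ends
  differ from a and b, and u is adjacent to at most one of them because ab is a bridge; hence
  \<open>stuck_cross_edge\<close> applies to ab or to ba.\<close>

lemma attach_swap_exists:
  assumes I: "attach_inv H T (\<rho> ` V)" and p: "2 \<le> card (\<rho> ` V)"
    and st: "stuck_matching V T H N a b" and viol: "{a, b} \<notin> H - E"
    and ns: "\<And>x y. {x, y} \<in> sym_diff E (sym_diff H N) \<Longrightarrow> x \<notin> {a, b} \<Longrightarrow> y \<notin> {a, b} \<Longrightarrow>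
      \<not> conn V (swap4 (sym_diff H N) a b x y)"
  shows False
proof -
  interpret p: stuck_matching V T H N a b by (rule st)
  interpret q: stuck_matching V T H N b a by (rule p.swapped)
  note D = attach_invD[OF I]
  have abE: "{a, b} \<in> E" using viol p.ab by auto
  have abV: "a \<in> V" "b \<in> V" using p.ab p.S by auto
  have rab: "\<rho> a = \<rho> b" using is_repD(3)[OF rep abV(1,2)] abE reach_edge by metis
  have "\<exists>u v. {u, v} \<in> H - E \<and> \<rho> u = \<rho> a"
  proof (rule ccontr)
    assume no: "\<not> ?thesis"
    have "\<not> \<rho> ` V \<subseteq> {\<rho> a}" using p card_mono[of "{\<rho> a}" "\<rho> ` V"] by auto
    then obtain z where z: "z \<in> V" "\<rho> z \<noteq> \<rho> a" by auto
    have "reach H a z" using p.H(1) z abV by (simp add: conn_def)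
    moreover have "a \<in> {w \<in> V. \<rho> w = \<rho> a}" using abV by simp
    moreover have "y \<in> {w \<in> V. \<rho> w = \<rho> a}" if x: "x \<in> {w \<in> V. \<rho> w = \<rho> a}" and xy: "{x, y} \<in> H" for x y
    proof -
      have "{x, y} \<in> E" using no x xy by blast
      moreover then have "y \<in> V" using EV by auto
      ultimately show ?thesis using is_repD(3)[OF rep, of x y] x reach_edge[of x y E] by simp
    qed
    ultimately have "z \<in> {w \<in> V. \<rho> w = \<rho> a}" by (rule reach_closed)
    then show False using z by simp
  qed
  then obtain u v where uv: "{u, v} \<in> H - E" "\<rho> u = \<rho> a" by auto
  have ruv: "\<rho> u \<noteq> \<rho> v" using D(5)[OF uv(1)] by simp
  have uvV: "u \<in> V" "v \<in> V" using uv D(4) by auto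
  \<comment> \<open>A wrong end of a joining edge is the only wrong vertex of its component, but a
    and b are two wrong vertices of one component.\<close>
  have no_end: "x \<notin> {a, b}" if xy: "{x, y} \<in> H - E" and x: "\<rho> x = \<rho> a" for x y
  proof
    assume "x \<in> {a, b}"
    then have xT: "x \<in> T" using p.ab by blast
    have "a = x" by (rule D(11)[OF xy xT abV(1)]) (use x p.ab in simp_all)
    moreover have "b = x" by (rule D(11)[OF xy xT abV(2)]) (use x rab p.ab in simp_all)
    ultimately show False using p.ab(3) by simp
  qed
  have uab: "u \<notin> {a, b}" using no_end[OF uv] .
  have vab: "v \<notin> {a, b}" using ruv uv(2) rab by auto
  have cross: "{c, v} \<notin> H" if c: "c \<in> {a, b}" for c
  proof
    assume cv: "{c, v} \<in> H"
    have "{c, v} \<notin> E"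
    proof
      assume "{c, v} \<in> E"
      then have "\<rho> c = \<rho> v" using is_repD(3)[OF rep, of c v] c abV uvV reach_edge[of c v E] by auto
      then show False using c ruv uv(2) rab by auto
    qed
    then have cvH: "{c, v} \<in> H - E" using cv by simp
    show False using no_end[OF cvH] c rab by auto
  qed
  have F: "{u, v} \<in> sym_diff E (sym_diff H N)" "{v, u} \<in> sym_diff E (sym_diff H N)"
    using uv p.NHD[of "{u, v}"] uab by (auto simp: doubleton_eq_iff insert_commute)
  have ru: "reach (H - {{u, v}}) u c" if c: "c \<in> {a, b}" for c
  proof -
    have "reach E u c" using is_repD(3)[OF rep uvV(1), of c] c abV uv(2) rab by auto
    then show ?thesis by (rule reach_mono) (use D(3) uv in auto)
  qed
  show False
  proof (cases "{b, u} \<in> H")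
    case False
    then have "conn V (swap4 (sym_diff H N) a b v u)"
      using stuck_cross_edge[OF st, of u v] uv uab vab cross ru by auto
    then show False using ns[OF F(2) vab uab] by simp
  next
    case True
    then have "{a, u} \<notin> H" using p.no_common by blast
    then have "conn V (swap4 (sym_diff H N) b a v u)"
      using stuck_cross_edge[OF p.swapped, of u v] uv uab vab cross ru by auto
    then show False using ns[OF F(1) uab vab] swap4_commute[of _ b a] by metis
  qed
qed

end

text \<open>Two pairs leave the set and at most two enter it, so an exchange never costs
  anything.\<close>

lemma card_swap4:
  assumes "finite F" "{a, b} \<in> F" "{x, y} \<in> F" "{a, b} \<noteq> {x, y}"
  shows "card (swap4 F a b x y) \<le> card F"
proof -
  have "swap4 F a b x y \<subseteq> insert {a, x} (insert {b, y} (F - {{a, b}, {x, y}}))"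
  proof
    fix e assume e: "e \<in> swap4 F a b x y"
    show "e \<in> insert {a, x} (insert {b, y} (F - {{a, b}, {x, y}}))"
    proof (cases "e = {a, x} \<or> e = {b, y}")
      case False
      then have "((e \<in> F) \<noteq> (e = {a, b})) \<noteq> (e = {x, y})"
        using e by (simp add: swap4_def tog_iff)
      then have "e \<in> F" "e \<noteq> {a, b}" "e \<noteq> {x, y}" using assms(2-4) by metis+
      then show ?thesis by simp
    qed auto
  qed
  then have "card (swap4 F a b x y) \<le> card (insert {a, x} (insert {b, y} (F - {{a, b}, {x, y}})))"
    using assms(1) by (intro card_mono) auto
  also have "\<dots> \<le> Suc (Suc (card (F - {{a, b}, {x, y}})))"
    using assms(1) by (simp add: card_insert_if)
  also have "card (F - {{a, b}, {x, y}}) = card F - 2"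
    using assms by (subst card_Diff_subset) auto
  also have "2 \<le> card F" using card_mono[of F "{{a, b}, {x, y}}"] assms by auto
  then have "Suc (Suc (card F - 2)) = card F" by simp
  finally show ?thesis .
qed

lemma card_tog_le: "finite F \<Longrightarrow> card (tog F x y) \<le> Suc (card F)"
proof -
  assume "finite F"
  then have "card (tog F x y) \<le> card (insert {x, y} F)" by (intro card_mono) (auto simp: tog_def)
  then show ?thesis using \<open>finite F\<close> by (simp add: card_insert_if split: if_splits)
qed

section \<open>The linear-time decision program\<close>

lemma wp_SeqI:
  assumes "wp W P s R" "\<And>t s'. R t s' \<Longrightarrow> wp W P' s' (\<lambda>u. Q (t + u))"
  shows "wp W (P ;; P') s Q"
  unfolding wp_Seq using assms by (rule wp_mono)

text \<open>The machine cannot divide: parities and halves up to n are tabulated in arrays 9 and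
  10.\<close>

definition halving_table :: program where
  "halving_table =
     For 30 (Num 0) (Reg 10)
       (Load 25 9 (Reg 30) ;; Sub 26 (Num 1) (Reg 25) ;; Load 27 10 (Reg 30) ;;
        Add 27 (Reg 27) (Reg 25) ;; Add 28 (Reg 30) (Num 1) ;; Store 9 (Reg 28) (Reg 26) ;; Store 10 (Reg 28) (Reg 27))"

text \<open>A degree is the difference of two consecutive offsets; its parity is looked up in array
  9. Array 11 becomes the characteristic function of the wrong vertices, register 22 their
  number.\<close>

definition mark_odd :: program where
  "mark_odd =
     Assign 22 (Num 0) ;;
     For 30 (Num 0) (Reg 10)
       (Load 25 1 (Reg 30) ;; Add 28 (Reg 30) (Num 1) ;; Load 26 1 (Reg 28) ;; Sub 26 (Reg 26) (Reg 25) ;;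
        Load 25 9 (Reg 26) ;; Load 26 0 (Reg 30) ;;
        Cond (Equal (Reg 25) (Reg 26)) Skip (Store 11 (Reg 30) (Num 1) ;; Add 22 (Reg 22) (Num 1)))"

definition count_odd :: program where
  "count_odd =
     For 30 (Num 0) (Reg 10)
       (Load 25 7 (Reg 30) ;; Load 26 12 (Reg 25) ;; Load 27 11 (Reg 30) ;;
        Add 26 (Reg 26) (Reg 27) ;; Store 12 (Reg 25) (Reg 26))"

definition odd_degree :: program where
  "odd_degree =
     Assign 25 (Num 0) ;; Load 26 1 (Reg 30) ;; Add 27 (Reg 30) (Num 1) ;; Load 27 1 (Reg 27) ;;
     For 31 (Reg 26) (Reg 27) (Load 28 2 (Reg 31) ;; Load 28 11 (Reg 28) ;; Add 25 (Reg 25) (Reg 28))"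

text \<open>Register 23 holds the maximum plus 1, so that the initial 0 is beaten even by a wrong
  vertex without wrong neighbours.\<close>

definition find_center :: program where
  "find_center =
     Assign 23 (Num 0) ;; Assign 24 (Num 0) ;;
     For 30 (Num 0) (Reg 10)
       (odd_degree ;; Load 28 11 (Reg 30) ;;
        Cond (Equal (Reg 28) (Num 1))
          (Add 25 (Reg 25) (Num 1) ;;
           Cond (Less (Reg 23) (Reg 25)) (Assign 23 (Reg 25) ;; Assign 24 (Reg 30)) Skip) Skip)"

definition prep :: program where
  "prep = Assign 10 (Reg 0) ;; halving_table ;; mark_odd ;; Assign 11 (Reg 10) ;; search 1 2 ;;
     count_odd ;; find_center"

lemma wregs_prep_parts [simp]:
  "wregs halving_table = {25, 26, 27, 28, 30}" "wregs mark_odd = {22, 25, 26, 28, 30}"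
  "wregs count_odd = {25, 26, 27, 30}" "wregs odd_degree = {25, 26, 27, 28, 31}"
  "wregs find_center = {23, 24, 25, 26, 27, 28, 30, 31}"
  by (auto simp: halving_table_def mark_odd_def count_odd_def odd_degree_def find_center_def)

lemma warrs_prep_parts [simp]:
  "warrs halving_table = {9, 10}" "warrs mark_odd = {11}" "warrs count_odd = {12}"
  "warrs odd_degree = {}" "warrs find_center = {}"
  by (auto simp: halving_table_def mark_odd_def count_odd_def odd_degree_def find_center_def)

lemma wp_halving_table:
  assumes "regs s 10 = n" "Suc n < W" "arrs s 9 0 = 0" "arrs s 10 0 = 0"
  shows "wp W halving_table s (\<lambda>t s'. t \<le> 9 * n + 2 \<and>
    (\<forall>j\<le>n. arrs s' 9 j = j mod 2 \<and> arrs s' 10 j = j div 2) \<and> frame {25, 26, 27, 28, 30} {9, 10} s s')"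
  unfolding halving_table_def
proof (rule wp_mono[OF wp_For_const[where c = 7 and n = n and
    I = "\<lambda>j s'. \<forall>k\<le>j. arrs s' 9 k = k mod 2 \<and> arrs s' 10 k = k div 2"]], goal_cases)
  case (7 j s')
  define x y where "x = j mod 2" and "y = j div 2"
  have x: "Suc j mod 2 = 1 - x" "Suc j div 2 = y + x" "x < 2" "y \<le> j" "y + x \<le> Suc j"
    unfolding x_def y_def by presburger+
  have e: "arrs s' 9 j = x" "arrs s' 10 j = y" using 7(3) by (auto simp: x_def y_def)
  have "x < W" "1 - x < W" "y < W" "y + x < W" "Suc j < W" using x 7(1) assms(1,2) by auto
  then show ?case using 7(2,3) e x(1,2) by (auto simp: wp_simps le_Suc_eq)
next
  case (8 t s')
  then show ?case using assms(1) by (auto simp: insert_commute frame_def)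
qed (use assms in auto)

context input_graph
begin

definition T0 :: "nat set" where
  "T0 = odd_set G \<delta>"

definition td :: "nat \<Rightarrow> nat" where
  "td v = card {w \<in> T0. {v, w} \<in> E}"

lemma T0_V: "T0 \<subseteq> V"
  by (auto simp: T0_def odd_set_def verts_eq)

lemma finite_T0: "finite T0"
  using T0_V finite_subset by blast

lemma card_T0_le: "card T0 \<le> n"
  using card_mono[OF _ T0_V] by simp

lemma td_less: "td v \<le> n"
proof -
  have "td v \<le> card T0" unfolding td_def using finite_T0 by (intro card_mono) auto
  then show ?thesis using card_T0_le by simp
qed

lemma T0_iff: "v < n \<Longrightarrow> v \<in> T0 \<longleftrightarrow> length (adj ! v) mod 2 \<noteq> \<delta> v"
proof -
  assume v: "v < n"
  have "degree G v = length (adj ! v)" using length_adj[OF v] by (simp add: degree_eq_dg)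
  moreover have "\<delta> v \<in> {0, 1}" using \<delta>01 v verts_eq by auto
  ultimately show ?thesis using v by (auto simp: T0_def odd_set_def verts_eq)
qed

definition inp :: "state \<Rightarrow> bool" where
  "inp s \<longleftrightarrow> regs s 10 = n \<and> arrs s 0 = (\<lambda>v. if v < n then \<delta> v else 0) \<and>
     arrs s 1 = off \<and> arrs s 2 = nb"

definition T_arr :: "nat set \<Rightarrow> state \<Rightarrow> bool" where
  "T_arr T s \<longleftrightarrow> (\<forall>v. arrs s 11 v = (if v \<in> T then 1 else 0))"

lemma off_less:
  assumes "v \<le> n" "2 * m < W"
  shows "off v < W"
  using off_le_n[OF assms(1)] off_n_eq assms(2) by simp

lemma bij_nb:
  assumes "v < n"
  shows "bij_betw nb {off v..<off (Suc v)} {w. {v, w} \<in> E}"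
  unfolding bij_betw_def
proof
  show "inj_on nb {off v..<off (Suc v)}"
  proof (rule inj_onI)
    fix i j assume i: "i \<in> {off v..<off (Suc v)}" and j: "j \<in> {off v..<off (Suc v)}" and eq: "nb i = nb j"
    obtain k l where kl: "i = off v + k" "j = off v + l" "k < length (adj ! v)" "l < length (adj ! v)"
      using i j off_Suc[OF assms] by (auto dest!: le_Suc_ex)
    then have "adj ! v ! k = adj ! v ! l" using eq nb_off[OF assms] by simp
    then show "i = j" using kl adj_set(2)[OF assms] by (simp add: nth_eq_iff_index_eq)
  qed
  show "nb ` {off v..<off (Suc v)} = {w. {v, w} \<in> E}"
    using arc_iff[OF assms] by (auto simp: image_iff) (metis atLeastLessThan_iff)+
qed

lemma wp_mark_odd:
  assumes I: "inp s" and par: "\<forall>j\<le>n. arrs s 9 j = j mod 2" and T: "\<forall>v. arrs s 11 v = 0"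
    and W: "2 * m < W" "Suc n < W"
  shows "wp W mark_odd s (\<lambda>t s'. t \<le> 11 * n + 3 \<and> T_arr T0 s' \<and> regs s' 22 = card T0 \<and>
    frame {22, 25, 26, 28, 30} {11} s s')"
proof -
  have n: "regs s 10 = n" using I by (simp add: inp_def)
  have "wp W mark_odd s (\<lambda>t s'. t \<le> 11 * n + 3 \<and> T_arr T0 s' \<and> regs s' 22 = card T0)"
    unfolding mark_odd_def wp_Seq wp_Assign
  proof (intro conjI, goal_cases)
    case 1
    then show ?case using W by simp
  next
    case 2
    show ?case
    proof (rule wp_mono[OF wp_For_const[where c = 9 and n = n and
        I = "\<lambda>j s'. T_arr (T0 \<inter> {..<j}) s' \<and> regs s' 22 = card (T0 \<inter> {..<j})"]], goal_cases)
      case (7 j s')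
      then have j: "j < n" using n by simp
      have s': "arrs s' 0 = (\<lambda>v. if v < n then \<delta> v else 0)" "arrs s' 1 = off" "arrs s' 9 = arrs s 9"
        using 7(4) I by (auto simp: inp_def frame_def)
      have len: "off (Suc j) - off j = length (adj ! j)" "length (adj ! j) < n"
        using off_Suc[OF j] length_adj_less[OF j] by auto
      have "\<delta> j \<in> {0, 1}" using \<delta>01 j verts_eq by (metis lessThan_iff)
      then have d1: "\<delta> j < W" using W by auto
      have le: "card (T0 \<inter> {..<j}) \<le> j" using card_mono[of "{..<j}" "T0 \<inter> {..<j}"] by simp
      have ins: "T0 \<inter> {..<Suc j} = (if j \<in> T0 then insert j (T0 \<inter> {..<j}) else T0 \<inter> {..<j})"
        by (auto simp: lessThan_Suc)
      have cins: "card (insert j (T0 \<inter> {..<j})) = Suc (card (T0 \<inter> {..<j}))" by simp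
      show ?case
        using 7 j s' len d1 le W par off_less[of j W] off_less[of "Suc j" W] T0_iff[OF j] cins
        by (auto simp: wp_simps ins T_arr_def)
    next
      case (8 t s')
      have "T0 \<inter> {..<n} = T0" using T0_V by auto
      then show ?case using 8 n by simp
    qed (use n W T in \<open>auto simp: T_arr_def\<close>)
  qed
  from wp_frame[OF this] show ?thesis by (rule wp_mono) (auto simp: insert_commute)
qed

lemma wp_count_odd:
  assumes n: "regs s 10 = n" and T: "T_arr T0 s" and lab: "\<forall>v<n. arrs s 7 v \<le> Suc n"
    and z: "\<forall>v. arrs s 12 v = 0" and W: "Suc n < W"
  shows "wp W count_odd s (\<lambda>t s'. t \<le> 7 * n + 2 \<and>
    (\<forall>l. arrs s' 12 l = card {v \<in> V. arrs s 7 v = l \<and> v \<in> T0}) \<and> frame {25, 26, 27, 30} {12} s s')"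
proof -
  define cnt where "cnt j l = card {v. v < j \<and> arrs s 7 v = l \<and> v \<in> T0}" for j l
  have cnt_0: "cnt 0 l = 0" for l by (simp add: cnt_def)
  have cnt_Suc: "cnt (Suc j) l = (if arrs s 7 j = l \<and> j \<in> T0 then Suc (cnt j l) else cnt j l)" for j l
  proof -
    have "{v. v < Suc j \<and> arrs s 7 v = l \<and> v \<in> T0} =
      (if arrs s 7 j = l \<and> j \<in> T0 then insert j {v. v < j \<and> arrs s 7 v = l \<and> v \<in> T0}
       else {v. v < j \<and> arrs s 7 v = l \<and> v \<in> T0})"
      by (auto simp: less_Suc_eq)
    then show ?thesis by (simp add: cnt_def)
  qed
  have cnt_le: "cnt j l \<le> j" for j l
    unfolding cnt_def by (rule order_trans[OF card_mono[of "{..<j}"]]) auto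
  show ?thesis
    unfolding count_odd_def
  proof (rule wp_mono[OF wp_For_const[where c = 5 and n = n and I = "\<lambda>j s'. \<forall>l. arrs s' 12 l = cnt j l"]], goal_cases)
    case (7 j s')
    then have j: "j < n" using n by simp
    have s': "arrs s' 7 = arrs s 7" "arrs s' 11 j = (if j \<in> T0 then 1 else 0)" "arrs s' 12 l = cnt j l" for l
      using 7(3,4) T by (auto simp: frame_def T_arr_def)
    have "arrs s 7 j < W" using lab j W by (meson le_less_trans)
    moreover have "cnt j l < W" "Suc (cnt j l) < W" for l using cnt_le[of j l] j W by linarith+
    ultimately show ?case using 7(2) s' W by (simp add: wp_simps cnt_Suc)
  next
    case (8 t s')
    then show ?case using n by (auto simp: insert_commute cnt_def)
  qed (use n W z cnt_0 in auto)
qed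

lemma wp_odd_degree:
  assumes I: "inp s" and T: "T_arr T0 s" and v: "regs s 30 = v" "v < n" and W: "2 * m < W" "Suc n < W"
  shows "wp W odd_degree s (\<lambda>t s'. t \<le> 5 * length (adj ! v) + 6 \<and> regs s' 25 = td v \<and>
    frame {25, 26, 27, 28, 31} {} s s')"
proof -
  let ?f = "\<lambda>w. if w \<in> T0 then 1 else 0 :: nat"
  let ?s = "set_reg 27 (off (Suc v)) (set_reg 27 (Suc v) (set_reg 26 (off v) (set_reg 25 0 s)))"
  have io: "arrs s 1 = off" "arrs s 2 = nb" using I by (auto simp: inp_def)
  have ow: "off v < W" "off (Suc v) < W" using off_less v W by auto
  have tot: "(\<Sum>k = off v..<off (Suc v). ?f (nb k)) = td v"
  proof -
    have "(\<Sum>k = off v..<off (Suc v). ?f (nb k)) = sum ?f {w. {v, w} \<in> E}"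
      by (rule sum.reindex_bij_betw[OF bij_nb[OF v(2)]])
    also have "\<dots> = card {w \<in> T0. {v, w} \<in> E}"
    proof -
      have "{w. {v, w} \<in> E} = set (adj ! v)" using adj_set(1)[OF v(2)] by simp
      then have "finite {w. {v, w} \<in> E}" by simp
      then have "sum ?f {w. {v, w} \<in> E} = card ({w. {v, w} \<in> E} \<inter> T0)" by (simp add: sum.If_cases)
      also have "{w. {v, w} \<in> E} \<inter> T0 = {w \<in> T0. {v, w} \<in> E}" by auto
      finally show ?thesis .
    qed
    finally show ?thesis by (simp add: td_def)
  qed
  have F: "wp W (For 31 (Reg 26) (Reg 27) (Load 28 2 (Reg 31) ;; Load 28 11 (Reg 28) ;; Add 25 (Reg 25) (Reg 28))) ?s
    (\<lambda>t s'. t \<le> (\<Sum>j = val ?s (Reg 26)..<val ?s (Reg 27). 3 + 2) + 2 \<and>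
      regs s' 25 = (\<Sum>k = off v..<val ?s (Reg 27). ?f (nb k)) \<and> regs s' 31 = val ?s (Reg 27) \<and>
      frame (insert 31 (wregs (Load 28 2 (Reg 31) ;; Load 28 11 (Reg 28) ;; Add 25 (Reg 25) (Reg 28))))
        (warrs (Load 28 2 (Reg 31) ;; Load 28 11 (Reg 28) ;; Add 25 (Reg 25) (Reg 28))) ?s s')"
  proof (rule wp_For[where c = "\<lambda>_. 3" and I = "\<lambda>j s'. regs s' 25 = (\<Sum>k = off v..<j. ?f (nb k))"], goal_cases)
    case (6 j s')
    then have j: "off v \<le> j" "j < off (Suc v)" by auto
    have "nb j < n" using nb_less_n off_le_n[of "Suc v"] v j by simp
    then have nw: "nb j < W" using W by simp
    have arr: "arrs s' 2 = nb" "arrs s' 11 = arrs s 11" using 6(5) io by (auto simp: frame_def)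
    have "(\<Sum>k = off v..<j. ?f (nb k)) + ?f (nb j) = (\<Sum>k = off v..<Suc j. ?f (nb k))" using j by simp
    also have "\<dots> \<le> td v" unfolding tot[symmetric] using j by (intro sum_mono2) auto
    also have "\<dots> < W" using td_less W by (meson le_less_trans Suc_lessD)
    finally have "(\<Sum>k = off v..<j. ?f (nb k)) + ?f (nb j) < W" .
    then show ?case using 6(3,4) j nw arr T W by (auto simp: wp_simps T_arr_def split: if_splits)
  qed (use ow off_Suc[OF v(2)] in auto)
  have "wp W odd_degree s (\<lambda>t s'. t \<le> 5 * length (adj ! v) + 6 \<and> regs s' 25 = td v)"
  proof -
    have len: "off (Suc v) - off v = length (adj ! v)" using off_Suc[OF v(2)] by simp
    have "wp W (For 31 (Reg 26) (Reg 27) (Load 28 2 (Reg 31) ;; Load 28 11 (Reg 28) ;; Add 25 (Reg 25) (Reg 28))) ?s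
      (\<lambda>t s'. 4 + t \<le> 5 * length (adj ! v) + 6 \<and> regs s' 25 = td v)"
      by (rule wp_mono[OF F]) (use len tot in simp)
    then show ?thesis
      unfolding odd_degree_def wp_Seq[of W "Assign a b" for a b] wp_Seq[of W "Load a b c" for a b c]
        wp_Seq[of W "Add a b c" for a b c] wp_Assign wp_Load wp_Add
      using io v ow W by simp
  qed
  from wp_frame[OF this] show ?thesis by (rule wp_mono) (auto simp: insert_commute)
qed

definition center_ok :: "nat \<Rightarrow> state \<Rightarrow> bool" where
  "center_ok j s \<longleftrightarrow> (if T0 \<inter> {..<j} = {} then regs s 23 = 0 else
     regs s 24 \<in> T0 \<and> regs s 23 = Suc (td (regs s 24)) \<and> (\<forall>v \<in> T0 \<inter> {..<j}. td v \<le> td (regs s 24)))"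

lemma wp_find_center:
  assumes I: "inp s" and T: "T_arr T0 s" and W: "2 * m < W" "Suc (Suc n) < W"
  shows "wp W find_center s (\<lambda>t s'. t \<le> 10 * m + 15 * n + 4 \<and> center_ok n s' \<and>
    frame {23, 24, 25, 26, 27, 28, 30, 31} {} s s')"
proof -
  let ?body = "odd_degree ;; Load 28 11 (Reg 30) ;;
        Cond (Equal (Reg 28) (Num 1))
          (Add 25 (Reg 25) (Num 1) ;;
           Cond (Less (Reg 23) (Reg 25)) (Assign 23 (Reg 25) ;; Assign 24 (Reg 30)) Skip) Skip"
  let ?s = "set_reg 24 0 (set_reg 23 0 s)"
  have n: "regs s 10 = n" using I by (simp add: inp_def)
  have F: "wp W (For 30 (Num 0) (Reg 10) ?body) ?s
    (\<lambda>t s'. t \<le> (\<Sum>j = val ?s (Num 0)..<val ?s (Reg 10). (5 * length (adj ! j) + 12) + 2) + 2 \<and>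
      center_ok (val ?s (Reg 10)) s' \<and> regs s' 30 = val ?s (Reg 10) \<and>
      frame (insert 30 (wregs ?body)) (warrs ?body) ?s s')"
  proof (rule wp_For[where c = "\<lambda>j. 5 * length (adj ! j) + 12" and I = center_ok], goal_cases)
    case (6 j s')
    then have j: "j < n" using n by simp
    have Is: "inp s'" "T_arr T0 s'" using 6(5) I T by (auto simp: frame_def inp_def T_arr_def)
    have W': "Suc n < W" using W by simp
    show ?case
    proof (rule wp_SeqI[OF wp_odd_degree[OF Is 6(3) j W(1) W']], goal_cases)
      case (1 t s2)
      then have s2: "t \<le> 5 * length (adj ! j) + 6" "regs s2 25 = td j" "regs s2 23 = regs s' 23"
        "regs s2 24 = regs s' 24" "regs s2 30 = j" "arrs s2 11 = arrs s' 11"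
        using 6(3) by (auto simp: frame_def)
      have "td j < W" "Suc (td j) < W" using td_less[of j] W by auto
      have ins: "T0 \<inter> {..<Suc j} = (if j \<in> T0 then insert j (T0 \<inter> {..<j}) else T0 \<inter> {..<j})"
        by (auto simp: lessThan_Suc)
      have aj: "arrs s' 11 j = (if j \<in> T0 then 1 else 0)" using Is by (simp add: T_arr_def)
      show ?case
      proof (cases "j \<in> T0")
        case False
        then show ?thesis using s2 aj 6(4) W by (simp add: wp_simps center_ok_def ins)
      next
        case True
        then have ins: "T0 \<inter> {..<Suc j} = insert j (T0 \<inter> {..<j})" using ins by simp
        show ?thesis
        proof (cases "regs s' 23 < Suc (td j)")
          case less: True
          have "td v \<le> td j" if "v \<in> T0 \<inter> {..<j}" for v
          proof -
            have "T0 \<inter> {..<j} \<noteq> {}" using that by blast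
            then have c: "regs s' 23 = Suc (td (regs s' 24))" "\<forall>v \<in> T0 \<inter> {..<j}. td v \<le> td (regs s' 24)"
              using 6(4) by (simp_all add: center_ok_def)
            have "td v \<le> td (regs s' 24)" using c(2) that by (rule bspec)
            then show ?thesis using c(1) less by linarith
          qed
          then show ?thesis using s2 aj True less \<open>Suc (td j) < W\<close> j W
            by (simp add: wp_simps center_ok_def ins)
        next
          case ge: False
          then have ne: "T0 \<inter> {..<j} \<noteq> {}" using 6(4) by (auto simp: center_ok_def)
          then have c: "regs s' 24 \<in> T0" "regs s' 23 = Suc (td (regs s' 24))"
            "\<forall>v \<in> T0 \<inter> {..<j}. td v \<le> td (regs s' 24)" using 6(4) by (auto simp: center_ok_def)
          then show ?thesis using s2 aj True ge \<open>Suc (td j) < W\<close> j W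
            by (simp add: wp_simps center_ok_def ins)
        qed
      qed
    qed
  qed (use n W in \<open>auto simp: center_ok_def\<close>)
  \<comment> \<open>The cost of a round is linear in the degree of its vertex, so the whole loop
    stays linear by the handshake lemma.\<close>
  have "(\<Sum>j = 0..<n. 5 * length (adj ! j) + 14) = 5 * (\<Sum>j<n. dg E j) + 14 * n"
    by (simp add: sum.distrib sum_distrib_left length_adj lessThan_atLeast0)
  also have "(\<Sum>j<n. dg E j) = 2 * m" using handshake[of V E] E_pairs by simp
  finally have cost: "(\<Sum>j = 0..<n. (5 * length (adj ! j) + 12) + 2) = 10 * m + 14 * n"
    by (simp add: add.commute)
  have "wp W find_center s (\<lambda>t s'. t \<le> 10 * m + 15 * n + 4 \<and> center_ok n s')"
    unfolding find_center_def wp_Seq[of W "Assign 23 (Num 0)"] wp_Seq[of W "Assign 24 (Num 0)"] wp_Assign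
  proof (intro conjI, goal_cases)
    case 3
    show ?case unfolding val.simps by (rule wp_mono[OF F]) (use n cost in simp)
  qed (use W in auto)
  from wp_frame[OF this] show ?thesis by (rule wp_mono) (auto simp: insert_commute)
qed

definition prepared :: "state \<Rightarrow> bool" where
  "prepared s \<longleftrightarrow> inp s \<and> T_arr T0 s \<and> regs s 22 = card T0 \<and>
     (\<forall>j\<le>n. arrs s 9 j = j mod 2 \<and> arrs s 10 j = j div 2) \<and>
     is_rep V E (\<lambda>v. arrs s 7 v - 1) \<and> (\<forall>v<n. 0 < arrs s 7 v \<and> arrs s 7 v \<le> n) \<and>
     (\<forall>l. arrs s 12 l = card {v \<in> V. arrs s 7 v = l \<and> v \<in> T0}) \<and> center_ok n s"

lemma wp_prep:
  assumes s: "regs s 0 = n" "arrs s 0 = (\<lambda>v. if v < n then \<delta> v else 0)" "arrs s 1 = off" "arrs s 2 = nb"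
    "\<And>a v. a \<in> {9, 10, 11, 12} \<Longrightarrow> arrs s a v = 0"
    and W: "2 * m < W" "Suc (Suc n) < W"
  shows "wp W prep s (\<lambda>t s'. t \<le> 32 * m + 70 * n + 60 \<and> prepared s' \<and>
    frame {10, 11, 12, 13, 14, 15, 16, 17, 18, 19, 20, 22, 23, 24, 25, 26, 27, 28, 30, 31} {7, 8, 9, 10, 11, 12} s s')"
proof -
  have W': "Suc n < W" "off n < W" using W off_n_eq by auto
  have "wp W prep s (\<lambda>t s'. t \<le> 32 * m + 70 * n + 60 \<and> prepared s')"
    unfolding prep_def wp_Seq[of W "Assign 10 (Reg 0)"] wp_Assign
  proof (intro conjI wp_SeqI[OF wp_halving_table[where n = n]], goal_cases)
    case (6 t1 s1)
    then have s1: "inp s1" "\<forall>j\<le>n. arrs s1 9 j = j mod 2" "\<forall>j\<le>n. arrs s1 10 j = j div 2" "\<forall>v. arrs s1 11 v = 0"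
      "\<forall>v. arrs s1 12 v = 0" "t1 \<le> 9 * n + 2"
      using s by (auto simp: inp_def frame_def)
    show ?case
    proof (rule wp_SeqI[OF wp_mark_odd[OF s1(1,2,4) W(1) W'(1)]], goal_cases)
      case (1 t2 s2)
      then have s2: "inp s2" "\<forall>j\<le>n. arrs s2 9 j = j mod 2" "\<forall>j\<le>n. arrs s2 10 j = j div 2"
        "\<forall>v. arrs s2 12 v = 0" "t2 \<le> 11 * n + 3" "T_arr T0 s2" "regs s2 22 = card T0"
        using s1 by (auto simp: inp_def frame_def)
      show ?case unfolding wp_Seq[of W "Assign 11 (Reg 10)"] wp_Assign
      proof (intro conjI wp_SeqI[OF input.wp_search[where X = n]], goal_cases)
        case (10 t3 s3)
        then have L: "input.labelling n (arrs s3 7)" and fr: "frame {12, 13, 14, 15, 16, 17, 18, 19, 20} {7, 8}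
          (set_reg 11 (val s2 (Reg 10)) s2) s3" and t3: "t3 \<le> 11 * off n + 25 * n + 30" by auto
        have s3: "inp s3" "\<forall>j\<le>n. arrs s3 9 j = j mod 2" "\<forall>j\<le>n. arrs s3 10 j = j div 2"
          "\<forall>v. arrs s3 12 v = 0" "T_arr T0 s3" "regs s3 22 = card T0"
          using fr s2 by (auto simp: inp_def frame_def T_arr_def)
        have n3: "regs s3 10 = n" using s3 by (simp add: inp_def)
        have lab: "0 < arrs s3 7 v \<and> arrs s3 7 v \<le> n" if v: "v < n" for v
        proof -
          have "\<exists>r<n. r \<noteq> n \<and> arrs s3 7 v = Suc r \<and> arrs s3 7 r = Suc r \<and> (r, v) \<in> (input.arcs n)\<^sup>*"
            using L v unfolding input.labelling_def by (elim conjE) simp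
          then show ?thesis by auto
        qed
        then have lab': "\<forall>v<n. arrs s3 7 v \<le> Suc n" by (auto intro: le_SucI)
        show ?case
        proof (rule wp_SeqI[OF wp_count_odd[OF n3 s3(5) lab' s3(4) W'(1)]], goal_cases)
          case (1 t4 s4)
          then have s4: "inp s4" "\<forall>j\<le>n. arrs s4 9 j = j mod 2" "\<forall>j\<le>n. arrs s4 10 j = j div 2"
            "T_arr T0 s4" "regs s4 22 = card T0" "arrs s4 7 = arrs s3 7"
            "\<forall>l. arrs s4 12 l = card {v \<in> V. arrs s4 7 v = l \<and> v \<in> T0}" "t4 \<le> 7 * n + 2"
            using s3 by (auto simp: inp_def frame_def T_arr_def)
          show ?case
          proof (rule wp_mono[OF wp_find_center[OF s4(1,4) W]], goal_cases)
            case (1 t5 s5)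
            then have fr5: "frame {23, 24, 25, 26, 27, 28, 30, 31} {} s4 s5" and t5: "t5 \<le> 10 * m + 15 * n + 4"
              and c: "center_ok n s5" by auto
            have "prepared s5"
              unfolding prepared_def using s4 fr5 c input_rep[OF L] lab
              by (auto simp: inp_def frame_def T_arr_def)
            moreover have "t1 + (t2 + (1 + (t3 + (t4 + t5)))) \<le> 32 * m + 68 * n + 50"
              using t3 t5 s1 s2 s4 off_n_eq by simp
            ultimately show ?case by simp
          qed
        qed
      qed (use s2 W' in \<open>auto simp: inp_def\<close>)
    qed
  qed (use s W' in auto)
  from wp_frame[OF this] show ?thesis by (rule wp_mono) (auto simp: prep_def frame_def)
qed

end

section \<open>Recognising the exceptional star\<close>

lemma bridge_iff_unique:
  assumes "{s, x} \<in> E" "s \<noteq> x"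
  shows "bridge E s x \<longleftrightarrow> (\<forall>z. {s, z} \<in> E \<longrightarrow> z \<noteq> s \<longrightarrow> reach {e \<in> E. s \<notin> e} z x \<longrightarrow> z = x)"
proof
  assume br: "bridge E s x"
  show "\<forall>z. {s, z} \<in> E \<longrightarrow> z \<noteq> s \<longrightarrow> reach {e \<in> E. s \<notin> e} z x \<longrightarrow> z = x"
  proof (intro allI impI, rule ccontr)
    fix z assume z: "{s, z} \<in> E" "z \<noteq> s" "reach {e \<in> E. s \<notin> e} z x" "z \<noteq> x"
    have "reach (E - {{s, x}}) z x" using z(3) by (rule reach_mono) auto
    moreover have "reach (E - {{s, x}}) s z" using z by (intro reach_edge) (auto simp: doubleton_eq_iff)
    ultimately have "reach (E - {{s, x}}) s x" by (meson rtrancl_trans)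
    then show False using br by (simp add: bridge_def)
  qed
next
  assume A: "\<forall>z. {s, z} \<in> E \<longrightarrow> z \<noteq> s \<longrightarrow> reach {e \<in> E. s \<notin> e} z x \<longrightarrow> z = x"
  show "bridge E s x"
  proof (rule ccontr)
    assume "\<not> bridge E s x"
    then have r: "reach (E - {{s, x}}) s x" using assms by (simp add: bridge_def)
    \<comment> \<open>The induction remembers the neighbour z through which the walk last left s;
      from z on it avoids s.\<close>
    have "y = s \<or> (\<exists>z. {s, z} \<in> E' \<and> z \<noteq> s \<and> reach {e \<in> E. s \<notin> e} z y)"
      if "reach E' s y" "E' \<subseteq> E" for y E'
      using that
    proof (induction rule: rtrancl_induct)
      case (step y w)
      have yw: "{y, w} \<in> E'" using step.hyps by simp
      show ?case
      proof (cases "w = s")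
        case ws: False
        show ?thesis
        proof (cases "y = s")
          case True
          then show ?thesis using yw ws by (intro disjI2 exI[of _ w]) auto
        next
          case False
          then obtain z where z: "{s, z} \<in> E'" "z \<noteq> s" "reach {e \<in> E. s \<notin> e} z y" using step.IH step.prems by auto
          have "{y, w} \<in> {e \<in> E. s \<notin> e}" using yw False ws step.prems by auto
          then have "reach {e \<in> E. s \<notin> e} z w" by (rule reach_step[OF z(3)])
          then show ?thesis using z by blast
        qed
      qed simp
    qed simp
    from this[OF r] obtain z where "{s, z} \<in> E - {{s, x}}" "z \<noteq> s" "reach {e \<in> E. s \<notin> e} z x" using assms by auto
    then show False using A by auto
  qed
qed

text \<open>A centre c is adjacent to all other vertices of \<open>T\<close>, so by maximality s is
  as well. If s differs from c, a third vertex of \<open>T\<close> would form a triangle with the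
  bridge cs, so only the pair cs itself is left.\<close>

lemma star_exc_center:
  assumes E: "E \<subseteq> pairs V" and fin: "finite T" and s: "s \<in> T"
    and max: "\<And>v. v \<in> T \<Longrightarrow> card {w \<in> T. {v, w} \<in> E} \<le> card {w \<in> T. {s, w} \<in> E}"
  shows "star_exc E T \<longleftrightarrow> (\<forall>x \<in> T - {s}. bridge E s x)"
proof
  assume "star_exc E T"
  then obtain c where c: "c \<in> T" "\<And>x. x \<in> T - {c} \<Longrightarrow> bridge E c x" by (auto simp: star_exc_def)
  have no_loop: "{v} \<notin> E" for v using subsetD[OF E, of "{v}"] by auto
  show "\<forall>x \<in> T - {s}. bridge E s x"
  proof (cases "s = c")
    case True
    then show ?thesis using c by blast
  next
    case False
    have "{c, w} \<in> E \<longleftrightarrow> w \<noteq> c" if "w \<in> T" for w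
      using c(2)[of w] that no_loop[of c] by (cases "w = c") (simp_all add: bridge_def)
    then have "{w \<in> T. {c, w} \<in> E} = T - {c}" by blast
    then have "card (T - {c}) \<le> card {w \<in> T. {s, w} \<in> E}" using max[OF c(1)] by simp
    moreover have "card (T - {c}) = card (T - {s})" using c s by simp
    moreover have "{w \<in> T. {s, w} \<in> E} \<subseteq> T - {s}" using no_loop[of s] by auto
    ultimately have eq: "{w \<in> T. {s, w} \<in> E} = T - {s}" using fin by (metis card_seteq finite_Diff)
    show ?thesis
    proof
      fix x assume x: "x \<in> T - {s}"
      have cs: "bridge E c s" using c(2)[of s] s False by simp
      show "bridge E s x"
      proof (cases "x = c")
        case True
        then show ?thesis using cs by (simp add: bridge_commute)
      next
        case xc: False
        have "{s, x} \<in> E" using x eq by blast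
        moreover have "{c, x} \<in> E" using c(2)[of x] x xc by (simp add: bridge_def)
        ultimately show ?thesis using bridge_no_common[OF cs, of x] x xc by auto
      qed
    qed
  qed
qed (use s in \<open>auto simp: star_exc_def\<close>)

lemma card_rep_indep:
  assumes "is_rep V E \<rho>" "is_rep V E \<sigma>" "finite V"
  shows "card (\<rho> ` V) = card (\<sigma> ` V)" "card (tfree V \<rho> T) = card (tfree V \<sigma> T)"
proof -
  show "card (\<rho> ` V) = card (\<sigma> ` V)" using card_comps_rep[of V E] assms by metis
  have le: "card (tfree V \<rho> T) \<le> card (tfree V \<sigma> T)" if r: "is_rep V E \<rho>" "is_rep V E \<sigma>" for \<rho> \<sigma>
  proof (rule card_inj_on_le)
    have mem: "r \<in> V \<and> \<rho> r = r" if "r \<in> tfree V \<rho> T" for r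
      using that is_repD(1,2)[OF r(1)] by (auto simp: tfree_def)
    show "inj_on \<sigma> (tfree V \<rho> T)"
    proof (rule inj_onI)
      fix a b assume ab: "a \<in> tfree V \<rho> T" "b \<in> tfree V \<rho> T" "\<sigma> a = \<sigma> b"
      then have "reach E a b" using is_repD(3)[OF r(2)] mem by metis
      then show "a = b" using is_repD(3)[OF r(1)] mem ab by metis
    qed
    show "\<sigma> ` tfree V \<rho> T \<subseteq> tfree V \<sigma> T"
    proof
      fix q assume "q \<in> \<sigma> ` tfree V \<rho> T"
      then obtain a where a: "a \<in> tfree V \<rho> T" "q = \<sigma> a" by auto
      have nt: "v \<notin> T" if v: "v \<in> V" "\<sigma> v = \<sigma> a" for v
      proof -
        have "\<rho> v = a" using is_repD(3)[OF r(1)] is_repD(3)[OF r(2)] mem[OF a(1)] v by metis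
        then show ?thesis using a(1) v(1) unfolding tfree_def by blast
      qed
      have "\<sigma> a \<in> \<sigma> ` V" using mem[OF a(1)] by blast
      then show "q \<in> tfree V \<sigma> T" unfolding tfree_def a(2) using nt by blast
    qed
    show "finite (tfree V \<sigma> T)" using assms(3) by (simp add: tfree_def)
  qed
  show "card (tfree V \<rho> T) = card (tfree V \<sigma> T)" using le assms by (metis le_antisym)
qed

text \<open>Each program works with the representatives it computes, and the existence of a feasible
  set is taken from a run of \<open>optimize\<close>; the bound computed by \<open>decide\<close>
  has to be the same number.\<close>

lemma opt_bound_indep:
  assumes "is_rep V E \<rho>" "is_rep V E \<sigma>" "finite V"
  shows "opt_bound V E \<rho> T = opt_bound V E \<sigma> T"
  using card_rep_indep[OF assms] by (simp add: opt_bound_def)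

lemma card_1_iff_unique: "x \<in> S \<Longrightarrow> card S = 1 \<longleftrightarrow> (\<forall>z \<in> S. z = x)"
proof
  assume "x \<in> S" "card S = 1"
  then obtain y where "S = {y}" using card_1_singletonE by blast
  then show "\<forall>z \<in> S. z = x" using \<open>x \<in> S\<close> by simp
next
  assume "x \<in> S" "\<forall>z \<in> S. z = x"
  then have "S = {x}" by blast
  then show "card S = 1" by simp
qed

definition count_comps :: program where
  "count_comps =
     Assign 32 (Num 0) ;; Assign 33 (Num 0) ;;
     For 30 (Num 0) (Reg 10)
       (Load 25 7 (Reg 30) ;; Add 26 (Reg 30) (Num 1) ;;
        Cond (Equal (Reg 25) (Reg 26))
          (Add 32 (Reg 32) (Num 1) ;; Load 27 12 (Reg 26) ;;
           Cond (Equal (Reg 27) (Num 0)) (Add 33 (Reg 33) (Num 1)) Skip) Skip)"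

text \<open>Run after a search that skips the centre. Array 13 then counts the neighbours of the
  centre in each remaining component, and by \<open>bridge_iff_unique\<close> the edge to a
  neighbour is a bridge exactly if its component has count 1.\<close>

definition count_neighbours :: program where
  "count_neighbours =
     Load 26 1 (Reg 24) ;; Add 27 (Reg 24) (Num 1) ;; Load 27 1 (Reg 27) ;;
     For 31 (Reg 26) (Reg 27)
       (Load 28 2 (Reg 31) ;; Load 28 7 (Reg 28) ;; Load 29 13 (Reg 28) ;;
        Add 29 (Reg 29) (Num 1) ;; Store 13 (Reg 28) (Reg 29))"

definition check_bridges :: program where
  "check_bridges =
     Assign 34 (Num 1) ;;
     For 30 (Num 0) (Reg 10)
       (Cond (Equal (Reg 30) (Reg 24)) Skip
          (Load 25 11 (Reg 30) ;;
           Cond (Equal (Reg 25) (Num 1))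
             (Load 25 7 (Reg 30) ;; Load 26 13 (Reg 25) ;;
              Cond (Equal (Reg 26) (Num 1)) Skip (Assign 34 (Num 0))) Skip))"

text \<open>Register 23 exceeds the number of wrong neighbours of the candidate by 1, so the third
  test asks whether the candidate is adjacent to all other wrong vertices. Only then is the second
  search worthwhile.\<close>

definition star_test :: program where
  "star_test =
     Assign 34 (Num 0) ;;
     Cond (Less (Reg 32) (Num 2))
       (Cond (Less (Num 0) (Reg 22))
          (Cond (Equal (Reg 23) (Reg 22))
             (Assign 11 (Reg 24) ;; search 1 2 ;; count_neighbours ;; check_bridges) Skip) Skip) Skip"

definition compute_bound :: program where
  "compute_bound =
     Load 25 10 (Reg 22) ;;
     Cond (Less (Reg 32) (Num 2)) (Add 26 (Reg 25) (Reg 34))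
       (Sub 26 (Reg 32) (Num 1) ;; Add 27 (Reg 25) (Reg 33) ;;
        Cond (Less (Reg 26) (Reg 27)) (Assign 26 (Reg 27)) Skip ;;
        Cond (Equal (Reg 22) (Num 0)) (Cond (Less (Reg 26) (Num 3)) (Assign 26 (Num 3)) Skip) Skip)"

text \<open>With fewer than three vertices there is at most one pair to toggle, so a bound above 1
  excludes every solution, whatever the budget.\<close>

definition compare_budget :: program where
  "compare_budget =
     Cond (Less (Reg 1) (Reg 26)) (Assign 0 (Num 0))
       (Cond (Less (Reg 10) (Num 3))
          (Cond (Less (Num 1) (Reg 26)) (Assign 0 (Num 0)) (Assign 0 (Num 1))) (Assign 0 (Num 1)))"

definition verdict :: program where
  "verdict =
     Load 25 9 (Reg 22) ;;
     Cond (Equal (Reg 25) (Num 1)) (Assign 0 (Num 0)) (compute_bound ;; compare_budget)"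

lemma wp_compute_bound:
  assumes s: "regs s 32 = p" "regs s 33 = q" "regs s 22 = x" "regs s 34 = e" "arrs s 10 x = h"
    and W: "p + q + h + e + 4 < W"
  shows "wp W compute_bound s (\<lambda>t s'. t \<le> 9 \<and> regs s' 1 = regs s 1 \<and> regs s' 10 = regs s 10 \<and>
    regs s' 26 = (if p < 2 then h + e else max (max (p - 1) (h + q)) (if x = 0 then 3 else 0)))"
proof (cases "p < 2")
  case True
  then show ?thesis using s W by (simp add: compute_bound_def wp_simps)
next
  case False
  show ?thesis
  proof (cases "p - 1 < h + q")
    case True
    then show ?thesis using s W False by (cases "h + q < 3") (auto simp: compute_bound_def wp_simps max_def)
  next
    case ge: False
    then show ?thesis using s W False by (cases "p - 1 < 3") (auto simp: compute_bound_def wp_simps max_def)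
  qed
qed

lemma wp_compare_budget:
  assumes "2 < W"
  shows "wp W compare_budget s (\<lambda>t s'. t \<le> 4 \<and>
    regs s' 0 = (if regs s 26 \<le> regs s 1 \<and> \<not> (regs s 10 < 3 \<and> 1 < regs s 26) then 1 else 0))"
  using assms by (simp add: compare_budget_def wp_simps)

definition decide :: program where
  "decide = prep ;; count_comps ;; star_test ;; verdict"

lemma wregs_decide_parts [simp]:
  "wregs count_comps = {25, 26, 27, 30, 32, 33}" "wregs count_neighbours = {26, 27, 28, 29, 31}"
  "wregs check_bridges = {25, 26, 30, 34}"
  "wregs star_test = {11, 12, 13, 14, 15, 16, 17, 18, 19, 20, 25, 26, 27, 28, 29, 30, 31, 34}"
  by (auto simp: count_comps_def count_neighbours_def check_bridges_def star_test_def)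

lemma warrs_decide_parts [simp]:
  "warrs count_comps = {}" "warrs count_neighbours = {13}" "warrs check_bridges = {}"
  "warrs star_test = {7, 8, 13}"
  by (auto simp: count_comps_def count_neighbours_def check_bridges_def star_test_def)

context input_graph
begin

abbreviation rho :: "state \<Rightarrow> nat \<Rightarrow> nat" where
  "rho s \<equiv> \<lambda>v. arrs s 7 v - 1"

lemma prepared_reps:
  assumes P: "prepared s"
  shows "rho s ` V = {r. r < n \<and> arrs s 7 r = Suc r}"
    and "tfree V (rho s) T0 = {r. r < n \<and> arrs s 7 r = Suc r \<and> arrs s 12 (Suc r) = 0}"
proof -
  have rep: "is_rep V E (rho s)" and lab: "\<forall>v<n. 0 < arrs s 7 v \<and> arrs s 7 v \<le> n"
    and tc: "\<And>l. arrs s 12 l = card {v \<in> V. arrs s 7 v = l \<and> v \<in> T0}" using P by (auto simp: prepared_def)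
  show 1: "rho s ` V = {r. r < n \<and> arrs s 7 r = Suc r}"
  proof (intro equalityI subsetI)
    fix r assume "r \<in> rho s ` V"
    then obtain v where "v \<in> V" "r = rho s v" by auto
    then have r: "r \<in> V" "rho s r = r" using is_repD(1,2)[OF rep] by auto
    then have "0 < arrs s 7 r" using lab by auto
    then show "r \<in> {r. r < n \<and> arrs s 7 r = Suc r}" using r by auto
  next
    fix r assume "r \<in> {r. r < n \<and> arrs s 7 r = Suc r}"
    then show "r \<in> rho s ` V" by (intro image_eqI[of _ _ r]) auto
  qed
  have "arrs s 12 (Suc r) = 0 \<longleftrightarrow> (\<forall>v\<in>V. rho s v = r \<longrightarrow> v \<notin> T0)" for r
  proof -
    have "arrs s 7 v = Suc r \<longleftrightarrow> rho s v = r" if "v < n" for v using lab that by auto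
    then have "{v \<in> V. arrs s 7 v = Suc r \<and> v \<in> T0} = {v \<in> V. rho s v = r \<and> v \<in> T0}" by auto
    then show ?thesis using tc by auto
  qed
  then show "tfree V (rho s) T0 = {r. r < n \<and> arrs s 7 r = Suc r \<and> arrs s 12 (Suc r) = 0}"
    unfolding tfree_def 1 by auto
qed

lemma wp_count_comps:
  assumes P: "prepared s" and W: "Suc (Suc n) < W"
  shows "wp W count_comps s (\<lambda>t s'. t \<le> 10 * n + 4 \<and> regs s' 32 = card (rho s ` V) \<and>
    regs s' 33 = card (tfree V (rho s) T0) \<and> frame {25, 26, 27, 30, 32, 33} {} s s')"
proof -
  have n: "regs s 10 = n" using P by (simp add: prepared_def inp_def)
  define p where "p j = card {r. r < j \<and> arrs s 7 r = Suc r}" for j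
  define q where "q j = card {r. r < j \<and> arrs s 7 r = Suc r \<and> arrs s 12 (Suc r) = 0}" for j
  have p: "p 0 = 0" "p (Suc j) = (if arrs s 7 j = Suc j then Suc (p j) else p j)" for j
  proof -
    have "{r. r < Suc j \<and> arrs s 7 r = Suc r} =
      (if arrs s 7 j = Suc j then insert j {r. r < j \<and> arrs s 7 r = Suc r} else {r. r < j \<and> arrs s 7 r = Suc r})"
      by (auto simp: less_Suc_eq)
    then show "p 0 = 0" "p (Suc j) = (if arrs s 7 j = Suc j then Suc (p j) else p j)" by (simp_all add: p_def)
  qed
  have q: "q 0 = 0" "q (Suc j) = (if arrs s 7 j = Suc j \<and> arrs s 12 (Suc j) = 0 then Suc (q j) else q j)" for j
  proof -
    have "{r. r < Suc j \<and> arrs s 7 r = Suc r \<and> arrs s 12 (Suc r) = 0} =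
      (if arrs s 7 j = Suc j \<and> arrs s 12 (Suc j) = 0
       then insert j {r. r < j \<and> arrs s 7 r = Suc r \<and> arrs s 12 (Suc r) = 0}
       else {r. r < j \<and> arrs s 7 r = Suc r \<and> arrs s 12 (Suc r) = 0})"
      by (auto simp: less_Suc_eq)
    then show "q 0 = 0" "q (Suc j) = (if arrs s 7 j = Suc j \<and> arrs s 12 (Suc j) = 0 then Suc (q j) else q j)"
      by (simp_all add: q_def)
  qed
  have le: "p j \<le> j" "q j \<le> j" for j by (induction j) (auto simp: p q)
  have tcW: "arrs s 12 l < W" for l
  proof -
    have "arrs s 12 l = card {v \<in> V. arrs s 7 v = l \<and> v \<in> T0}" using P by (simp add: prepared_def)
    also have "\<dots> \<le> card V" by (intro card_mono) auto
    finally show ?thesis using W by simp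
  qed
  have lab: "arrs s 7 v < W" if "v < n" for v using P W that by (auto simp: prepared_def)
  have "wp W count_comps s (\<lambda>t s'. t \<le> 10 * n + 4 \<and> regs s' 32 = p n \<and> regs s' 33 = q n)"
    unfolding count_comps_def wp_Seq[of W "Assign a b" for a b] wp_Assign
  proof (intro conjI, goal_cases)
    case 3
    show ?case
    proof (rule wp_mono[OF wp_For_const[where c = 8 and n = n and
        I = "\<lambda>j s'. regs s' 32 = p j \<and> regs s' 33 = q j"]], goal_cases)
      case (7 j s')
      then have j: "j < n" using n by simp
      have s': "arrs s' 7 = arrs s 7" "arrs s' 12 = arrs s 12" using 7(4) by (auto simp: frame_def)
      have "p j < W" "Suc (p j) < W" "Suc (q j) < W" "Suc j < W" using le[of j] j W by linarith+
      then show ?case using 7(2,3) s' j lab[OF j] tcW[of "Suc j"] by (auto simp: wp_simps p q)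
    qed (use n W p q in auto)
  qed (use W in auto)
  from wp_frame[OF this] show ?thesis unfolding prepared_reps[OF P]
    by (rule wp_mono) (auto simp: p_def q_def insert_commute)
qed

lemma wp_count_neighbours:
  assumes I: "inp s" and c: "regs s 24 = c" "c < n" and lab: "\<forall>v<n. arrs s 7 v \<le> Suc n"
    and z: "\<forall>v. arrs s 13 v = 0" and W: "2 * m < W" "Suc n < W"
  shows "wp W count_neighbours s (\<lambda>t s'. t \<le> 14 * m + 5 \<and>
    (\<forall>l. arrs s' 13 l = card {v. {c, v} \<in> E \<and> arrs s 7 v = l}) \<and> frame {26, 27, 28, 29, 31} {13} s s')"
proof -
  define cnt where "cnt j l = card {k. off c \<le> k \<and> k < j \<and> arrs s 7 (nb k) = l}" for j l
  let ?s = "set_reg 27 (off (Suc c)) (set_reg 27 (Suc c) (set_reg 26 (off c) s))"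
  let ?body = "Load 28 2 (Reg 31) ;; Load 28 7 (Reg 28) ;; Load 29 13 (Reg 28) ;;
        Add 29 (Reg 29) (Num 1) ;; Store 13 (Reg 28) (Reg 29)"
  have io: "arrs s 1 = off" "arrs s 2 = nb" using I by (auto simp: inp_def)
  have ow: "off c < W" "off (Suc c) < W" using off_less c W by auto
  have cnt0: "cnt (off c) l = 0" for l by (simp add: cnt_def)
  have cntS: "cnt (Suc j) l = (if arrs s 7 (nb j) = l then Suc (cnt j l) else cnt j l)" if "off c \<le> j" for j l
  proof -
    have "{k. off c \<le> k \<and> k < Suc j \<and> arrs s 7 (nb k) = l} = (if arrs s 7 (nb j) = l
      then insert j {k. off c \<le> k \<and> k < j \<and> arrs s 7 (nb k) = l} else {k. off c \<le> k \<and> k < j \<and> arrs s 7 (nb k) = l})"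
      using that by (auto simp: less_Suc_eq)
    moreover have "finite {k. off c \<le> k \<and> k < j \<and> arrs s 7 (nb k) = l}" by (rule finite_subset[of _ "{..<j}"]) auto
    ultimately show ?thesis by (simp add: cnt_def)
  qed
  have cntle: "cnt j l \<le> j" for j l
    unfolding cnt_def by (rule order_trans[OF card_mono[of "{..<j}"]]) auto
  have tot: "cnt (off (Suc c)) l = card {v. {c, v} \<in> E \<and> arrs s 7 v = l}" for l
  proof -
    have bij: "bij_betw nb {off c..<off (Suc c)} {w. {c, w} \<in> E}" by (rule bij_nb[OF c(2)])
    have img: "nb ` {k. off c \<le> k \<and> k < off (Suc c) \<and> arrs s 7 (nb k) = l} = {v. {c, v} \<in> E \<and> arrs s 7 v = l}"
    proof -
      have "nb ` {k. off c \<le> k \<and> k < off (Suc c) \<and> arrs s 7 (nb k) = l} =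
        {v \<in> nb ` {off c..<off (Suc c)}. arrs s 7 v = l}" by auto
      then show ?thesis using bij unfolding bij_betw_def by simp
    qed
    have inj: "inj_on nb {k. off c \<le> k \<and> k < off (Suc c) \<and> arrs s 7 (nb k) = l}"
      using bij unfolding bij_betw_def by (auto elim: inj_on_subset)
    show ?thesis unfolding cnt_def img[symmetric] card_image[OF inj] ..
  qed
  have F: "wp W (For 31 (Reg 26) (Reg 27) ?body) ?s
    (\<lambda>t s'. t \<le> (\<Sum>j = val ?s (Reg 26)..<val ?s (Reg 27). 5 + 2) + 2 \<and>
      (\<forall>l. arrs s' 13 l = cnt (val ?s (Reg 27)) l) \<and> regs s' 31 = val ?s (Reg 27) \<and>
      frame (insert 31 (wregs ?body)) (warrs ?body) ?s s')"
  proof (rule wp_For[where c = "\<lambda>_. 5" and I = "\<lambda>j s'. \<forall>l. arrs s' 13 l = cnt j l"], goal_cases)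
    case (6 j s')
    then have j: "off c \<le> j" "j < off (Suc c)" by auto
    have nbj: "nb j < n" using nb_less_n off_le_n[of "Suc c"] c j by simp
    then have nw: "nb j < W" "arrs s 7 (nb j) < W" using W lab by (auto intro: le_less_trans)
    have arr: "arrs s' 2 = nb" "arrs s' 7 = arrs s 7" using 6(5) io by (auto simp: frame_def)
    have "Suc (cnt j l) \<le> Suc j" for l using cntle by simp
    then have "Suc (cnt j l) < W" for l using j ow by (meson le_less_trans Suc_leI)
    then show ?case using 6(3,4) nw arr W by (auto simp: wp_simps cntS[OF j(1)] Suc_lessD)
  qed (use ow off_Suc[OF c(2)] cnt0 z in auto)
  have len: "off (Suc c) - off c \<le> 2 * m" using off_le_n[of "Suc c"] off_n_eq c by simp
  have "wp W count_neighbours s (\<lambda>t s'. t \<le> 14 * m + 5 \<and>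
    (\<forall>l. arrs s' 13 l = card {v. {c, v} \<in> E \<and> arrs s 7 v = l}))"
  proof -
    have "wp W (For 31 (Reg 26) (Reg 27) ?body) ?s
      (\<lambda>t s'. 3 + t \<le> 14 * m + 5 \<and> (\<forall>l. arrs s' 13 l = card {v. {c, v} \<in> E \<and> arrs s 7 v = l}))"
      by (rule wp_mono[OF F]) (use len tot in simp)
    then show ?thesis
      unfolding count_neighbours_def wp_Seq[of W "Load 26 a c" for a c]
        wp_Seq[of W "Load 27 a c" for a c] wp_Seq[of W "Add 27 b c" for b c] wp_Load wp_Add
      using io c ow W by simp
  qed
  from wp_frame[OF this] show ?thesis by (rule wp_mono) (auto simp: insert_commute)
qed

lemma wp_check_bridges:
  assumes n: "regs s 10 = n" and T: "T_arr T0 s" and lab: "\<forall>v<n. arrs s 7 v \<le> Suc n"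
    and cn: "\<forall>l. arrs s 13 l < W" and W: "Suc n < W"
  shows "wp W check_bridges s (\<lambda>t s'. t \<le> 9 * n + 3 \<and>
    regs s' 34 = (if \<forall>x \<in> T0 - {regs s 24}. arrs s 13 (arrs s 7 x) = 1 then 1 else 0))"
  unfolding check_bridges_def wp_Seq[of W "Assign a b" for a b] wp_Assign
proof (intro conjI, goal_cases)
  case 2
  show ?case
  proof (rule wp_mono[OF wp_For_const[where c = 7 and n = n and
      I = "\<lambda>j s'. regs s' 34 = (if \<forall>x \<in> T0 \<inter> {..<j} - {regs s 24}. arrs s 13 (arrs s 7 x) = 1 then 1 else 0)"]],
      goal_cases)
    case (7 j s')
    then have j: "j < n" using n by simp
    have s': "arrs s' 7 = arrs s 7" "arrs s' 13 = arrs s 13" "arrs s' 11 j = (if j \<in> T0 then 1 else 0)"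
      "regs s' 24 = regs s 24"
      using 7(4) T by (auto simp: frame_def T_arr_def)
    have lw: "arrs s 7 j < W" using lab j W by (auto intro: le_less_trans)
    have ins: "T0 \<inter> {..<Suc j} - {regs s 24} = (if j \<in> T0 \<and> j \<noteq> regs s 24
      then insert j (T0 \<inter> {..<j} - {regs s 24}) else T0 \<inter> {..<j} - {regs s 24})"
      by (auto simp: lessThan_Suc)
    show ?case using 7(2,3) s' lw cn W by (auto simp: wp_simps ins split: if_splits)
  next
    case (8 t s')
    have "T0 \<inter> {..<n} = T0" using T0_V by auto
    then show ?case using 8 n by simp
  qed (use n W in auto)
qed (use W in auto)

lemma wp_star_test:
  assumes P: "prepared s" and p: "regs s 32 = card (rho s ` V)" and z: "\<forall>v. arrs s 13 v = 0"
    and W: "2 * m < W" "Suc (Suc n) < W"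
  shows "wp W star_test s (\<lambda>t s'. t \<le> 36 * m + 40 * n + 50 \<and>
    regs s' 34 = (if card (rho s ` V) < 2 \<and> star_exc E T0 then 1 else 0) \<and>
    frame {11, 12, 13, 14, 15, 16, 17, 18, 19, 20, 25, 26, 27, 28, 29, 30, 31, 34} {7, 8, 13} s s')"
proof -
  let ?c = "regs s 24"
  have P': "inp s" "T_arr T0 s" "regs s 22 = card T0" "center_ok n s" using P by (auto simp: prepared_def)
  have n: "regs s 10 = n" using P' by (simp add: inp_def)
  have TV: "T0 \<inter> V = T0" using T0_V by auto
  have "wp W star_test s (\<lambda>t s'. t \<le> 36 * m + 40 * n + 50 \<and>
    regs s' 34 = (if card (rho s ` V) < 2 \<and> star_exc E T0 then 1 else 0))"
  proof (cases "card (rho s ` V) < 2 \<and> T0 \<noteq> {}")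
    case False
    have "\<not> star_exc E T0" if "T0 = {}" using that by (simp add: star_exc_def)
    then show ?thesis using False p P'(3) W finite_T0
      by (cases "card (rho s ` V) < 2") (auto simp: star_test_def wp_simps)
  next
    case True
    then have c: "?c \<in> T0" "regs s 23 = Suc (td ?c)" "\<And>v. v \<in> T0 \<Longrightarrow> td v \<le> td ?c"
      using P'(4) TV by (auto simp: center_ok_def)
    have cn: "?c < n" using c T0_V by auto
    have T_pos: "0 < card T0" using c finite_T0 by (auto simp: card_gt_0_iff)
    have star: "star_exc E T0 \<longleftrightarrow> (\<forall>x \<in> T0 - {?c}. bridge E ?c x)"
      by (rule star_exc_center[OF E_pairs finite_T0 c(1)]) (use c(3) in \<open>simp add: td_def\<close>)
    have no_loop: "{v} \<notin> E" for v using subsetD[OF E_pairs, of "{v}"] by auto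
    have tds: "{w \<in> T0. {?c, w} \<in> E} \<subseteq> T0 - {?c}" using no_loop[of ?c] by auto
    have cT: "card (T0 - {?c}) = card T0 - 1" using c by simp
    show ?thesis
    proof (cases "Suc (td ?c) = card T0")
      case False
      \<comment> \<open>By \<open>star_exc_center\<close> the candidate would be a centre, hence
        adjacent to all other wrong vertices, against the count.\<close>
      have "\<not> star_exc E T0"
      proof
        assume "star_exc E T0"
        then have "{w \<in> T0. {?c, w} \<in> E} = T0 - {?c}" using star tds unfolding bridge_def by blast
        then have "td ?c = card T0 - 1" using cT by (simp add: td_def)
        then show False using False T_pos by simp
      qed
      then show ?thesis using False True p P'(3) W c T_pos by (auto simp: star_test_def wp_simps)
    next
      case eq: True
      have "card {w \<in> T0. {?c, w} \<in> E} = card (T0 - {?c})" using eq cT by (simp add: td_def)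
      then have all: "{w \<in> T0. {?c, w} \<in> E} = T0 - {?c}" using tds finite_T0 by (metis card_subset_eq finite_Diff)
      let ?s = "set_reg 11 ?c (set_reg 34 0 s)"
      have off_W: "off n < W" using W off_n_eq by simp
      have main: "wp W (search 1 2 ;; count_neighbours ;; check_bridges) ?s (\<lambda>t s'. t \<le> 36 * m + 40 * n + 40 \<and>
        regs s' 34 = (if star_exc E T0 then 1 else 0))"
      proof (rule wp_SeqI[OF input.wp_search[where X = ?c]], goal_cases)
        case (9 t1 s1)
        then have t1: "t1 \<le> 11 * off n + 25 * n + 30" and L: "input.labelling ?c (arrs s1 7)"
          and fr: "frame {12, 13, 14, 15, 16, 17, 18, 19, 20} {7, 8} ?s s1" by auto
        have s1: "inp s1" "regs s1 24 = ?c" "\<forall>v. arrs s1 13 v = 0" "T_arr T0 s1" "regs s1 10 = n"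
          using fr P' z n by (auto simp: inp_def frame_def T_arr_def)
        let ?lab = "arrs s1 7"
        have lab_ex: "\<exists>r<n. r \<noteq> ?c \<and> ?lab v = Suc r \<and> ?lab r = Suc r \<and> (r, v) \<in> (input.arcs ?c)\<^sup>*"
          if "v < n" "v \<noteq> ?c" for v
          using L that unfolding input.labelling_def by (elim conjE) simp
        have lab: "\<forall>v<n. ?lab v \<le> Suc n"
        proof (intro allI impI)
          fix v assume v: "v < n"
          show "?lab v \<le> Suc n"
          proof (cases "v = ?c")
            case True
            then show ?thesis using L by (simp add: input.labelling_def)
          next
            case False
            then show ?thesis using lab_ex[OF v] by auto
          qed
        qed
        have W': "Suc n < W" using W by simp
        show ?case
        proof (rule wp_SeqI[OF wp_count_neighbours[OF s1(1,2) cn lab s1(3) W(1) W']], goal_cases)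
          case (1 t2 s2)
          then have t2: "t2 \<le> 14 * m + 5" and cnt: "\<And>l. arrs s2 13 l = card {v. {?c, v} \<in> E \<and> ?lab v = l}"
            and fr2: "frame {26, 27, 28, 29, 31} {13} s1 s2" by auto
          have s2: "regs s2 10 = n" "T_arr T0 s2" "arrs s2 7 = ?lab" "regs s2 24 = ?c"
            using fr2 s1 by (auto simp: frame_def T_arr_def)
          have nbV: "v < n" if "{?c, v} \<in> E" for v
          proof -
            have "{?c, v} \<in> pairs V" using that E_pairs by blast
            then show ?thesis by simp
          qed
          have cw: "arrs s2 13 l < W" for l
          proof -
            have "{v. {?c, v} \<in> E \<and> ?lab v = l} \<subseteq> V" using nbV by auto
            then have "arrs s2 13 l \<le> card V" unfolding cnt by (intro card_mono) auto
            then show ?thesis using W by simp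
          qed
          \<comment> \<open>Two neighbours of the centre have equal labels exactly if they are
            connected without it, so count 1 says that x is the only neighbour in its
            component.\<close>
          have iff: "arrs s2 13 (?lab x) = 1 \<longleftrightarrow> bridge E ?c x" if x: "x \<in> T0 - {?c}" for x
          proof -
            have xE: "{?c, x} \<in> E" using all x by blast
            have xn: "x < n" "x \<noteq> ?c" using x T0_V by auto
            have leq: "?lab z = ?lab x \<longleftrightarrow> reach {e \<in> E. ?c \<notin> e} z x" if "{?c, z} \<in> E" for z
            proof -
              have "z < n" "z \<noteq> ?c" using that nbV no_loop[of ?c] by auto
              then show ?thesis using input.labelling_iff[OF L _ xn(1) _ xn(2)] by (simp add: input_arcs)
            qed
            let ?S = "{v. {?c, v} \<in> E \<and> ?lab v = ?lab x}"
            have "?S \<subseteq> V" using nbV by auto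
            then have finS: "finite ?S" using finite_subset by blast
            have xS: "x \<in> ?S" using xE by simp
            have "card ?S = 1 \<longleftrightarrow> (\<forall>z \<in> ?S. z = x)" by (rule card_1_iff_unique[OF xS])
            also have "\<dots> \<longleftrightarrow> bridge E ?c x"
              unfolding bridge_iff_unique[OF xE xn(2)[symmetric]] using leq no_loop[of ?c] by auto
            finally show ?thesis unfolding cnt .
          qed
          have cwa: "\<forall>l. arrs s2 13 l < W" using cw by blast
          have lab2: "\<forall>v<n. arrs s2 7 v \<le> Suc n" using lab s2 by simp
          show ?case
          proof (rule wp_mono[OF wp_check_bridges[OF s2(1,2) lab2 cwa W']], goal_cases)
            case (1 t3 s3)
            have "(\<forall>x \<in> T0 - {?c}. arrs s2 13 (arrs s2 7 x) = 1) \<longleftrightarrow> star_exc E T0"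
              unfolding star s2(3) using iff by (metis (no_types, lifting))
            then show ?case using 1 t1 t2 off_n_eq s2(4) by simp
          qed
        qed
      qed (use P' n W off_W in \<open>auto simp: inp_def\<close>)
      have cW: "?c < W" using cn W by simp
      have "wp W (search 1 2 ;; count_neighbours ;; check_bridges) ?s (\<lambda>t s'.
         1 + (1 + (1 + (1 + (1 + t)))) \<le> 36 * m + 40 * n + 50 \<and> regs s' 34 = (if star_exc E T0 then 1 else 0))"
        by (rule wp_mono[OF main]) simp
      then show ?thesis
        unfolding star_test_def wp_Seq[of W "Assign a b" for a b] wp_Assign wp_Cond
        using True eq p P'(3) c T_pos W cW by simp
    qed
  qed
  from wp_frame[OF this] show ?thesis by (rule wp_mono) auto
qed

lemma wp_decide:
  assumes s: "regs s 0 = n" "regs s 1 = k" "arrs s 0 = (\<lambda>v. if v < n then \<delta> v else 0)" "arrs s 1 = off" "arrs s 2 = nb"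
    "\<And>a v. a \<in> {9, 10, 11, 12, 13} \<Longrightarrow> arrs s a v = 0"
    and W: "2 * m < W" "4 * n + 8 < W" and rep: "is_rep V E \<rho>"
  shows "wp W decide s (\<lambda>t s'. t \<le> 200 * (n + m + 1) \<and>
    regs s' 0 = (if even (card T0) \<and> opt_bound V E \<rho> T0 \<le> k \<and> \<not> (n < 3 \<and> 1 < opt_bound V E \<rho> T0) then 1 else 0))"
  unfolding decide_def
proof (rule wp_SeqI[OF wp_prep], goal_cases)
  case (8 t1 s1)
  then have t1: "t1 \<le> 32 * m + 70 * n + 60" and P: "prepared s1" and s1: "regs s1 1 = k" "\<forall>v. arrs s1 13 v = 0"
    using s by (auto simp: frame_def)
  have W': "Suc (Suc n) < W" using W by simp
  show ?case
  proof (rule wp_SeqI[OF wp_count_comps[OF P W']], goal_cases)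
    case (1 t2 s2)
    then have t2: "t2 \<le> 10 * n + 4" and c2: "regs s2 32 = card (rho s1 ` V)" "regs s2 33 = card (tfree V (rho s1) T0)"
      and fr: "frame {25, 26, 27, 30, 32, 33} {} s1 s2" by auto
    have arr: "arrs s2 = arrs s1" using fr by (auto simp: frame_def)
    have P2: "prepared s2" using P fr by (auto simp: prepared_def inp_def T_arr_def center_ok_def frame_def)
    have s2: "regs s2 1 = k" "\<forall>v. arrs s2 13 v = 0" using fr s1 arr by (auto simp: frame_def)
    have c2': "regs s2 32 = card (rho s2 ` V)" using c2 arr by simp
    show ?case
    proof (rule wp_SeqI[OF wp_star_test[OF P2 c2' s2(2) W(1) W']], goal_cases)
      case (1 t3 s3)
      then have t3: "t3 \<le> 36 * m + 40 * n + 50"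
        and ex: "regs s3 34 = (if card (rho s2 ` V) < 2 \<and> star_exc E T0 then 1 else 0)"
        and fr3: "frame {11, 12, 13, 14, 15, 16, 17, 18, 19, 20, 25, 26, 27, 28, 29, 30, 31, 34} {7, 8, 13} s2 s3" by auto
      let ?p = "card (rho s2 ` V)" and ?q = "card (tfree V (rho s2) T0)" and ?T = "card T0"
      have s3: "regs s3 32 = ?p" "regs s3 33 = ?q" "regs s3 22 = ?T" "regs s3 1 = k" "regs s3 10 = n"
        "arrs s3 9 ?T = ?T mod 2" "arrs s3 10 ?T = ?T div 2"
        using fr3 c2 arr P2 s2 card_T0_le by (auto simp: frame_def prepared_def inp_def)
      have B: "opt_bound V E \<rho> T0 = opt_bound V E (rho s2) T0"
        using opt_bound_indep[OF rep, of "rho s2"] P2 by (simp add: prepared_def)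
      have T_empty: "T0 = {} \<longleftrightarrow> ?T = 0" using finite_T0 by simp
      have pq: "?p \<le> n" "?q \<le> n" "?T div 2 \<le> n"
      proof -
        show "?p \<le> n" using card_image_le[of V "rho s2"] by simp
        have "?q \<le> card (rho s2 ` V)" unfolding tfree_def by (intro card_mono) auto
        then show "?q \<le> n" using \<open>?p \<le> n\<close> by simp
        show "?T div 2 \<le> n" using card_T0_le by simp
      qed
      define b where "b = opt_bound V E \<rho> T0"
      have b: "b = (if ?p < 2 then ?T div 2 + regs s3 34
         else max (max (?p - 1) (?T div 2 + ?q)) (if ?T = 0 then 3 else 0))"
        unfolding b_def
      proof (rule trans[OF B])
        show "opt_bound V E (rho s2) T0 = (if ?p < 2 then ?T div 2 + regs s3 34
           else max (max (?p - 1) (?T div 2 + ?q)) (if ?T = 0 then 3 else 0))"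
          unfolding opt_bound_def T_empty ex by (cases "?p < 2") simp_all
      qed
      have e1: "regs s3 34 \<le> 1" unfolding ex by simp
      \<comment> \<open>Both component counts and half the number of wrong vertices are at most n
        and the flag is at most 1, which the assumption \<open>4 * n + 8 < W\<close> covers.\<close>
      have W4': "?p + ?q + ?T div 2 + regs s3 34 + 4 < W" using pq W e1 by linarith
      have V: "wp W verdict s3 (\<lambda>t s'. t \<le> 15 \<and>
        regs s' 0 = (if even ?T \<and> b \<le> k \<and> \<not> (n < 3 \<and> 1 < b) then 1 else 0))"
      proof (cases "even ?T")
        case False
        then have "?T mod 2 = 1" by presburger
        then show ?thesis using s3 W False by (simp add: verdict_def wp_simps)
      next
        case True
        then have ev: "?T mod 2 = 0" by presburger
        have "wp W (compute_bound ;; compare_budget) (set_reg 25 0 s3) (\<lambda>t s'. 2 + t \<le> 15 \<and>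
          regs s' 0 = (if b \<le> k \<and> \<not> (n < 3 \<and> 1 < b) then 1 else 0))"
        proof (rule wp_SeqI[OF wp_compute_bound[where p = ?p and q = ?q and x = ?T and e = "regs s3 34" and h = "?T div 2"]],
            goal_cases)
          case (7 t4 s4)
          then have "regs s4 26 = b" "regs s4 1 = k" "regs s4 10 = n" "t4 \<le> 9" using b s3 by simp_all
          then show ?case using wp_compare_budget[of W s4] W by (auto elim!: wp_mono)
        qed (use s3 W4' in auto)
        then show ?thesis unfolding verdict_def wp_Seq[of W "Load a b c" for a b c] wp_Load wp_Cond
          using s3 ev True W by simp
      qed
      show ?case by (rule wp_mono[OF V]) (use t1 t2 t3 in \<open>simp add: b_def\<close>)
    qed
  qed
qed (use s W in auto)

end

section \<open>The cubic-time optimization program\<close>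

text \<open>The machine cannot multiply, so the row starts are tabulated by repeated addition. The
  same table later serves the search as its array of offsets.\<close>

definition build_rows :: program where
  "build_rows =
     For 30 (Num 0) (Reg 10)
       (Load 25 14 (Reg 30) ;; Add 25 (Reg 25) (Reg 10) ;; Add 26 (Reg 30) (Num 1) ;; Store 14 (Reg 26) (Reg 25))"

definition pad_row :: program where
  "pad_row =
     For 31 (Num 0) (Reg 10) (Add 26 (Reg 25) (Reg 31) ;; Store 15 (Reg 26) (Reg 30) ;; Store 16 (Reg 26) (Reg 30))"

definition enter_row :: program where
  "enter_row =
     Load 26 1 (Reg 30) ;; Add 27 (Reg 30) (Num 1) ;; Load 27 1 (Reg 27) ;;
     For 31 (Reg 26) (Reg 27)
       (Load 28 2 (Reg 31) ;; Add 29 (Reg 25) (Reg 28) ;; Store 15 (Reg 29) (Reg 28) ;; Store 16 (Reg 29) (Reg 28))"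

text \<open>Array 15 keeps the input graph, array 16 the current graph. The toggled pairs are
  exactly the cells where the two differ, so they need no storage of their own.\<close>

definition build_matrix :: program where
  "build_matrix = For 30 (Num 0) (Reg 10) (Load 25 14 (Reg 30) ;; pad_row ;; enter_row)"

lemma wregs_build [simp]:
  "wregs build_rows = {25, 26, 30}" "wregs pad_row = {26, 31}" "wregs enter_row = {26, 27, 28, 29, 31}"
  "wregs build_matrix = {25, 26, 27, 28, 29, 30, 31}"
  by (auto simp: build_rows_def pad_row_def enter_row_def build_matrix_def)

lemma warrs_build [simp]:
  "warrs build_rows = {14}" "warrs pad_row = {15, 16}" "warrs enter_row = {15, 16}"
  "warrs build_matrix = {15, 16}"
  by (auto simp: build_rows_def pad_row_def enter_row_def build_matrix_def)

lemma wp_build_rows: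
  assumes n: "regs s 10 = n" and z: "arrs s 14 0 = 0" and W: "n * n < W" "Suc n < W"
  shows "wp W build_rows s (\<lambda>t s'. t \<le> 6 * n + 2 \<and> is_row n (arrs s' 14) \<and> frame {25, 26, 30} {14} s s')"
  unfolding build_rows_def
proof (rule wp_mono[OF wp_For_const[where c = 4 and n = n and I = "\<lambda>j s'. \<forall>v\<le>j. arrs s' 14 v = v * n"]], goal_cases)
  case (7 j s')
  then have j: "j < n" "regs s' 10 = n" "arrs s' 14 j = j * n" using n by (auto simp: frame_def)
  have "j * n + n \<le> n * n" using mult_le_mono1[of "Suc j" n n] j by simp
  then have "j * n + n < W" using W by simp
  then show ?case using 7(2,3) j W by (auto simp: wp_simps le_Suc_eq add.commute)
next
  case (8 t s')
  then show ?case using n by (auto simp: is_row_def insert_commute)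
qed (use n W z in auto)

lemma mat_state_frame:
  "mat_state n H s \<Longrightarrow> frame R A s s' \<Longrightarrow> 10 \<notin> R \<Longrightarrow> 14 \<notin> A \<Longrightarrow> 16 \<notin> A \<Longrightarrow> mat_state n H s'"
  by (simp add: mat_state_def frame_def)

context input_graph
begin

definition rows_done :: "nat \<Rightarrow> (nat \<Rightarrow> nat) \<Rightarrow> bool" where
  "rows_done j M \<longleftrightarrow> (\<forall>u<j. \<forall>v<n. M (u * n + v) = (if {u, v} \<in> E then v else u))"

lemma rows_done_upd:
  assumes "rows_done j M" "v < n"
  shows "rows_done j (M(j * n + v := x))"
  unfolding rows_done_def
proof (intro allI impI)
  fix u w assume uw: "u < j" "w < n"
  then have "u * n + w \<noteq> j * n + v" using cell_inj(1)[of w n v u j] assms(2) by auto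
  then show "(M(j * n + v := x)) (u * n + w) = (if {u, w} \<in> E then w else u)"
    using assms(1) uw by (simp add: rows_done_def)
qed

lemma wp_build_matrix:
  assumes I: "inp s" and R: "is_row n (arrs s 14)" and eq: "arrs s 16 = arrs s 15"
    and W: "n * n < W" "Suc n < W" "2 * m < W"
  shows "wp W build_matrix s (\<lambda>t s'. t \<le> 12 * (n * n) + 15 * n + 2 \<and> is_mat n (arrs s' 15) E \<and> arrs s' 16 = arrs s' 15 \<and>
    frame {25, 26, 27, 28, 29, 30, 31} {15, 16} s s')"
  unfolding build_matrix_def
proof (rule wp_mono[OF wp_For_const[where c = "11 * n + 11" and n = n and
      I = "\<lambda>j s'. rows_done j (arrs s' 15) \<and> arrs s' 16 = arrs s' 15"]], goal_cases)
  case (7 j s')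
  have j: "j < n" using 7(1) I by (simp add: inp_def)
  have s': "inp s'" "arrs s' 14 j = j * n" "regs s' 10 = n" "arrs s' 1 = off" "arrs s' 2 = nb" "regs s' 30 = j"
    using 7(2,4) I R j by (auto simp: frame_def inp_def is_row_def)
  have small: "j * n + v < W" "j * n < W" if "v < n" for v
    using cell_less[OF j that] W by auto
  have jW: "j < W" "j * n < W" using j W cell_less[OF j j] by linarith+
  let ?s1 = "set_reg 25 (j * n) s'"
  have pad: "wp W pad_row ?s1 (\<lambda>t s2. t \<le> (3 + 2) * n + 2 \<and>
     (rows_done j (arrs s2 15) \<and> (\<forall>v<n. arrs s2 15 (j * n + v) = j) \<and> arrs s2 16 = arrs s2 15) \<and> frame {26, 31} {15, 16} ?s1 s2)"
    unfolding pad_row_def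
  proof (rule wp_mono[OF wp_For_const[where c = 3 and n = n and
      I = "\<lambda>i s2. rows_done j (arrs s2 15) \<and> (\<forall>v<i. arrs s2 15 (j * n + v) = j) \<and> arrs s2 16 = arrs s2 15"]], goal_cases)
    case (7 i s2)
    then have i: "i < n" using s' by simp
    have r: "regs s2 25 = j * n" "regs s2 30 = j" using 7(4) s' by (auto simp: frame_def)
    have e: "j * n + v = j * n + i \<longleftrightarrow> v = i" for v by simp
    have "rows_done j ((arrs s2 15)(j * n + i := j))" using 7(3) rows_done_upd[OF _ i] by blast
    then show ?case using 7(2,3) r small[OF i] jW by (auto simp: wp_simps less_Suc_eq)
  next
    case (8 t s2)
    then show ?case using s' by (auto simp: insert_commute)
  qed (use s' W 7(3) in auto)
  show ?case unfolding wp_Seq[of W "Load a b c" for a b c] wp_Load val.simps s'(6,2)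
  proof (intro conjI wp_SeqI[OF pad], goal_cases)
    case 1
    then show ?case using jW by simp
  next
    case (2 t2 s2)
    then have t2: "t2 \<le> 5 * n + 2" and rd: "rows_done j (arrs s2 15)" "\<forall>v<n. arrs s2 15 (j * n + v) = j"
      "arrs s2 16 = arrs s2 15" and fr: "frame {26, 31} {15, 16} ?s1 s2" by auto
    have s2: "arrs s2 1 = off" "arrs s2 2 = nb" "regs s2 30 = j" "regs s2 25 = j * n"
      using fr s' by (auto simp: frame_def)
    let ?s3 = "set_reg 27 (off (Suc j)) (set_reg 27 (Suc j) (set_reg 26 (off j) s2))"
    let ?body = "Load 28 2 (Reg 31) ;; Add 29 (Reg 25) (Reg 28) ;; Store 15 (Reg 29) (Reg 28) ;; Store 16 (Reg 29) (Reg 28)"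
    let ?I = "\<lambda>i s3. rows_done j (arrs s3 15) \<and> arrs s3 16 = arrs s3 15 \<and>
      (\<forall>v<n. arrs s3 15 (j * n + v) = (if \<exists>k. off j \<le> k \<and> k < i \<and> nb k = v then v else j))"
    have F: "wp W (For 31 (Reg 26) (Reg 27) ?body) ?s3
      (\<lambda>t s4. t \<le> (\<Sum>i = val ?s3 (Reg 26)..<val ?s3 (Reg 27). 4 + 2) + 2 \<and> ?I (val ?s3 (Reg 27)) s4 \<and>
        regs s4 31 = val ?s3 (Reg 27) \<and> frame (insert 31 (wregs ?body)) (warrs ?body) ?s3 s4)"
    proof (rule wp_For[where c = "\<lambda>_. 4" and I = ?I], goal_cases)
      case 1
      then show ?case using off_Suc[OF j] by simp
    next
      case 2
      then show ?case using off_less[of "Suc j" W] j W by simp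
    next
      case (6 i s4)
      then have i: "off j \<le> i" "i < off (Suc j)" by auto
      have nbi: "nb i < n" using nb_less_n off_le_n[of "Suc j"] i j by simp
      have r: "arrs s4 2 = nb" "regs s4 25 = j * n" using 6(5) s2 by (auto simp: frame_def)
      have rd': "rows_done j ((arrs s4 15)(j * n + nb i := nb i))" using 6(4) rows_done_upd[OF _ nbi] by blast
      have ex: "(\<exists>k\<ge>off j. k < Suc i \<and> nb k = v) \<longleftrightarrow> (\<exists>k\<ge>off j. k < i \<and> nb k = v) \<or> nb i = v" for v
        using i(1) by (auto simp: less_Suc_eq)
      show ?case using 6(3,4) r rd' small(1)[OF nbi] nbi W by (auto simp: wp_simps ex)
    qed (use rd in auto)
    have len: "off (Suc j) - off j \<le> n" using off_Suc[OF j] length_adj_less[OF j] by simp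
    have E_row: "rows_done (Suc j) M" if "rows_done j M"
      "\<forall>v<n. M (j * n + v) = (if \<exists>k. off j \<le> k \<and> k < off (Suc j) \<and> nb k = v then v else j)" for M
      using that arc_iff[OF j] by (auto simp: rows_done_def less_Suc_eq)
    have "wp W (For 31 (Reg 26) (Reg 27) ?body) ?s3 (\<lambda>t s4. 1 + (t2 + (3 + t)) \<le> 11 * n + 11 \<and>
      rows_done (Suc j) (arrs s4 15) \<and> arrs s4 16 = arrs s4 15)"
    proof (rule wp_mono[OF F], goal_cases)
      case (1 t s4)
      then have "t \<le> 6 * (off (Suc j) - off j) + 2" by simp
      then show ?case using 1 t2 len E_row[of "arrs s4 15"] by simp
    qed
    then show ?case
      unfolding enter_row_def wp_Seq[of W "Load 26 b c" for b c] wp_Seq[of W "Load 27 b c" for b c]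
        wp_Seq[of W "Add 27 b c" for b c] wp_Load wp_Add
      using s2 off_less[of j W] off_less[of "Suc j" W] j W by simp
  qed
next
  case (8 t s')
  have "(11 * n + 11 + 2) * n + 2 \<le> 12 * (n * n) + 15 * n + 2" by (simp add: algebra_simps)
  then show ?case using 8 I E_pairs by (auto simp: is_mat_def rows_done_def inp_def insert_commute)
qed (use I W eq in \<open>auto simp: inp_def rows_done_def\<close>)

end

section \<open>Joining the components by program\<close>

definition flip :: "nat \<Rightarrow> program" where
  "flip r = Load 27 11 (Reg r) ;; Sub 27 (Num 1) (Reg 27) ;; Store 11 (Reg r) (Reg 27)"

text \<open>Registers 40 and 39 enter with default ends, the representative of the new component and
  some vertex of the merged part; each is replaced by a wrong vertex of its side if there is
  one.\<close>

definition find_ends :: program where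
  "find_ends =
     For 41 (Num 0) (Reg 10)
       (Load 27 11 (Reg 41) ;;
        Cond (Equal (Reg 27) (Num 1))
          (Load 27 7 (Reg 41) ;;
           Cond (Equal (Reg 27) (Reg 26)) (Assign 40 (Reg 41))
             (Load 27 17 (Reg 27) ;; Cond (Equal (Reg 27) (Num 1)) (Assign 39 (Reg 41)) Skip)) Skip)"

definition attach_rep :: program where
  "attach_rep =
     Assign 40 (Reg 38) ;; Assign 39 (Reg 36) ;; find_ends ;;
     Cond (Equal (Reg 35) (Num 1)) (toggle 39 40 ;; flip 39 ;; flip 40) (Assign 35 (Num 1) ;; Assign 36 (Reg 38)) ;;
     Store 17 (Reg 26) (Num 1)"

definition attach_one :: program where
  "attach_one =
     Load 25 7 (Reg 38) ;; Add 26 (Reg 38) (Num 1) ;;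
     Cond (Equal (Reg 25) (Reg 26))
       (Load 27 12 (Reg 26) ;; Cond (Equal (Reg 27) (Num 1)) (Assign 28 (Num 1)) (Assign 28 (Num 0)) ;;
        Cond (Equal (Reg 28) (Reg 37)) attach_rep Skip) Skip"

text \<open>Two passes over the representatives realise the order that \<open>attach_step\<close>
  demands: pass 0 takes the components whose number of wrong vertices is not 1, pass 1 the
  others.\<close>

definition attach_all :: program where
  "attach_all =
     Assign 35 (Num 0) ;; Assign 36 (Num 0) ;; For 37 (Num 0) (Num 2) (For 38 (Num 0) (Reg 10) attach_one)"

lemma wregs_attach [simp]:
  "wregs (flip r) = {27}" "wregs find_ends = {27, 39, 40, 41}"
  "wregs attach_rep = {18, 19, 27, 35, 36, 39, 40, 41}"
  "wregs attach_one = {18, 19, 25, 26, 27, 28, 35, 36, 39, 40, 41}"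
  "wregs attach_all = {18, 19, 25, 26, 27, 28, 35, 36, 37, 38, 39, 40, 41}"
  by (auto simp: flip_def find_ends_def attach_rep_def attach_one_def attach_all_def)

lemma warrs_attach [simp]:
  "warrs (flip r) = {11}" "warrs find_ends = {}"
  "warrs attach_rep = {11, 16, 17}" "warrs attach_one = {11, 16, 17}" "warrs attach_all = {11, 16, 17}"
  by (auto simp: flip_def find_ends_def attach_rep_def attach_one_def attach_all_def)

text \<open>Fixes the labels found in the preparation. Later connectivity checks overwrite array 7,
  while the argument keeps referring to the components of the input.\<close>

locale labelled_graph = input_graph +
  fixes lab :: "nat \<Rightarrow> nat"
  assumes lab_rep: "is_rep V E (\<lambda>v. lab v - 1)" and lab_range: "v < n \<Longrightarrow> 0 < lab v \<and> lab v \<le> n"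
begin

definition rep :: "nat \<Rightarrow> nat" where
  "rep v = lab v - 1"

sublocale comp_graph V E T0 rep
  by unfold_locales (use E_pairs T0_V lab_rep in \<open>auto simp: rep_def[abs_def]\<close>)

lemma lab_eq: "v < n \<Longrightarrow> lab v = Suc (rep v)"
  using lab_range[of v] by (simp add: rep_def)

lemma rep_less: "v < n \<Longrightarrow> rep v < n"
  using is_repD(1)[OF rep, of v] by simp

lemma reps_eq: "rep ` V = {r. r < n \<and> lab r = Suc r}"
proof (intro equalityI subsetI)
  fix r assume "r \<in> rep ` V"
  then obtain v where "v \<in> V" "r = rep v" by auto
  then have "r \<in> V" "rep r = r" using is_repD(1,2)[OF rep] by auto
  then show "r \<in> {r. r < n \<and> lab r = Suc r}" using lab_eq[of r] by auto
next
  fix r assume "r \<in> {r. r < n \<and> lab r = Suc r}"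
  then show "r \<in> rep ` V" by (intro image_eqI[of _ _ r]) (auto simp: rep_def)
qed

text \<open>Register 35 tells whether anything has been merged yet, and register 36 is then a vertex
  of the merged part, the default end for the next join. Array 17 is indexed by labels, hence the
  shift by 1.\<close>

definition attach_state :: "nat set set \<Rightarrow> nat set \<Rightarrow> nat set \<Rightarrow> state \<Rightarrow> bool" where
  "attach_state H T R s \<longleftrightarrow> attach_inv H T R \<and> mat_state n H s \<and> T_arr T s \<and>
     (\<forall>r<n. arrs s 17 (Suc r) = (if r \<in> R then 1 else 0)) \<and>
     (R = {} \<longrightarrow> regs s 35 = 0 \<and> H = E \<and> T = T0) \<and>
     (R \<noteq> {} \<longrightarrow> regs s 35 = 1 \<and> regs s 36 \<in> blob R) \<and> regs s 36 \<le> n \<and> arrs s 7 = lab"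

lemma attach_state_set_reg [simp]:
  "i \<notin> {10, 35, 36} \<Longrightarrow> attach_state H T R (set_reg i a s) \<longleftrightarrow> attach_state H T R s"
  by (simp add: attach_state_def mat_state_def T_arr_def)

lemma wp_find_ends:
  assumes S: "attach_state H T R s" and r: "r < n" "lab r = Suc r" "r \<notin> R"
    and s: "regs s 26 = Suc r" "regs s 40 = r" "regs s 39 = regs s 36" and W: "Suc n < W"
  shows "wp W find_ends s (\<lambda>t s'. t \<le> 10 * n + 2 \<and>
    (regs s' 40 < n \<and> rep (regs s' 40) = r \<and> (T \<inter> blob {r} \<noteq> {} \<longrightarrow> regs s' 40 \<in> T)) \<and>
    (R \<noteq> {} \<longrightarrow> regs s' 39 \<in> blob R \<and> (T \<inter> blob R \<noteq> {} \<longrightarrow> regs s' 39 \<in> T)) \<and>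
    frame {27, 39, 40, 41} {} s s')"
proof -
  have n: "regs s 10 = n" and T: "T_arr T s" and l: "arrs s 7 = lab" and TV: "T \<subseteq> V"
    and m17: "\<forall>r<n. arrs s 17 (Suc r) = (if r \<in> R then 1 else 0)"
    and b36: "R \<noteq> {} \<longrightarrow> regs s 36 \<in> blob R"
    using S attach_invD(2) by (auto simp: attach_state_def mat_state_def)
  let ?I = "\<lambda>j s'. (regs s' 40 < n \<and> rep (regs s' 40) = r \<and> (T \<inter> blob {r} \<inter> {..<j} \<noteq> {} \<longrightarrow> regs s' 40 \<in> T)) \<and>
    (R \<noteq> {} \<longrightarrow> regs s' 39 \<in> blob R \<and> (T \<inter> blob R \<inter> {..<j} \<noteq> {} \<longrightarrow> regs s' 39 \<in> T))"
  have blobV: "blob Q \<subseteq> V" for Q by (auto simp: blob_def)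
  show ?thesis unfolding find_ends_def
  proof (rule wp_mono[OF wp_For_const[where c = 8 and n = n and I = ?I]], goal_cases)
    case 6
    then show ?case using r s b36 by (simp add: rep_def)
  next
    case (7 j s')
    then have j: "j < n" using n by simp
    have s': "arrs s' 11 j = (if j \<in> T then 1 else 0)" "arrs s' 7 = lab" "arrs s' 17 = arrs s 17" "regs s' 26 = Suc r"
      using 7(4) T l s by (auto simp: frame_def T_arr_def)
    have lj: "lab j = Suc (rep j)" "rep j < n" using lab_eq[OF j] rep_less[OF j] by auto
    have m17j: "arrs s 17 (Suc (rep j)) = (if rep j \<in> R then 1 else 0)" using m17 lj by simp
    have Suc_int: "X \<inter> {..<Suc j} = (if j \<in> X then insert j (X \<inter> {..<j}) else X \<inter> {..<j})" for X
      by (auto simp: lessThan_Suc)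
    have jb: "j \<in> blob Q \<longleftrightarrow> rep j \<in> Q" for Q using j by (simp add: blob_def)
    consider "j \<notin> T" | "j \<in> T" "rep j = r" | "j \<in> T" "rep j \<noteq> r" "rep j \<in> R" | "j \<in> T" "rep j \<noteq> r" "rep j \<notin> R"
      by blast
    then show ?case
    proof cases
      case 1
      then show ?thesis using 7(2,3) s' W by (simp add: wp_simps Suc_int)
    next
      case 2
      then have "j \<in> T \<inter> blob {r}" "j \<notin> T \<inter> blob R" using jb r by auto
      then show ?thesis using 7(2,3) s' lj 2 j W by (simp add: wp_simps Suc_int)
    next
      case 3
      then have "j \<notin> T \<inter> blob {r}" "j \<in> T \<inter> blob R" "j \<in> blob R" using jb r by auto
      then show ?thesis using 7(2,3) s' lj 3 j m17j W by (simp add: wp_simps Suc_int)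
    next
      case 4
      then have "j \<notin> T \<inter> blob {r}" "j \<notin> T \<inter> blob R" using jb r by auto
      then show ?thesis using 7(2,3) s' lj 4 j m17j W by (simp add: wp_simps Suc_int)
    qed
  next
    case (8 t s')
    have "T \<inter> blob Q \<inter> {..<n} = T \<inter> blob Q" for Q using TV by auto
    then show ?case using 8 n by (simp add: insert_commute)
  qed (use n W in auto)
qed

lemma wp_flip:
  assumes "T_arr T s" "regs s r = v" "r \<noteq> 27" "1 < W"
  shows "wp W (flip r) s (\<lambda>t s'. t = 3 \<and> T_arr (sym_diff T {v}) s' \<and> frame {27} {11} s s')"
proof -
  have "arrs s 11 v < W" "1 - arrs s 11 v < W" using assms by (auto simp: T_arr_def)
  then have "wp W (flip r) s (\<lambda>t s'. t = 3 \<and> T_arr (sym_diff T {v}) s')"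
    using assms by (auto simp: flip_def wp_simps T_arr_def)
  from wp_frame[OF this] show ?thesis by (rule wp_mono) auto
qed

lemma wp_attach_rep:
  assumes S: "attach_state H T R s" and r: "r < n" "lab r = Suc r" "r \<notin> R"
    and order: "tc r \<noteq> 1 \<Longrightarrow> \<forall>q \<in> R. tc q \<noteq> 1"
    and s: "regs s 26 = Suc r" "regs s 38 = r" and W: "Suc n < W" "n * n < W"
  shows "wp W attach_rep s (\<lambda>t s'. t \<le> 10 * n + 30 \<and> (\<exists>H T. attach_state H T (insert r R) s'))"
proof -
  let ?s1 = "set_reg 39 (regs s 36) (set_reg 40 r s)"
  have S1: "attach_state H T R ?s1" using S by (simp add: attach_state_def mat_state_def T_arr_def)
  have I: "attach_inv H T R" using S by (simp add: attach_state_def)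
  have rV: "r \<in> rep ` V" using reps_eq r by simp
  have w36: "regs s 36 < W" using S W by (simp add: attach_state_def)
  have tcT: "tc r \<noteq> 0 \<longleftrightarrow> T \<inter> blob {r} \<noteq> {}"
  proof -
    have "T \<inter> blob {r} = T0 \<inter> blob {r}" using attach_outside[OF I] r by (auto simp: blob_def)
    moreover have "finite (blob {r})" by (simp add: blob_def)
    ultimately show ?thesis by (simp add: tc_eq)
  qed
  have "wp W (find_ends ;; Cond (Equal (Reg 35) (Num 1)) (toggle 39 40 ;; flip 39 ;; flip 40) (Assign 35 (Num 1) ;; Assign 36 (Reg 38)) ;;
     Store 17 (Reg 26) (Num 1)) ?s1 (\<lambda>t s'. 2 + t \<le> 10 * n + 30 \<and> (\<exists>H T. attach_state H T (insert r R) s'))"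
  proof (rule wp_SeqI[OF wp_find_ends[OF S1 r]], goal_cases)
    case (5 t2 s2)
    then have t2: "t2 \<le> 10 * n + 2" and v: "regs s2 40 < n" "rep (regs s2 40) = r" "T \<inter> blob {r} \<noteq> {} \<longrightarrow> regs s2 40 \<in> T"
      and u: "R \<noteq> {} \<longrightarrow> regs s2 39 \<in> blob R \<and> (T \<inter> blob R \<noteq> {} \<longrightarrow> regs s2 39 \<in> T)"
      and fr: "frame {27, 39, 40, 41} {} ?s1 s2" by auto
    have S2: "attach_state H T R s2" using S1 fr by (auto simp: attach_state_def mat_state_def T_arr_def frame_def)
    have r2: "regs s2 26 = Suc r" "regs s2 38 = r" using fr s by (auto simp: frame_def)
    let ?u = "regs s2 39" and ?v = "regs s2 40"
    show ?case
    proof (cases "R = {}")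
      case True
      then have "regs s2 35 = 0" "H = E" "T = T0" using S2 by (auto simp: attach_state_def)
      moreover have "attach_state E T0 {r} (set_arr 17 (Suc r) 1 (set_reg 36 r (set_reg 35 1 s2)))"
        using S2 True calculation attach_first[OF rV] r
        by (auto simp: attach_state_def mat_state_def T_arr_def blob_def rep_def)
      ultimately show ?thesis using True t2 r2 r W by (auto simp: wp_simps)
    next
      case ne: False
      then have flag: "regs s2 35 = 1" using S2 by (auto simp: attach_state_def)
      have uB: "?u \<in> V" "rep ?u \<in> R" using u ne by (auto simp: blob_def)
      have uv: "?u \<noteq> ?v" using uB v r by auto
      have new: "attach_inv (tog H ?u ?v) (sym_diff T {?u, ?v}) (insert r R)"
        by (rule attach_step[OF I ne rV r(3) order]) (use v u ne uB tcT in auto)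
      have TT: "sym_diff (sym_diff T {?u}) {?v} = sym_diff T {?u, ?v}" using uv by auto
      have M2: "mat_state n H s2" and T2: "T_arr T s2" using S2 by (auto simp: attach_state_def)
      have main: "wp W (toggle 39 40 ;; flip 39 ;; flip 40) s2 (\<lambda>t s3. t = 16 \<and> mat_state n (tog H ?u ?v) s3 \<and>
        T_arr (sym_diff T {?u, ?v}) s3 \<and> frame {18, 19, 27} {11, 16} s2 s3)"
      proof (rule wp_SeqI[OF wp_toggle[OF M2 W(2), where a = ?u and b = ?v]], goal_cases)
        case (8 t3 s3)
        then have "T_arr T s3" "regs s3 39 = ?u" "regs s3 40 = ?v" using T2 by (auto simp: frame_def T_arr_def)
        moreover have "mat_state n (tog H ?u ?v) s3" "frame {18, 19, 27} {11, 16} s2 s3" "t3 = 10"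
          using 8 by (auto intro: frame_mono)
        ultimately have s3: "T_arr T s3" "regs s3 39 = ?u" "regs s3 40 = ?v"
          "mat_state n (tog H ?u ?v) s3" "frame {18, 19, 27} {11, 16} s2 s3" "t3 = 10" by auto
        show ?case
        proof (rule wp_SeqI[OF wp_flip[OF s3(1,2)]], goal_cases)
          case (3 t4 s4)
          then have s4: "T_arr (sym_diff T {?u}) s4" "regs s4 40 = ?v" using s3 by (auto simp: frame_def)
          have f4: "frame {27} {11} s3 s4" "t4 = 3" using 3 by auto
          show ?case
          proof (rule wp_mono[OF wp_flip[OF s4]], goal_cases)
            case (3 t5 s5)
            then have f5: "frame {27} {11} s4 s5" "t5 = 3" "T_arr (sym_diff T {?u, ?v}) s5" unfolding TT by auto
            have "mat_state n (tog H ?u ?v) s5"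
              using mat_state_frame[OF mat_state_frame[OF s3(4) f4(1)] f5(1)] by simp
            moreover have "frame {18, 19, 27} {11, 16} s2 s5"
              by (rule frame_trans[OF s3(5)], rule frame_mono[OF frame_trans[OF f4(1) f5(1)]]) auto
            ultimately show ?case using f4 f5 s3(6) by simp
          qed (use W in auto)
        qed (use W in auto)
      qed (use uB v uv in auto)
      have "wp W (Cond (Equal (Reg 35) (Num 1)) (toggle 39 40 ;; flip 39 ;; flip 40) (Assign 35 (Num 1) ;; Assign 36 (Reg 38))) s2
        (\<lambda>t s3. t \<le> 17 \<and> mat_state n (tog H ?u ?v) s3 \<and>
        T_arr (sym_diff T {?u, ?v}) s3 \<and> frame {18, 19, 27} {11, 16} s2 s3)"
        unfolding wp_Cond using flag by (simp, intro wp_mono[OF main]) simp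
      then show ?thesis
      proof (rule wp_SeqI, goal_cases)
        case (1 t3 s3)
        then have fr3: "frame {18, 19, 27} {11, 16} s2 s3" by simp
        have "attach_state (tog H ?u ?v) (sym_diff T {?u, ?v}) (insert r R) (set_arr 17 (Suc r) 1 s3)"
        proof -
          have "regs s3 36 \<in> blob (insert r R)" "regs s3 35 = 1" "regs s3 36 \<le> n"
            using S2 fr3 ne by (auto simp: attach_state_def frame_def blob_def)
          moreover have "\<forall>q<n. ((arrs s3 17)(Suc r := 1)) (Suc q) = (if q \<in> insert r R then 1 else 0)"
            using S2 fr3 by (auto simp: attach_state_def frame_def)
          moreover have "arrs s3 7 = lab" using S2 fr3 by (auto simp: attach_state_def frame_def)
          ultimately show ?thesis unfolding attach_state_def using new 1
            by (simp add: mat_state_def T_arr_def)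
        qed
        moreover have "regs s3 26 = Suc r" using fr3 r2 by (simp add: frame_def)
        ultimately show ?case using 1 t2 W by (auto simp: wp_simps)
      qed
    qed
  qed (use s W in auto)
  then show ?thesis unfolding attach_rep_def wp_Seq[of W "Assign a b" for a b] wp_Assign
    using s r w36 W by simp
qed

definition cls :: "nat \<Rightarrow> nat" where
  "cls r = (if tc r = 1 then 1 else 0)"

text \<open>The progress of the double loop in pass \<open>c\<close> before candidate
  \<open>j\<close>. The end of one pass is literally the start of the next.\<close>

definition merged :: "nat \<Rightarrow> nat \<Rightarrow> nat set" where
  "merged c j = {r \<in> rep ` V. cls r < c \<or> (cls r = c \<and> r < j)}"

lemma wp_attach_all:
  assumes M: "mat_state n E s" and T: "T_arr T0 s" and l: "arrs s 7 = lab" and z: "\<forall>v. arrs s 17 v = 0"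
    and tc12: "\<And>l. arrs s 12 l = card {v \<in> V. lab v = l \<and> v \<in> T0}" and W: "Suc (Suc n) < W" "n * n < W"
  shows "wp W attach_all s (\<lambda>t s'. t \<le> 20 * (n * n) + 90 * n + 20 \<and>
    (\<exists>H T. attach_inv H T (rep ` V) \<and> mat_state n H s' \<and> T_arr T s'))"
proof -
  let ?A = "\<lambda>c j s'. \<exists>H T. attach_state H T (merged c j) s'"
  have n: "regs s 10 = n" using M by (simp add: mat_state_def)
  have W1: "Suc n < W" using W by simp
  have tcs: "arrs s 12 (Suc r) = tc r" if "r < n" for r
  proof -
    have "{v \<in> V. lab v = Suc r \<and> v \<in> T0} = {v \<in> V. rep v = r \<and> v \<in> T0}" using lab_eq by auto
    then show ?thesis by (simp add: tc12 tc_def)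
  qed
  have tcW: "tc r < W" for r
  proof -
    have "tc r \<le> card V" unfolding tc_def by (intro card_mono) auto
    then show ?thesis using W by simp
  qed
  have one: "wp W attach_one s' (\<lambda>t s''. t \<le> 10 * n + 40 \<and> ?A c (Suc j) s'')"
    if A: "?A c j s'" and j: "j < n" and c: "c < 2" and r: "regs s' 38 = j" "regs s' 37 = c" and tc': "arrs s' 12 = arrs s 12" for c j s'
  proof -
    obtain H T where S: "attach_state H T (merged c j) s'" using A by auto
    have lw: "lab j < W" using lab_range[OF j] W by simp
    have l': "arrs s' 7 = lab" using S by (simp add: attach_state_def)
    show ?thesis
    proof (cases "lab j = Suc j \<and> cls j = c")
      case False
      have "merged c (Suc j) = merged c j"
        using False by (auto simp: merged_def reps_eq less_Suc_eq)
      then have A': "?A c (Suc j) s'" using A by simp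
      show ?thesis
      proof (cases "lab j = Suc j")
        case True
        then have "cls j \<noteq> c" using False by simp
        then show ?thesis using True A' r l' lw j W tc' tcs[OF j] tcW[of j]
          by (cases "tc j = 1") (simp_all add: attach_one_def wp_simps cls_def)
      next
        case False
        then show ?thesis using A' r l' lw j W by (simp add: attach_one_def wp_simps)
      qed
    next
      case True
      have mS: "merged c (Suc j) = insert j (merged c j)"
        using True j by (auto simp: merged_def reps_eq less_Suc_eq)
      let ?s2 = "set_reg 28 c (set_reg 27 (tc j) (set_reg 26 (Suc j) (set_reg 25 (Suc j) s')))"
      have S2: "attach_state H T (merged c j) ?s2" using S by (simp add: attach_state_def mat_state_def T_arr_def)
      have "wp W attach_rep ?s2 (\<lambda>t s''. t \<le> 10 * n + 30 \<and> (\<exists>H T. attach_state H T (insert j (merged c j)) s''))"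
      proof (rule wp_attach_rep[OF S2 j])
        show "lab j = Suc j" using True by simp
        show "j \<notin> merged c j" using True by (simp add: merged_def)
        \<comment> \<open>In this case the pass is pass 0, in which only components of the same kind
          have been merged.\<close>
        show "\<forall>q \<in> merged c j. tc q \<noteq> 1" if "tc j \<noteq> 1"
          using True that by (auto simp: merged_def cls_def split: if_splits)
      qed (use r W in auto)
      then have "wp W attach_rep ?s2 (\<lambda>t s''. 7 + t \<le> 10 * n + 40 \<and> ?A c (Suc j) s'')"
        unfolding mS by (rule wp_mono) auto
      note main = this
      have lj: "lab j = Suc j" using True by simp
      have tj: "arrs s' 12 (Suc j) = tc j" using tc' tcs[OF j] by simp
      note unf = attach_one_def wp_Seq[of W "Load a b c" for a b c] wp_Seq[of W "Add a b c" for a b c]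
          wp_Seq[of W "Cond a b c" for a b c] wp_Load wp_Add wp_Cond wp_Assign
      show ?thesis
      proof (cases "tc j = 1")
        case t1: True
        then have c1: "c = 1" using True by (simp add: cls_def)
        show ?thesis unfolding unf c1
          using main[unfolded c1] lj tj t1 r(1) r(2)[unfolded c1] l' lw j W by simp
      next
        case t1: False
        then have c0: "c = 0" using True by (simp add: cls_def)
        show ?thesis unfolding unf c0
          using main[unfolded c0] lj tj t1 r(1) r(2)[unfolded c0] l' lw j W tcW[of j] by simp
      qed
    qed
  qed
  have m0: "merged 0 0 = {}" "merged c n = merged (Suc c) 0" "merged 2 0 = rep ` V" for c
  proof -
    show "merged 0 0 = {}" by (simp add: merged_def)
    show "merged c n = merged (Suc c) 0" by (auto simp: merged_def reps_eq less_Suc_eq)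
    show "merged 2 0 = rep ` V" by (auto simp: merged_def cls_def)
  qed
  have init: "?A 0 0 (set_reg 36 0 (set_reg 35 0 s))"
    unfolding m0 by (intro exI[of _ E] exI[of _ T0])
      (use M T l z attach_inv_empty in \<open>auto simp: attach_state_def mat_state_def T_arr_def\<close>)
  have st: "?A c j (set_reg i a s')" if "?A c j s'" "i \<in> {37, 38}" for c j i a s'
  proof -
    have "i \<notin> {10, 35, 36}" using that(2) by auto
    then show ?thesis using that(1) by simp
  qed
  have "wp W attach_all s (\<lambda>t s'. t \<le> 20 * (n * n) + 90 * n + 20 \<and> ?A 2 0 s')"
    unfolding attach_all_def wp_Seq[of W "Assign a b" for a b] wp_Assign
  proof (intro conjI, goal_cases)
    case 3
    show ?case
    proof (rule wp_mono[OF wp_For_const[where c = "(10 * n + 40 + 2) * n + 2" and n = 2 and I = "\<lambda>c. ?A c 0"]], goal_cases)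
      case 6
      then show ?case using init by simp
    next
      case (7 c s')
      then have c: "c < 2" by simp
      have s': "regs s' 10 = n" "arrs s' 12 = arrs s 12" using 7(4) n by (auto simp: frame_def)
      show ?case
      proof (rule wp_mono[OF wp_For_const[where c = "10 * n + 40" and n = n and I = "?A c"]], goal_cases)
        case 6
        then show ?case using \<open>?A c 0 s'\<close> by simp
      next
        case (7 j s2)
        note step = this
        have s2: "regs s2 37 = c" "arrs s2 12 = arrs s 12" using step(4) s' \<open>regs s' 37 = c\<close> by (auto simp: frame_def)
        have "wp W attach_one s2 (\<lambda>t s''. t \<le> 10 * n + 40 \<and> ?A c (Suc j) s'')"
          by (rule one) (use step s2 c s' in auto)
        then show ?case by (rule wp_mono) (use st in blast)
      next
        case (8 t s2)
        then show ?case using s' m0(2)[of c] by simp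
      qed (use s' W in auto)
    next
      case (8 t s')
      have "((10 * n + 40 + 2) * n + 2 + 2) * 2 + 2 + 2 \<le> 20 * (n * n) + 90 * n + 20" by (simp add: algebra_simps)
      then show ?case using 8 by simp
    qed (use W in auto)
  qed (use W in auto)
  then show ?thesis by (rule wp_mono) (auto simp: m0 attach_state_def)
qed

end

section \<open>Matching, exchange and output programs\<close>

definition find_mate :: program where
  "find_mate =
     Assign 44 (Reg 10) ;; Load 29 14 (Reg 43) ;;
     For 45 (Num 0) (Reg 10)
       (Load 27 11 (Reg 45) ;;
        Cond (Equal (Reg 27) (Num 1))
          (Cond (Equal (Reg 45) (Reg 43)) Skip
             (Cond (Equal (Reg 42) (Num 1)) (Assign 44 (Reg 45))
                (Add 28 (Reg 29) (Reg 45) ;; Load 28 16 (Reg 28) ;;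
                 Cond (Equal (Reg 28) (Reg 45)) Skip (Assign 44 (Reg 45))))) Skip)"

definition take_mate :: program where
  "take_mate = toggle 43 44 ;; Store 11 (Reg 43) (Num 0) ;; Store 11 (Reg 44) (Num 0) ;;
     Assign 46 (Reg 43) ;; Assign 47 (Reg 44)"

definition match_one :: program where
  "match_one =
     Load 27 11 (Reg 43) ;;
     Cond (Equal (Reg 27) (Num 1)) (find_mate ;; Cond (Equal (Reg 44) (Reg 10)) Skip take_mate) Skip"

text \<open>Register 42 is 0 while only non-adjacent mates are accepted and 1 afterwards. The vertex
  with the most wrong neighbours goes first: it stays unmatched only if it is adjacent to all other
  wrong vertices, as \<open>stuck_star_exc\<close> requires. When the first phase ends, the
  unmatched vertices form a clique.\<close>

definition match_all :: program where
  "match_all =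
     Assign 42 (Num 0) ;; Assign 43 (Reg 24) ;; match_one ;; For 43 (Num 0) (Reg 10) match_one ;;
     Assign 42 (Num 1) ;; For 43 (Num 0) (Reg 10) match_one"

definition swap_prog :: program where
  "swap_prog = toggle 46 47 ;; toggle 30 31 ;; toggle 46 30 ;; toggle 47 31"

text \<open>Register 21, the answer of the last connectivity check, doubles as success flag, so the
  loops idle after a success. A pair is tried only if arrays 15 and 16 differ there, and a failed
  exchange is undone by repeating it.\<close>

definition try_swap :: program where
  "try_swap =
     Cond (Equal (Reg 21) (Num 0))
      (Cond (Equal (Reg 30) (Reg 46)) Skip (Cond (Equal (Reg 30) (Reg 47)) Skip
      (Cond (Equal (Reg 31) (Reg 46)) Skip (Cond (Equal (Reg 31) (Reg 47)) Skip
        (Load 27 14 (Reg 30) ;; Add 27 (Reg 27) (Reg 31) ;; Load 28 15 (Reg 27) ;; Load 29 16 (Reg 27) ;;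
         Cond (Equal (Reg 28) (Reg 29)) Skip
           (swap_prog ;; conn_check ;; Cond (Equal (Reg 21) (Num 1)) Skip swap_prog)))))) Skip"

definition swap_search :: program where
  "swap_search = For 30 (Num 0) (Reg 10) (For 31 (Num 0) (Reg 10) try_swap)"

text \<open>Where the matrices differ, a current entry equal to the column index belongs to an added
  edge, any other to a deleted one.\<close>

definition output_edge :: program where
  "output_edge =
     Add 26 (Reg 25) (Reg 31) ;; Load 27 15 (Reg 26) ;; Load 28 16 (Reg 26) ;;
     Cond (Equal (Reg 27) (Reg 28)) Skip
       (Cond (Equal (Reg 28) (Reg 31))
          (Store 3 (Reg 1) (Reg 30) ;; Store 4 (Reg 1) (Reg 31) ;; Add 1 (Reg 1) (Num 1))
          (Store 5 (Reg 2) (Reg 30) ;; Store 6 (Reg 2) (Reg 31) ;; Add 2 (Reg 2) (Num 1)))"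

definition output_all :: program where
  "output_all =
     Assign 0 (Num 1) ;; Assign 1 (Num 0) ;; Assign 2 (Num 0) ;;
     For 30 (Num 0) (Reg 10) (Load 25 14 (Reg 30) ;; For 31 (Num 0) (Reg 30) output_edge)"

definition find_third :: program where
  "find_third =
     Assign 48 (Reg 10) ;;
     For 45 (Num 0) (Reg 10)
       (Cond (Equal (Reg 45) (Reg 46)) Skip (Cond (Equal (Reg 45) (Reg 47)) Skip (Assign 48 (Reg 45))))"

lemma wregs_match [simp]:
  "wregs find_mate = {27, 28, 29, 44, 45}" "wregs take_mate = {18, 19, 46, 47}"
  "wregs match_one = {18, 19, 27, 28, 29, 44, 45, 46, 47}"
  "wregs match_all = {18, 19, 27, 28, 29, 42, 43, 44, 45, 46, 47}"
  "wregs swap_prog = {18, 19}"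
  "wregs try_swap = {11, 12, 13, 14, 15, 16, 17, 18, 19, 20, 21, 27, 28, 29}"
  "wregs swap_search = {11, 12, 13, 14, 15, 16, 17, 18, 19, 20, 21, 27, 28, 29, 30, 31}"
  "wregs output_edge = {1, 2, 26, 27, 28}" "wregs find_third = {45, 48}"
  by (auto simp: find_mate_def take_mate_def match_one_def match_all_def swap_prog_def try_swap_def
      swap_search_def output_edge_def find_third_def)

lemma warrs_match [simp]:
  "warrs find_mate = {}" "warrs take_mate = {11, 16}" "warrs match_one = {11, 16}" "warrs match_all = {11, 16}"
  "warrs swap_prog = {16}" "warrs try_swap = {7, 8, 16}" "warrs swap_search = {7, 8, 16}"
  "warrs output_edge = {3, 4, 5, 6}" "warrs find_third = {}"
  by (auto simp: find_mate_def take_mate_def match_one_def match_all_def swap_prog_def try_swap_def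
      swap_search_def output_edge_def find_third_def)

lemma mat_state_set_reg [simp]: "i \<noteq> 10 \<Longrightarrow> mat_state n H (set_reg i a s) \<longleftrightarrow> mat_state n H s"
  by (simp add: mat_state_def)

lemma mat_cell:
  assumes "is_mat n M H" "u < n" "v < n"
  shows "M (u * n + v) = (if {u, v} \<in> H then v else u)"
  using assms by (simp add: is_mat_def)

lemma cell_W:
  assumes "u < n" "v < n" "n * n < (W :: nat)"
  shows "u * n + v < W" "u * n < W" "u < W" "v < W"
  using cell_less[OF assms(1,2)] assms cell_less[OF assms(1), of 0]
  by (auto intro: le_less_trans[of u "u * n"] less_trans)

lemma is_pm_insert:
  assumes N: "is_pm N (S - K)" and uv: "u \<in> K" "v \<in> K" "u \<noteq> v" and K: "K \<subseteq> S"
  shows "is_pm (insert {u, v} N) (S - (K - {u, v}))"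
  unfolding is_pm_def
proof (intro conjI allI ballI impI)
  have out: "x \<notin> K" "y \<notin> K" if "{x, y} \<in> N" for x y using is_pmD(4)[OF N that] by auto
  show "insert {u, v} N \<subseteq> pairs (S - (K - {u, v}))"
  proof
    fix e assume e: "e \<in> insert {u, v} N"
    show "e \<in> pairs (S - (K - {u, v}))"
    proof (cases "e = {u, v}")
      case True
      then show ?thesis using uv K by auto
    next
      case False
      then have eN: "e \<in> N" using e by simp
      then obtain x y where "e = {x, y}" using is_pmD(1)[OF N] by (auto simp: pairs_def)
      then show ?thesis using is_pmD(4)[OF N, of x y] eN by auto
    qed
  qed
  fix x assume x: "x \<in> S - (K - {u, v})"
  show "\<exists>y. {x, y} \<in> insert {u, v} N"
  proof (cases "x \<in> K")
    case True
    then have "x = u \<or> x = v" using x by auto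
    then show ?thesis by (metis insertI1 insert_commute)
  next
    case False
    then show ?thesis using is_pmD(2)[OF N, of x] x by auto
  qed
next
  have out: "x \<notin> K" if "{x, y} \<in> N" for x y using is_pmD(4)[OF N that] by auto
  fix x y z assume xyz: "{x, y} \<in> insert {u, v} N" "{x, z} \<in> insert {u, v} N"
  show "y = z"
  proof (cases "x \<in> K")
    case True
    then have "{x, y} = {u, v}" "{x, z} = {u, v}" using xyz out by blast+
    then show ?thesis by (auto simp: doubleton_eq_iff)
  next
    case False
    then have "{x, y} \<in> N" "{x, z} \<in> N" using xyz uv by (auto simp: doubleton_eq_iff)
    then show ?thesis using is_pmD(3)[OF N] by blast
  qed
qed

lemma wp_swap_prog:
  assumes S: "mat_state n X s" and W: "n * n < W"
    and r: "regs s 46 = a" "regs s 47 = b" "regs s 30 = x" "regs s 31 = y"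
    and lt: "a < n" "b < n" "x < n" "y < n" and ne: "a \<noteq> b" "x \<noteq> y" "a \<noteq> x" "b \<noteq> y"
  shows "wp W swap_prog s (\<lambda>t s'. t = 40 \<and> mat_state n (swap4 X a b x y) s' \<and> frame {18, 19} {16} s s')"
proof -
  have "wp W swap_prog s (\<lambda>t s'. t = 40 \<and> mat_state n (swap4 X a b x y) s')"
    unfolding swap_prog_def
  proof (rule wp_SeqI[OF wp_toggle[OF S W, where a = a and b = b]], goal_cases)
    case (8 t1 s1)
    then have s1: "mat_state n (tog X a b) s1" "t1 = 10" "regs s1 46 = a" "regs s1 47 = b" "regs s1 30 = x" "regs s1 31 = y"
      using r by (auto simp: frame_def)
    show ?case
    proof (rule wp_SeqI[OF wp_toggle[OF s1(1) W, where a = x and b = y]], goal_cases)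
      case (8 t2 s2)
      then have s2: "mat_state n (tog (tog X a b) x y) s2" "t2 = 10" "regs s2 46 = a" "regs s2 47 = b" "regs s2 30 = x" "regs s2 31 = y"
        using s1 by (auto simp: frame_def)
      show ?case
      proof (rule wp_SeqI[OF wp_toggle[OF s2(1) W, where a = a and b = x]], goal_cases)
        case (8 t3 s3)
        then have s3: "mat_state n (tog (tog (tog X a b) x y) a x) s3" "t3 = 10" "regs s3 47 = b" "regs s3 31 = y"
          using s2 by (auto simp: frame_def)
        show ?case
          by (rule wp_mono[OF wp_toggle[OF s3(1) W, where a = b and b = y]])
            (use s1 s2 s3 lt ne in \<open>auto simp: swap4_def\<close>)
      qed (use s2 lt ne in auto)
    qed (use s1 lt ne in auto)
  qed (use r lt ne in auto)
  from wp_frame[OF this] show ?thesis by (rule wp_mono) auto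
qed

lemma swap4_swap4: "swap4 (swap4 X a b x y) a b x y = X"
proof (rule set_eqI)
  have xor: "((((((((P \<noteq> p) \<noteq> q) \<noteq> r) \<noteq> t) \<noteq> p) \<noteq> q) \<noteq> r) \<noteq> t) = P" for P p q r t
    by (cases p; cases q; cases r; cases t; simp)
  show "e \<in> swap4 (swap4 X a b x y) a b x y \<longleftrightarrow> e \<in> X" for e
    unfolding swap4_def tog_iff by (rule xor)
qed

context input_graph
begin

lemma T_arr_set_reg [simp]: "T_arr T (set_reg i a s) \<longleftrightarrow> T_arr T s"
  by (simp add: T_arr_def)

lemma wp_match_one:
  assumes M: "mat_state n X s" and T: "T_arr K s" and K: "K \<subseteq> V" and u: "regs s 43 = u"
    and W: "n * n < W" "Suc n < W"
    and C: "C = {v \<in> K. v \<noteq> u \<and> (regs s 42 = 1 \<or> {u, v} \<notin> X)}"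
  shows "wp W match_one s (\<lambda>t s'. t \<le> 11 * n + 30 \<and>
    (if u \<in> K \<and> C \<noteq> {}
     then \<exists>v\<in>C. mat_state n (tog X u v) s' \<and> T_arr (K - {u, v}) s' \<and> regs s' 46 = u \<and> regs s' 47 = v
     else mat_state n X s' \<and> T_arr K s' \<and> regs s' 46 = regs s 46 \<and> regs s' 47 = regs s 47) \<and>
    frame {18, 19, 27, 28, 29, 44, 45, 46, 47} {11, 16} s s')"
proof -
  have n: "regs s 10 = n" and R: "is_row n (arrs s 14)" and X: "is_mat n (arrs s 16) X"
    using M by (auto simp: mat_state_def)
  have CK: "C \<subseteq> K" using C by auto
  have "wp W match_one s (\<lambda>t s'. t \<le> 11 * n + 30 \<and>
    (if u \<in> K \<and> C \<noteq> {}
     then \<exists>v\<in>C. mat_state n (tog X u v) s' \<and> T_arr (K - {u, v}) s' \<and> regs s' 46 = u \<and> regs s' 47 = v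
     else mat_state n X s' \<and> T_arr K s' \<and> regs s' 46 = regs s 46 \<and> regs s' 47 = regs s 47))"
  proof (cases "u \<in> K")
    case False
    then show ?thesis using M T u W by (simp add: match_one_def wp_simps T_arr_def mat_state_def)
  next
    case uK: True
    have un: "u < n" using uK K by auto
    have uW: "u * n < W" "u < W" using cell_W[OF un un W(1)] by auto
    have Ru: "arrs s 14 u = u * n" using R un by (simp add: is_row_def)
    let ?s1 = "set_reg 27 1 s" and ?s2 = "set_reg 29 (u * n) (set_reg 44 n (set_reg 27 1 s))"
    have find: "wp W find_mate ?s1 (\<lambda>t s'. t \<le> 11 * n + 4 \<and> (if C = {} then regs s' 44 = n else regs s' 44 \<in> C))"
      unfolding find_mate_def wp_Seq[of W "Assign a b" for a b] wp_Seq[of W "Load 29 b c" for b c] wp_Assign wp_Load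
    proof (intro conjI, goal_cases)
      case 3
      show ?case
      proof (rule wp_mono[OF wp_For_const[where c = 9 and n = n and
          I = "\<lambda>j s'. if C \<inter> {..<j} = {} then regs s' 44 = n else regs s' 44 \<in> C"]], goal_cases)
        case (7 j s')
        then have j: "j < n" using n by simp
        have s': "arrs s' 11 j = (if j \<in> K then 1 else 0)" "arrs s' 16 = arrs s 16" "regs s' 43 = u" "regs s' 42 = regs s 42"
          "regs s' 29 = u * n"
          using 7(4) T u Ru by (auto simp: frame_def T_arr_def)
        note cW = cell_W[OF un j W(1)]
        have cell: "arrs s 16 (u * n + j) = (if {u, j} \<in> X then j else u)" using mat_cell[OF X un j] .
        have Suc_int: "C \<inter> {..<Suc j} = (if j \<in> C then insert j (C \<inter> {..<j}) else C \<inter> {..<j})"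
          by (auto simp: lessThan_Suc)
        show ?case
        proof (cases "j \<in> K \<and> j \<noteq> u")
          case False
          then have "j \<notin> C" using C by auto
          then have "C \<inter> {..<Suc j} = C \<inter> {..<j}" using Suc_int by simp
          then show ?thesis using 7(2,3) s' False W by (cases "j \<in> K") (simp_all add: wp_simps)
        next
          case jK: True
          show ?thesis
          proof (cases "j \<in> C")
            case True
            then have "regs s 42 = 1 \<or> {u, j} \<notin> X" using C by simp
            then show ?thesis using 7(2) s' jK W cW cell True
              by (cases "regs s 42 = 1") (simp_all add: wp_simps Suc_int)
          next
            case False
            have "regs s 42 \<noteq> 1" "{u, j} \<in> X" using False jK C by auto
            moreover have "C \<inter> {..<Suc j} = C \<inter> {..<j}" using False Suc_int by simp
            ultimately show ?thesis using 7(2,3) s' jK W cW cell by (simp add: wp_simps)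
          qed
        qed
      next
        case (8 t s')
        have "C \<inter> {..<n} = C" using CK K by auto
        then show ?case using 8 n by (simp split: if_splits)
      qed (use n W in auto)
    qed (use n W u Ru uW in auto)
    note find' = wp_frame[OF find]
    have "wp W (find_mate ;; Cond (Equal (Reg 44) (Reg 10)) Skip take_mate) ?s1 (\<lambda>t s'. 2 + t \<le> 11 * n + 30 \<and>
      (if C \<noteq> {}
       then \<exists>v\<in>C. mat_state n (tog X u v) s' \<and> T_arr (K - {u, v}) s' \<and> regs s' 46 = u \<and> regs s' 47 = v
       else mat_state n X s' \<and> T_arr K s' \<and> regs s' 46 = regs s 46 \<and> regs s' 47 = regs s 47))"
    proof (rule wp_SeqI[OF find'], goal_cases)
      case (1 t2 s2)
      then have t2: "t2 \<le> 11 * n + 4" and fr: "frame {27, 28, 29, 44, 45} {} ?s1 s2" by auto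
      have s2: "mat_state n X s2" "T_arr K s2" "regs s2 43 = u" "regs s2 10 = n"
        "regs s2 46 = regs s 46" "regs s2 47 = regs s 47"
        using fr M T u n by (auto simp: frame_def mat_state_def T_arr_def)
      show ?case
      proof (cases "C = {}")
        case True
        then have "regs s2 44 = n" using 1 by simp
        then show ?thesis using True s2 t2 by (simp add: wp_simps)
      next
        case False
        define v where "v = regs s2 44"
        have vC: "v \<in> C" using 1 False by (simp add: v_def)
        have v: "v < n" "v \<in> K" "v \<noteq> u" using vC C K by auto
        have "wp W take_mate s2 (\<lambda>t s'. t = 14 \<and> mat_state n (tog X u v) s' \<and> T_arr (K - {u, v}) s' \<and> regs s' 46 = u \<and> regs s' 47 = v)"
          unfolding take_mate_def
        proof (rule wp_SeqI[OF wp_toggle[OF s2(1) W(1), where a = u and b = v]], goal_cases)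
          case (8 t3 s3)
          then have "T_arr K s3" "regs s3 43 = u" "regs s3 44 = v" using s2 v_def by (auto simp: frame_def T_arr_def)
          then show ?case using 8 uW(2) v(1) W by (auto simp: wp_simps mat_state_def T_arr_def)
        qed (use s2 un v v_def in auto)
        then have "wp W take_mate s2 (\<lambda>t s'. 2 + (t2 + (1 + t)) \<le> 11 * n + 30 \<and> (\<exists>v\<in>C. mat_state n (tog X u v) s' \<and> T_arr (K - {u, v}) s' \<and> regs s' 46 = u \<and> regs s' 47 = v))"
          by (rule wp_mono) (use t2 vC in auto)
        then show ?thesis using False v v_def s2(4) by (simp add: wp_Cond)
      qed
    qed
    then show ?thesis unfolding match_one_def wp_Seq[of W "Load 27 b c" for b c] wp_Load wp_Cond
      using T u uK W by (simp add: T_arr_def)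
  qed
  from wp_frame[OF this] show ?thesis by (rule wp_mono) auto
qed

text \<open>First phase, with \<open>K\<close> the unmatched vertices. A vertex that found no
  partner is adjacent to all unmatched ones and remains so because \<open>K\<close> only shrinks.
  The last clause is what the initial match of the centre achieves.\<close>

definition match0 :: "nat set set \<Rightarrow> nat set \<Rightarrow> nat \<Rightarrow> nat \<Rightarrow> nat set set \<Rightarrow> nat set \<Rightarrow> bool" where
  "match0 H S c j N K \<longleftrightarrow> K \<subseteq> S \<and> is_pm N (S - K) \<and> finite N \<and> 2 * card N + card K = card S \<and> N \<inter> H = {} \<and>
     (\<forall>u\<in>K. u < j \<longrightarrow> (\<forall>v\<in>K. v \<noteq> u \<longrightarrow> {u, v} \<in> H)) \<and> (c \<in> K \<longrightarrow> (\<forall>v\<in>S - {c}. {c, v} \<in> H))"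

text \<open>Second phase. Unmatched vertices and ends of deleted pairs together stay the clique left
  by the first phase, since a vertex only moves from one kind to the other. The pair ab is the last
  one matched in this phase; if the graph gets disconnected, it is the only deleted one.\<close>

definition match1 :: "nat set set \<Rightarrow> nat set \<Rightarrow> nat \<Rightarrow> nat \<Rightarrow> nat set set \<Rightarrow> nat set \<Rightarrow> nat \<Rightarrow> nat \<Rightarrow> bool" where
  "match1 H S c j N K a b \<longleftrightarrow> K \<subseteq> S \<and> is_pm N (S - K) \<and> finite N \<and> 2 * card N + card K = card S \<and>
     (\<forall>x \<in> K \<union> \<Union>(N \<inter> H). \<forall>y \<in> K \<union> \<Union>(N \<inter> H). x \<noteq> y \<longrightarrow> {x, y} \<in> H) \<and> (\<forall>u\<in>K. j \<le> u) \<and>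
     (c \<in> K \<union> \<Union>(N \<inter> H) \<longrightarrow> (\<forall>v\<in>S - {c}. {c, v} \<in> H)) \<and> (N \<inter> H \<noteq> {} \<longrightarrow> {a, b} \<in> N \<inter> H)"

lemma pm_outside:
  assumes "is_pm N (S - K)" "u \<in> K"
  shows "{u, v} \<notin> N"
  using is_pmD(4)[OF assms(1), of u v] assms(2) by blast

lemma card_remove_pair:
  assumes "finite K" "u \<in> K" "v \<in> K" "u \<noteq> v"
  shows "card K = card (K - {u, v}) + 2"
proof -
  have "card {u, v} \<le> card K" using assms by (intro card_mono) auto
  moreover have "card (K - {u, v}) = card K - card {u, v}" using assms by (intro card_Diff_subset) auto
  ultimately show ?thesis using assms by simp
qed

lemma match0_step:
  assumes I: "match0 H S c j N K" and uv: "u \<in> K" "v \<in> K" "u \<noteq> v" "{u, v} \<notin> H" and S: "finite S"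
  shows "match0 H S c j (insert {u, v} N) (K - {u, v})"
    and "sym_diff H (insert {u, v} N) = tog (sym_diff H N) u v"
proof -
  have N: "is_pm N (S - K)" "K \<subseteq> S" "finite N" using I by (auto simp: match0_def)
  have new: "{u, v} \<notin> N" using pm_outside[OF N(1) uv(1)] .
  have "finite K" using N(2) S finite_subset by blast
  then have c: "card K = card (K - {u, v}) + 2" by (rule card_remove_pair[OF _ uv(1-3)])
  show "match0 H S c j (insert {u, v} N) (K - {u, v})"
    unfolding match0_def
  proof (intro conjI)
    show "is_pm (insert {u, v} N) (S - (K - {u, v}))" by (rule is_pm_insert[OF N(1) uv(1-3) N(2)])
    show "2 * card (insert {u, v} N) + card (K - {u, v}) = card S" using I new c by (simp add: match0_def)
    show "insert {u, v} N \<inter> H = {}" using I uv(4) by (simp add: match0_def)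
    show "K - {u, v} \<subseteq> S" "finite (insert {u, v} N)" using N by auto
    show "\<forall>w\<in>K - {u, v}. w < j \<longrightarrow> (\<forall>v\<in>K - {u, v}. v \<noteq> w \<longrightarrow> {w, v} \<in> H)"
      "c \<in> K - {u, v} \<longrightarrow> (\<forall>v\<in>S - {c}. {c, v} \<in> H)" using I unfolding match0_def by blast+
  qed
  show "sym_diff H (insert {u, v} N) = tog (sym_diff H N) u v" using new by (auto simp: tog_def)
qed

lemma match1_step:
  assumes I: "match1 H S c j N K a b" and uv: "u \<in> K" "v \<in> K" "u \<noteq> v" and S: "finite S"
  shows "match1 H S c j (insert {u, v} N) (K - {u, v}) u v"
    and "sym_diff H (insert {u, v} N) = tog (sym_diff H N) u v"
proof -
  have N: "is_pm N (S - K)" "K \<subseteq> S" "finite N" using I by (auto simp: match1_def)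
  have new: "{u, v} \<notin> N" using pm_outside[OF N(1) uv(1)] .
  have uvH: "{u, v} \<in> H" using I uv by (simp add: match1_def)
  have U: "(K - {u, v}) \<union> \<Union>(insert {u, v} N \<inter> H) = K \<union> \<Union>(N \<inter> H)" using uvH uv by auto
  have "finite K" using N(2) S finite_subset by blast
  then have c: "card K = card (K - {u, v}) + 2" by (rule card_remove_pair[OF _ uv])
  show "match1 H S c j (insert {u, v} N) (K - {u, v}) u v"
    unfolding match1_def U
  proof (intro conjI)
    show "is_pm (insert {u, v} N) (S - (K - {u, v}))" by (rule is_pm_insert[OF N(1) uv N(2)])
    show "2 * card (insert {u, v} N) + card (K - {u, v}) = card S" using I new c by (simp add: match1_def)
    show "insert {u, v} N \<inter> H \<noteq> {} \<longrightarrow> {u, v} \<in> insert {u, v} N \<inter> H" using uvH by simp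
  qed (use I in \<open>auto simp: match1_def\<close>)
  show "sym_diff H (insert {u, v} N) = tog (sym_diff H N) u v" using new by (auto simp: tog_def)
qed

lemma wp_match_all:
  assumes M: "mat_state n H s" and T: "T_arr S s" and S: "S \<subseteq> V" "even (card S)"
    and W: "n * n < W" "Suc n < W" "regs s 24 < W"
  shows "wp W match_all s (\<lambda>t s'. t \<le> 22 * (n * n) + 80 * n + 50 \<and>
    (\<exists>N. is_pm N S \<and> 2 * card N = card S \<and> finite N \<and> mat_state n (sym_diff H N) s' \<and>
       (\<forall>x y. x \<in> \<Union>(N \<inter> H) \<longrightarrow> y \<in> \<Union>(N \<inter> H) \<longrightarrow> x \<noteq> y \<longrightarrow> {x, y} \<in> H) \<and>
       (regs s 24 \<in> \<Union>(N \<inter> H) \<longrightarrow> (\<forall>v\<in>S - {regs s 24}. {regs s 24, v} \<in> H)) \<and>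
       (N \<inter> H \<noteq> {} \<longrightarrow> {regs s' 46, regs s' 47} \<in> N \<inter> H)) \<and>
    frame {18, 19, 27, 28, 29, 42, 43, 44, 45, 46, 47} {11, 16} s s')"
proof -
  have n: "regs s 10 = n" using M by (simp add: mat_state_def)
  have finS: "finite S" using S finite_subset by blast
  let ?c = "regs s 24"
  let ?A0 = "\<lambda>j s'. \<exists>N K. match0 H S ?c j N K \<and> mat_state n (sym_diff H N) s' \<and> T_arr K s' \<and> regs s' 42 = 0"
  let ?A1 = "\<lambda>j s'. \<exists>N K. match1 H S ?c j N K (regs s' 46) (regs s' 47) \<and> mat_state n (sym_diff H N) s' \<and> T_arr K s' \<and> regs s' 42 = 1"
  have step0: "wp W match_one s' (\<lambda>t s''. t \<le> 11 * n + 30 \<and> ?A0 (Suc j) s'')"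
    if A: "?A0 j s'" and j: "regs s' 43 = j" for j s'
  proof -
    obtain N K where I: "match0 H S ?c j N K" and m: "mat_state n (sym_diff H N) s'" "T_arr K s'" "regs s' 42 = 0"
      using A by auto
    have NK: "is_pm N (S - K)" "K \<subseteq> S" using I by (auto simp: match0_def)
    have KV: "K \<subseteq> V" using NK S by auto
    define C where "C = {v \<in> K. v \<noteq> j \<and> (regs s' 42 = 1 \<or> {j, v} \<notin> sym_diff H N)}"
    show ?thesis
    proof (rule wp_mono[OF wp_match_one[OF m(1,2) KV j W(1,2) C_def]], goal_cases)
      case (1 t s'')
      then have t: "t \<le> 11 * n + 30" and r42: "regs s'' 42 = 0" using m by (auto simp: frame_def)
      show ?case
      proof (cases "j \<in> K \<and> C \<noteq> {}")
        case True
        then obtain v where v: "v \<in> C" "mat_state n (tog (sym_diff H N) j v) s''" "T_arr (K - {j, v}) s''" using 1 by auto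
        have jv: "j \<in> K" "v \<in> K" "j \<noteq> v" "{j, v} \<notin> H"
          using v(1) True m(3) pm_outside[OF NK(1), of j v] by (auto simp: C_def)
        note st = match0_step[OF I jv finS]
        have "match0 H S ?c (Suc j) (insert {j, v} N) (K - {j, v})"
          using st(1) by (auto simp: match0_def less_Suc_eq)
        then show ?thesis using t r42 v st(2) by metis
      next
        case False
        then have m'': "mat_state n (sym_diff H N) s''" "T_arr K s''" using 1 by auto
        have "{j, v} \<in> H" if "j \<in> K" "v \<in> K" "v \<noteq> j" for v
          using False that m(3) pm_outside[OF NK(1) that(1), of v] by (auto simp: C_def)
        then have "match0 H S ?c (Suc j) N K" using I by (auto simp: match0_def less_Suc_eq)
        then show ?thesis using t r42 m'' by auto
      qed
    qed
  qed
  have step1: "wp W match_one s' (\<lambda>t s''. t \<le> 11 * n + 30 \<and> ?A1 (Suc j) s'')"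
    if A: "?A1 j s'" and j: "regs s' 43 = j" for j s'
  proof -
    obtain N K where I: "match1 H S ?c j N K (regs s' 46) (regs s' 47)"
      and m: "mat_state n (sym_diff H N) s'" "T_arr K s'" "regs s' 42 = 1" using A by auto
    have NK: "is_pm N (S - K)" "K \<subseteq> S" "2 * card N + card K = card S" using I by (auto simp: match1_def)
    have KV: "K \<subseteq> V" and finK: "finite K" using NK S finS finite_subset by auto
    define C where "C = {v \<in> K. v \<noteq> j \<and> (regs s' 42 = 1 \<or> {j, v} \<notin> sym_diff H N)}"
    have C: "C = K - {j}" using m(3) by (auto simp: C_def)
    show ?thesis
    proof (rule wp_mono[OF wp_match_one[OF m(1,2) KV j W(1,2) C_def]], goal_cases)
      case (1 t s'')
      then have t: "t \<le> 11 * n + 30" and r42: "regs s'' 42 = 1" using m by (auto simp: frame_def)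
      show ?case
      proof (cases "j \<in> K")
        case True
        \<comment> \<open>Any other unmatched vertex is admissible now, and there is one because the
          number of unmatched vertices is even.\<close>
        have "C \<noteq> {}"
        proof
          assume "C = {}"
          then have "K = {j}" using True C by auto
          then have "card S = 2 * card N + 1" using NK(3) by simp
          then show False using S(2) by simp
        qed
        then obtain v where v: "v \<in> C" "mat_state n (tog (sym_diff H N) j v) s''" "T_arr (K - {j, v}) s''"
          "regs s'' 46 = j" "regs s'' 47 = v" using 1 True by auto
        have jv: "v \<in> K" "j \<noteq> v" using v(1) C by auto
        note st = match1_step[OF I True jv finS]
        have "match1 H S ?c (Suc j) (insert {j, v} N) (K - {j, v}) (regs s'' 46) (regs s'' 47)"
        proof -
          have "\<forall>u\<in>K - {j, v}. Suc j \<le> u" using I by (auto simp: match1_def Suc_le_eq le_neq_implies_less)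
          then show ?thesis using st(1) unfolding v(4,5) match1_def by (elim conjE) (intro conjI; assumption)
        qed
        then show ?thesis using t r42 v(2,3) st(2) by metis
      next
        case False
        then have m'': "mat_state n (sym_diff H N) s''" "T_arr K s''" "regs s'' 46 = regs s' 46" "regs s'' 47 = regs s' 47"
          using 1 by auto
        have ge: "\<forall>u\<in>K. j \<le> u" using I by (simp add: match1_def)
        have "\<forall>u\<in>K. Suc j \<le> u"
        proof
          fix u assume "u \<in> K"
          then have "j \<le> u" "j \<noteq> u" using ge False by auto
          then show "Suc j \<le> u" by simp
        qed
        then have "match1 H S ?c (Suc j) N K (regs s'' 46) (regs s'' 47)"
          using I m''(3,4) unfolding match1_def by simp
        then show ?thesis using t r42 m'' by blast
      qed
    qed
  qed
  let ?s0 = "set_reg 43 ?c (set_reg 42 0 s)"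
  have first: "wp W match_one ?s0 (\<lambda>t s'. t \<le> 11 * n + 30 \<and> ?A0 0 s' \<and> frame {18, 19, 27, 28, 29, 44, 45, 46, 47} {11, 16} ?s0 s')"
  proof -
    have m: "mat_state n H ?s0" "T_arr S ?s0" using M T by auto
    have c43: "regs ?s0 43 = ?c" by simp
    define C where "C = {v \<in> S. v \<noteq> ?c \<and> (regs ?s0 42 = 1 \<or> {?c, v} \<notin> H)}"
    have "is_pm {} (S - S)" by (simp add: is_pm_def)
    then have base: "match0 H S d 0 {} S" if "d \<notin> S \<or> (\<forall>v\<in>S - {d}. {d, v} \<in> H)" for d
      using that by (auto simp: match0_def)
    show ?thesis
    proof (rule wp_mono[OF wp_match_one[OF m S(1) c43 W(1,2) C_def]], goal_cases)
      case (1 t s')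
      then have r42: "regs s' 42 = 0" by (auto simp: frame_def)
      show ?case
      proof (cases "?c \<in> S \<and> C \<noteq> {}")
        case True
        then obtain v where v: "v \<in> C" "mat_state n (tog H ?c v) s'" "T_arr (S - {?c, v}) s'" using 1 by auto
        have cv: "v \<in> S" "?c \<noteq> v" "{?c, v} \<notin> H" using v(1) by (auto simp: C_def)
        \<comment> \<open>The clause on the centre may fail before the centre is matched. The step
          lemma is therefore applied with a dummy centre outside \<open>S\<close>; afterwards the
          true centre is no longer unmatched and its clause holds trivially.\<close>
        have b: "match0 H S (Suc (Max (insert 0 S))) 0 {} S"
        proof (rule base)
          have "x \<le> Max (insert 0 S)" if "x \<in> S" for x using finS that by simp
          then show "Suc (Max (insert 0 S)) \<notin> S \<or> (\<forall>v\<in>S - {Suc (Max (insert 0 S))}. {Suc (Max (insert 0 S)), v} \<in> H)"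
            by (meson Suc_n_not_le_n)
        qed
        have "?c \<in> S" using True by simp
        note st = match0_step[OF b this cv(1,2,3) finS]
        have "match0 H S ?c 0 (insert {?c, v} {}) (S - {?c, v})" using st(1) by (auto simp: match0_def)
        then show ?thesis using 1 r42 v(2,3) st(2) by (metis Diff_empty empty_Diff sup_bot.right_neutral)
      next
        case False
        then have "?c \<notin> S \<or> (\<forall>v\<in>S - {?c}. {?c, v} \<in> H)" by (auto simp: C_def)
        from base[OF this] show ?thesis using 1 False r42 by (auto intro!: exI[of _ "{}"] exI[of _ S])
      qed
    qed
  qed
  have reg0: "?A0 j (set_reg 43 x s')" if "?A0 j s'" for j x s' using that by simp
  have reg1: "?A1 j (set_reg 43 x s')" if "?A1 j s'" for j x s' using that by simp
  have "wp W match_all s (\<lambda>t s'. t \<le> 22 * (n * n) + 80 * n + 50 \<and> ?A1 n s')"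
    unfolding match_all_def wp_Seq[of W "Assign 42 (Num 0)"] wp_Seq[of W "Assign 43 b" for b] wp_Assign val.simps regs_set_reg
  proof (intro conjI, goal_cases)
    case 3
    have e: "((regs s)(42 := 0)) 24 = ?c" by simp
    show ?case unfolding e
    proof (rule wp_SeqI[OF first], goal_cases)
      case (1 t1 s1)
      then have t1: "t1 \<le> 11 * n + 30" and A: "?A0 0 s1" and n1: "regs s1 10 = n" using n by (auto simp: frame_def)
      show ?case
      proof (rule wp_SeqI[OF wp_For_const[where c = "11 * n + 30" and n = n and I = ?A0]], goal_cases)
        case 6
        then show ?case using reg0[OF A] .
      next
        case (7 j s2)
        then show ?case using step0[of j s2] reg0 by (auto elim!: wp_mono)
      next
        case (8 t2 s2)
        then have t2: "t2 \<le> (11 * n + 30 + 2) * n + 2" and A2: "?A0 n s2" using n1 by simp_all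
        have n2: "regs s2 10 = n" using 8 n1 by (simp add: frame_def)
        obtain N K where I: "match0 H S ?c n N K" and m: "mat_state n (sym_diff H N) s2" "T_arr K s2" using A2 by auto
        have KV: "K \<subseteq> V" using I S by (auto simp: match0_def)
        \<comment> \<open>All unmatched vertices are below n and have been visited, so they form a
          clique; no pair has been deleted yet, so nothing is asked of the last pair.\<close>
        have "match1 H S ?c 0 N K (regs s2 46) (regs s2 47)"
          using I KV unfolding match0_def match1_def by auto
        then have A3: "?A1 0 (set_reg 43 0 (set_reg 42 1 s2))" using m by auto
        show ?case unfolding wp_Seq wp_Assign
        proof (intro conjI, goal_cases)
          case 2
          show ?case
          proof (rule wp_mono[OF wp_For_const[where c = "11 * n + 30" and n = n and I = ?A1]], goal_cases)
            case 6
            then show ?case using A3 by simp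
          next
            case (7 j s3)
            then show ?case using step1[of j s3] reg1 by (auto elim!: wp_mono)
          next
            case (8 t3 s3)
            have "1 + (1 + (t1 + (t2 + (1 + t3)))) \<le> 22 * (n * n) + 80 * n + 50"
              using t1 t2 8 by (simp add: algebra_simps)
            then show ?case using 8 n2 by auto
          qed (use n2 W in auto)
        qed (use W in auto)
      qed (use n1 W in auto)
    qed
  qed (use W in auto)
  from wp_frame[OF this] show ?thesis
  proof (rule wp_mono, goal_cases)
    case (1 t s')
    then obtain N K where I: "match1 H S ?c n N K (regs s' 46) (regs s' 47)" and m: "mat_state n (sym_diff H N) s'" by auto
    have "\<forall>u\<in>K. n \<le> u" "K \<subseteq> S" using I by (auto simp: match1_def)
    then have "K = {}" using S by fastforce
    then show ?case using 1 I m by (intro conjI exI[of _ N]) (auto simp: match1_def)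
  qed
qed

end

lemma outputs_edges_push:
  assumes F: "outputs_edges s r a b F" and fin: "finite F" and new: "{x, y} \<notin> F"
    and s': "regs s' r = Suc (regs s r)" "arrs s' a = (arrs s a)(regs s r := x)" "arrs s' b = (arrs s b)(regs s r := y)"
  shows "outputs_edges s' r a b (insert {x, y} F)"
proof -
  have "F = (\<lambda>i. {arrs s a i, arrs s b i}) ` {..<regs s r}" "card F = regs s r"
    using F by (auto simp: outputs_edges_def)
  moreover have "(\<lambda>i. {arrs s' a i, arrs s' b i}) ` {..<regs s r} = (\<lambda>i. {arrs s a i, arrs s b i}) ` {..<regs s r}"
    using s' by (intro image_cong) auto
  ultimately show ?thesis using fin new s' by (simp add: outputs_edges_def lessThan_Suc)
qed

lemma outputs_edges_cong:
  assumes "outputs_edges s r a b F" "regs s' r = regs s r" "arrs s' a = arrs s a" "arrs s' b = arrs s b"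
  shows "outputs_edges s' r a b F"
  using assms(1) unfolding outputs_edges_def assms(2-4) .

lemma outputs_edges_set_reg [simp]:
  "k \<noteq> r \<Longrightarrow> outputs_edges (set_reg k z s) r a b F \<longleftrightarrow> outputs_edges s r a b F"
  by (simp add: outputs_edges_def)

text \<open>The pairs already visited when the output loop is in row \<open>j\<close> before column
  \<open>i\<close>. Only columns below the row are scanned, so every unordered pair is listed
  once.\<close>

definition lower_pairs :: "nat \<Rightarrow> nat \<Rightarrow> nat set set" where
  "lower_pairs j i = {{u, v} | u v. v < u \<and> (u < j \<or> (u = j \<and> v < i))}"

lemma lower_pairs_simps:
  "lower_pairs 0 0 = {}" "lower_pairs (Suc j) 0 = lower_pairs j j"
  "i < j \<Longrightarrow> lower_pairs j (Suc i) = insert {j, i} (lower_pairs j i)"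
  "i < j \<Longrightarrow> {j, i} \<notin> lower_pairs j i" "pairs {..<n} = lower_pairs n 0"
proof -
  show "lower_pairs 0 0 = {}" by (simp add: lower_pairs_def)
  show "lower_pairs (Suc j) 0 = lower_pairs j j" unfolding lower_pairs_def by (auto simp: less_Suc_eq)
  show "i < j \<Longrightarrow> lower_pairs j (Suc i) = insert {j, i} (lower_pairs j i)"
    unfolding lower_pairs_def by (auto simp: less_Suc_eq)
  show "i < j \<Longrightarrow> {j, i} \<notin> lower_pairs j i"
    unfolding lower_pairs_def by (auto simp: doubleton_eq_iff)
  show "pairs {..<n} = lower_pairs n 0"
  proof (intro equalityI subsetI)
    fix e assume "e \<in> pairs {..<n}"
    then obtain u v where e: "e = {u, v}" "u < n" "v < n" "u \<noteq> v" by (auto simp: pairs_def)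
    show "e \<in> lower_pairs n 0"
    proof (cases "v < u")
      case True
      then show ?thesis using e unfolding lower_pairs_def by blast
    next
      case False
      then have "e = {v, u}" "u < v" using e by auto
      then show ?thesis using e(3) unfolding lower_pairs_def by blast
    qed
  qed (auto simp: lower_pairs_def)
qed

lemma card_pairs_le: "card (pairs {..<n}) \<le> n * n"
proof -
  have "pairs {..<n} \<subseteq> (\<lambda>(u, v). {u, v}) ` ({..<n} \<times> {..<n})" by (auto simp: pairs_def image_iff)
  then have "card (pairs {..<n}) \<le> card ((\<lambda>(u, v). {u, v}) ` ({..<n} \<times> {..<n}))" by (intro card_mono) auto
  also have "\<dots> \<le> card ({..<n} \<times> {..<n})" by (intro card_image_le) auto
  finally show ?thesis by simp
qed

lemma dg_row:
  assumes "F \<subseteq> pairs V"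
  shows "dg F v = card {u \<in> V. {v, u} \<in> F}"
proof -
  have "{e \<in> F. v \<in> e} = (\<lambda>u. {v, u}) ` {u \<in> V. {v, u} \<in> F}"
  proof (intro equalityI subsetI)
    fix e assume e: "e \<in> {e \<in> F. v \<in> e}"
    then obtain x y where xy: "e = {x, y}" "x \<in> V" "y \<in> V" using assms by (auto simp: pairs_def)
    then have "e = {v, if v = x then y else x}" using e by auto
    then show "e \<in> (\<lambda>u. {v, u}) ` {u \<in> V. {v, u} \<in> F}" using e xy by (auto split: if_splits)
  qed auto
  moreover have "inj_on (\<lambda>u. {v, u}) {u \<in> V. {v, u} \<in> F}" by (auto simp: inj_on_def doubleton_eq_iff)
  ultimately show ?thesis unfolding dg_def by (simp add: card_image)
qed

lemma odd_dg_pm: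
  assumes "is_pm N S"
  shows "odd (dg N v) \<longleftrightarrow> v \<in> S"
proof (cases "v \<in> S")
  case True
  then obtain y where y: "{v, y} \<in> N" using is_pmD(2)[OF assms] by auto
  have "{u \<in> S. {v, u} \<in> N} = {y}"
    using y is_pmD(3)[OF assms, of v] is_pmD(4)[OF assms y] by blast
  then show ?thesis using True dg_row[OF is_pmD(1)[OF assms], of v] by simp
next
  case False
  then have "{u \<in> S. {v, u} \<in> N} = {}" using is_pmD(4)[OF assms, of v] by blast
  then have "dg N v = 0" unfolding dg_row[OF is_pmD(1)[OF assms], of v] by (simp only: card.empty)
  then show ?thesis using False by simp
qed

lemma finite_tog: "finite F \<Longrightarrow> finite (tog F x y)"
  by (simp add: tog_def)

lemma odd_dg_swap4:
  assumes "finite F" "a \<noteq> b" "x \<noteq> y" "x \<notin> {a, b}" "y \<notin> {a, b}"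
  shows "odd (dg (swap4 F a b x y) v) \<longleftrightarrow> odd (dg F v)"
  unfolding swap4_def using assms by (simp add: odd_dg_tog finite_tog) blast

lemma odd_dg_triangle:
  assumes "finite F" "a \<noteq> b" "w \<noteq> a" "w \<noteq> b"
  shows "odd (dg (tog (tog (tog F a b) a w) w b) v) \<longleftrightarrow> odd (dg F v)"
  using assms by (simp add: odd_dg_tog finite_tog) blast

lemma cost_sum: "(\<Sum>j = 0..<n. (14 * n + c * f j + 2) + 2) = (14 * n + 4) * n + c * (\<Sum>j<n. f j)"
  for f :: "nat \<Rightarrow> nat"
proof -
  have "(\<Sum>j = 0..<n. (14 * n + c * f j + 2) + 2) = (\<Sum>j<n. (14 * n + 4) + c * f j)"
    by (intro sum.cong) auto
  also have "\<dots> = (\<Sum>j<n. 14 * n + 4) + (\<Sum>j<n. c * f j)" by (rule sum.distrib)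
  finally show ?thesis by (simp add: sum_distrib_left algebra_simps)
qed

definition finish :: program where
  "finish =
     conn_check ;;
     Cond (Equal (Reg 21) (Num 1)) output_all
       (swap_search ;;
        Cond (Equal (Reg 21) (Num 1)) output_all
          (find_third ;;
           Cond (Equal (Reg 48) (Reg 10)) (Assign 0 (Num 0))
             (toggle 46 47 ;; toggle 46 48 ;; toggle 48 47 ;; output_all)))"

text \<open>Without wrong vertices the invariant \<open>center_ok\<close> says nothing about
  register 24, so it is reset unless it is a vertex; this keeps its value below the word bound for
  the matching.\<close>

definition optimize :: program where
  "optimize =
     prep ;; Load 25 9 (Reg 22) ;;
     Cond (Equal (Reg 25) (Num 1)) (Assign 0 (Num 0))
       (build_rows ;; build_matrix ;; attach_all ;;
        Cond (Less (Reg 24) (Reg 10)) Skip (Assign 24 (Num 0)) ;; match_all ;; finish)"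

context input_graph
begin

text \<open>The quadratic cost of exchange, check and undoing is charged only to toggled pairs;
  every other pair costs a constant.\<close>

lemma wp_try_swap:
  assumes M: "mat_state n Y s" and E15: "is_mat n (arrs s 15) E" and W: "n * n < W" "Suc n < W"
    and r: "regs s 46 = a" "regs s 47 = b" "regs s 30 = x" "regs s 31 = y" "regs s 21 = 0"
    and lt: "a < n" "b < n" "x < n" "y < n" "a \<noteq> b"
  shows "wp W try_swap s (\<lambda>t s'. t \<le> 12 + (if {x, y} \<in> sym_diff E Y then 11 * (n * n) + 40 * n + 130 else 0) \<and>
    (if {x, y} \<in> sym_diff E Y \<and> x \<notin> {a, b} \<and> y \<notin> {a, b} \<and> conn V (swap4 Y a b x y)
     then regs s' 21 = 1 \<and> mat_state n (swap4 Y a b x y) s' else regs s' 21 = 0 \<and> mat_state n Y s'))"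
proof (cases "x \<notin> {a, b} \<and> y \<notin> {a, b}")
  case False
  then show ?thesis using r M by (auto simp: try_swap_def wp_simps)
next
  case ok: True
  have R: "arrs s 14 x = x * n" and Y: "is_mat n (arrs s 16) Y" and n: "regs s 10 = n"
    using M lt by (auto simp: mat_state_def is_row_def)
  note cW = cell_W[OF lt(3,4) W(1)]
  have c15: "arrs s 15 (x * n + y) = (if {x, y} \<in> E then y else x)" using mat_cell[OF E15 lt(3,4)] .
  have c16: "arrs s 16 (x * n + y) = (if {x, y} \<in> Y then y else x)" using mat_cell[OF Y lt(3,4)] .
  have cells: "arrs s 15 (x * n + y) < W" "arrs s 16 (x * n + y) < W" using c15 c16 cW by auto
  have loops: "{x} \<notin> E" "{x} \<notin> Y"
    using subsetD[OF E_pairs, of "{x}"] Y subsetD[of Y "pairs V" "{x}"] by (auto simp: is_mat_def)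
  have diff: "arrs s 15 (x * n + y) \<noteq> arrs s 16 (x * n + y) \<longleftrightarrow> {x, y} \<in> sym_diff E Y"
    using c15 c16 loops by (cases "x = y") auto
  note unf = try_swap_def wp_Cond wp_Seq[of W "Load a b c" for a b c] wp_Seq[of W "Add a b c" for a b c] wp_Load wp_Add
  let ?s1 = "set_reg 29 (arrs s 16 (x * n + y)) (set_reg 28 (arrs s 15 (x * n + y)) (set_reg 27 (x * n + y) (set_reg 27 (x * n) s)))"
  show ?thesis
  proof (cases "{x, y} \<in> sym_diff E Y")
    case False
    then have "arrs s 15 (x * n + y) = arrs s 16 (x * n + y)" using diff by blast
    then show ?thesis unfolding unf using False ok r M R cW cells by (simp add: wp_Skip)
  next
    case True
    have ne: "arrs s 15 (x * n + y) \<noteq> arrs s 16 (x * n + y)" using True diff by blast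
    have xy: "x \<noteq> y" using True loops by auto
    have dist: "a \<noteq> x" "b \<noteq> y" using ok by auto
    have M1: "mat_state n Y ?s1" using M by simp
    let ?Z = "swap4 Y a b x y"
    have sw: "wp W (swap_prog ;; conn_check ;; Cond (Equal (Reg 21) (Num 1)) Skip swap_prog) ?s1
      (\<lambda>t s'. t \<le> 11 * (n * n) + 40 * n + 130 \<and> (if conn V ?Z then regs s' 21 = 1 \<and> mat_state n ?Z s'
        else regs s' 21 = 0 \<and> mat_state n Y s'))"
    proof (rule wp_SeqI[OF wp_swap_prog[OF M1 W(1), where a = a and b = b and x = x and y = y]], goal_cases)
      case (13 t2 s2)
      then have s2: "mat_state n ?Z s2" "t2 = 40" "regs s2 46 = a" "regs s2 47 = b" "regs s2 30 = x" "regs s2 31 = y"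
        using r by (auto simp: frame_def)
      show ?case
      proof (rule wp_SeqI[OF wp_conn_check[OF s2(1) W]], goal_cases)
        case (1 t3 s3)
        then have s3: "mat_state n ?Z s3" "t3 \<le> 11 * (n * n) + 40 * n + 40" "regs s3 21 = (if conn V ?Z then 1 else 0)"
          "regs s3 46 = a" "regs s3 47 = b" "regs s3 30 = x" "regs s3 31 = y"
          using s2 by (auto simp: frame_def)
        show ?case
        proof (cases "conn V ?Z")
          case True
          then show ?thesis using s2 s3 by (simp add: wp_Cond wp_Skip)
        next
          case False
          have "wp W swap_prog s3 (\<lambda>t s'. t = 40 \<and> mat_state n Y s' \<and> regs s' 21 = 0)"
          proof (rule wp_mono[OF wp_swap_prog[OF s3(1) W(1), where a = a and b = b and x = x and y = y]], goal_cases)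
            case (13 t s')
            then show ?case using s3 False by (simp add: swap4_swap4 frame_def)
          qed (use s3 lt xy dist in auto)
          then have "wp W swap_prog s3 (\<lambda>t s'. t2 + (t3 + (1 + t)) \<le> 11 * (n * n) + 40 * n + 130 \<and>
            regs s' 21 = 0 \<and> mat_state n Y s')"
            by (rule wp_mono) (use s2 s3 in auto)
          then show ?thesis using False s3(3) by (simp add: wp_Cond)
        qed
      qed
    qed (use r lt xy dist in auto)
    have "wp W (swap_prog ;; conn_check ;; Cond (Equal (Reg 21) (Num 1)) Skip swap_prog) ?s1
      (\<lambda>t s'. 10 + t \<le> 12 + (11 * (n * n) + 40 * n + 130) \<and> (if conn V ?Z then regs s' 21 = 1 \<and> mat_state n ?Z s'
        else regs s' 21 = 0 \<and> mat_state n Y s'))"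
      by (rule wp_mono[OF sw]) simp
    then show ?thesis unfolding unf using True ok ne r R cW cells by (simp del: Un_iff Diff_iff)
  qed
qed

text \<open>At most 2n pairs are toggled and each is met in both orientations, so there are at most
  4n connectivity checks. This gives the leading constant 44 from the 11 of a single check.\<close>

lemma wp_swap_search:
  assumes M: "mat_state n X s" and E15: "is_mat n (arrs s 15) E" and W: "n * n < W" "Suc n < W"
    and r: "regs s 46 = a" "regs s 47 = b" "regs s 21 = 0" and lt: "a < n" "b < n" "a \<noteq> b"
    and F: "F = sym_diff E X" "card F \<le> 2 * n"
  shows "wp W swap_search s (\<lambda>t s'. t \<le> 44 * (n * n * n) + 180 * (n * n) + 530 * n + 2 \<and>
    ((regs s' 21 = 1 \<and> (\<exists>x y. {x, y} \<in> F \<and> x \<notin> {a, b} \<and> y \<notin> {a, b} \<and> conn V (swap4 X a b x y) \<and>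
        mat_state n (swap4 X a b x y) s')) \<or>
     (regs s' 21 = 0 \<and> mat_state n X s' \<and>
        (\<forall>x y. {x, y} \<in> F \<longrightarrow> x \<notin> {a, b} \<longrightarrow> y \<notin> {a, b} \<longrightarrow> \<not> conn V (swap4 X a b x y)))))"
proof -
  let ?CC = "11 * (n * n) + 40 * n + 130"
  have n: "regs s 10 = n" and XV: "X \<subseteq> pairs V" using M by (auto simp: mat_state_def is_mat_def)
  have FV: "F \<subseteq> pairs V" using F(1) XV E_pairs by blast
  let ?ok = "\<lambda>s'. regs s' 21 = 1 \<and> (\<exists>x y. {x, y} \<in> F \<and> x \<notin> {a, b} \<and> y \<notin> {a, b} \<and> conn V (swap4 X a b x y) \<and>
        mat_state n (swap4 X a b x y) s')"
  let ?bad = "\<lambda>j i s'. regs s' 21 = 0 \<and> mat_state n X s' \<and>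
    (\<forall>x y. x < j \<or> (x = j \<and> y < i) \<longrightarrow> {x, y} \<in> F \<longrightarrow> x \<notin> {a, b} \<longrightarrow> y \<notin> {a, b} \<longrightarrow> \<not> conn V (swap4 X a b x y))"
  let ?I = "\<lambda>j i s'. ?ok s' \<or> ?bad j i s'"
  have upd: "?I j i (set_reg k z s')" if "?I j i s'" "k \<in> {30, 31}" for j i k z s'
  proof -
    have "k \<noteq> 10" "k \<noteq> 21" using that(2) by auto
    then show ?thesis using that(1) by simp
  qed
  have FVn: "y < n" if "{x, y} \<in> F" for x y using FV that by auto
  have inner: "wp W (For 31 (Num 0) (Reg 10) try_swap) s1
      (\<lambda>t s'. t \<le> 14 * n + ?CC * dg F j + 2 \<and> ?I (Suc j) 0 s')"
    if A: "?I j 0 s1" and s1: "regs s1 30 = j" "j < n" "regs s1 10 = n" "regs s1 46 = a" "regs s1 47 = b" "is_mat n (arrs s1 15) E" for j s1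
  proof -
    let ?c = "\<lambda>i. 12 + (if {j, i} \<in> F then ?CC else 0)"
    have "wp W (For 31 (Num 0) (Reg 10) try_swap) s1 (\<lambda>t s'. t \<le> (\<Sum>i = val s1 (Num 0)..<val s1 (Reg 10). ?c i + 2) + 2 \<and>
      ?I j (val s1 (Reg 10)) s' \<and> regs s' 31 = val s1 (Reg 10) \<and> frame (insert 31 (wregs try_swap)) (warrs try_swap) s1 s')"
    proof (rule wp_For[where c = ?c and I = "?I j"], goal_cases)
      case 5
      then show ?case using upd[OF A, of 31] by simp
    next
      case (6 i s2)
      then have i: "i < n" using s1 by simp
      have s2: "regs s2 46 = a" "regs s2 47 = b" "regs s2 30 = j" "is_mat n (arrs s2 15) E"
        using 6(5) s1 by (auto simp: frame_def)
      from 6(4) show ?case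
      proof
        assume ok: "?ok s2"
        have "wp W try_swap s2 (\<lambda>t s''. t = 2 \<and> s'' = s2)" using ok by (simp add: try_swap_def wp_simps)
        then show ?case
        proof (rule wp_mono, goal_cases)
          case (1 t s3)
          then have "?I j (Suc i) s3" using ok by simp
          then have "?I j (Suc i) (set_reg 31 (Suc i) s3)" by (rule upd) simp
          moreover have "t \<le> ?c i" using 1 by simp
          ultimately show ?case by (rule conjI[rotated])
        qed
      next
        assume bad: "?bad j i s2"
        show ?case
        proof (rule wp_mono[OF wp_try_swap[where Y = X and a = a and b = b and x = j and y = i]], goal_cases)
          case (15 t s3)
          have t: "t \<le> ?c i" using 15 unfolding F(1) by blast
          have "?I j (Suc i) s3"
          proof (cases "{j, i} \<in> F \<and> j \<notin> {a, b} \<and> i \<notin> {a, b} \<and> conn V (swap4 X a b j i)")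
            case True
            then have "regs s3 21 = 1 \<and> mat_state n (swap4 X a b j i) s3" using 15 unfolding F(1) by meson
            then show ?thesis using True by blast
          next
            case False
            then have "regs s3 21 = 0 \<and> mat_state n X s3" using 15 unfolding F(1) by meson
            then show ?thesis using bad False by (auto simp: less_Suc_eq)
          qed
          then have "?I j (Suc i) (set_reg 31 (Suc i) s3)" by (rule upd) simp
          then show ?case by (rule conjI[OF t])
        qed (use bad s2 6 i s1 lt W in auto)
      qed
    qed (use s1 W in auto)
    then show ?thesis
    proof (rule wp_mono, goal_cases)
      case (1 t s')
      have "(\<Sum>i = 0..<n. ?c i + 2) = 14 * n + ?CC * card {u \<in> V. {j, u} \<in> F}"
      proof -
        have "(\<Sum>i = 0..<n. ?c i + 2) = (\<Sum>i\<in>V. 14 + (if {j, i} \<in> F then ?CC else 0))"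
          by (intro sum.cong) auto
        also have "\<dots> = 14 * n + (\<Sum>i\<in>V. if {j, i} \<in> F then ?CC else 0)" by (simp add: sum.distrib)
        also have "(\<Sum>i\<in>V. if {j, i} \<in> F then ?CC else 0) = ?CC * card {u \<in> V. {j, u} \<in> F}"
          by (simp add: sum.If_cases Int_def)
        finally show ?thesis .
      qed
      then have t: "t \<le> 14 * n + ?CC * dg F j + 2" using 1 s1(3) dg_row[OF FV, of j] by simp
      have "?I j n s'" using 1 s1(3) by simp
      then have "?I (Suc j) 0 s'"
      proof
        assume bad: "?bad j n s'"
        have "\<not> conn V (swap4 X a b x y)"
          if "x < Suc j \<or> (x = Suc j \<and> y < 0)" "{x, y} \<in> F" "x \<notin> {a, b}" "y \<notin> {a, b}" for x y
        proof -
          have "x < j \<or> (x = j \<and> y < n)" using that(1) FVn[OF that(2)] by (auto simp: less_Suc_eq)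
          then show ?thesis using bad that(2-4) by blast
        qed
        then show ?thesis using bad by (intro disjI2) simp
      qed (rule disjI1)
      then show ?case by (rule conjI[OF t])
    qed
  qed
  have hs: "(\<Sum>j<n. dg F j) = 2 * card F" using handshake[of V F] FV by simp
  have "wp W swap_search s (\<lambda>t s'. t \<le> (\<Sum>j = val s (Num 0)..<val s (Reg 10). (14 * n + ?CC * dg F j + 2) + 2) + 2 \<and>
      ?I (val s (Reg 10)) 0 s' \<and> regs s' 30 = val s (Reg 10) \<and>
      frame (insert 30 (wregs (For 31 (Num 0) (Reg 10) try_swap))) (warrs (For 31 (Num 0) (Reg 10) try_swap)) s s')"
    unfolding swap_search_def
  proof (rule wp_For[where c = "\<lambda>j. 14 * n + ?CC * dg F j + 2" and I = "\<lambda>j. ?I j 0"], goal_cases)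
    case 5
    then show ?case using M r by simp
  next
    case (6 j s1)
    then have s1: "regs s1 30 = j" "j < n" "regs s1 10 = n" "regs s1 46 = a" "regs s1 47 = b" "is_mat n (arrs s1 15) E"
      using n r E15 by (auto simp: frame_def)
    show ?case
    proof (rule wp_mono[OF inner[OF 6(4) s1]], goal_cases)
      case (1 t s2)
      show ?case by (rule conjI[OF conjunct1[OF 1] upd[OF conjunct2[OF 1]]]) simp
    qed
  qed (use n W in auto)
  then show ?thesis
  proof (rule wp_mono, goal_cases)
    case (1 t s')
    have "(\<Sum>j = 0..<n. (14 * n + ?CC * dg F j + 2) + 2) = (14 * n + 4) * n + ?CC * (2 * card F)"
      unfolding hs[symmetric] by (rule cost_sum)
    also have "?CC * (2 * card F) \<le> ?CC * (2 * (2 * n))" using F(2) by (intro mult_le_mono) auto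
    finally have "t \<le> (14 * n + 4) * n + ?CC * (2 * (2 * n)) + 2" using 1 n by simp
    also have "\<dots> \<le> 44 * (n * n * n) + 180 * (n * n) + 530 * n + 2" by (simp add: algebra_simps)
    finally have t: "t \<le> 44 * (n * n * n) + 180 * (n * n) + 530 * n + 2" .
    have "?I n 0 s'" using 1 n by simp
    then show ?case
    proof
      assume bad: "?bad n 0 s'"
      have "\<not> conn V (swap4 X a b x y)" if "{x, y} \<in> F" "x \<notin> {a, b}" "y \<notin> {a, b}" for x y
      proof -
        have "x < n" using FV that(1) by auto
        then show ?thesis using bad that by blast
      qed
      then show ?case using bad t by simp
    qed (rule conjI[OF t disjI1])
  qed
qed

lemma wp_output_all:
  assumes M: "mat_state n X s" and E15: "is_mat n (arrs s 15) E" and W: "n * n < W" "Suc n < W" "1 < W"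
  shows "wp W output_all s (\<lambda>t s'. t \<le> 11 * (n * n) + 20 * n + 10 \<and> regs s' 0 = 1 \<and>
    outputs_edges s' 1 3 4 (X - E) \<and> outputs_edges s' 2 5 6 (E - X))"
proof -
  have n: "regs s 10 = n" and R: "is_row n (arrs s 14)" and X16: "is_mat n (arrs s 16) X" and XV: "X \<subseteq> pairs V"
    using M by (auto simp: mat_state_def is_mat_def)
  let ?I = "\<lambda>j i s'. outputs_edges s' 1 3 4 ((X - E) \<inter> lower_pairs j i) \<and>
    outputs_edges s' 2 5 6 ((E - X) \<inter> lower_pairs j i) \<and> regs s' 0 = 1"
  have upd: "?I j i (set_reg k z s')" if "?I j i s'" "k \<notin> {0, 1, 2}" for j i k z s'
    using that by (auto simp: outputs_edges_def)
  have fin: "finite ((X - E) \<inter> L)" "finite ((E - X) \<inter> L)" for L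
    using XV E_pairs finite_pairs[of V] by (auto intro: finite_subset)
  have bound: "card (insert e D) < W" if "insert e D \<subseteq> pairs V" for e D
  proof -
    have "card (insert e D) \<le> card (pairs V)" using that finite_pairs[of V] by (intro card_mono) auto
    then show ?thesis using card_pairs_le[of n] W by simp
  qed
  have edge: "wp W output_edge s2 (\<lambda>t s''. t \<le> 9 \<and> ?I j (Suc i) s'')"
    if A: "?I j i s2" and s2: "regs s2 25 = j * n" "regs s2 30 = j" "regs s2 31 = i" "i < j" "j < n"
      "arrs s2 15 = arrs s 15" "arrs s2 16 = arrs s 16" for j i s2
  proof -
    have i: "i < n" using s2 by simp
    note cW = cell_W[OF s2(5) i W(1)]
    have c: "arrs s 15 (j * n + i) = (if {j, i} \<in> E then i else j)" "arrs s 16 (j * n + i) = (if {j, i} \<in> X then i else j)"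
      using mat_cell[OF E15 s2(5) i] mat_cell[OF X16 s2(5) i] by auto
    have L: "lower_pairs j (Suc i) = insert {j, i} (lower_pairs j i)" "{j, i} \<notin> lower_pairs j i"
      using lower_pairs_simps(3,4)[OF s2(4)] by auto
    consider "({j, i} \<in> E) = ({j, i} \<in> X)" | "{j, i} \<in> X" "{j, i} \<notin> E" | "{j, i} \<notin> X" "{j, i} \<in> E" by blast
    then show ?thesis
    proof cases
      case 1
      then have e: "(X - E) \<inter> lower_pairs j (Suc i) = (X - E) \<inter> lower_pairs j i"
        "(E - X) \<inter> lower_pairs j (Suc i) = (E - X) \<inter> lower_pairs j i" unfolding L by auto
      show ?thesis unfolding e using 1 A s2 c cW
        by (cases "{j, i} \<in> E") (simp_all add: output_edge_def wp_simps)
    next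
      case 2
      then have e: "(X - E) \<inter> lower_pairs j (Suc i) = insert {j, i} ((X - E) \<inter> lower_pairs j i)"
        "(E - X) \<inter> lower_pairs j (Suc i) = (E - X) \<inter> lower_pairs j i" unfolding L by auto
      have new: "{j, i} \<notin> (X - E) \<inter> lower_pairs j i" using L by blast
      have r1: "card ((X - E) \<inter> lower_pairs j i) = regs s2 1" using A unfolding outputs_edges_def by blast
      have "insert {j, i} ((X - E) \<inter> lower_pairs j i) \<subseteq> pairs V" using 2 XV by auto
      then have "Suc (regs s2 1) < W" using bound new fin(1) r1 by (metis card_insert_disjoint)
      moreover have "outputs_edges s' 1 3 4 (insert {j, i} ((X - E) \<inter> lower_pairs j i))"
        if "regs s' 1 = Suc (regs s2 1)" "arrs s' 3 = (arrs s2 3)(regs s2 1 := j)" "arrs s' 4 = (arrs s2 4)(regs s2 1 := i)" for s'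
        using outputs_edges_push[OF _ fin(1) new that] A by blast
      moreover have "outputs_edges s' 2 5 6 ((E - X) \<inter> lower_pairs j i)"
        if "regs s' 2 = regs s2 2" "arrs s' 5 = arrs s2 5" "arrs s' 6 = arrs s2 6" for s'
        using outputs_edges_cong[OF _ that] A by blast
      ultimately show ?thesis unfolding e using 2 s2 c cW A by (simp add: output_edge_def wp_simps)
    next
      case 3
      then have e: "(E - X) \<inter> lower_pairs j (Suc i) = insert {j, i} ((E - X) \<inter> lower_pairs j i)"
        "(X - E) \<inter> lower_pairs j (Suc i) = (X - E) \<inter> lower_pairs j i" unfolding L by auto
      have new: "{j, i} \<notin> (E - X) \<inter> lower_pairs j i" using L by blast
      have r1: "card ((E - X) \<inter> lower_pairs j i) = regs s2 2" using A unfolding outputs_edges_def by blast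
      have "insert {j, i} ((E - X) \<inter> lower_pairs j i) \<subseteq> pairs V" using 3 E_pairs by auto
      then have "Suc (regs s2 2) < W" using bound new fin(2) r1 by (metis card_insert_disjoint)
      moreover have "outputs_edges s' 2 5 6 (insert {j, i} ((E - X) \<inter> lower_pairs j i))"
        if "regs s' 2 = Suc (regs s2 2)" "arrs s' 5 = (arrs s2 5)(regs s2 2 := j)" "arrs s' 6 = (arrs s2 6)(regs s2 2 := i)" for s'
        using outputs_edges_push[OF _ fin(2) new that] A by blast
      moreover have "outputs_edges s' 1 3 4 ((X - E) \<inter> lower_pairs j i)"
        if "regs s' 1 = regs s2 1" "arrs s' 3 = arrs s2 3" "arrs s' 4 = arrs s2 4" for s'
        using outputs_edges_cong[OF _ that] A by blast
      ultimately show ?thesis unfolding e using 3 s2 c cW A by (simp add: output_edge_def wp_simps)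
    qed
  qed
  let ?s1 = "set_reg 2 0 (set_reg 1 0 (set_reg 0 1 s))"
  have "wp W (For 30 (Num 0) (Reg 10) (Load 25 14 (Reg 30) ;; For 31 (Num 0) (Reg 30) output_edge)) ?s1
    (\<lambda>t s'. t \<le> ((11 * n + 3) + 2) * n + 2 \<and> ?I (val ?s1 (Reg 10)) 0 s' \<and>
      frame (insert 30 (wregs (Load 25 14 (Reg 30) ;; For 31 (Num 0) (Reg 30) output_edge)))
        (warrs (Load 25 14 (Reg 30) ;; For 31 (Num 0) (Reg 30) output_edge)) ?s1 s')"
  proof (rule wp_For_const[where I = "\<lambda>j. ?I j 0"], goal_cases)
    case 6
    then show ?case by (simp add: lower_pairs_simps(1) outputs_edges_def)
  next
    case (7 j s2)
    then have j: "j < n" using n by simp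
    have s2: "arrs s2 14 j = j * n" "arrs s2 15 = arrs s 15" "arrs s2 16 = arrs s 16"
      using 7(4) R j by (auto simp: frame_def is_row_def)
    note cW = cell_W[OF j j W(1)]
    let ?s3 = "set_reg 25 (j * n) s2"
    have I3: "?I j 0 (set_reg 31 0 ?s3)" using 7(3) by simp
    have "wp W (For 31 (Num 0) (Reg 30) output_edge) ?s3 (\<lambda>t s'. t \<le> (9 + 2) * n + 2 \<and> ?I j (val ?s3 (Reg 30)) s' \<and>
      frame (insert 31 (wregs output_edge)) (warrs output_edge) ?s3 s')"
    proof (rule wp_For_const[where I = "?I j"], goal_cases)
      case 6
      then show ?case using I3 .
    next
      case (7 i s4)
      note st = this
      have "regs s4 25 = j * n" "regs s4 30 = j" "arrs s4 15 = arrs s 15" "arrs s4 16 = arrs s 16" "i < j"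
        using st s2 \<open>regs s2 30 = j\<close> by (auto simp: frame_def)
      then have "wp W output_edge s4 (\<lambda>t s''. t \<le> 9 \<and> ?I j (Suc i) s'')"
        using edge[OF st(3)] st(2) j by blast
      then show ?case by (rule wp_mono) (use upd in auto)
    qed (use 7(2) j W in auto)
    then have "wp W (For 31 (Num 0) (Reg 30) output_edge) ?s3 (\<lambda>t s'. 1 + t \<le> 11 * n + 3 \<and>
      ?I (Suc j) 0 (set_reg 30 (Suc j) s'))"
    proof (rule wp_mono, goal_cases)
      case (1 t s')
      then have "?I (Suc j) 0 s'" using 7(2) by (simp add: lower_pairs_simps(2))
      then show ?case using 1 upd by auto
    qed
    then show ?case using 7(2) s2 cW by (simp add: wp_Seq wp_Load)
  qed (use n W in auto)
  then have "wp W (For 30 (Num 0) (Reg 10) (Load 25 14 (Reg 30) ;; For 31 (Num 0) (Reg 30) output_edge)) ?s1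
    (\<lambda>t s'. 3 + t \<le> 11 * (n * n) + 20 * n + 10 \<and> regs s' 0 = 1 \<and>
    outputs_edges s' 1 3 4 (X - E) \<and> outputs_edges s' 2 5 6 (E - X))"
  proof (rule wp_mono, goal_cases)
    case (1 t s')
    have "(X - E) \<inter> lower_pairs n 0 = X - E" "(E - X) \<inter> lower_pairs n 0 = E - X"
      using XV E_pairs lower_pairs_simps(5)[of n] by auto
    moreover have "3 + (((11 * n + 3) + 2) * n + 2) \<le> 11 * (n * n) + 20 * n + 10" by (simp add: algebra_simps)
    ultimately show ?case using 1 n by simp
  qed
  then show ?thesis unfolding output_all_def wp_Seq[of W "Assign a b" for a b] wp_Assign using W by simp
qed

end

section \<open>Optimality of the constructed set\<close>

context labelled_graph
begin

definition solved :: "state \<Rightarrow> bool" where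
  "solved s \<longleftrightarrow> (\<exists>F. feasible V E T0 F \<and> card F \<le> opt_bound V E rep T0 \<and> regs s 0 = 1 \<and>
     outputs_edges s 1 3 4 (F - E) \<and> outputs_edges s 2 5 6 (F \<inter> E))"

lemma wp_output_solved:
  assumes M: "mat_state n X s" and E15: "is_mat n (arrs s 15) E" and W: "n * n < W" "Suc n < W" "1 < W"
    and X: "conn V X" "\<And>v. v \<in> V \<Longrightarrow> odd (dg (sym_diff E X) v) \<longleftrightarrow> v \<in> T0" "card (sym_diff E X) \<le> opt_bound V E rep T0"
  shows "wp W output_all s (\<lambda>t s'. t \<le> 11 * (n * n) + 20 * n + 10 \<and> solved s')"
proof (rule wp_mono[OF wp_output_all[OF M E15 W]], goal_cases)
  case (1 t s')
  have XV: "X \<subseteq> pairs V" using M by (simp add: mat_state_def is_mat_def)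
  have "sym_diff E (sym_diff E X) = X" by auto
  then have "feasible V E T0 (sym_diff E X)"
    using X XV E_pairs unfolding feasible_def by (simp add: Diff_subset_conv le_supI1 le_supI2 subset_trans[OF Diff_subset])
  moreover have "sym_diff E X - E = X - E" "sym_diff E X \<inter> E = E - X" by auto
  ultimately show ?case using 1 X(3) unfolding solved_def by (metis (no_types, lifting))
qed

text \<open>By the handshake lemma the joining edges change the parity of an even number of
  vertices.\<close>

lemma even_card_attached:
  assumes I: "attach_inv H T (rep ` V)" and ev: "even (card T0)"
  shows "even (card T)"
proof -
  note D = attach_invD[OF I]
  let ?O = "{v \<in> V. odd (dg (H - E) v)}"
  have "T = sym_diff T0 ?O" using D(2) D(8) T0_V by blast
  moreover have "even (card ?O)"
  proof -
    have "(\<Sum>v\<in>V. dg (H - E) v) = 2 * card (H - E)" using D(4) by (intro handshake) auto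
    then show ?thesis using even_sum_iff[of V "dg (H - E)"] by simp
  qed
  ultimately show ?thesis using odd_card_sym_diff[OF finite_T0, of ?O] ev by simp
qed

lemma matched_diff:
  assumes I: "attach_inv H T (rep ` V)" and N: "is_pm N T" "finite N"
  shows "sym_diff E (sym_diff H N) = sym_diff (H - E) N" "finite (H - E)"
    and "v \<in> V \<Longrightarrow> odd (dg (sym_diff E (sym_diff H N)) v) \<longleftrightarrow> v \<in> T0"
    and "card (sym_diff E (sym_diff H N)) \<le> card (H - E) + card N"
proof -
  note D = attach_invD[OF I]
  show eq: "sym_diff E (sym_diff H N) = sym_diff (H - E) N" using D(3) by auto
  show fin: "finite (H - E)" using D(4) finite_pairs[of V] finite_subset by auto
  show "odd (dg (sym_diff E (sym_diff H N)) v) \<longleftrightarrow> v \<in> T0" if "v \<in> V"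
    unfolding eq odd_dg_sym_diff[OF fin N(2)] odd_dg_pm[OF N(1)] using D(8)[OF that] by blast
  have "card (sym_diff (H - E) N) \<le> card ((H - E) \<union> N)" using fin N(2) by (intro card_mono) auto
  also have "\<dots> \<le> card (H - E) + card N" by (rule card_Un_le)
  finally show "card (sym_diff E (sym_diff H N)) \<le> card (H - E) + card N" unfolding eq .
qed

text \<open>The first bound makes the result optimal whenever toggling the matching leaves the graph
  connected; the second limits the number of exchanges to be tried and so yields cubic time.\<close>

lemma matched_bound:
  assumes I: "attach_inv H T (rep ` V)" and ev: "even (card T)" and N: "2 * card N = card T"
  shows "card (H - E) + card N \<le> opt_bound V E rep T0" "card (H - E) + card N \<le> 2 * n"
proof -
  note D = attach_invD[OF I] and A = attach_final[OF I ev]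
  have cN: "card N = card T div 2" using N by simp
  show "card (H - E) + card N \<le> opt_bound V E rep T0"
  proof (cases "card (rep ` V) < 2")
    case True
    then show ?thesis using A(3) cN by (simp add: opt_bound_def)
  next
    case False
    then have "card (H - E) + card N \<le> max (card (rep ` V) - 1) (card T0 div 2 + card (tfree V rep T0))"
      using A(2) cN by simp
    then show ?thesis using False by (simp add: opt_bound_def)
  qed
  have "card T \<le> n" using card_mono[OF _ D(2)] by simp
  moreover have "card (rep ` V) \<le> n" using card_image_le[of V rep] by simp
  ultimately show "card (H - E) + card N \<le> 2 * n" using D(7) cN by linarith
qed

text \<open>The guilty pair ab is a toggled pair unless it cancels against a joining edge. By the
  joining invariant this happens only for two components and no wrong vertices at the start, where
  the matching removes the only joining edge again and nothing is toggled.\<close>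

lemma stuck_cases:
  assumes I: "attach_inv H T (rep ` V)" and ev: "even (card T)"
    and Nf: "finite N" "2 * card N = card T" and st: "stuck_matching V T H N a b"
  shows "{a, b} \<in> sym_diff (H - E) N \<or> (sym_diff (H - E) N = {} \<and> 2 \<le> card (rep ` V) \<and> T0 = {})"
    and "{a, b} \<in> H - E \<Longrightarrow> sym_diff (H - E) N = {} \<and> 2 \<le> card (rep ` V) \<and> T0 = {}"
proof -
  interpret st: stuck_matching V T H N a b by (rule st)
  show *: "sym_diff (H - E) N = {} \<and> 2 \<le> card (rep ` V) \<and> T0 = {}" if abT: "{a, b} \<in> H - E"
  proof -
    have A: "card (rep ` V) = 2 \<and> card T = 2 \<and> T0 = {}" using attach_final(4)[OF I ev abT st.ab(4,5)] .
    then have "card N = 1" using Nf(2) by simp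
    then have N1: "N = {{a, b}}" using st.ab(1) card_1_singletonE by blast
    have "card (H - E) \<le> 1" using attach_invD(7)[OF I] A by simp
    moreover have "finite (H - E)" using attach_invD(4)[OF I] finite_pairs[of V] finite_subset by auto
    ultimately have "H - E = {{a, b}}" using abT by (metis card_le_Suc0_iff_eq One_nat_def subsetI subset_singletonD empty_iff singletonI insertI1)
    then show ?thesis using A N1 by simp
  qed
  show "{a, b} \<in> sym_diff (H - E) N \<or> (sym_diff (H - E) N = {} \<and> 2 \<le> card (rep ` V) \<and> T0 = {})"
    using * st.ab(1) by blast
qed

text \<open>Covers the case that no exchange works. For a connected graph the star is present;
  replacing ab by a path through w costs one more pair, just what the bound allows. For several
  components \<open>attach_swap_exists\<close> makes ab a joining edge, so nothing is toggled and
  the triangle on a, b, w attains 3. In both cases the bound exceeds 1, so two vertices do not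
  suffice.\<close>

lemma stuck_bounds:
  assumes I: "attach_inv H T (rep ` V)" and ev: "even (card T)"
    and N: "is_pm N T" "finite N" "2 * card N = card T" and st: "stuck_matching V T H N a b"
    and center: "T0 \<noteq> {} \<Longrightarrow> c \<in> T0 \<and> (\<forall>v\<in>T0. td v \<le> td c)"
    and all: "c \<in> {a, b} \<Longrightarrow> \<forall>v\<in>T - {c}. {c, v} \<in> H"
    and ns: "\<And>x y. {x, y} \<in> sym_diff E (sym_diff H N) \<Longrightarrow> x \<notin> {a, b} \<Longrightarrow> y \<notin> {a, b} \<Longrightarrow>
      \<not> conn V (swap4 (sym_diff H N) a b x y)"
  shows "card (tog (tog (tog (sym_diff (H - E) N) a b) a w) w b) \<le> opt_bound V E rep T0"
    and "1 < opt_bound V E rep T0"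
proof -
  interpret st: stuck_matching V T H N a b by (rule st)
  let ?F = "sym_diff (H - E) N"
  have eq: "sym_diff E (sym_diff H N) = ?F" by (rule matched_diff(1)[OF I N(1,2)])
  have tri: "card (tog (tog G a w) w b) \<le> card G + 2" if "finite G" for G
    using card_tog_le[OF that, of a w] card_tog_le[OF finite_tog[OF that], of "a" w w b] by linarith
  have "card (tog (tog (tog ?F a b) a w) w b) \<le> opt_bound V E rep T0 \<and> 1 < opt_bound V E rep T0"
  proof (cases "card (rep ` V) < 2")
    case True
    then have H: "H = E" and T: "T = T0" using attach_final(3)[OF I ev] by auto
    have ne: "T0 \<noteq> {}" using st.ab(4) T by blast
    have star: "star_exc E T0"
    proof (rule stuck_star_exc[OF st[unfolded H T], where s = c])
      show "\<not> conn V (swap4 (sym_diff E N) a b x y)" if "{x, y} \<in> N" "x \<notin> {a, b}" "y \<notin> {a, b}" for x y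
        using ns[of x y] that unfolding eq H by simp
      show "c \<in> T0" using center[OF ne] by simp
      show "\<forall>v\<in>T0 - {c}. {c, v} \<in> E" if "c \<in> {a, b}" using all[OF that] H T by simp
      show "card {w \<in> T0. {v, w} \<in> E} \<le> card {w \<in> T0. {c, w} \<in> E}" if "v \<in> T0" for v
        using center[OF ne] that by (simp add: td_def)
    qed
    have bound: "opt_bound V E rep T0 = card T0 div 2 + 1" using star True by (simp add: opt_bound_def)
    have "2 \<le> card T0"
      using card_mono[of T0 "{a, b}"] st.ab T finite_T0 by auto
    moreover have F: "?F = N" using H by auto
    have "tog ?F a b = N - {{a, b}}" using st.ab(1) F by (auto simp: tog_def)
    then have "card (tog ?F a b) = card N - 1" using st.ab(1) N(2) by simp
    moreover have "1 \<le> card N" using st.ab(1) N(2) by (metis One_nat_def Suc_leI card_gt_0_iff empty_iff)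
    moreover have "card (tog (tog (tog ?F a b) a w) w b) \<le> card (tog ?F a b) + 2"
      using F N(2) by (intro tri finite_tog) simp
    ultimately show ?thesis using bound N(3) T by simp
  next
    case False
    then have p: "2 \<le> card (rep ` V)" by simp
    have "{a, b} \<in> H - E"
    proof (rule ccontr)
      assume nab: "{a, b} \<notin> H - E"
      show False by (rule attach_swap_exists[OF I p st nab]) (rule ns)
    qed
    then have F: "?F = {}" and T0: "T0 = {}" using stuck_cases(2)[OF I ev N(2,3) st] by auto
    have "3 \<le> opt_bound V E rep T0" using False T0 by (simp add: opt_bound_def)
    moreover have "card (tog (tog (tog {} a b) a w) w b) \<le> card (tog {} a b) + 2" by (intro tri finite_tog) simp
    moreover have "card (tog {} a b) = 1" by (simp add: tog_def)
    ultimately show ?thesis unfolding F by linarith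
  qed
  then show "card (tog (tog (tog ?F a b) a w) w b) \<le> opt_bound V E rep T0" "1 < opt_bound V E rep T0" by auto
qed

lemma wp_find_third:
  assumes n: "regs s 10 = n" and r: "regs s 46 = a" "regs s 47 = b" and W: "Suc n < W"
  shows "wp W find_third s (\<lambda>t s'. t \<le> 5 * n + 3 \<and>
    ((regs s' 48 = n \<and> V \<subseteq> {a, b}) \<or> (regs s' 48 < n \<and> regs s' 48 \<notin> {a, b})) \<and> frame {45, 48} {} s s')"
proof -
  have "wp W find_third s (\<lambda>t s'. t \<le> 5 * n + 3 \<and>
    ((regs s' 48 = n \<and> V \<subseteq> {a, b}) \<or> (regs s' 48 < n \<and> regs s' 48 \<notin> {a, b})))"
    unfolding find_third_def wp_Seq[of W "Assign a b" for a b] wp_Assign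
  proof (intro conjI, goal_cases)
    case 2
    show ?case
    proof (rule wp_mono[OF wp_For_const[where c = 3 and n = n and
        I = "\<lambda>j s'. (regs s' 48 = n \<and> {..<j} \<subseteq> {a, b}) \<or> (regs s' 48 < n \<and> regs s' 48 \<notin> {a, b})"]], goal_cases)
      case (7 j s')
      then have j: "j < n" "regs s' 46 = a" "regs s' 47 = b" using n r by (auto simp: frame_def)
      show ?case using 7(2,3) j W by (auto simp: wp_simps lessThan_Suc)
    next
      case (8 t s')
      then show ?case using n by simp
    qed (use n W in auto)
  qed (use n W in auto)
  from wp_frame[OF this] show ?thesis by (rule wp_mono) auto
qed

lemma wp_finish:
  assumes I: "attach_inv H T (rep ` V)" and ev: "even (card T)"
    and N: "is_pm N T" "finite N" "2 * card N = card T"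
    and M: "mat_state n (sym_diff H N) s" and E15: "is_mat n (arrs s 15) E" and W: "n * n < W" "Suc (Suc n) < W"
    and clique: "\<And>x y. x \<in> \<Union>(N \<inter> H) \<Longrightarrow> y \<in> \<Union>(N \<inter> H) \<Longrightarrow> x \<noteq> y \<Longrightarrow> {x, y} \<in> H"
    and last: "N \<inter> H \<noteq> {} \<Longrightarrow> {regs s 46, regs s 47} \<in> N \<inter> H"
    and center: "T0 \<noteq> {} \<Longrightarrow> c \<in> T0 \<and> (\<forall>v\<in>T0. td v \<le> td c)"
    and all: "c \<in> \<Union>(N \<inter> H) \<Longrightarrow> \<forall>v\<in>T - {c}. {c, v} \<in> H"
  shows "wp W finish s (\<lambda>t s'. t \<le> 44 * (n * n * n) + 230 * (n * n) + 650 * n + 150 \<and>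
    (solved s' \<or> (regs s' 0 = 0 \<and> n < 3 \<and> 1 < opt_bound V E rep T0)))"
proof -
  let ?X = "sym_diff H N" and ?F = "sym_diff (H - E) N" and ?B = "opt_bound V E rep T0"
  note md = matched_diff[OF I N(1,2)] and mb = matched_bound[OF I ev N(3)]
  have W1: "Suc n < W" "1 < W" using W by auto
  have cF: "card ?F \<le> ?B" "card ?F \<le> 2 * n" using md(1,4) mb by auto
  have finF: "finite ?F" using md(2) N(2) by simp
  have par: "odd (dg ?F v) \<longleftrightarrow> v \<in> T0" if "v \<in> V" for v using md(1) md(3)[OF that] by simp
  have connH: "conn V H" using attach_final(1)[OF I ev] .
  show ?thesis unfolding finish_def
  proof (rule wp_SeqI[OF wp_conn_check[OF M W(1) W1(1)]], goal_cases)
    case (1 t1 s1)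
    then have t1: "t1 \<le> 11 * (n * n) + 40 * n + 40" and M1: "mat_state n ?X s1"
      and c1: "regs s1 21 = (if conn V ?X then 1 else 0)"
      and fr1: "frame {11, 12, 13, 14, 15, 16, 17, 18, 19, 20, 21} {7, 8} s s1" by auto
    have E1: "is_mat n (arrs s1 15) E" and ab1: "regs s1 46 = regs s 46" "regs s1 47 = regs s 47"
      using fr1 E15 by (auto simp: frame_def)
    show ?case
    proof (cases "conn V ?X")
      case True
      have "wp W output_all s1 (\<lambda>t s'. t \<le> 11 * (n * n) + 20 * n + 10 \<and> solved s')"
        by (rule wp_output_solved[OF M1 E1 W(1) W1 True]) (use par cF md(1) in auto)
      then have "wp W output_all s1 (\<lambda>t s'. t1 + (1 + t) \<le> 44 * (n * n * n) + 230 * (n * n) + 650 * n + 150 \<and>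
          (solved s' \<or> (regs s' 0 = 0 \<and> n < 3 \<and> 1 < ?B)))"
        by (rule wp_mono) (use t1 in simp)
      then show ?thesis unfolding wp_Cond[of W "Equal (Reg 21) (Num 1)" output_all "swap_search ;; Q" for Q] using c1 True by simp
    next
      case disc: False
      define a b where "a = regs s 46" and "b = regs s 47"
      have "N \<inter> H \<noteq> {}" by (rule clique_matching_stuck(1)[OF connH N(1) _ disc]) (rule clique)
      then have abNH: "{a, b} \<in> N \<inter> H" using last by (simp add: a_def b_def)
      have G2: "N \<inter> H = {{a, b}} \<and> bridge H a b"
        by (rule clique_matching_stuck(2)[OF connH N(1) _ disc abNH]) (rule clique)
      have HV: "H \<subseteq> pairs V" and TV: "T \<subseteq> V" using attach_invD[OF I] by auto
      have st: "stuck_matching V T H N a b"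
        by unfold_locales (use connH HV TV N G2 in auto)
      interpret st: stuck_matching V T H N a b by (rule st)
      have abn: "a < n" "b < n" "a \<noteq> b" using st.ab TV by auto
      have all': "\<forall>v\<in>T - {c}. {c, v} \<in> H" if "c \<in> {a, b}" using all that abNH by blast
      have F1: "?F = sym_diff E ?X" using md(1) by simp
      have r1: "regs s1 46 = a" "regs s1 47 = b" "regs s1 21 = 0" using ab1 c1 disc by (auto simp: a_def b_def)
      have S: "wp W (swap_search ;;
        Cond (Equal (Reg 21) (Num 1)) output_all
          (find_third ;;
           Cond (Equal (Reg 48) (Reg 10)) (Assign 0 (Num 0))
             (toggle 46 47 ;; toggle 46 48 ;; toggle 48 47 ;; output_all))) s1
        (\<lambda>t s'. t \<le> 44 * (n * n * n) + 191 * (n * n) + 560 * n + 60 \<and>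
          (solved s' \<or> (regs s' 0 = 0 \<and> n < 3 \<and> 1 < ?B)))"
      proof (rule wp_SeqI[OF wp_frame[OF wp_swap_search[OF M1 E1 W(1) W1(1) r1 abn F1 cF(2)]]], goal_cases)
        case (1 t2 s2)
        then have t2: "t2 \<le> 44 * (n * n * n) + 180 * (n * n) + 530 * n + 2" by blast
        have fr2: "frame {11, 12, 13, 14, 15, 16, 17, 18, 19, 20, 21, 27, 28, 29, 30, 31} {7, 8, 16} s1 s2"
          using 1 by simp
        have E2: "is_mat n (arrs s2 15) E" and ab2: "regs s2 46 = a" "regs s2 47 = b"
          using fr2 E1 r1 by (auto simp: frame_def)
        from conjunct2[OF conjunct1[OF 1]] show ?case
        proof (elim disjE conjE exE)
          fix x y
          assume f: "regs s2 21 = 1" and xy: "{x, y} \<in> ?F" "x \<notin> {a, b}" "y \<notin> {a, b}"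
            and cn: "conn V (swap4 ?X a b x y)" and M2: "mat_state n (swap4 ?X a b x y) s2"
          have xyne: "x \<noteq> y"
          proof -
            have "pairs T \<subseteq> pairs V" using TV unfolding pairs_def by blast
            then have "N \<subseteq> pairs V" using is_pmD(1)[OF st.N] by (rule subset_trans[rotated])
            then have "{x, y} \<in> pairs V" using xy(1) HV by blast
            then show ?thesis by simp
          qed
          have eq: "sym_diff E (swap4 ?X a b x y) = swap4 ?F a b x y"
            unfolding swap4_def sym_diff_tog F1 ..
          \<comment> \<open>Since xy is toggled, the set of toggled pairs is not empty and contains
            ab by \<open>stuck_cases\<close>; both pairs are thus traded in, and the size does not
            grow.\<close>
          have "{a, b} \<in> ?F" using stuck_cases(1)[OF I ev N(2,3) st] xy(1) by blast
          moreover have "{a, b} \<noteq> {x, y}" using xy(2) by auto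
          ultimately have "card (swap4 ?F a b x y) \<le> ?B" using card_swap4[OF finF _ xy(1)] cF(1) by (meson le_trans)
          moreover have "odd (dg (swap4 ?F a b x y) v) \<longleftrightarrow> v \<in> T0" if "v \<in> V" for v
            using odd_dg_swap4[OF finF abn(3) xyne xy(2,3)] par[OF that] by simp
          ultimately have out: "wp W output_all s2 (\<lambda>t s'. t \<le> 11 * (n * n) + 20 * n + 10 \<and> solved s')"
            by (intro wp_output_solved[OF M2 E2 W(1) W1 cn]) (simp_all only: eq)
          have "wp W output_all s2 (\<lambda>t s'. t2 + (1 + t) \<le> 44 * (n * n * n) + 191 * (n * n) + 560 * n + 60 \<and>
            (solved s' \<or> (regs s' 0 = 0 \<and> n < 3 \<and> 1 < ?B)))"
            by (rule wp_mono[OF out]) (use t2 in simp)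
          then show ?case using f by (simp add: wp_Cond)
        next
          assume f: "regs s2 21 = 0" and M2: "mat_state n ?X s2"
            and ns: "\<forall>x y. {x, y} \<in> ?F \<longrightarrow> x \<notin> {a, b} \<longrightarrow> y \<notin> {a, b} \<longrightarrow> \<not> conn V (swap4 ?X a b x y)"
          have ns': "\<not> conn V (swap4 ?X a b x y)" if "{x, y} \<in> sym_diff E ?X" "x \<notin> {a, b}" "y \<notin> {a, b}" for x y
            using ns that unfolding F1 by blast
          have sb1: "card (tog (tog (tog ?F a b) a w) w b) \<le> ?B" for w
            by (rule stuck_bounds(1)[OF I ev N st, where c = c]) (rule center all' ns', assumption+)+
          have sb2: "1 < ?B"
            by (rule stuck_bounds(2)[OF I ev N st, where c = c]) (rule center all' ns', assumption+)+
          have n2: "regs s2 10 = n" using M2 by (simp add: mat_state_def)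
          have T: "wp W (find_third ;;
           Cond (Equal (Reg 48) (Reg 10)) (Assign 0 (Num 0))
             (toggle 46 47 ;; toggle 46 48 ;; toggle 48 47 ;; output_all)) s2
             (\<lambda>t s'. t \<le> 11 * (n * n) + 25 * n + 50 \<and> (solved s' \<or> (regs s' 0 = 0 \<and> n < 3 \<and> 1 < ?B)))"
          proof (rule wp_SeqI[OF wp_find_third[OF n2 ab2 W1(1)]], goal_cases)
            case (1 t3 s3)
            then have t3: "t3 \<le> 5 * n + 3" and fr3: "frame {45, 48} {} s2 s3" by auto
            have s3: "mat_state n ?X s3" "is_mat n (arrs s3 15) E" "regs s3 46 = a" "regs s3 47 = b" "regs s3 10 = n"
              using fr3 M2 E2 ab2 by (auto simp: frame_def mat_state_def)
            define w where "w = regs s3 48"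
            from conjunct1[OF conjunct2[OF 1]] consider "w = n" "V \<subseteq> {a, b}" | "w < n" "w \<notin> {a, b}"
              unfolding w_def by blast
            then show ?case
            proof cases
              case 1
              \<comment> \<open>No third vertex exists; the bound above 1 shows that the answer 0 is
                then right.\<close>
              have "n \<le> card {a, b}" using card_mono[OF _ 1(2)] by simp
              then have "n < 3" using abn by simp
              then show ?thesis using 1(1) s3(5) t3 W sb2 by (simp add: wp_Cond wp_Assign w_def)
            next
              case 2
              then have w: "w \<noteq> a" "w \<noteq> b" by auto
              have cn: "conn V (tog (tog (tog ?X a b) a w) w b)" using st.conn_third_vertex[of w] 2 w by simp
              have eq: "sym_diff E (tog (tog (tog ?X a b) a w) w b) = tog (tog (tog ?F a b) a w) w b"
                unfolding sym_diff_tog F1 ..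
              have "wp W (toggle 46 47 ;; toggle 46 48 ;; toggle 48 47 ;; output_all) s3
                (\<lambda>t s'. t \<le> 30 + (11 * (n * n) + 20 * n + 10) \<and> solved s')"
              proof (rule wp_SeqI[OF wp_toggle[OF s3(1) W(1), where a = a and b = b]], goal_cases)
                case (8 t4 s4)
                then have s4: "t4 = 10" "mat_state n (tog ?X a b) s4" "is_mat n (arrs s4 15) E" "regs s4 46 = a" "regs s4 47 = b" "regs s4 48 = w"
                  using s3 by (auto simp: frame_def w_def)
                show ?case
                proof (rule wp_SeqI[OF wp_toggle[OF s4(2) W(1), where a = a and b = w]], goal_cases)
                  case (8 t5 s5)
                  then have s5: "t5 = 10" "mat_state n (tog (tog ?X a b) a w) s5" "is_mat n (arrs s5 15) E" "regs s5 47 = b" "regs s5 48 = w"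
                    using s4 by (auto simp: frame_def)
                  show ?case
                  proof (rule wp_SeqI[OF wp_toggle[OF s5(2) W(1), where a = w and b = b]], goal_cases)
                    case (8 t6 s6)
                    then have s6: "t6 = 10" "mat_state n (tog (tog (tog ?X a b) a w) w b) s6" "is_mat n (arrs s6 15) E"
                      using s5 by (auto simp: frame_def)
                    have "wp W output_all s6 (\<lambda>t s'. t \<le> 11 * (n * n) + 20 * n + 10 \<and> solved s')"
                    proof (rule wp_output_solved[OF s6(2,3) W(1) W1 cn], unfold eq)
                      show "odd (dg (tog (tog (tog ?F a b) a w) w b) v) \<longleftrightarrow> v \<in> T0" if "v \<in> V" for v
                        using odd_dg_triangle[OF finF abn(3) w] par[OF that] by simp
                    qed (rule sb1)
                    then show ?case by (rule wp_mono) (use s4(1) s5(1) s6(1) in simp)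
                  qed (use s5 2 w abn in auto)
                qed (use s4 2 w abn in auto)
              qed (use s3 abn in auto)
              then have "wp W (toggle 46 47 ;; toggle 46 48 ;; toggle 48 47 ;; output_all) s3
                (\<lambda>t s'. t3 + (1 + t) \<le> 11 * (n * n) + 25 * n + 50 \<and> (solved s' \<or> (regs s' 0 = 0 \<and> n < 3 \<and> 1 < ?B)))"
                by (rule wp_mono) (use t3 in simp)
              then show ?thesis unfolding wp_Cond[of W "Equal (Reg 48) (Reg 10)"] using 2(1) s3(5) by (simp add: w_def)
            qed
          qed
          have "wp W (find_third ;;
           Cond (Equal (Reg 48) (Reg 10)) (Assign 0 (Num 0))
             (toggle 46 47 ;; toggle 46 48 ;; toggle 48 47 ;; output_all)) s2
             (\<lambda>t s'. t2 + (1 + t) \<le> 44 * (n * n * n) + 191 * (n * n) + 560 * n + 60 \<and>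
              (solved s' \<or> (regs s' 0 = 0 \<and> n < 3 \<and> 1 < ?B)))"
            by (rule wp_mono[OF T]) (use t2 in simp)
          then show ?case unfolding wp_Cond[of W "Equal (Reg 21) (Num 1)"] using f by simp
        qed
      qed
      have "wp W (swap_search ;;
        Cond (Equal (Reg 21) (Num 1)) output_all
          (find_third ;;
           Cond (Equal (Reg 48) (Reg 10)) (Assign 0 (Num 0))
             (toggle 46 47 ;; toggle 46 48 ;; toggle 48 47 ;; output_all))) s1
        (\<lambda>t s'. t1 + (1 + t) \<le> 44 * (n * n * n) + 230 * (n * n) + 650 * n + 150 \<and>
          (solved s' \<or> (regs s' 0 = 0 \<and> n < 3 \<and> 1 < ?B)))"
        by (rule wp_mono[OF S]) (use t1 in simp)
      then show ?thesis unfolding wp_Cond[of W "Equal (Reg 21) (Num 1)" output_all "swap_search ;; Q" for Q] using r1(3) by simp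
    qed
  qed
qed

end

context input_graph
begin

text \<open>The representatives are quantified because the array of labels may have been overwritten
  by connectivity checks when the program halts.\<close>

definition optimum_found :: "state \<Rightarrow> bool" where
  "optimum_found s \<longleftrightarrow> (\<exists>\<rho>. is_rep V E \<rho> \<and>
     (if even (card T0)
      then (\<exists>F. feasible V E T0 F \<and> card F \<le> opt_bound V E \<rho> T0 \<and> regs s 0 = 1 \<and>
             outputs_edges s 1 3 4 (F - E) \<and> outputs_edges s 2 5 6 (F \<inter> E)) \<or>
           (regs s 0 = 0 \<and> n < 3 \<and> 1 < opt_bound V E \<rho> T0)
      else regs s 0 = 0))"

lemma m_le: "m \<le> n * n"
  using card_mono[OF finite_pairs E_pairs] card_pairs_le[of n] by simp

lemma wp_optimize:
  assumes s: "regs s 0 = n" "arrs s 0 = (\<lambda>v. if v < n then \<delta> v else 0)" "arrs s 1 = off" "arrs s 2 = nb"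
    "\<And>a v. a \<in> {9, 10, 11, 12, 14, 15, 16, 17} \<Longrightarrow> arrs s a v = 0"
    and W: "2 * m < W" "n * n < W" "Suc (Suc n) < W"
  shows "wp W optimize s (\<lambda>t s'. t \<le> 2000 * (n ^ 3 + 1) \<and> optimum_found s')"
  unfolding optimize_def
proof (rule wp_SeqI[OF wp_prep], goal_cases)
  case (8 t1 s1)
  then have t1: "t1 \<le> 32 * m + 70 * n + 60" and P: "prepared s1"
    and fr1: "frame {10, 11, 12, 13, 14, 15, 16, 17, 18, 19, 20, 22, 23, 24, 25, 26, 27, 28, 30, 31} {7, 8, 9, 10, 11, 12} s s1"
    by auto
  have z1: "arrs s1 a v = 0" if "a \<in> {14, 15, 16, 17}" for a v
  proof -
    have "arrs s1 a = arrs s a" using fr1 that unfolding frame_def by auto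
    then show ?thesis using s(5)[of a v] that by auto
  qed
  have W1: "Suc n < W" "1 < W" using W by auto
  have pr: "inp s1" "T_arr T0 s1" "regs s1 22 = card T0" "regs s1 10 = n" "center_ok n s1"
    "arrs s1 9 (card T0) = card T0 mod 2" "is_rep V E (\<lambda>v. arrs s1 7 v - 1)"
    "\<And>l. arrs s1 12 l = card {v \<in> V. arrs s1 7 v = l \<and> v \<in> T0}"
    using P card_T0_le by (auto simp: prepared_def inp_def)
  \<comment> \<open>Since n and its square are at most its cube, the coefficients 44, 320 and 960
    may be added, and their sum is below 2000.\<close>
  have time: "t \<le> 2000 * (n ^ 3 + 1)" if "t \<le> 44 * (n * n * n) + 320 * (n * n) + 960 * n + 300" for t
  proof -
    have 3: "n ^ 3 = n * n * n" by (simp add: power3_eq_cube)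
    have "n * n \<le> n * n * n" "n \<le> n * n * n" by (cases n; simp)+
    moreover have "t \<le> 2000 * (x + 1)" if "t \<le> 44 * x + 320 * y + 960 * n + 300" "y \<le> x" "n \<le> x" for x y
      using that by simp
    ultimately show ?thesis using that unfolding 3 by blast
  qed
  show ?case
  proof (cases "even (card T0)")
    case False
    then have "card T0 mod 2 = 1" by presburger
    moreover have "t1 + 3 \<le> 2000 * (n ^ 3 + 1)" using t1 m_le by (intro time) simp
    moreover have "optimum_found (set_reg 0 0 (set_reg 25 1 s1))"
      unfolding optimum_found_def using False pr(7) by auto
    ultimately show ?thesis using pr W1 by (simp add: wp_simps)
  next
    case ev: True
    then have par: "card T0 mod 2 = 0" by presburger
    interpret L: labelled_graph G adj \<delta> "arrs s1 7"
      by unfold_locales (use P in \<open>auto simp: prepared_def\<close>)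
    let ?s2 = "set_reg 25 0 s1"
    have found: "optimum_found s'" if "L.solved s' \<or> (regs s' 0 = 0 \<and> n < 3 \<and> 1 < opt_bound V E L.rep T0)" for s'
      unfolding optimum_found_def
    proof (intro exI[of _ L.rep] conjI)
      show "is_rep V E L.rep" using L.rep .
      show "if even (card T0) then (\<exists>F. feasible V E T0 F \<and> card F \<le> opt_bound V E L.rep T0 \<and> regs s' 0 = 1 \<and>
             outputs_edges s' 1 3 4 (F - E) \<and> outputs_edges s' 2 5 6 (F \<inter> E)) \<or>
           (regs s' 0 = 0 \<and> n < 3 \<and> 1 < opt_bound V E L.rep T0) else regs s' 0 = 0"
        unfolding if_P[OF ev] using that unfolding L.solved_def .
    qed
    have "wp W (build_rows ;; build_matrix ;; attach_all ;;
        Cond (Less (Reg 24) (Reg 10)) Skip (Assign 24 (Num 0)) ;; match_all ;; finish) ?s2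
        (\<lambda>t s'. t1 + (1 + (1 + t)) \<le> 2000 * (n ^ 3 + 1) \<and> optimum_found s')"
    proof (rule wp_SeqI[OF wp_build_rows[where n = n]], goal_cases)
      case (5 t2 s2)
      then have t2: "t2 \<le> 6 * n + 2" and R: "is_row n (arrs s2 14)" and fr2: "frame {25, 26, 30} {14} ?s2 s2" by auto
      have p2: "inp s2" "T_arr T0 s2" "regs s2 10 = n" "arrs s2 7 = arrs s1 7" "arrs s2 12 = arrs s1 12"
        "regs s2 24 = regs s1 24" "arrs s2 17 = arrs s1 17"
        using pr fr2 by (auto simp: inp_def T_arr_def frame_def)
      have "arrs s2 16 = arrs s1 16" "arrs s2 15 = arrs s1 15" using fr2 by (auto simp: frame_def)
      moreover have "arrs s1 16 = arrs s1 15" using z1[of 16] z1[of 15] by (intro ext) simp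
      ultimately have eq2: "arrs s2 16 = arrs s2 15" by simp
      show ?case
      proof (rule wp_SeqI[OF wp_build_matrix[OF p2(1) R eq2 W(2) W1(1) W(1)]], goal_cases)
        case (1 t3 s3)
        then have t3: "t3 \<le> 12 * (n * n) + 15 * n + 2" and m3: "is_mat n (arrs s3 15) E" "arrs s3 16 = arrs s3 15"
          and fr3: "frame {25, 26, 27, 28, 29, 30, 31} {15, 16} s2 s3" by auto
        have p3: "T_arr T0 s3" "arrs s3 7 = arrs s1 7" "arrs s3 12 = arrs s1 12" "regs s3 24 = regs s1 24" "arrs s3 17 = arrs s1 17"
          using p2 fr3 by (auto simp: T_arr_def frame_def)
        have M3: "mat_state n E s3" using m3 R p2 fr3 by (simp add: mat_state_def frame_def)
        have z3: "\<forall>v. arrs s3 17 v = 0" using z1[of 17] p3(5) by simp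
        have tc3: "arrs s3 12 l = card {v \<in> V. arrs s1 7 v = l \<and> v \<in> T0}" for l using pr(8) p3(3) by simp
        show ?case
        proof (rule wp_SeqI[OF wp_frame[OF L.wp_attach_all[OF M3 p3(1,2) z3 tc3 W(3,2)]]], goal_cases)
          case (1 t4 s4)
          then obtain H T where t4: "t4 \<le> 20 * (n * n) + 90 * n + 20" and I: "L.attach_inv H T (L.rep ` V)"
            and M4: "mat_state n H s4" and T4: "T_arr T s4" by blast
          have fr4: "frame {18, 19, 25, 26, 27, 28, 35, 36, 37, 38, 39, 40, 41} {11, 16, 17} s3 s4" using 1 by simp
          have r24: "regs s4 24 = regs s1 24" and E4: "is_mat n (arrs s4 15) E" and n4: "regs s4 10 = n"
            using fr4 p3 m3 M4 by (auto simp: frame_def mat_state_def)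
          have evT: "even (card T)" using L.even_card_attached[OF I ev] .
          have TV: "T \<subseteq> V" using L.attach_invD(2)[OF I] .
          define s5 where "s5 = (if regs s4 24 < n then s4 else set_reg 24 0 s4)"
          have M5: "mat_state n H s5" and T5: "T_arr T s5" and E5: "is_mat n (arrs s5 15) E" and w5: "regs s5 24 < W"
            using M4 T4 E4 W by (auto simp: s5_def)
          have center: "regs s5 24 \<in> T0 \<and> (\<forall>v\<in>T0. td v \<le> td (regs s5 24))" if "T0 \<noteq> {}"
          proof -
            have "T0 \<inter> {..<n} = T0" using T0_V by auto
            then have c: "regs s1 24 \<in> T0" "\<forall>v\<in>T0. td v \<le> td (regs s1 24)" using pr(5) that by (simp_all add: center_ok_def)
            then have "regs s1 24 < n" using T0_V by auto
            then show ?thesis using c r24 by (simp add: s5_def)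
          qed
          have rest: "wp W (match_all ;; finish) s5 (\<lambda>t s'. t1 + (1 + (1 + (t2 + (t3 + (t4 + (2 + t)))))) \<le> 2000 * (n ^ 3 + 1) \<and> optimum_found s')"
          proof (rule wp_SeqI[OF wp_match_all[OF M5 T5 TV evT W(2) W1(1) w5]], goal_cases)
            case (1 t6 s6)
            then have t6: "t6 \<le> 22 * (n * n) + 80 * n + 50"
              and fr6: "frame {18, 19, 27, 28, 29, 42, 43, 44, 45, 46, 47} {11, 16} s5 s6" by blast+
            from conjunct1[OF conjunct2[OF 1]] obtain N where N: "is_pm N T" "2 * card N = card T" "finite N"
              "mat_state n (sym_diff H N) s6"
              "\<forall>x y. x \<in> \<Union>(N \<inter> H) \<longrightarrow> y \<in> \<Union>(N \<inter> H) \<longrightarrow> x \<noteq> y \<longrightarrow> {x, y} \<in> H"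
              "regs s5 24 \<in> \<Union>(N \<inter> H) \<longrightarrow> (\<forall>v\<in>T - {regs s5 24}. {regs s5 24, v} \<in> H)"
              "N \<inter> H \<noteq> {} \<longrightarrow> {regs s6 46, regs s6 47} \<in> N \<inter> H" by (elim exE conjE)
            have E6: "is_mat n (arrs s6 15) E" using fr6 E5 by (simp add: frame_def)
            have fin: "wp W finish s6 (\<lambda>t s'. t \<le> 44 * (n * n * n) + 230 * (n * n) + 650 * n + 150 \<and>
              (L.solved s' \<or> (regs s' 0 = 0 \<and> n < 3 \<and> 1 < opt_bound V E L.rep T0)))"
              by (rule L.wp_finish[OF I evT N(1,3,2,4) E6 W(2,3), where c = "regs s5 24"])
                (use N(5,6,7) center in blast)+
            show ?case
            proof (rule wp_mono[OF fin], goal_cases)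
              case (1 t7 s7)
              have "t1 + (1 + (1 + (t2 + (t3 + (t4 + (2 + (t6 + t7))))))) \<le> 2000 * (n ^ 3 + 1)"
              proof (rule time)
                have "t7 \<le> 44 * (n * n * n) + 230 * (n * n) + 650 * n + 150" using 1 by blast
                then show "t1 + (1 + (1 + (t2 + (t3 + (t4 + (2 + (t6 + t7))))))) \<le> 44 * (n * n * n) + 320 * (n * n) + 960 * n + 300"
                  using t1 t2 t3 t4 t6 m_le by linarith
              qed
              then show ?case using found 1 by blast
            qed
          qed
          have c: "wp W (Cond (Less (Reg 24) (Reg 10)) Skip (Assign 24 (Num 0))) s4 (\<lambda>t s'. t = 2 \<and> s' = s5)"
            using n4 W by (simp add: wp_simps s5_def)
          show ?case
          proof (rule wp_SeqI[OF c], goal_cases)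
            case (1 t5 s')
            then show ?case using rest by (simp add: add.assoc)
          qed
        qed
      qed
    qed (use pr z1[of 14 0] W W1 in auto)
    then show ?thesis
      unfolding wp_Seq[of W "Load a b c" for a b c] wp_Load wp_Cond using pr par W1 by simp
  qed
qed (use s W in auto)

section \<open>From program runs to decision and optimality\<close>

lemma graph_input_simps:
  "regs (graph_input adj \<delta>) 0 = n" "arrs (graph_input adj \<delta>) 0 = (\<lambda>v. if v < n then \<delta> v else 0)"
  "arrs (graph_input adj \<delta>) 1 = off" "arrs (graph_input adj \<delta>) 2 = nb"
  "a \<notin> {0, 1, 2} \<Longrightarrow> arrs (graph_input adj \<delta>) a v = 0"
  by (auto simp: graph_input_def off_def nb_def)

lemma feasible_bounds:
  assumes F: "feasible V E T0 F" and rep: "is_rep V E \<rho>"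
  shows "even (card T0)" "opt_bound V E \<rho> T0 \<le> card F" "n < 3 \<Longrightarrow> opt_bound V E \<rho> T0 \<le> 1"
proof -
  show "even (card T0)" using feasible_card_T(1)[OF _ T0_V F] by simp
  show b: "opt_bound V E \<rho> T0 \<le> card F" using opt_bound_le[OF _ E_pairs T0_V F rep] by simp
  assume "n < 3"
  then have "card (pairs V) \<le> 1" by (intro card_pairs_le1) auto
  moreover have "card F \<le> card (pairs V)" using F finite_pairs[of V] by (intro card_mono) (auto simp: feasible_def)
  ultimately show "opt_bound V E \<rho> T0 \<le> 1" using b by simp
qed

lemma optimize_run:
  assumes W: "2 * m < W" "n * n < W" "Suc (Suc n) < W"
  shows "\<exists>t s. exec W optimize (graph_input adj \<delta>) t s \<and> t \<le> 2000 * (n ^ 3 + 1) \<and> optimum_found s"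
proof -
  have "wp W optimize (graph_input adj \<delta>) (\<lambda>t s. t \<le> 2000 * (n ^ 3 + 1) \<and> optimum_found s)"
    by (rule wp_optimize[OF graph_input_simps(1-4) _ W]) (rule graph_input_simps(5), auto)
  then show ?thesis unfolding wp_def .
qed

text \<open>A purely combinatorial statement extracted from a program run: \<open>optimize\<close>
  halts for a sufficiently large word bound, and its final state exhibits the set. Here W is simply
  the sum of everything that must fit.\<close>

lemma feasible_exists:
  obtains \<rho> where "is_rep V E \<rho>"
    "even (card T0) \<Longrightarrow> \<not> (n < 3 \<and> 1 < opt_bound V E \<rho> T0) \<Longrightarrow> \<exists>F. feasible V E T0 F \<and> card F \<le> opt_bound V E \<rho> T0"
proof -
  have "2 * m < 2 * m + n * n + n + 3" "n * n < 2 * m + n * n + n + 3" "Suc (Suc n) < 2 * m + n * n + n + 3" by auto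
  from optimize_run[OF this] obtain s where "optimum_found s" by blast
  then obtain \<rho> where r: "is_rep V E \<rho>" and *: "if even (card T0)
      then (\<exists>F. feasible V E T0 F \<and> card F \<le> opt_bound V E \<rho> T0 \<and> regs s 0 = 1 \<and>
             outputs_edges s 1 3 4 (F - E) \<and> outputs_edges s 2 5 6 (F \<inter> E)) \<or>
           (regs s 0 = 0 \<and> n < 3 \<and> 1 < opt_bound V E \<rho> T0)
      else regs s 0 = 0" unfolding optimum_found_def by blast
  show ?thesis by (rule that[OF r]) (use * in \<open>simp, blast\<close>)
qed

lemma decide_run:
  assumes W: "2 * m < W" "4 * n + 8 < W"
  shows "\<exists>t s. exec W decide (cdpe_input adj \<delta> k) t s \<and> t \<le> 200 * (n + m + 1) \<and>
    regs s 0 = (if CDPE {ea, ed} G k \<delta> then 1 else 0)"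
proof -
  obtain \<rho> where r: "is_rep V E \<rho>" and ex: "even (card T0) \<Longrightarrow> \<not> (n < 3 \<and> 1 < opt_bound V E \<rho> T0) \<Longrightarrow>
    \<exists>F. feasible V E T0 F \<and> card F \<le> opt_bound V E \<rho> T0" using feasible_exists by blast
  have inp: "regs (cdpe_input adj \<delta> k) 0 = n" "regs (cdpe_input adj \<delta> k) 1 = k"
    "arrs (cdpe_input adj \<delta> k) = arrs (graph_input adj \<delta>)"
    using graph_input_simps(1) by (simp_all add: cdpe_input_def)
  have iff: "CDPE {ea, ed} G k \<delta> \<longleftrightarrow>
    even (card T0) \<and> opt_bound V E \<rho> T0 \<le> k \<and> \<not> (n < 3 \<and> 1 < opt_bound V E \<rho> T0)"
    unfolding CDPE_iff_feasible[OF simple] verts_eq T0_def[symmetric]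
  proof
    assume "\<exists>F. feasible V E T0 F \<and> card F \<le> k"
    then obtain F where F: "feasible V E T0 F" "card F \<le> k" by blast
    show "even (card T0) \<and> opt_bound V E \<rho> T0 \<le> k \<and> \<not> (n < 3 \<and> 1 < opt_bound V E \<rho> T0)"
      using feasible_bounds[OF F(1) r] F(2) by linarith
  next
    assume A: "even (card T0) \<and> opt_bound V E \<rho> T0 \<le> k \<and> \<not> (n < 3 \<and> 1 < opt_bound V E \<rho> T0)"
    then obtain F where "feasible V E T0 F" "card F \<le> opt_bound V E \<rho> T0" using ex by blast
    then show "\<exists>F. feasible V E T0 F \<and> card F \<le> k" using A le_trans by blast
  qed
  have "wp W decide (cdpe_input adj \<delta> k) (\<lambda>t s'. t \<le> 200 * (n + m + 1) \<and>
    regs s' 0 = (if even (card T0) \<and> opt_bound V E \<rho> T0 \<le> k \<and> \<not> (n < 3 \<and> 1 < opt_bound V E \<rho> T0) then 1 else 0))"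
    by (rule wp_decide[OF inp(1,2) _ _ _ _ W r]) (use inp(3) graph_input_simps in auto)
  then show ?thesis unfolding iff wp_def .
qed

lemma optimum_found_correct:
  assumes "optimum_found s"
  shows "if \<exists>X. is_solution G \<delta> X
    then regs s 0 = 1 \<and> (\<exists>X. is_optimal_solution G \<delta> X \<and> outputs_solution s X) else regs s 0 = 0"
proof -
  obtain \<rho> where r: "is_rep V E \<rho>" and found: "if even (card T0)
      then (\<exists>F. feasible V E T0 F \<and> card F \<le> opt_bound V E \<rho> T0 \<and> regs s 0 = 1 \<and>
             outputs_edges s 1 3 4 (F - E) \<and> outputs_edges s 2 5 6 (F \<inter> E)) \<or>
           (regs s 0 = 0 \<and> n < 3 \<and> 1 < opt_bound V E \<rho> T0)
      else regs s 0 = 0" using assms unfolding optimum_found_def by blast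
  have sol: "\<exists>F. feasible V E T0 F \<and> solution_size Y = card F" if "is_solution G \<delta> Y" for Y
    using solution_feasible[OF simple that] unfolding verts_eq T0_def .
  show ?thesis
  proof (cases "\<exists>F. feasible V E T0 F \<and> card F \<le> opt_bound V E \<rho> T0 \<and> regs s 0 = 1 \<and>
             outputs_edges s 1 3 4 (F - E) \<and> outputs_edges s 2 5 6 (F \<inter> E)")
    case True
    then obtain F where F: "feasible V E T0 F" "card F \<le> opt_bound V E \<rho> T0" "regs s 0 = 1"
      "outputs_edges s 1 3 4 (F - E)" "outputs_edges s 2 5 6 (F \<inter> E)" by blast
    have F': "feasible (verts G) E (odd_set G \<delta>) F" using F(1) unfolding verts_eq T0_def .
    let ?X = "(F - E, F \<inter> E)"
    have "is_solution G \<delta> ?X" "solution_size ?X = card F" using feasible_solution[OF simple F'] by auto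
    moreover have "card F \<le> solution_size Y" if "is_solution G \<delta> Y" for Y
      using sol[OF that] feasible_bounds(2)[OF _ r] F(2) by (metis le_trans)
    ultimately have "is_optimal_solution G \<delta> ?X" by (simp add: is_optimal_solution_def)
    moreover have "outputs_solution s ?X" using F(4,5) by (simp add: outputs_solution_def)
    ultimately show ?thesis using F(3) \<open>is_solution G \<delta> ?X\<close> by (smt (verit))
  next
    case False
    have "\<not> feasible V E T0 F" for F
    proof
      assume F: "feasible V E T0 F"
      note b = feasible_bounds[OF F r]
      then show False using found False by auto
    qed
    then have no: "\<not> (\<exists>X. is_solution G \<delta> X)" using sol by blast
    have "regs s 0 = 0" using found False by (cases "even (card T0)") auto
    then show ?thesis using no by simp
  qed
qed

end

lemma input_graphI:
  assumes "simple_graph G" "adjacency_lists G adj" "\<forall>v \<in> verts G. \<delta> v \<in> {0, 1}"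
  shows "input_graph G adj \<delta>" "length adj = card (verts G)"
  using assms by (simp_all add: input_graph_def adjacency_lists_def)

text \<open>All bounds reduce to the square of b = n + m + k + 2: as b is at least 2, its fourth
  power is at least 4 times and its fifth at least 8 times that square.\<close>

lemma word_bounds:
  fixes n m k :: nat
  shows "2 * m < (n + m + k + 2) ^ 4" "4 * n + 8 < (n + m + k + 2) ^ 5" "n * n < (n + m + k + 2) ^ 4"
    "Suc (Suc n) < (n + m + k + 2) ^ 4"
proof -
  define b where "b = n + m + k + 2"
  have le: "n + 2 \<le> b" "m \<le> b" "2 \<le> b" by (auto simp: b_def)
  have 2: "b * 2 \<le> b * b" using le(3) by (rule mult_le_mono2)
  have sq: "n * n \<le> b * b" using le(1) by (intro mult_le_mono) auto
  have 4: "b ^ 4 = (b * b) * (b * b)" by (simp add: power4_eq_xxxx)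
  have 5: "b ^ 5 = b * b ^ 4" by (simp add: numeral_eq_Suc)
  have bb: "4 \<le> b * b" using mult_le_mono[OF le(3,3)] by simp
  have "(b * b) * 4 \<le> (b * b) * (b * b)" using bb by (rule mult_le_mono2)
  then have b4: "4 * (b * b) \<le> b ^ 4" unfolding 4 by (simp only: mult.commute)
  then show "2 * m < (n + m + k + 2) ^ 4" "n * n < (n + m + k + 2) ^ 4" "Suc (Suc n) < (n + m + k + 2) ^ 4"
    unfolding b_def[symmetric] using 2 sq bb le by linarith+
  have "2 * b ^ 4 \<le> b * b ^ 4" using le(3) by (rule mult_le_mono1)
  then have "8 * (b * b) \<le> b ^ 5" using b4 unfolding 5 by linarith
  then show "4 * n + 8 < (n + m + k + 2) ^ 5" unfolding b_def[symmetric] using 2 bb le by linarith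
qed

theorem theorem3p3:
  "(\<exists>P C c. \<forall>(G :: nat graph) adj \<delta> k.
      simple_graph G \<and> adjacency_lists G adj \<and> (\<forall>v \<in> verts G. \<delta> v \<in> {0, 1}) \<longrightarrow>
      (let n = card (verts G); m = card (edges G) in
       \<exists>t s. exec ((n + m + k + 2) ^ c) P (cdpe_input adj \<delta> k) t s \<and>
         t \<le> C * (n + m + 1) \<and>
         regs s 0 = (if CDPE {ea, ed} G k \<delta> then 1 else 0)))
   \<and>
   (\<exists>P C c. \<forall>(G :: nat graph) adj \<delta>.
      simple_graph G \<and> adjacency_lists G adj \<and> (\<forall>v \<in> verts G. \<delta> v \<in> {0, 1}) \<longrightarrow>
      (let n = card (verts G); m = card (edges G) in
       \<exists>t s. exec ((n + m + 2) ^ c) P (graph_input adj \<delta>) t s \<and>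
         t \<le> C * (n ^ 3 + 1) \<and>
         (if \<exists>X. is_solution G \<delta> X
          then regs s 0 = 1 \<and> (\<exists>X. is_optimal_solution G \<delta> X \<and> outputs_solution s X)
          else regs s 0 = 0)))"
proof (rule conjI)
  show "\<exists>P C c. \<forall>(G :: nat graph) adj \<delta> k.
      simple_graph G \<and> adjacency_lists G adj \<and> (\<forall>v \<in> verts G. \<delta> v \<in> {0, 1}) \<longrightarrow>
      (let n = card (verts G); m = card (edges G) in
       \<exists>t s. exec ((n + m + k + 2) ^ c) P (cdpe_input adj \<delta> k) t s \<and>
         t \<le> C * (n + m + 1) \<and>
         regs s 0 = (if CDPE {ea, ed} G k \<delta> then 1 else 0))"
  \<comment> \<open>The constant 200 is the one of \<open>wp_decide\<close>; the exponent 5 accounts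
    for its demand \<open>4 * n + 8 < W\<close>.\<close>
  proof (rule exI[of _ decide], rule exI[of _ 200], rule exI[of _ 5], intro allI impI, unfold Let_def)
    fix G :: "nat graph" and adj and \<delta> :: "nat \<Rightarrow> nat" and k
    assume A: "simple_graph G \<and> adjacency_lists G adj \<and> (\<forall>v \<in> verts G. \<delta> v \<in> {0, 1})"
    interpret input_graph G adj \<delta> using A by (intro input_graphI) auto
    have len: "card (verts G) = n" using A by (intro input_graphI(2)[symmetric]) auto
    have "2 * m < (n + m + k + 2) ^ 5"
      using word_bounds(1)[of m n k] power_increasing[of 4 5 "n + m + k + 2"] by linarith
    then show "\<exists>t s. exec ((card (verts G) + card (edges G) + k + 2) ^ 5) decide (cdpe_input adj \<delta> k) t s \<and>
         t \<le> 200 * (card (verts G) + card (edges G) + 1) \<and>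
         regs s 0 = (if CDPE {ea, ed} G k \<delta> then 1 else 0)"
      unfolding len by (rule decide_run) (rule word_bounds)
  qed
next
  show "\<exists>P C c. \<forall>(G :: nat graph) adj \<delta>.
      simple_graph G \<and> adjacency_lists G adj \<and> (\<forall>v \<in> verts G. \<delta> v \<in> {0, 1}) \<longrightarrow>
      (let n = card (verts G); m = card (edges G) in
       \<exists>t s. exec ((n + m + 2) ^ c) P (graph_input adj \<delta>) t s \<and>
         t \<le> C * (n ^ 3 + 1) \<and>
         (if \<exists>X. is_solution G \<delta> X
          then regs s 0 = 1 \<and> (\<exists>X. is_optimal_solution G \<delta> X \<and> outputs_solution s X)
          else regs s 0 = 0))"
  proof (rule exI[of _ optimize], rule exI[of _ 2000], rule exI[of _ 4], intro allI impI, unfold Let_def)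
    fix G :: "nat graph" and adj and \<delta> :: "nat \<Rightarrow> nat"
    assume A: "simple_graph G \<and> adjacency_lists G adj \<and> (\<forall>v \<in> verts G. \<delta> v \<in> {0, 1})"
    interpret input_graph G adj \<delta> using A by (intro input_graphI) auto
    have len: "card (verts G) = n" using A by (intro input_graphI(2)[symmetric]) auto
    have "2 * m < (n + m + 2) ^ 4" "n * n < (n + m + 2) ^ 4" "Suc (Suc n) < (n + m + 2) ^ 4"
      using word_bounds[where n = n and m = m and k = 0] by (simp_all only: add_0_right)
    from optimize_run[OF this] obtain t s where "exec ((n + m + 2) ^ 4) optimize (graph_input adj \<delta>) t s"
      "t \<le> 2000 * (n ^ 3 + 1)" "optimum_found s" by blast
    then show "\<exists>t s. exec ((card (verts G) + card (edges G) + 2) ^ 4) optimize (graph_input adj \<delta>) t s \<and>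
         t \<le> 2000 * (card (verts G) ^ 3 + 1) \<and>
         (if \<exists>X. is_solution G \<delta> X
          then regs s 0 = 1 \<and> (\<exists>X. is_optimal_solution G \<delta> X \<and> outputs_solution s X)
          else regs s 0 = 0)"
      unfolding len using optimum_found_correct by blast
  qed
qed

end
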